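(* The orbit category $\mathcal D^b(\mathbb Z)/[1]$ of the bounded derived category of the integers carries the structure of a triangulated category.
   Context: $\mathcal D^b(\mathbb Z)$ is the bounded derived category of finitely generated abelian groups, with shift $[1]$. The orbit category $\mathcal D^b(\mathbb Z)/[1]$ has the same objects as $\mathcal D^b(\mathbb Z)$ and $\operatorname{Hom}_{\mathcal D^b(\mathbb Z)/[1]}(X,Y)=\bigoplus_{i\in\mathbb Z}\operatorname{Hom}_{\mathcal D^b(\mathbb Z)}(X,Y[i])$, with composition of $f:X\to Y[i]$ and $g:Y\to Z[k]$ given by $g[i]\circ f$. *)

theory Defs
  imports "HOL-Algebra.FiniteProduct" "HOL-Algebra.Product_Groups"
begin

section \<open>Preadditive and triangulated categories\<close>

text \<open>All abelian groups are \<^term>\<open>comm_group\<close>s, hence written multiplicatively: in a group of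
  morphisms, \<open>\<otimes>\<close> is the sum, \<open>\<one>\<close> is the zero morphism and \<open>inv f\<close> is \<open>-f\<close>.
  Sets of morphisms between different pairs of objects need not be disjoint, so composition
  carries the objects: \<open>Comp C X Y Z g f\<close> is \<open>g \<circ> f\<close> for \<open>f : X \<rightarrow> Y\<close> and \<open>g : Y \<rightarrow> Z\<close>.\<close>

record ('o, 'm) precat =
  Ob :: "'o set"
  Hom :: "'o \<Rightarrow> 'o \<Rightarrow> 'm monoid"
  Comp :: "'o \<Rightarrow> 'o \<Rightarrow> 'o \<Rightarrow> 'm \<Rightarrow> 'm \<Rightarrow> 'm"
  IdM :: "'o \<Rightarrow> 'm"

abbreviation Mor :: "('o, 'm) precat \<Rightarrow> 'o \<Rightarrow> 'o \<Rightarrow> 'm set"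
  where "Mor C X Y \<equiv> carrier (Hom C X Y)"

locale preadditive_category =
  fixes C :: "('o, 'm) precat"
  assumes Hom_comm_group: "\<lbrakk>X \<in> Ob C; Y \<in> Ob C\<rbrakk> \<Longrightarrow> comm_group (Hom C X Y)"
    and Id_closed: "X \<in> Ob C \<Longrightarrow> IdM C X \<in> Mor C X X"
    and Comp_closed:
      "\<lbrakk>X \<in> Ob C; Y \<in> Ob C; Z \<in> Ob C; f \<in> Mor C X Y; g \<in> Mor C Y Z\<rbrakk>
        \<Longrightarrow> Comp C X Y Z g f \<in> Mor C X Z"
    and Comp_Id_right: "\<lbrakk>X \<in> Ob C; Y \<in> Ob C; f \<in> Mor C X Y\<rbrakk> \<Longrightarrow> Comp C X X Y f (IdM C X) = f"
    and Comp_Id_left: "\<lbrakk>X \<in> Ob C; Y \<in> Ob C; f \<in> Mor C X Y\<rbrakk> \<Longrightarrow> Comp C X Y Y (IdM C Y) f = f"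
    and Comp_assoc:
      "\<lbrakk>W \<in> Ob C; X \<in> Ob C; Y \<in> Ob C; Z \<in> Ob C;
        f \<in> Mor C W X; g \<in> Mor C X Y; h \<in> Mor C Y Z\<rbrakk>
        \<Longrightarrow> Comp C W Y Z h (Comp C W X Y g f) = Comp C W X Z (Comp C X Y Z h g) f"
    and Comp_add_left:
      "\<lbrakk>X \<in> Ob C; Y \<in> Ob C; Z \<in> Ob C; f \<in> Mor C X Y; g \<in> Mor C Y Z; g' \<in> Mor C Y Z\<rbrakk>
        \<Longrightarrow> Comp C X Y Z (g \<otimes>\<^bsub>Hom C Y Z\<^esub> g') f
            = Comp C X Y Z g f \<otimes>\<^bsub>Hom C X Z\<^esub> Comp C X Y Z g' f"
    and Comp_add_right:
      "\<lbrakk>X \<in> Ob C; Y \<in> Ob C; Z \<in> Ob C; f \<in> Mor C X Y; f' \<in> Mor C X Y; g \<in> Mor C Y Z\<rbrakk>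
        \<Longrightarrow> Comp C X Y Z g (f \<otimes>\<^bsub>Hom C X Y\<^esub> f')
            = Comp C X Y Z g f \<otimes>\<^bsub>Hom C X Z\<^esub> Comp C X Y Z g f'"

definition zero_object :: "('o, 'm) precat \<Rightarrow> 'o \<Rightarrow> bool"
  where "zero_object C Z \<longleftrightarrow> Z \<in> Ob C \<and>
    (\<forall>X \<in> Ob C. (\<exists>!f. f \<in> Mor C X Z) \<and> (\<exists>!f. f \<in> Mor C Z X))"

definition iso_mor :: "('o, 'm) precat \<Rightarrow> 'o \<Rightarrow> 'o \<Rightarrow> 'm \<Rightarrow> bool"
  where "iso_mor C X Y f \<longleftrightarrow> f \<in> Mor C X Y \<and>
    (\<exists>g \<in> Mor C Y X. Comp C X Y X g f = IdM C X \<and> Comp C Y X Y f g = IdM C Y)"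

locale additive_category = preadditive_category +
  assumes ex_zero_object: "\<exists>Z. zero_object C Z"
    and ex_biproduct:
      "\<lbrakk>X \<in> Ob C; Y \<in> Ob C\<rbrakk> \<Longrightarrow>
        \<exists>P \<in> Ob C. \<exists>i \<in> Mor C X P. \<exists>j \<in> Mor C Y P. \<exists>p \<in> Mor C P X. \<exists>q \<in> Mor C P Y.
          Comp C X P X p i = IdM C X \<and> Comp C Y P Y q j = IdM C Y \<and>
          Comp C X P Y q i = \<one>\<^bsub>Hom C X Y\<^esub> \<and> Comp C Y P X p j = \<one>\<^bsub>Hom C Y X\<^esub> \<and>
          Comp C P X P i p \<otimes>\<^bsub>Hom C P P\<^esub> Comp C P Y P j q = IdM C P"

locale additive_automorphism = preadditive_category +
  fixes F :: "'a \<Rightarrow> 'a" and Fm :: "'a \<Rightarrow> 'a \<Rightarrow> 'b \<Rightarrow> 'b"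
  assumes F_bij: "bij_betw F (Ob C) (Ob C)"
    and Fm_iso: "\<lbrakk>X \<in> Ob C; Y \<in> Ob C\<rbrakk> \<Longrightarrow> Fm X Y \<in> iso (Hom C X Y) (Hom C (F X) (F Y))"
    and Fm_Id: "X \<in> Ob C \<Longrightarrow> Fm X X (IdM C X) = IdM C (F X)"
    and Fm_Comp:
      "\<lbrakk>X \<in> Ob C; Y \<in> Ob C; Z \<in> Ob C; f \<in> Mor C X Y; g \<in> Mor C Y Z\<rbrakk>
        \<Longrightarrow> Fm X Z (Comp C X Y Z g f) = Comp C (F X) (F Y) (F Z) (Fm Y Z g) (Fm X Y f)"

text \<open>Verdier's axioms. \<open>\<Sigma>\<close> and \<open>\<Sigma>m\<close> are the suspension on objects and on morphisms, and
  \<open>(X, Y, Z, f, g, h)\<close> stands for the triangle \<open>X \<rightarrow> Y \<rightarrow> Z \<rightarrow> \<Sigma> X\<close> with morphisms \<open>f\<close>, \<open>g\<close>, \<open>h\<close>.\<close>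

type_synonym ('o, 'm) triangle = "'o \<times> 'o \<times> 'o \<times> 'm \<times> 'm \<times> 'm"

definition triangles :: "('o, 'm) precat \<Rightarrow> ('o \<Rightarrow> 'o) \<Rightarrow> ('o, 'm) triangle set"
  where "triangles C \<Sigma> = {(X, Y, Z, f, g, h). X \<in> Ob C \<and> Y \<in> Ob C \<and> Z \<in> Ob C \<and>
    f \<in> Mor C X Y \<and> g \<in> Mor C Y Z \<and> h \<in> Mor C Z (\<Sigma> X)}"

locale triangulated_category =
  additive_category C + additive_automorphism C \<Sigma> \<Sigma>m
  for C :: "('o, 'm) precat" and \<Sigma> :: "'o \<Rightarrow> 'o" and \<Sigma>m :: "'o \<Rightarrow> 'o \<Rightarrow> 'm \<Rightarrow> 'm" +
  fixes \<Delta> :: "('o, 'm) triangle set"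
  assumes Delta_triangles: "\<Delta> \<subseteq> triangles C \<Sigma>"
    and TR1_iso:
      "\<lbrakk>(X, Y, Z, f, g, h) \<in> \<Delta>; (X', Y', Z', f', g', h') \<in> triangles C \<Sigma>;
        iso_mor C X X' a; iso_mor C Y Y' b; iso_mor C Z Z' c;
        Comp C X Y Y' b f = Comp C X X' Y' f' a;
        Comp C Y Z Z' c g = Comp C Y Y' Z' g' b;
        Comp C Z (\<Sigma> X) (\<Sigma> X') (\<Sigma>m X X' a) h = Comp C Z Z' (\<Sigma> X') h' c\<rbrakk>
        \<Longrightarrow> (X', Y', Z', f', g', h') \<in> \<Delta>"
    and TR1_id:
      "\<lbrakk>X \<in> Ob C; zero_object C N\<rbrakk>
        \<Longrightarrow> (X, X, N, IdM C X, \<one>\<^bsub>Hom C X N\<^esub>, \<one>\<^bsub>Hom C N (\<Sigma> X)\<^esub>) \<in> \<Delta>"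
    and TR1_cone:
      "\<lbrakk>X \<in> Ob C; Y \<in> Ob C; f \<in> Mor C X Y\<rbrakk> \<Longrightarrow> \<exists>Z g h. (X, Y, Z, f, g, h) \<in> \<Delta>"
    and TR2:
      "(X, Y, Z, f, g, h) \<in> triangles C \<Sigma>
        \<Longrightarrow> (X, Y, Z, f, g, h) \<in> \<Delta>
          \<longleftrightarrow> (Y, Z, \<Sigma> X, g, h, inv\<^bsub>Hom C (\<Sigma> X) (\<Sigma> Y)\<^esub> (\<Sigma>m X Y f)) \<in> \<Delta>"
    and TR3:
      "\<lbrakk>(X, Y, Z, f, g, h) \<in> \<Delta>; (X', Y', Z', f', g', h') \<in> \<Delta>;
        a \<in> Mor C X X'; b \<in> Mor C Y Y'; Comp C X Y Y' b f = Comp C X X' Y' f' a\<rbrakk>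
        \<Longrightarrow> \<exists>c \<in> Mor C Z Z'.
              Comp C Y Z Z' c g = Comp C Y Y' Z' g' b \<and>
              Comp C Z (\<Sigma> X) (\<Sigma> X') (\<Sigma>m X X' a) h = Comp C Z Z' (\<Sigma> X') h' c"
    and TR4:
      "\<lbrakk>(X, Y, Z', f, i, i') \<in> \<Delta>; (Y, Z, X', g, j, j') \<in> \<Delta>;
        (X, Z, Y', Comp C X Y Z g f, k, k') \<in> \<Delta>\<rbrakk>
        \<Longrightarrow> \<exists>u v.
              (Z', Y', X', u, v, Comp C X' (\<Sigma> Y) (\<Sigma> Z') (\<Sigma>m Y Z' i) j') \<in> \<Delta> \<and>
              Comp C Y Z' Y' u i = Comp C Y Z Y' k g \<and>
              Comp C Z' Y' (\<Sigma> X) k' u = i' \<and>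
              Comp C Z Y' X' v k = j \<and>
              Comp C Y' X' (\<Sigma> Y) j' v = Comp C Y' (\<Sigma> X) (\<Sigma> Y) (\<Sigma>m X Y f) k'"


section \<open>Localization by roofs\<close>

text \<open>\<open>S X Y\<close> is the set of inverted morphisms \<open>X \<rightarrow> Y\<close>. The roof \<open>(W, s, f)\<close> from \<open>X\<close> to \<open>Y\<close> is
  \<open>X \<leftarrow> W \<rightarrow> Y\<close> with \<open>s \<in> S W X\<close> and \<open>f : W \<rightarrow> Y\<close>. The constructions below are meaningful when
  \<open>S\<close> admits a calculus of fractions; the unions are then unions of copies of one and the same
  equivalence class.\<close>

type_synonym ('o, 'm) roof = "'o \<times> 'm \<times> 'm"

definition roofs ::
    "('o, 'm) precat \<Rightarrow> ('o \<Rightarrow> 'o \<Rightarrow> 'm set) \<Rightarrow> 'o \<Rightarrow> 'o \<Rightarrow> ('o, 'm) roof set"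
  where "roofs C S X Y = {(W, s, f). W \<in> Ob C \<and> s \<in> S W X \<and> f \<in> Mor C W Y}"

definition roof_rel ::
    "('o, 'm) precat \<Rightarrow> ('o \<Rightarrow> 'o \<Rightarrow> 'm set) \<Rightarrow> 'o \<Rightarrow> 'o \<Rightarrow> ('o, 'm) roof rel"
  where "roof_rel C S X Y = {((W, s, f), (W', s', f')).
    (W, s, f) \<in> roofs C S X Y \<and> (W', s', f') \<in> roofs C S X Y \<and>
    (\<exists>V \<in> Ob C. \<exists>u \<in> Mor C V W. \<exists>u' \<in> Mor C V W'.
       Comp C V W X s u \<in> S V X \<and>
       Comp C V W X s u = Comp C V W' X s' u' \<and>
       Comp C V W Y f u = Comp C V W' Y f' u')}"

definition roof_Hom ::
    "('o, 'm) precat \<Rightarrow> ('o \<Rightarrow> 'o \<Rightarrow> 'm set) \<Rightarrow> 'o \<Rightarrow> 'o \<Rightarrow> ('o, 'm) roof set monoid"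
  where "roof_Hom C S X Y =
    \<lparr>carrier = roofs C S X Y // roof_rel C S X Y,
     monoid.mult = (\<lambda>\<alpha> \<beta>. \<Union>{roof_rel C S X Y `` {(W, s, f \<otimes>\<^bsub>Hom C W Y\<^esub> g)} | W s f g.
                        (W, s, f) \<in> \<alpha> \<and> (W, s, g) \<in> \<beta>}),
     one = roof_rel C S X Y `` {(X, IdM C X, \<one>\<^bsub>Hom C X Y\<^esub>)}\<rparr>"

definition localization ::
    "('o, 'm) precat \<Rightarrow> ('o \<Rightarrow> 'o \<Rightarrow> 'm set) \<Rightarrow> ('o, ('o, 'm) roof set) precat"
  where "localization C S =
    \<lparr>Ob = Ob C,
     Hom = roof_Hom C S,
     Comp = (\<lambda>X Y Z \<beta> \<alpha>.
       \<Union>{roof_rel C S X Z `` {(V, Comp C V W X s u, Comp C V W' Z g v)} | W s f W' t g V u v.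
          (W, s, f) \<in> \<alpha> \<and> (W', t, g) \<in> \<beta> \<and>
          V \<in> Ob C \<and> u \<in> S V W \<and> v \<in> Mor C V W' \<and> Comp C V W Y f u = Comp C V W' Y t v}),
     IdM = (\<lambda>X. roof_rel C S X X `` {(X, IdM C X, IdM C X)})\<rparr>"


section \<open>Orbit categories\<close>

text \<open>For a strict action of the integers on \<open>C\<close>, given by \<open>T i\<close> on objects and \<open>Tm i\<close> on morphisms.
  A morphism \<open>X \<rightarrow> Y\<close> is a finitely supported family of morphisms \<open>f i : X \<rightarrow> T i Y\<close>, and the
  component of \<open>g \<circ> f\<close> at \<open>n\<close> is the sum of \<open>Tm i (g k) \<circ> f i\<close> over \<open>i + k = n\<close>.\<close>

definition orbit_category ::
    "('o, 'm) precat \<Rightarrow> (int \<Rightarrow> 'o \<Rightarrow> 'o) \<Rightarrow> (int \<Rightarrow> 'm \<Rightarrow> 'm) \<Rightarrow> ('o, int \<Rightarrow> 'm) precat"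
  where "orbit_category C T Tm =
    \<lparr>Ob = Ob C,
     Hom = (\<lambda>X Y. sum_group UNIV (\<lambda>i. Hom C X (T i Y))),
     Comp = (\<lambda>X Y Z g f n.
       finprod (Hom C X (T n Z))
         (\<lambda>i. Comp C X (T i Y) (T n Z) (Tm i (g (n - i))) (f i))
         {i. f i \<noteq> \<one>\<^bsub>Hom C X (T i Y)\<^esub>}),
     IdM = (\<lambda>X n. if n = 0 then IdM C X else \<one>\<^bsub>Hom C X (T n X)\<^esub>)\<rparr>"


section \<open>Bounded complexes of finitely generated abelian groups\<close>

record 'a cochain_complex =
  grp :: "int \<Rightarrow> 'a monoid"
  diff :: "int \<Rightarrow> 'a \<Rightarrow> 'a"

definition finitely_generated :: "'a monoid \<Rightarrow> bool"
  where "finitely_generated G \<longleftrightarrow> (\<exists>S. finite S \<and> S \<subseteq> carrier G \<and> generate G S = carrier G)"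

text \<open>Homomorphisms are required to be extensional so that equality of maps is equality on the
  carrier, and so that \<open>X[i][j] = X[i + j]\<close> holds on the nose.\<close>

definition ehom :: "'a monoid \<Rightarrow> 'a monoid \<Rightarrow> ('a \<Rightarrow> 'a) set"
  where "ehom G H = hom G H \<inter> extensional (carrier G)"

definition bounded_fg_complexes :: "'a cochain_complex set"
  where "bounded_fg_complexes = {X.
    (\<forall>n. comm_group (grp X n) \<and> finitely_generated (grp X n)) \<and>
    (\<forall>n. diff X n \<in> ehom (grp X n) (grp X (n + 1))) \<and>
    (\<forall>n. \<forall>x \<in> carrier (grp X n). diff X (n + 1) (diff X n x) = \<one>\<^bsub>grp X (n + 2)\<^esub>) \<and>
    finite {n. carrier (grp X n) \<noteq> {\<one>\<^bsub>grp X n\<^esub>}}}"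

definition chain_maps ::
    "'a cochain_complex \<Rightarrow> 'a cochain_complex \<Rightarrow> (int \<Rightarrow> 'a \<Rightarrow> 'a) set"
  where "chain_maps X Y = {f.
    (\<forall>n. f n \<in> ehom (grp X n) (grp Y n)) \<and>
    (\<forall>n. \<forall>x \<in> carrier (grp X n). diff Y n (f n x) = f (n + 1) (diff X n x))}"

definition chain_map_group ::
    "'a cochain_complex \<Rightarrow> 'a cochain_complex \<Rightarrow> (int \<Rightarrow> 'a \<Rightarrow> 'a) monoid"
  where "chain_map_group X Y =
    \<lparr>carrier = chain_maps X Y,
     monoid.mult = (\<lambda>f g n. \<lambda>x \<in> carrier (grp X n). f n x \<otimes>\<^bsub>grp Y n\<^esub> g n x),
     one = (\<lambda>n. \<lambda>x \<in> carrier (grp X n). \<one>\<^bsub>grp Y n\<^esub>)\<rparr>"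

definition null_homotopic ::
    "'a cochain_complex \<Rightarrow> 'a cochain_complex \<Rightarrow> (int \<Rightarrow> 'a \<Rightarrow> 'a) set"
  where "null_homotopic X Y = {f \<in> chain_maps X Y.
    \<exists>h. (\<forall>n. h n \<in> hom (grp X n) (grp Y (n - 1))) \<and>
      (\<forall>n. \<forall>x \<in> carrier (grp X n).
         f n x = diff Y (n - 1) (h n x) \<otimes>\<^bsub>grp Y n\<^esub> h (n + 1) (diff X n x))}"

definition homotopy_class ::
    "'a cochain_complex \<Rightarrow> 'a cochain_complex \<Rightarrow> (int \<Rightarrow> 'a \<Rightarrow> 'a) \<Rightarrow> (int \<Rightarrow> 'a \<Rightarrow> 'a) set"
  where "homotopy_class X Y f = null_homotopic X Y #>\<^bsub>chain_map_group X Y\<^esub> f"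

text \<open>The bounded homotopy category. The union defining composition is a union of copies of one
  and the same homotopy class.\<close>

definition Kb :: "('a cochain_complex, (int \<Rightarrow> 'a \<Rightarrow> 'a) set) precat"
  where "Kb =
    \<lparr>Ob = bounded_fg_complexes,
     Hom = (\<lambda>X Y. chain_map_group X Y Mod null_homotopic X Y),
     Comp = (\<lambda>X Y Z b a.
       \<Union>g \<in> b. \<Union>f \<in> a. homotopy_class X Z (\<lambda>n. compose (carrier (grp X n)) (g n) (f n))),
     IdM = (\<lambda>X. homotopy_class X X (\<lambda>n. \<lambda>x \<in> carrier (grp X n). x))\<rparr>"

definition cycles :: "'a cochain_complex \<Rightarrow> int \<Rightarrow> 'a set"
  where "cycles X n = kernel (grp X n) (grp X (n + 1)) (diff X n)"

definition boundaries :: "'a cochain_complex \<Rightarrow> int \<Rightarrow> 'a set"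
  where "boundaries X n = diff X (n - 1) ` carrier (grp X (n - 1))"

definition cohomology :: "'a cochain_complex \<Rightarrow> int \<Rightarrow> 'a set monoid"
  where "cohomology X n = (grp X n)\<lparr>carrier := cycles X n\<rparr> Mod boundaries X n"

definition cohomology_map ::
    "'a cochain_complex \<Rightarrow> (int \<Rightarrow> 'a \<Rightarrow> 'a) \<Rightarrow> int \<Rightarrow> 'a set \<Rightarrow> 'a set"
  where "cohomology_map Y f n c = (\<Union>x \<in> c. boundaries Y n #>\<^bsub>grp Y n\<^esub> f n x)"

definition quasi_isos ::
    "'a cochain_complex \<Rightarrow> 'a cochain_complex \<Rightarrow> (int \<Rightarrow> 'a \<Rightarrow> 'a) set set"
  where "quasi_isos X Y = {a \<in> Mor Kb X Y.
    \<forall>f \<in> a. \<forall>n. cohomology_map Y f n \<in> iso (cohomology X n) (cohomology Y n)}"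


section \<open>The bounded derived category and its orbit category\<close>

type_synonym 'a Db_mor = "('a cochain_complex, (int \<Rightarrow> 'a \<Rightarrow> 'a) set) roof set"

definition Db :: "('a cochain_complex, 'a Db_mor) precat"
  where "Db = localization Kb quasi_isos"

text \<open>\<open>X[i]\<close> in degree \<open>n\<close> is \<open>X\<close> in degree \<open>n + i\<close>, with differential \<open>(-1)^i d\<close>.\<close>

definition shift :: "int \<Rightarrow> 'a cochain_complex \<Rightarrow> 'a cochain_complex"
  where "shift i X =
    \<lparr>grp = (\<lambda>n. grp X (n + i)),
     diff = (\<lambda>n. \<lambda>x \<in> carrier (grp X (n + i)).
       if even i then diff X (n + i) x else inv\<^bsub>grp X (n + 1 + i)\<^esub> (diff X (n + i) x))\<rparr>"

definition shift_Kb_mor :: "int \<Rightarrow> (int \<Rightarrow> 'a \<Rightarrow> 'a) set \<Rightarrow> (int \<Rightarrow> 'a \<Rightarrow> 'a) set"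
  where "shift_Kb_mor i a = (\<lambda>f n. f (n + i)) ` a"

text \<open>Taking images is correct since \<open>X \<mapsto> X[i]\<close> is a bijection on complexes, on chain maps and on
  quasi-isomorphisms, so that it maps equivalence classes onto equivalence classes.\<close>

definition shift_Db_mor :: "int \<Rightarrow> 'a Db_mor \<Rightarrow> 'a Db_mor"
  where "shift_Db_mor i \<alpha> =
    (\<lambda>(W, s, f). (shift i W, shift_Kb_mor i s, shift_Kb_mor i f)) ` \<alpha>"

definition Db_orbit :: "('a cochain_complex, int \<Rightarrow> 'a Db_mor) precat"
  where "Db_orbit = orbit_category Db shift shift_Db_mor"

end

theory Submission
  imports Defs "HOL-Library.Function_Algebras" "HOL-Library.Product_Plus" "HOL-Library.Countable_Set"
begin

text \<open>Since \<open>\<int>\<close> is hereditary, every bounded complex of finitely generated groups has a bounded resolution by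
  finitely generated free groups. Folding a complex \<open>X\<close> into the differential group \<open>\<Oplus>X\<^sup>n\<close> with differential
  \<open>(-1)\<^sup>n d\<close> therefore identifies morphisms of the orbit category with homotopy classes of maps between finitely
  generated free differential groups. The homotopy category of the latter is triangulated by mapping cones,
  with suspension \<open>(P, \<delta>) \<mapsto> (P, -\<delta>)\<close>. Folding is essentially surjective: a free differential group \<open>P\<close> is the
  folding of the two-term complex \<open>im \<delta> \<rightarrow> ker \<delta>\<close>. On foldings, the sign \<open>\<sigma> = (-1)\<^sup>n\<close> anticommutes with the
  differential and so identifies the suspension with the identity on objects, acting on morphisms by \<open>f \<mapsto> \<sigma>f\<sigma>\<close>.\<close>

section \<open>Differential objects in a ring\<close>

text \<open>Orbit categories of triangulated categories are not triangulated in general: a morphism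
  with components in several degrees has no evident cone among complexes. After folding it has one,
  but the cone is only a differential group, and the point is that over the integers a free one
  splits into a two-term complex. Heredity is thus used twice, for bounded resolutions and for this
  splitting. Two constraints shape the rest. The suspension must be a bijection on objects, so
  sending X to some chosen complex that folds to the negated differential would not do in general;
  hence the sign \<open>sigma\<close>. And all groups of a complex have their elements in one type
  \<open>'a\<close>. Free groups of positive rank exist there only if \<open>'a\<close> is infinite,
  which is the hypothesis of the theorem. Cones and maps between varying carriers are awkward in
  this setting, so maps become elements of one large endomorphism ring. There the triangulated
  structure is a computation with 2 by 2 matrices; only afterwards are ring elements matched with
  families of roofs of homotopy classes.\<close>

text \<open>The pair \<open>(e, \<delta>)\<close> stands for the image of the idempotent \<open>e\<close> with differential \<open>\<delta>\<close>. Taking all objects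
  inside one ring keeps them of one type.\<close>

definition is_dobj :: "'r::{ring,monoid_mult} \<times> 'r \<Rightarrow> bool"
  where "is_dobj A \<longleftrightarrow> fst A * fst A = fst A \<and> fst A * snd A = snd A \<and>
    snd A * fst A = snd A \<and> snd A * snd A = 0"

definition dmap :: "'r::{ring,monoid_mult} \<times> 'r \<Rightarrow> 'r \<times> 'r \<Rightarrow> 'r set"
  where "dmap A B = {f. fst B * f = f \<and> f * fst A = f \<and> snd B * f = f * snd A}"

definition dnull :: "'r::{ring,monoid_mult} \<times> 'r \<Rightarrow> 'r \<times> 'r \<Rightarrow> 'r set"
  where "dnull A B = {snd B * h + h * snd A | h. fst B * h = h \<and> h * fst A = h}"

definition heq :: "'r::{ring,monoid_mult} \<times> 'r \<Rightarrow> 'r \<times> 'r \<Rightarrow> 'r \<Rightarrow> 'r \<Rightarrow> bool"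
  where "heq A B f g \<longleftrightarrow> f \<in> dmap A B \<and> g \<in> dmap A B \<and> f - g \<in> dnull A B"

definition hiso :: "'r::{ring,monoid_mult} \<times> 'r \<Rightarrow> 'r \<times> 'r \<Rightarrow> 'r \<Rightarrow> 'r \<Rightarrow> bool"
  where "hiso A B f g \<longleftrightarrow> f \<in> dmap A B \<and> g \<in> dmap B A \<and>
    heq A A (g * f) (fst A) \<and> heq B B (f * g) (fst B)"

definition sus :: "'r::{ring,monoid_mult} \<times> 'r \<Rightarrow> 'r \<times> 'r"
  where "sus A = (fst A, - snd A)"

lemma fst_sus [simp]: "fst (sus A) = fst A" and snd_sus [simp]: "snd (sus A) = - snd A"
  by (simp_all add: sus_def)

lemma sus_sus [simp]: "sus (sus A) = A"
  by (simp add: sus_def)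

lemma is_dobj_sus [simp]: "is_dobj (sus A) = is_dobj A"
  by (auto simp: is_dobj_def)

lemma dmap_sus [simp]: "dmap (sus A) (sus B) = dmap A B"
  by (auto simp: dmap_def)

lemma dnull_sus [simp]: "dnull (sus A) (sus B) = dnull A B"
proof -
  have "dnull A B \<subseteq> dnull (sus A) (sus B)" for A B :: "'a \<times> 'a"
  proof
    fix f assume "f \<in> dnull A B"
    then obtain h where "f = snd B * h + h * snd A" "fst B * h = h" "h * fst A = h"
      by (auto simp: dnull_def)
    then show "f \<in> dnull (sus A) (sus B)"
      unfolding dnull_def by (intro CollectI exI[of _ "- h"]) simp
  qed
  from this[of A B] this[of "sus A" "sus B"] show ?thesis by auto
qed

lemma heq_sus [simp]: "heq (sus A) (sus B) f g = heq A B f g"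
  by (simp add: heq_def)

lemma hiso_sus [simp]: "hiso (sus A) (sus B) f g = hiso A B f g"
  by (simp add: hiso_def)

lemma dmapI: "\<lbrakk>fst B * f = f; f * fst A = f; snd B * f = f * snd A\<rbrakk> \<Longrightarrow> f \<in> dmap A B"
  by (simp add: dmap_def)

lemma dmap_id: "is_dobj A \<Longrightarrow> fst A \<in> dmap A A"
  by (simp add: is_dobj_def dmap_def)

lemma dmap_comp: "\<lbrakk>f \<in> dmap A B; g \<in> dmap B D\<rbrakk> \<Longrightarrow> g * f \<in> dmap A D"
  by (simp add: dmap_def) (metis mult.assoc)

lemma dmap_add: "\<lbrakk>f \<in> dmap A B; g \<in> dmap A B\<rbrakk> \<Longrightarrow> f + g \<in> dmap A B"
  by (simp add: dmap_def algebra_simps)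

lemma dmap_minus: "f \<in> dmap A B \<Longrightarrow> - f \<in> dmap A B"
  by (simp add: dmap_def)

lemma dmap_minus_iff [simp]: "- f \<in> dmap A B \<longleftrightarrow> f \<in> dmap A B"
  using dmap_minus by fastforce

lemma dmap_diff: "\<lbrakk>f \<in> dmap A B; g \<in> dmap A B\<rbrakk> \<Longrightarrow> f - g \<in> dmap A B"
  by (simp add: dmap_def algebra_simps)

lemma dmap_zero [simp]: "0 \<in> dmap A B"
  by (simp add: dmap_def)

lemma dmap_unit: "f \<in> dmap A B \<Longrightarrow> fst B * f = f" "f \<in> dmap A B \<Longrightarrow> f * fst A = f"
  by (simp_all add: dmap_def)

lemma dnullI: "\<lbrakk>f = snd B * h + h * snd A; fst B * h = h; h * fst A = h\<rbrakk> \<Longrightarrow> f \<in> dnull A B"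
  by (auto simp: dnull_def)

lemma dnullE:
  assumes "f \<in> dnull A B"
  obtains h where "f = snd B * h + h * snd A" "fst B * h = h" "h * fst A = h"
  using assms by (auto simp: dnull_def)

lemma dnull_zero [simp]: "0 \<in> dnull A B"
  by (rule dnullI[of _ _ 0]) simp_all

lemma dnull_add: "\<lbrakk>f \<in> dnull A B; g \<in> dnull A B\<rbrakk> \<Longrightarrow> f + g \<in> dnull A B"
  by (elim dnullE, rule_tac h = "h + ha" in dnullI) (simp_all add: algebra_simps)

lemma dnull_minus: "f \<in> dnull A B \<Longrightarrow> - f \<in> dnull A B"
  by (elim dnullE, rule_tac h = "- h" in dnullI) simp_all

lemma dnull_diff: "\<lbrakk>f \<in> dnull A B; g \<in> dnull A B\<rbrakk> \<Longrightarrow> f - g \<in> dnull A B"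
  using dnull_add[of f A B "- g"] dnull_minus[of g A B] by simp

lemma dnull_comp_left:
  assumes "f \<in> dnull A B" "g \<in> dmap B D"
  shows "g * f \<in> dnull A D"
proof -
  obtain h where h: "f = snd B * h + h * snd A" "fst B * h = h" "h * fst A = h"
    using assms(1) by (rule dnullE)
  have g: "fst D * g = g" "g * snd B = snd D * g" using assms(2) by (auto simp: dmap_def)
  have "g * (snd B * h) = snd D * (g * h)" by (metis g(2) mult.assoc)
  then have "g * f = snd D * (g * h) + g * h * snd A"
    by (simp add: h(1) algebra_simps)
  moreover have "fst D * (g * h) = g * h" "g * h * fst A = g * h"
    by (metis g(1) mult.assoc) (simp add: h mult.assoc)
  ultimately show ?thesis by (rule dnullI)
qed

lemma dnull_comp_right:
  assumes "f \<in> dnull B D" "g \<in> dmap A B"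
  shows "f * g \<in> dnull A D"
proof -
  obtain h where h: "f = snd D * h + h * snd B" "fst D * h = h" "h * fst B = h"
    using assms(1) by (rule dnullE)
  have g: "g * fst A = g" "snd B * g = g * snd A" using assms(2) by (auto simp: dmap_def)
  have "f * g = snd D * (h * g) + h * g * snd A"
    by (simp add: h(1) algebra_simps g)
  moreover have "fst D * (h * g) = h * g" "h * g * fst A = h * g"
    by (metis h(2) mult.assoc) (simp add: g mult.assoc)
  ultimately show ?thesis by (rule dnullI)
qed

lemma dnull_dmap:
  assumes "is_dobj A" "is_dobj B" "f \<in> dnull A B" shows "f \<in> dmap A B"
proof -
  obtain h where h: "f = snd B * h + h * snd A" "fst B * h = h" "h * fst A = h"
    using assms(3) by (rule dnullE)
  have A: "snd A * fst A = snd A" "snd A * snd A = 0" and B: "fst B * snd B = snd B" "snd B * snd B = 0"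
    using assms by (auto simp: is_dobj_def)
  have "fst B * (snd B * h) = snd B * h" "fst B * (h * snd A) = h * snd A"
    "snd B * (snd B * h) = 0"
    by (metis B(1) mult.assoc, metis h(2) mult.assoc, metis B(2) mult.assoc mult_zero_left)
  then show ?thesis
    by (intro dmapI) (simp_all add: h algebra_simps A)
qed

lemma heq_refl: "f \<in> dmap A B \<Longrightarrow> heq A B f f"
  by (simp add: heq_def)

lemma heq_sym: "heq A B f g \<Longrightarrow> heq A B g f"
  using dnull_minus[of "f - g" A B] by (simp add: heq_def)

lemma heq_trans [trans]: "\<lbrakk>heq A B f g; heq A B g h\<rbrakk> \<Longrightarrow> heq A B f h"
  using dnull_add[of "f - g" A B "g - h"] by (simp add: heq_def)

lemma heq_dmap: "heq A B f g \<Longrightarrow> f \<in> dmap A B" "heq A B f g \<Longrightarrow> g \<in> dmap A B"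
  by (simp_all add: heq_def)

lemma heq_comp:
  assumes "heq A B f f'" "heq B D g g'" shows "heq A D (g * f) (g' * f')"
proof -
  have "g * (f - f') + (g - g') * f' \<in> dnull A D"
    using assms by (intro dnull_add dnull_comp_left[where B = B] dnull_comp_right[where B = B])
      (auto simp: heq_def)
  moreover have "g * (f - f') + (g - g') * f' = g * f - g' * f'"
    by (simp add: algebra_simps)
  ultimately show ?thesis using assms by (auto simp: heq_def intro: dmap_comp)
qed

lemma heq_compL: "\<lbrakk>heq A B f f'; g \<in> dmap B D\<rbrakk> \<Longrightarrow> heq A D (g * f) (g * f')"
  by (rule heq_comp[OF _ heq_refl])

lemma heq_compR: "\<lbrakk>heq B D g g'; f \<in> dmap A B\<rbrakk> \<Longrightarrow> heq A D (g * f) (g' * f)"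
  by (rule heq_comp[OF heq_refl])

lemma heq_minus: "heq A B f g \<Longrightarrow> heq A B (- f) (- g)"
  using dnull_minus[of "f - g" A B] by (simp add: heq_def)

lemma heqI_homotopy:
  "\<lbrakk>f \<in> dmap A B; g \<in> dmap A B; f = g + (snd B * h + h * snd A); fst B * h = h; h * fst A = h\<rbrakk>
    \<Longrightarrow> heq A B f g"
  unfolding heq_def by (auto intro!: dnullI[of _ _ h])

lemma heqE_homotopy:
  assumes "heq A B f g"
  obtains h where "f = g + (snd B * h + h * snd A)" "fst B * h = h" "h * fst A = h"
  using assms unfolding heq_def by (metis dnullE diff_add_cancel add.commute)

section \<open>Homotopy equivalences\<close>

lemma hiso_sym: "hiso A B f g \<Longrightarrow> hiso B A g f"
  by (simp add: hiso_def)

lemma hiso_id: "is_dobj A \<Longrightarrow> hiso A A (fst A) (fst A)"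
  by (simp add: hiso_def is_dobj_def heq_refl dmap_def)

lemma hisoI_strict:
  "\<lbrakk>is_dobj A; is_dobj B; f \<in> dmap A B; g \<in> dmap B A; g * f = fst A; f * g = fst B\<rbrakk> \<Longrightarrow> hiso A B f g"
  by (simp add: hiso_def heq_refl dmap_id)

lemma hiso_comp:
  assumes "hiso A B f f'" "hiso B D g g'"
  shows "hiso A D (g * f) (f' * g')"
proof -
  have fs: "f \<in> dmap A B" "f' \<in> dmap B A" "g \<in> dmap B D" "g' \<in> dmap D B"
    and h: "heq A A (f' * f) (fst A)" "heq B B (f * f') (fst B)"
      "heq B B (g' * g) (fst B)" "heq D D (g * g') (fst D)"
    using assms by (auto simp: hiso_def)
  have "heq A A (f' * ((g' * g) * f)) (f' * (fst B * f))"
    by (intro heq_compL[where B = B] heq_compR[where B = B] h fs)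
  then have 1: "heq A A (f' * g' * (g * f)) (fst A)"
    using h(1) dmap_unit(1)[OF fs(1)] by (metis heq_trans mult.assoc)
  have "heq D D (g * ((f * f') * g')) (g * (fst B * g'))"
    by (intro heq_compL[where B = B] heq_compR[where B = B] h fs)
  then have 2: "heq D D (g * f * (f' * g')) (fst D)"
    using h(4) dmap_unit(1)[OF fs(4)] by (metis heq_trans mult.assoc)
  show ?thesis using 1 2 fs by (auto simp: hiso_def intro: dmap_comp)
qed

lemma hiso_cancel_left:
  assumes "hiso A B f g" "heq D A x (g * y)" "y \<in> dmap D B"
  shows "heq D B (f * x) y"
proof -
  have "heq D B (f * x) (f * (g * y))" using assms by (auto simp: hiso_def intro: heq_compL)
  moreover have "heq D B (f * g * y) (fst B * y)" using assms by (auto simp: hiso_def intro: heq_compR)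
  ultimately show ?thesis using dmap_unit(1)[OF assms(3)] by (metis heq_trans mult.assoc)
qed

lemma hiso_cancel_right:
  assumes "hiso A B f g" "heq B D x (y * g)" "y \<in> dmap A D"
  shows "heq A D (x * f) y"
proof -
  have "heq A D (x * f) (y * g * f)" using assms by (auto simp: hiso_def intro: heq_compR)
  moreover have "heq A D (y * (g * f)) (y * fst A)" using assms by (auto simp: hiso_def intro: heq_compL)
  ultimately show ?thesis using dmap_unit(2)[OF assms(3)] by (metis heq_trans mult.assoc)
qed

text \<open>The left inverse \<open>g\<close> and the right inverse \<open>g'\<close> are both
  homotopic to \<open>g * f * g'\<close>. For cone maps the two one-sided inverses are found
  separately.\<close>

lemma hiso_two_sided:
  assumes "is_dobj A" "is_dobj B" "f \<in> dmap A B" "g \<in> dmap B A" "g' \<in> dmap B A"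
    and l: "heq A A (g * f) (fst A)" and r: "heq B B (f * g') (fst B)"
  shows "hiso A B f g"
proof -
  have "heq B A (g * f * g') (fst A * g')" using assms by (auto intro: heq_compR)
  moreover have "heq B A (g * (f * g')) (g * fst B)" using assms by (auto intro: heq_compL)
  ultimately have "heq B A g g'"
    using assms dmap_unit by (metis heq_sym heq_trans mult.assoc)
  then have "heq B B (f * g) (fst B)"
    using r assms(3) by (blast intro: heq_trans heq_compL)
  then show ?thesis using assms by (simp add: hiso_def)
qed

text \<open>The ring is decomposed as \<open>1 \<cong> 1 \<oplus> 1\<close>, which makes room for direct sums and cones inside it.\<close>

locale doubling =
  fixes s t s' t' :: "'r::{ring,monoid_mult}"
  assumes ss: "s' * s = 1" and tt: "t' * t = 1" and st: "s' * t = 0" and ts: "t' * s = 0"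
    and sum: "s * s' + t * t' = 1"
begin

lemma ass [simp]: "s' * (s * x) = x" "t' * (t * x) = x" "s' * (t * x) = 0" "t' * (s * x) = 0"
  by (metis mult.assoc mult_1_left mult_zero_left ss tt st ts)+

lemmas [simp] = ss tt st ts

text \<open>In matrix notation the differential has rows \<open>(snd B, f)\<close> and
  \<open>(0, - snd A)\<close>: \<open>s\<close> embeds the target, \<open>t\<close> the suspended
  source, and \<open>s * x * t'\<close> is the entry \<open>x\<close> leading from the second
  summand to the first.\<close>

definition cone :: "'r \<times> 'r \<Rightarrow> 'r \<times> 'r \<Rightarrow> 'r \<Rightarrow> 'r \<times> 'r"
  where "cone A B f = (s * fst B * s' + t * fst A * t',
    s * snd B * s' + s * f * t' - t * snd A * t')"

definition dsum :: "'r \<times> 'r \<Rightarrow> 'r \<times> 'r \<Rightarrow> 'r \<times> 'r"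
  where "dsum A B = (s * fst A * s' + t * fst B * t', s * snd A * s' + t * snd B * t')"

text \<open>The versions with a trailing factor \<open>x\<close> let the simplifier apply the
  relations in the middle of right-associated products; all matrix identities below are proved this
  way.\<close>

lemma dobj_rules:
  assumes "is_dobj A"
  shows "fst A * fst A = fst A" "fst A * snd A = snd A" "snd A * fst A = snd A" "snd A * snd A = 0"
    "fst A * (fst A * x) = fst A * x" "fst A * (snd A * x) = snd A * x"
    "snd A * (fst A * x) = snd A * x" "snd A * (snd A * x) = 0"
  using assms unfolding is_dobj_def by (auto simp flip: mult.assoc)

lemma dmap_rules:
  assumes "f \<in> dmap A B"
  shows "fst B * f = f" "f * fst A = f" "snd B * f = f * snd A"
    "fst B * (f * x) = f * x" "f * (fst A * x) = f * x" "snd B * (f * x) = f * (snd A * x)"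
  using assms unfolding dmap_def by (auto simp flip: mult.assoc)

lemma hom_rules:
  fixes h :: 'r
  assumes "fst B * h = h" "h * fst A = h"
  shows "fst B * h = h" "h * fst A = h" "fst B * (h * x) = h * x" "h * (fst A * x) = h * x"
  using assms by (auto simp flip: mult.assoc)

lemma is_dobj_dsum: "\<lbrakk>is_dobj A; is_dobj B\<rbrakk> \<Longrightarrow> is_dobj (dsum A B)"
  unfolding is_dobj_def[of "dsum A B"] by (simp add: dsum_def algebra_simps dobj_rules)

lemma is_dobj_cone:
  assumes "is_dobj A" "is_dobj B" "f \<in> dmap A B" shows "is_dobj (cone A B f)"
  unfolding is_dobj_def[of "cone A B f"]
  by (simp add: cone_def algebra_simps assms dobj_rules[OF assms(1)] dobj_rules[OF assms(2)] dmap_rules[OF assms(3)])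

section \<open>Cone triangles\<close>

lemma cone_incl: "\<lbrakk>is_dobj A; is_dobj B; f \<in> dmap A B\<rbrakk> \<Longrightarrow> s * fst B \<in> dmap B (cone A B f)"
  by (intro dmapI) (simp_all add: cone_def algebra_simps dobj_rules)

lemma cone_proj: "\<lbrakk>is_dobj A; is_dobj B; f \<in> dmap A B\<rbrakk> \<Longrightarrow> fst A * t' \<in> dmap (cone A B f) (sus A)"
  by (intro dmapI) (simp_all add: cone_def algebra_simps dobj_rules)

text \<open>A triangle isomorphic in the homotopy category to a cone triangle. The isomorphism is
  required to be the identity on A and B; by \<open>tri_iso\<close> this is no restriction.\<close>

definition tri :: "'r \<times> 'r \<Rightarrow> 'r \<times> 'r \<Rightarrow> 'r \<times> 'r \<Rightarrow> 'r \<Rightarrow> 'r \<Rightarrow> 'r \<Rightarrow> bool"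
  where "tri A B D f g h \<longleftrightarrow> f \<in> dmap A B \<and> g \<in> dmap B D \<and> h \<in> dmap D (sus A) \<and>
    (\<exists>c c'. hiso (cone A B f) D c c' \<and> heq B D (c * (s * fst B)) g \<and>
      heq (cone A B f) (sus A) (h * c) (fst A * t'))"

lemma tri_id:
  assumes A: "is_dobj A" and N: "is_dobj N" "heq N N (fst N) 0"
  shows "tri A A N (fst A) 0 0"
  unfolding tri_def
proof (intro conjI dmap_zero dmap_id A exI)
  let ?C = "cone A A (fst A)"
  have C: "is_dobj ?C" using A by (intro is_dobj_cone dmap_id)
  have 0: "heq ?C ?C (fst ?C) 0"
    \<comment> \<open>The contraction of the cone of an identity moves the target summand back onto
      the source summand.\<close>
    by (rule heqI_homotopy[where h = "t * fst A * s'"])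
      (simp_all add: dmap_id C, simp_all add: cone_def algebra_simps dobj_rules[OF A])
  show "hiso ?C N 0 0" using 0 N by (simp add: hiso_def heq_sym)
  show "heq A N (0 * (s * fst A)) 0" by (simp add: heq_refl)
  have "heq ?C (sus A) (fst A * t' * fst ?C) (fst A * t' * 0)"
    by (rule heq_compL[OF 0 cone_proj[OF A A dmap_id[OF A]]])
  then show "heq ?C (sus A) (0 * 0) (fst A * t')"
    using dmap_unit(2)[OF cone_proj[OF A A dmap_id[OF A]]] by (simp add: heq_sym)
qed

section \<open>Maps of cones\<close>

definition cmap :: "'r \<Rightarrow> 'r \<Rightarrow> 'r \<Rightarrow> 'r"
  where "cmap a b k = s * b * s' + s * k * t' + t * a * t'"

text \<open>The corner entry \<open>k\<close> absorbs the failure of the square to commute strictly,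
  so every homotopy filling the square gives a map of cones.\<close>

lemma cmap_dmap:
  assumes A: "is_dobj A" "is_dobj B" "is_dobj A'" "is_dobj B'"
    and f: "f \<in> dmap A B" "f' \<in> dmap A' B'" and a: "a \<in> dmap A A'" and b: "b \<in> dmap B B'"
    and k: "b * f = f' * a + (snd B' * k + k * snd A)" "fst B' * k = k" "k * fst A = k"
  shows "cmap a b k \<in> dmap (cone A B f) (cone A' B' f')"
proof -
  have k': "b * (f * x) = f' * (a * x) + (snd B' * (k * x) + k * (snd A * x))" for x
    using arg_cong[OF k(1), of "\<lambda>z. z * x"] by (simp add: algebra_simps)
  show ?thesis
    by (intro dmapI) (simp_all add: cone_def cmap_def algebra_simps dmap_rules[OF a] dmap_rules[OF b]
        hom_rules[OF k(2,3)] k(1) k')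
qed

text \<open>The corner part of \<open>n\<close> squares to zero, so reversing its sign inverts
  \<open>n\<close> strictly and not just up to homotopy.\<close>

lemma unitriangular_hiso:
  assumes A: "is_dobj A" "is_dobj B" and f: "f \<in> dmap A B"
    and n: "n = s * fst B * s' + s * q * t' + t * fst A * t'" "n \<in> dmap (cone A B f) (cone A B f)"
  shows "\<exists>n' \<in> dmap (cone A B f) (cone A B f). n' * n = fst (cone A B f) \<and> n * n' = fst (cone A B f)"
proof -
  let ?C = "cone A B f"
  have C: "is_dobj ?C" using A f by (rule is_dobj_cone)
  have "fst ?C * n = n" "n * fst ?C = n" using n(2) by (auto simp: dmap_def)
  \<comment> \<open>Reading off the corner entry of \<open>n\<close> shows that \<open>q\<close>
    runs from the image of A to the image of B.\<close>
  then have "s' * (fst ?C * n * t) = s' * (n * t)" "s' * (n * fst ?C) * t = s' * (n * t)" by (simp_all add: mult.assoc)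
  then have q: "fst B * q = q" "q * fst A = q"
    by (simp_all add: n(1) cone_def algebra_simps dobj_rules[OF A(1)] dobj_rules[OF A(2)])
  define n' where "n' = s * fst B * s' - s * q * t' + t * fst A * t'"
  have e: "n' * n = fst ?C" "n * n' = fst ?C" "fst ?C * n' = n'" "n' * fst ?C = n'"
    by (simp_all add: n(1) n'_def cone_def algebra_simps dobj_rules[OF A(1)] dobj_rules[OF A(2)] hom_rules[OF q])
  \<comment> \<open>A strict inverse of a map that commutes with the differential commutes with it
    as well.\<close>
  have "snd ?C * n' = n' * n * snd ?C * n'"
    using C by (simp add: e is_dobj_def)
  also have "\<dots> = n' * (snd ?C * n) * n'" using n(2) by (simp add: dmap_def mult.assoc)
  also have "\<dots> = n' * snd ?C" using C by (simp add: mult.assoc e is_dobj_def)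
  finally have "n' \<in> dmap ?C ?C" using e by (auto intro: dmapI)
  then show ?thesis using e by blast
qed

text \<open>The composite of the two cone maps need not be homotopic to the identity, because its
  corner depends on the homotopies \<open>k\<close> and \<open>k'\<close>. A diagonal homotopy makes
  its diagonal the identity, and the unitriangular map that remains is invertible.\<close>

lemma cmap_left_inverse:
  assumes A: "is_dobj A" "is_dobj B" "is_dobj A'" "is_dobj B'"
    and f: "f \<in> dmap A B" "f' \<in> dmap A' B'"
    and a: "a \<in> dmap A A'" "a' \<in> dmap A' A" "heq A A (a' * a) (fst A)"
    and b: "b \<in> dmap B B'" "b' \<in> dmap B' B" "heq B B (b' * b) (fst B)"
    and m: "cmap a b k \<in> dmap (cone A B f) (cone A' B' f')"
    and m': "cmap a' b' k' \<in> dmap (cone A' B' f') (cone A B f)"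
  shows "\<exists>n \<in> dmap (cone A B f) (cone A B f). heq (cone A B f) (cone A B f) (n * cmap a' b' k' * cmap a b k) (fst (cone A B f))
     \<and> heq (cone A B f) (cone A B f) (cmap a' b' k' * cmap a b k * n) (fst (cone A B f))"
proof -
  let ?C = "cone A B f" and ?m = "cmap a' b' k' * cmap a b k"
  have C: "is_dobj ?C" using A f by (intro is_dobj_cone)
  have mm: "?m \<in> dmap ?C ?C" using m m' by (rule dmap_comp)
  obtain w where w: "a' * a = fst A + (snd A * w + w * snd A)" "fst A * w = w" "w * fst A = w"
    using a(3) by (rule heqE_homotopy)
  obtain u where u: "b' * b = fst B + (snd B * u + u * snd B)" "fst B * u = u" "u * fst B = u"
    using b(3) by (rule heqE_homotopy)
  have w': "a' * (a * x) = fst A * x + (snd A * (w * x) + w * (snd A * x))" for x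
    using arg_cong[OF w(1), of "\<lambda>z. z * x"] by (simp add: algebra_simps)
  have u': "b' * (b * x) = fst B * x + (snd B * (u * x) + u * (snd B * x))" for x
    using arg_cong[OF u(1), of "\<lambda>z. z * x"] by (simp add: algebra_simps)
  \<comment> \<open>The sign in front of \<open>w\<close> is forced by the differential
    \<open>- snd A\<close> of the second summand.\<close>
  define H where "H = s * u * s' - t * w * t'"
  define n where "n = ?m - (snd ?C * H + H * snd ?C)"
  have H: "fst ?C * H = H" "H * fst ?C = H"
    by (simp_all add: H_def cone_def algebra_simps hom_rules[OF w(2,3)] hom_rules[OF u(2,3)])
  have Hn: "snd ?C * H + H * snd ?C \<in> dnull ?C ?C" using H by (intro dnullI[OF refl])
  have n: "n \<in> dmap ?C ?C" unfolding n_def by (intro dmap_diff mm dnull_dmap C Hn)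
  have "n = s * fst B * s' + s * (b' * k + k' * a - (u * f - f * w)) * t' + t * fst A * t'"
    by (simp add: n_def H_def cone_def cmap_def algebra_simps u' w')
  from unitriangular_hiso[OF A(1,2) f(1) this n] obtain n' where
    n': "n' \<in> dmap ?C ?C" "n' * n = fst ?C" "n * n' = fst ?C" by blast
  have e: "heq ?C ?C ?m n" using mm n Hn unfolding heq_def n_def by (simp only: diff_diff_eq2 add_diff_cancel_left' simp_thms)
  have "heq ?C ?C (n' * ?m) (fst ?C)" using heq_compL[OF e n'(1)] by (simp only: n'(2))
  moreover have "heq ?C ?C (?m * n') (fst ?C)" using heq_compR[OF e n'(1)] by (simp only: n'(3))
  ultimately show ?thesis using n'(1) by (metis mult.assoc)
qed

text \<open>This takes the place of the five lemma. The inverses of \<open>a\<close> and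
  \<open>b\<close> form a square with its own homotopy \<open>k'\<close>; the resulting map back is
  inverse to the given one up to an automorphism on either side, and \<open>hiso_two_sided\<close>
  combines the two.\<close>

lemma cmap_hiso:
  assumes A: "is_dobj A" "is_dobj B" "is_dobj A'" "is_dobj B'"
    and f: "f \<in> dmap A B" "f' \<in> dmap A' B'"
    and a: "hiso A A' a a'" and b: "hiso B B' b b'"
    and k: "b * f = f' * a + (snd B' * k + k * snd A)" "fst B' * k = k" "k * fst A = k"
  shows "\<exists>m'. hiso (cone A B f) (cone A' B' f') (cmap a b k) m'"
proof -
  have ab: "a \<in> dmap A A'" "a' \<in> dmap A' A" "b \<in> dmap B B'" "b' \<in> dmap B' B"
    and h: "heq A A (a' * a) (fst A)" "heq A' A' (a * a') (fst A')"
     "heq B B (b' * b) (fst B)" "heq B' B' (b * b') (fst B')"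
    using a b by (auto simp: hiso_def)
  have m: "cmap a b k \<in> dmap (cone A B f) (cone A' B' f')"
    using A f ab k by (intro cmap_dmap)
  have "heq A B' (b * f) (f' * a)"
    using k ab f by (intro heqI_homotopy dmap_comp[of f A B b B'] dmap_comp[of a A A' f' B']) auto
  then have "heq A' B' (b * f * a') (f' * a * a')" using ab by (intro heq_compR)
  also have "heq A' B' (f' * a * a') f'"
    using heq_compL[OF h(2) f(2)] dmap_unit[OF f(2)] by (simp add: mult.assoc)
  finally have "heq A' B' (b * (f * a')) f'" by (simp add: mult.assoc)
  then have "heq A' B (b' * f') (f * a')"
    using hiso_cancel_left[OF hiso_sym[OF b] heq_sym, of A' "f * a'" f'] dmap_comp[OF ab(2) f(1)] by simp
  then obtain k' where k': "b' * f' = f * a' + (snd B * k' + k' * snd A')" "fst B * k' = k'" "k' * fst A' = k'"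
    by (rule heqE_homotopy)
  have m': "cmap a' b' k' \<in> dmap (cone A' B' f') (cone A B f)"
    using A f ab k' by (intro cmap_dmap)
  obtain n where n: "n \<in> dmap (cone A B f) (cone A B f)"
    "heq (cone A B f) (cone A B f) (n * cmap a' b' k' * cmap a b k) (fst (cone A B f))"
    using cmap_left_inverse[OF A f ab(1,2) h(1) ab(3,4) h(3) m m'] by blast
  obtain l where l: "l \<in> dmap (cone A' B' f') (cone A' B' f')"
    "heq (cone A' B' f') (cone A' B' f') (cmap a b k * cmap a' b' k' * l) (fst (cone A' B' f'))"
    using cmap_left_inverse[OF A(3,4,1,2) f(2,1) ab(2,1) h(2) ab(4,3) h(4) m' m] by blast
  have "hiso (cone A B f) (cone A' B' f') (cmap a b k) (n * cmap a' b' k')"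
    by (rule hiso_two_sided[OF _ _ m dmap_comp[OF m' n(1)] dmap_comp[OF l(1) m']])
      (use A f n l in \<open>auto intro: is_dobj_cone simp: mult.assoc\<close>)
  then show ?thesis by blast
qed

lemma cmap_incl: "\<lbrakk>a \<in> dmap A A'; b \<in> dmap B B'\<rbrakk> \<Longrightarrow> cmap a b k * (s * fst B) = s * fst B' * b"
  by (simp add: cmap_def algebra_simps dmap_rules)

lemma cmap_proj: "\<lbrakk>a \<in> dmap A A'; b \<in> dmap B B'\<rbrakk> \<Longrightarrow> fst A' * t' * cmap a b k = a * (fst A * t')"
  by (simp add: cmap_def algebra_simps dmap_rules)

text \<open>The homotopy in the left square gives a map of cones, which commutes strictly with
  inclusions and projections. Conjugating it with the comparison maps \<open>c\<close> and
  \<open>c'\<close> gives the third map of TR3.\<close>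

lemma tri_morphism:
  assumes A: "is_dobj A" "is_dobj B" "is_dobj A'" "is_dobj B'"
    and T: "tri A B D f g h" and T': "tri A' B' D' f' g' h'"
    and a: "a \<in> dmap A A'" and b: "b \<in> dmap B B'" and ab: "heq A B' (b * f) (f' * a)"
  shows "\<exists>d \<in> dmap D D'. heq B D' (d * g) (g' * b) \<and> heq D (sus A') (a * h) (h' * d)"
proof -
  obtain k where k: "b * f = f' * a + (snd B' * k + k * snd A)" "fst B' * k = k" "k * fst A = k"
    using ab by (rule heqE_homotopy)
  obtain c c1 where c: "hiso (cone A B f) D c c1" "heq B D (c * (s * fst B)) g"
      "heq (cone A B f) (sus A) (h * c) (fst A * t')" and m: "f \<in> dmap A B" "g \<in> dmap B D" "h \<in> dmap D (sus A)"
    using T by (auto simp: tri_def)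
  obtain c' c1' where c': "hiso (cone A' B' f') D' c' c1'" "heq B' D' (c' * (s * fst B')) g'"
      "heq (cone A' B' f') (sus A') (h' * c') (fst A' * t')"
      and m': "f' \<in> dmap A' B'" "g' \<in> dmap B' D'" "h' \<in> dmap D' (sus A')"
    using T' by (auto simp: tri_def)
  let ?m = "cmap a b k"
  have mm: "?m \<in> dmap (cone A B f) (cone A' B' f')"
    using A m m' a b k by (intro cmap_dmap)
  have cs: "c \<in> dmap (cone A B f) D" "c1 \<in> dmap D (cone A B f)" "c' \<in> dmap (cone A' B' f') D'"
    using c c' by (auto simp: hiso_def)
  have i: "s * fst B \<in> dmap B (cone A B f)" "s * fst B' \<in> dmap B' (cone A' B' f')"
    using A m m' by (auto intro: cone_incl)
  have p: "fst A * t' \<in> dmap (cone A B f) (sus A)" "fst A' * t' \<in> dmap (cone A' B' f') (sus A')"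
    using A m m' by (auto intro: cone_proj)
  have 1: "heq B (cone A B f) (c1 * g) (s * fst B)"
    using hiso_cancel_left[OF hiso_sym[OF c(1)] heq_sym[OF c(2)] i(1)] .
  have "heq B D' (c' * ?m * (c1 * g)) (c' * ?m * (s * fst B))"
    by (rule heq_compL[OF 1 dmap_comp[OF mm cs(3)]])
  also have "c' * ?m * (s * fst B) = c' * (s * fst B') * b"
    using cmap_incl[OF a b, of k] by (simp add: mult.assoc)
  also have "heq B D' (c' * (s * fst B') * b) (g' * b)"
    using c'(2) b by (rule heq_compR)
  finally have I: "heq B D' (c' * ?m * c1 * g) (g' * b)" by (simp add: mult.assoc)
  have 2: "heq D (sus A) (fst A * t' * c1) h"
    using hiso_cancel_right[OF hiso_sym[OF c(1)] heq_sym[OF c(3)] m(3)] .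
  have "heq D (sus A') (h' * c' * (?m * c1)) (fst A' * t' * (?m * c1))"
    by (rule heq_compR[OF c'(3) dmap_comp[OF cs(2) mm]])
  also have "fst A' * t' * (?m * c1) = a * (fst A * t' * c1)"
    using cmap_proj[OF a b, of k] by (metis mult.assoc)
  also have "heq D (sus A') (a * (fst A * t' * c1)) (a * h)"
    using 2 by (rule heq_compL) (use a in simp)
  finally have "heq D (sus A') (h' * (c' * ?m * c1)) (a * h)" by (simp add: mult.assoc)
  then show ?thesis
    using I by (intro bexI[of _ "c' * ?m * c1"] conjI) (auto intro: heq_sym dmap_comp cs mm)
qed

text \<open>The cone of \<open>f'\<close> is compared with \<open>D'\<close> by going back along the
  cone map, across \<open>c\<close> and on along \<open>d\<close>. Thanks to this lemma rotation and
  the octahedron have to be computed for cone triangles only.\<close>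

lemma tri_iso:
  assumes A: "is_dobj A" "is_dobj B" "is_dobj D" "is_dobj A'" "is_dobj B'" "is_dobj D'"
    and T: "tri A B D f g h"
    and f': "f' \<in> dmap A' B'" "g' \<in> dmap B' D'" "h' \<in> dmap D' (sus A')"
    and a: "hiso A A' a a'" and b: "hiso B B' b b'" and d: "hiso D D' d d'"
    and ab: "heq A B' (b * f) (f' * a)" and bd: "heq B D' (d * g) (g' * b)"
    and da: "heq D (sus A') (a * h) (h' * d)"
  shows "tri A' B' D' f' g' h'"
proof -
  obtain k where k: "b * f = f' * a + (snd B' * k + k * snd A)" "fst B' * k = k" "k * fst A = k"
    using ab by (rule heqE_homotopy)
  obtain c c1 where c: "hiso (cone A B f) D c c1" "heq B D (c * (s * fst B)) g"
      "heq (cone A B f) (sus A) (h * c) (fst A * t')" and m: "f \<in> dmap A B" "g \<in> dmap B D" "h \<in> dmap D (sus A)"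
    using T by (auto simp: tri_def)
  let ?m = "cmap a b k"
  obtain m' where m': "hiso (cone A B f) (cone A' B' f') ?m m'"
    using cmap_hiso[OF A(1,2,4,5) m(1) f'(1) a b k] by blast
  have abd: "a \<in> dmap A A'" "a' \<in> dmap A' A" "b \<in> dmap B B'" "b' \<in> dmap B' B" "d \<in> dmap D D'" "d' \<in> dmap D' D"
    using a b d by (auto simp: hiso_def)
  have cs: "c \<in> dmap (cone A B f) D" "m' \<in> dmap (cone A' B' f') (cone A B f)"
    using c m' by (auto simp: hiso_def)
  have i: "s * fst B \<in> dmap B (cone A B f)" "s * fst B' \<in> dmap B' (cone A' B' f')"
    using A m f' by (auto intro: cone_incl)
  have p: "fst A * t' \<in> dmap (cone A B f) (sus A)" "fst A' * t' \<in> dmap (cone A' B' f') (sus A')"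
    using A m f' by (auto intro: cone_proj)
  have H: "hiso (cone A' B' f') D' (d * c * m') (?m * (c1 * d'))"
    using hiso_comp[OF hiso_sym[OF m'] hiso_comp[OF c(1) d]] by (simp add: mult.assoc)
  have "?m * (s * fst B * b') = s * fst B' * b * b'"
    using cmap_incl[OF abd(1,3), of k] by (metis mult.assoc)
  moreover have "heq B' (cone A' B' f') (s * fst B' * b * b') (s * fst B')"
  proof -
    have "heq B' B' (b * b') (fst B')" using b by (simp add: hiso_def)
    from heq_compL[OF this i(2)] show ?thesis by (simp add: mult.assoc dobj_rules[OF A(5)])
  qed
  ultimately have "heq B' (cone A' B' f') (s * fst B') (?m * (s * fst B * b'))"
    by (metis heq_sym)
  then have "heq B' (cone A B f) (m' * (s * fst B')) (s * fst B * b')"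
    using hiso_cancel_left[OF hiso_sym[OF m']] dmap_comp[OF abd(4) i(1)] by blast
  then have "heq B' D' (d * c * (m' * (s * fst B'))) (d * c * (s * fst B * b'))"
    by (rule heq_compL[OF _ dmap_comp[OF cs(1) abd(5)]])
  also have "heq B' D' (d * c * (s * fst B * b')) (d * (g * b'))"
    using heq_compL[OF heq_compR[OF c(2) abd(4)] abd(5)] by (simp add: mult.assoc)
  also have "heq B' D' (d * (g * b')) (g' * b * b')"
    using heq_compR[OF bd abd(4)] by (simp add: mult.assoc)
  also have "heq B' D' (g' * b * b') g'"
  proof -
    have "heq B' B' (b * b') (fst B')" using b by (simp add: hiso_def)
    from heq_compL[OF this f'(2)] show ?thesis by (simp add: mult.assoc dmap_unit(2)[OF f'(2)])
  qed
  finally have I: "heq B' D' (d * c * m' * (s * fst B')) g'" by (simp add: mult.assoc)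
  have 2: "heq (cone A' B' f') (sus A') (a * (fst A * t') * m') (fst A' * t')"
  proof (rule hiso_cancel_right[OF hiso_sym[OF m'] _ p(2)])
    have "a * (fst A * t') \<in> dmap (cone A B f) (sus A')"
      using dmap_comp[OF p(1), of a "sus A'"] abd(1) by simp
    then show "heq (cone A B f) (sus A') (a * (fst A * t')) (fst A' * t' * ?m)"
      unfolding cmap_proj[OF abd(1,3)] by (rule heq_refl)
  qed
  have "heq (cone A' B' f') (sus A') (h' * d * (c * m')) (a * h * (c * m'))"
    using heq_sym[OF da] dmap_comp[OF cs(2,1)] by (rule heq_compR)
  also have "heq (cone A' B' f') (sus A') (a * h * (c * m')) (a * (fst A * t') * m')"
    using heq_compL[OF heq_compR[OF c(3) cs(2)], of a "sus A'"] abd(1) by (simp add: mult.assoc)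
  also note 2
  finally have "heq (cone A' B' f') (sus A') (h' * (d * c * m')) (fst A' * t')"
    by (simp add: mult.assoc)
  then show ?thesis unfolding tri_def using f' H I by blast
qed

section \<open>Rotation\<close>

lemma tri_rotate_cone:
  assumes A: "is_dobj A" "is_dobj B" and f: "f \<in> dmap A B"
  shows "tri B (cone A B f) (sus A) (s * fst B) (fst A * t') (- f)"
proof -
  let ?C = "cone A B f" let ?i = "s * fst B" let ?p = "fst A * t'"
  note C = is_dobj_cone[OF A f] note i = cone_incl[OF A f] and p = cone_proj[OF A f]
  let ?E = "cone B ?C ?i"
  note E = is_dobj_cone[OF A(2) C i]
  note R = dobj_rules[OF A(1)] dobj_rules[OF A(2)] dmap_rules[OF f] cone_def algebra_simps
  \<comment> \<open>The cone \<open>?E\<close> of the inclusion consists of A and two copies of B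
    that cancel. \<open>?c\<close> projects onto A; in \<open>?c'\<close> the term
    \<open>- t * f\<close>, which enters the second copy of B, makes the map commute with the
    differentials.\<close>
  let ?c = "?p * s'" and ?c' = "s * t * fst A - t * f"
  have c: "?c \<in> dmap ?E (sus A)" by (rule dmapI) (simp_all add: R)
  have c': "?c' \<in> dmap (sus A) ?E" by (rule dmapI) (simp_all add: R)
  have 1: "heq (sus A) (sus A) (?c * ?c') (fst (sus A))"
    using A(1) by (simp add: R heq_refl dmap_id)
  have 2: "heq ?E ?E (fst ?E) (?c' * ?c)"
    \<comment> \<open>The homotopy maps the first copy of B identically onto the second.\<close>
    by (rule heqI_homotopy[where h = "t * fst B * s' * s'"])
      (use dmap_id[OF E] dmap_comp[OF c c'] in \<open>simp_all only:\<close>, simp_all add: R)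
  have 3: "heq ?C (sus A) (?c * (s * fst ?C)) ?p"
  proof -
    have "?c * (s * fst ?C) = ?p" by (simp add: R)
    then show ?thesis using p by (simp add: heq_refl)
  qed
  have f': "- f \<in> dmap (sus A) (sus B)" using f by simp
  have "fst B * t' \<in> dmap ?E (sus B)" by (rule cone_proj[OF A(2) C i])
  then have 4: "heq ?E (sus B) (- f * ?c) (fst B * t')"
    \<comment> \<open>This square commutes only up to homotopy: the two sides differ by the boundary
      of minus the projection onto the first copy of B.\<close>
    by (intro heqI_homotopy[where h = "- (fst B * s' * s')"] dmap_comp[OF c f'])
      (simp_all add: R)
  show ?thesis
    unfolding tri_def hiso_def using i p f' c c' 1 heq_sym[OF 2] 3 4 by blast
qed

lemma tri_rotate:
  assumes A: "is_dobj A" "is_dobj B" "is_dobj D" and T: "tri A B D f g h"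
  shows "tri B D (sus A) g h (- f)"
proof -
  obtain c c1 where c: "hiso (cone A B f) D c c1" "heq B D (c * (s * fst B)) g"
      "heq (cone A B f) (sus A) (h * c) (fst A * t')" and m: "f \<in> dmap A B" "g \<in> dmap B D" "h \<in> dmap D (sus A)"
    using T by (auto simp: tri_def)
  have C: "is_dobj (cone A B f)" using A(1,2) m(1) by (rule is_dobj_cone)
  have gB: "g * fst B = g" using m by (simp add: dmap_def)
  have pA: "fst A * (fst A * t') = fst A * t'" using A(1) by (simp add: dobj_rules)
  have f: "fst B * f = f" "f * fst A = f" using m(1) by (auto simp: dmap_def)
  have m3: "- f \<in> dmap (sus A) (sus B)" using m by simp
  show ?thesis
  proof (rule tri_iso[OF A(2) C _ A(2) A(3) _ tri_rotate_cone[OF A(1,2) m(1)]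
        m(2,3) m3 hiso_id[OF A(2)] c(1) hiso_id])
    show "heq B D (c * (s * fst B)) (g * fst B)" using c(2) gB by simp
    show "heq (cone A B f) (sus A) (fst (sus A) * (fst A * t')) (h * c)"
      using heq_sym[OF c(3)] pA by simp
    show "heq (sus A) (sus B) (fst B * - f) (- f * fst (sus A))"
      using heq_refl[OF m3] f by simp
  qed (use A in auto)
qed

text \<open>The cone of \<open>- f\<close> between the suspensions is the suspension of the cone of
  \<open>f\<close>, as a pair and not merely up to equivalence. The signs of \<open>g\<close> and
  \<open>h\<close> are absorbed by replacing the comparison map \<open>c\<close> by
  \<open>- c\<close>.\<close>

lemma tri_unsuspend:
  assumes T: "tri (sus A) (sus B) (sus D) (- f) (- g) (- h)"
  shows "tri A B D f g h"
proof -
  have C: "cone (sus A) (sus B) (- f) = sus (cone A B f)" by (simp add: cone_def sus_def)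
  obtain c c1 where c: "hiso (cone A B f) D c c1" "heq B D (c * (s * fst B)) (- g)"
      "heq (cone A B f) (sus A) (- h * c) (fst A * t')" and m: "f \<in> dmap A B" "g \<in> dmap B D" "h \<in> dmap D (sus A)"
    using T unfolding tri_def C
    by (auto simp: heq_sus[of "cone A B f" "sus A", simplified] dmap_sus[of D "sus A", simplified])
  have "hiso (cone A B f) D (- c) (- c1)" using c(1) by (simp add: hiso_def)
  moreover have "heq B D (- c * (s * fst B)) g" using heq_minus[OF c(2)] by simp
  moreover have "heq (cone A B f) (sus A) (h * - c) (fst A * t')" using c(3) by simp
  ultimately show ?thesis unfolding tri_def using m by blast
qed

text \<open>Three rotations give the suspended triangle with all three signs reversed, so two
  further forward rotations undo one.\<close>

lemma tri_rotate_back: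
  assumes A: "is_dobj A" "is_dobj B" "is_dobj D" and T: "tri B D (sus A) g h (- f)"
  shows "tri A B D f g h"
proof -
  have "tri D (sus A) (sus B) h (- f) (- g)"
    using tri_rotate[OF A(2,3) _ T] A by simp
  then have "tri (sus A) (sus B) (sus D) (- f) (- g) (- h)"
    using tri_rotate[OF A(3), of "sus A" "sus B"] A by simp
  then show ?thesis by (rule tri_unsuspend)
qed

section \<open>The octahedron\<close>

lemma tri_octahedron_cone:
  assumes A: "is_dobj A" "is_dobj B" "is_dobj E" and f: "f \<in> dmap A B" and g: "g \<in> dmap B E"
  defines "C1 \<equiv> cone A B f" and "C2 \<equiv> cone B E g" and "C3 \<equiv> cone A E (g * f)"
  defines "u \<equiv> s * g * s' + t * fst A * t'" and "v \<equiv> s * fst E * s' + t * f * t'"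
    and "w \<equiv> s * fst B * t'"
  shows "tri C1 C3 C2 u v w"
proof -
  have gf: "g * f \<in> dmap A E" using f g by (rule dmap_comp)
  have C: "is_dobj C1" "is_dobj C2" "is_dobj C3"
    unfolding C1_def C2_def C3_def using A f g gf by (auto intro: is_dobj_cone)
  note R = dobj_rules[OF A(1)] dobj_rules[OF A(2)] dobj_rules[OF A(3)] dmap_rules[OF f] dmap_rules[OF g]
    cone_def algebra_simps C1_def C2_def C3_def u_def v_def w_def
  have u: "u \<in> dmap C1 C3" by (rule dmapI) (simp_all add: R)
  have v: "v \<in> dmap C3 C2" by (rule dmapI) (simp_all add: R)
  have w: "w \<in> dmap C2 (sus C1)" by (rule dmapI) (simp_all add: R)
  let ?E = "cone C1 C3 u"
  have E: "is_dobj ?E" using C u by (intro is_dobj_cone)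
  \<comment> \<open>The cone \<open>?E\<close> of \<open>u\<close> contains, besides the two
    summands of \<open>C2\<close>, two copies of A that form the cone of an identity; the homotopy
    used for claim 2 below contracts them. \<open>?c'\<close> is a strict section of
    \<open>?c\<close>.\<close>
  let ?c = "v * s' + t * fst B * s' * t'" and ?c' = "s * s * fst E * s' + t * s * fst B * t'"
  have c: "?c \<in> dmap ?E C2" by (rule dmapI) (simp_all add: R)
  have c': "?c' \<in> dmap C2 ?E" by (rule dmapI) (simp_all add: R)
  have 1: "heq C2 C2 (?c * ?c') (fst C2)"
  proof -
    have "?c * ?c' = fst C2" by (simp add: R)
    then show ?thesis using C by (simp add: heq_refl dmap_id)
  qed
  have 2: "heq ?E ?E (fst ?E) (?c' * ?c)"
    by (rule heqI_homotopy[where h = "t * t * fst A * t' * s'"])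
      (use dmap_id[OF E] dmap_comp[OF c c'] in \<open>simp_all only:\<close>, simp_all add: R)
  have 3: "heq C3 C2 (?c * (s * fst C3)) v"
  proof -
    have "?c * (s * fst C3) = v" by (simp add: R)
    then show ?thesis using v by (simp add: heq_refl)
  qed
  have "fst C1 * t' \<in> dmap ?E (sus C1)" by (rule cone_proj[OF C(1,3) u])
  then have 4: "heq ?E (sus C1) (w * ?c) (fst C1 * t')"
    by (intro heqI_homotopy[where h = "- (t * fst A * t' * s')"] dmap_comp[OF c w])
      (simp_all add: R)
  show ?thesis
    unfolding tri_def hiso_def using u v w c c' 1 heq_sym[OF 2] 3 4 by blast
qed

text \<open>For the cones the four commutation relations hold strictly. Transport along the
  comparison maps of the three given triangles turns them into homotopies.\<close>

lemma tri_octahedron: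
  assumes A: "is_dobj A" "is_dobj B" "is_dobj E" "is_dobj D1" "is_dobj D2" "is_dobj D3"
    and T1: "tri A B D1 f i i'" and T2: "tri B E D2 g j j'" and T3: "tri A E D3 (g * f) k k'"
  shows "\<exists>u v. u \<in> dmap D1 D3 \<and> v \<in> dmap D3 D2 \<and> tri D1 D3 D2 u v (i * j') \<and>
    heq B D3 (u * i) (k * g) \<and> heq D1 (sus A) (k' * u) i' \<and>
    heq E D2 (v * k) j \<and> heq D3 (sus B) (j' * v) (f * k')"
proof -
  let ?C1 = "cone A B f" and ?C2 = "cone B E g" and ?C3 = "cone A E (g * f)"
  obtain c1 b1 where c1: "hiso ?C1 D1 c1 b1" "heq B D1 (c1 * (s * fst B)) i"
      "heq ?C1 (sus A) (i' * c1) (fst A * t')" and m1: "f \<in> dmap A B" "i \<in> dmap B D1" "i' \<in> dmap D1 (sus A)"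
    using T1 by (auto simp: tri_def)
  obtain c2 b2 where c2: "hiso ?C2 D2 c2 b2" "heq E D2 (c2 * (s * fst E)) j"
      "heq ?C2 (sus B) (j' * c2) (fst B * t')" and m2: "g \<in> dmap B E" "j \<in> dmap E D2" "j' \<in> dmap D2 (sus B)"
    using T2 by (auto simp: tri_def)
  obtain c3 b3 where c3: "hiso ?C3 D3 c3 b3" "heq E D3 (c3 * (s * fst E)) k"
      "heq ?C3 (sus A) (k' * c3) (fst A * t')" and m3: "g * f \<in> dmap A E" "k \<in> dmap E D3" "k' \<in> dmap D3 (sus A)"
    using T3 by (auto simp: tri_def)
  define u0 where "u0 = s * g * s' + t * fst A * t'"
  define v0 where "v0 = s * fst E * s' + t * f * t'"
  define w0 where "w0 = s * fst B * t'"
  have T0: "tri ?C1 ?C3 ?C2 u0 v0 w0"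
    unfolding u0_def v0_def w0_def using A m1 m2 by (intro tri_octahedron_cone)
  have uvw: "u0 \<in> dmap ?C1 ?C3" "v0 \<in> dmap ?C3 ?C2" "w0 \<in> dmap ?C2 (sus ?C1)"
    using T0 by (auto simp: tri_def)
  have C: "is_dobj ?C1" "is_dobj ?C2" "is_dobj ?C3"
    using A m1 m2 m3 by (auto intro: is_dobj_cone)
  have cb: "c1 \<in> dmap ?C1 D1" "b1 \<in> dmap D1 ?C1" "c2 \<in> dmap ?C2 D2" "b2 \<in> dmap D2 ?C2" 
     "c3 \<in> dmap ?C3 D3" "b3 \<in> dmap D3 ?C3"
    using c1 c2 c3 by (auto simp: hiso_def)
  have ip: "s * fst B \<in> dmap B ?C1" "s * fst E \<in> dmap E ?C2" "s * fst E \<in> dmap E ?C3"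
    "fst A * t' \<in> dmap ?C1 (sus A)" "fst B * t' \<in> dmap ?C2 (sus B)" "fst A * t' \<in> dmap ?C3 (sus A)"
    using A m1 m2 m3 by (auto intro: cone_incl cone_proj)
  define u where "u = c3 * u0 * b1"
  define v where "v = c2 * v0 * b3"
  have u: "u \<in> dmap D1 D3" and v: "v \<in> dmap D3 D2"
    unfolding u_def v_def using uvw cb by (auto intro: dmap_comp)
  have ij: "i * j' \<in> dmap D2 (sus D1)"
    using m1 m2 dmap_comp[of j' D2 "sus B" i "sus D1"] by simp
  have b1c1: "heq ?C1 ?C1 (b1 * c1) (fst ?C1)" and b3c3: "heq ?C3 ?C3 (b3 * c3) (fst ?C3)"
    using c1 c3 by (auto simp: hiso_def)
  have X: "heq ?C1 D3 (u * c1) (c3 * u0)"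
    using heq_compL[OF b1c1 dmap_comp[OF uvw(1) cb(5)]] dmap_unit(2)[OF uvw(1)]
    by (simp add: u_def mult.assoc)
  have Y: "heq ?C3 D2 (v * c3) (c2 * v0)"
    using heq_compL[OF b3c3 dmap_comp[OF uvw(2) cb(3)]] dmap_unit(2)[OF uvw(2)]
    by (simp add: v_def mult.assoc)
  have "heq ?C2 (sus D1) (c1 * (s * fst B) * (fst B * t')) (i * (fst B * t'))"
    using c1(2) ip(5) by (intro heq_compR[where B = "sus B"]) simp_all
  moreover have "heq ?C2 (sus D1) (i * (fst B * t')) (i * (j' * c2))"
    using heq_sym[OF c2(3)] m1(2) by (intro heq_compL[where B = "sus B"]) simp_all
  ultimately have Z: "heq ?C2 (sus D1) (c1 * w0) (i * j' * c2)"
    using A(2) by (simp add: w0_def mult.assoc dobj_rules(5)) (blast intro: heq_trans)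
  have T: "tri D1 D3 D2 u v (i * j')"
    by (rule tri_iso[OF C(1,3,2) A(4,6,5) T0 u v ij c1(1) c3(1) c2(1) heq_sym[OF X] heq_sym[OF Y] Z])
  have "heq B ?C1 (b1 * i) (s * fst B)"
    using hiso_cancel_left[OF hiso_sym[OF c1(1)] heq_sym[OF c1(2)] ip(1)] .
  then have "heq B D3 (c3 * u0 * (b1 * i)) (c3 * u0 * (s * fst B))"
    by (rule heq_compL[OF _ dmap_comp[OF uvw(1) cb(5)]])
  also have "c3 * u0 * (s * fst B) = c3 * (s * fst E) * g"
    by (simp add: u0_def algebra_simps dmap_rules[OF m2(1)])
  also have "heq B D3 (c3 * (s * fst E) * g) (k * g)" using c3(2) m2(1) by (rule heq_compR)
  finally have P1: "heq B D3 (u * i) (k * g)" by (simp add: u_def mult.assoc)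
  have "heq D1 (sus A) (k' * c3 * (u0 * b1)) (fst A * t' * (u0 * b1))"
    using c3(3) dmap_comp[OF cb(2) uvw(1)] by (rule heq_compR)
  also have "fst A * t' * (u0 * b1) = fst A * t' * b1"
    by (simp add: u0_def algebra_simps dobj_rules[OF A(1)])
  also have "heq D1 (sus A) (fst A * t' * b1) i'"
    using hiso_cancel_right[OF hiso_sym[OF c1(1)] heq_sym[OF c1(3)] m1(3)] .
  finally have P2: "heq D1 (sus A) (k' * u) i'" by (simp add: u_def mult.assoc)
  have "heq E ?C3 (b3 * k) (s * fst E)"
    using hiso_cancel_left[OF hiso_sym[OF c3(1)] heq_sym[OF c3(2)] ip(3)] .
  then have "heq E D2 (c2 * v0 * (b3 * k)) (c2 * v0 * (s * fst E))"
    by (rule heq_compL[OF _ dmap_comp[OF uvw(2) cb(3)]])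
  also have "c2 * v0 * (s * fst E) = c2 * (s * fst E)"
    by (simp add: v0_def algebra_simps dobj_rules[OF A(3)])
  also note c2(2)
  finally have P3: "heq E D2 (v * k) j" by (simp add: v_def mult.assoc)
  have "heq D3 (sus B) (j' * c2 * (v0 * b3)) (fst B * t' * (v0 * b3))"
    using c2(3) dmap_comp[OF cb(6) uvw(2)] by (rule heq_compR)
  also have "fst B * t' * (v0 * b3) = f * (fst A * t' * b3)"
    by (simp add: v0_def algebra_simps dmap_rules[OF m1(1)])
  also have "heq D3 (sus B) (f * (fst A * t' * b3)) (f * k')"
    using hiso_cancel_right[OF hiso_sym[OF c3(1)] heq_sym[OF c3(3)] m3(3)] m1(1)
    by (intro heq_compL[where B = "sus A"]) simp_all
  finally have P4: "heq D3 (sus B) (j' * v) (f * k')" by (simp add: v_def mult.assoc)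
  show ?thesis using u v T P1 P2 P3 P4 by blast
qed

end

section \<open>Categories represented by differential objects\<close>

text \<open>Composition and addition are computed on representatives in a ring, where associativity
  and distributivity are given; the axioms for \<open>C\<close> follow through the surjections
  \<open>\<Phi>\<close>. The locale serves twice: for the homotopy category with homogeneous maps of
  degree 0, and for the orbit category with all maps of folded complexes.\<close>

locale represented_category =
  fixes C :: "('o, 'm) precat" and M N :: "'o \<Rightarrow> 'o \<Rightarrow> 'r::{ring,monoid_mult} set"
    and e :: "'o \<Rightarrow> 'r" and \<Phi> :: "'o \<Rightarrow> 'o \<Rightarrow> 'r \<Rightarrow> 'm"
  assumes M_zero: "\<lbrakk>X \<in> Ob C; Y \<in> Ob C\<rbrakk> \<Longrightarrow> 0 \<in> M X Y"
    and M_diff: "\<lbrakk>X \<in> Ob C; Y \<in> Ob C; f \<in> M X Y; g \<in> M X Y\<rbrakk> \<Longrightarrow> f - g \<in> M X Y"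
    and M_comp: "\<lbrakk>X \<in> Ob C; Y \<in> Ob C; Z \<in> Ob C; f \<in> M X Y; g \<in> M Y Z\<rbrakk> \<Longrightarrow> g * f \<in> M X Z"
    and M_id: "X \<in> Ob C \<Longrightarrow> e X \<in> M X X"
    and M_unit: "\<lbrakk>X \<in> Ob C; Y \<in> Ob C; f \<in> M X Y\<rbrakk> \<Longrightarrow> e Y * f = f \<and> f * e X = f"
    and Phi_image: "\<lbrakk>X \<in> Ob C; Y \<in> Ob C\<rbrakk> \<Longrightarrow> \<Phi> X Y ` M X Y = Mor C X Y"
    and Phi_eq: "\<lbrakk>X \<in> Ob C; Y \<in> Ob C; f \<in> M X Y; g \<in> M X Y\<rbrakk> \<Longrightarrow> \<Phi> X Y f = \<Phi> X Y g \<longleftrightarrow> f - g \<in> N X Y"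
    and Phi_add: "\<lbrakk>X \<in> Ob C; Y \<in> Ob C; f \<in> M X Y; g \<in> M X Y\<rbrakk>
      \<Longrightarrow> \<Phi> X Y (f + g) = \<Phi> X Y f \<otimes>\<^bsub>Hom C X Y\<^esub> \<Phi> X Y g"
    and Phi_zero: "\<lbrakk>X \<in> Ob C; Y \<in> Ob C\<rbrakk> \<Longrightarrow> \<Phi> X Y 0 = \<one>\<^bsub>Hom C X Y\<^esub>"
    and Phi_id: "X \<in> Ob C \<Longrightarrow> \<Phi> X X (e X) = IdM C X"
    and Phi_comp: "\<lbrakk>X \<in> Ob C; Y \<in> Ob C; Z \<in> Ob C; f \<in> M X Y; g \<in> M Y Z\<rbrakk>
      \<Longrightarrow> \<Phi> X Z (g * f) = Comp C X Y Z (\<Phi> Y Z g) (\<Phi> X Y f)"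
begin

lemma M_minus: "\<lbrakk>X \<in> Ob C; Y \<in> Ob C; f \<in> M X Y\<rbrakk> \<Longrightarrow> - f \<in> M X Y"
  using M_diff[OF _ _ M_zero] by simp

lemma M_add: "\<lbrakk>X \<in> Ob C; Y \<in> Ob C; f \<in> M X Y; g \<in> M X Y\<rbrakk> \<Longrightarrow> f + g \<in> M X Y"
  using M_diff[OF _ _ _ M_minus, of X Y f g] by simp

lemma Phi_closed: "\<lbrakk>X \<in> Ob C; Y \<in> Ob C; f \<in> M X Y\<rbrakk> \<Longrightarrow> \<Phi> X Y f \<in> Mor C X Y"
  using Phi_image by blast

lemma Phi_cases:
  assumes "X \<in> Ob C" "Y \<in> Ob C" "a \<in> Mor C X Y"
  obtains f where "f \<in> M X Y" "a = \<Phi> X Y f"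
  using assms Phi_image by blast

lemma Hom_group:
  assumes "X \<in> Ob C" "Y \<in> Ob C" shows "comm_group (Hom C X Y)"
proof (rule comm_groupI)
  note XY = assms
  show "\<one>\<^bsub>Hom C X Y\<^esub> \<in> Mor C X Y" using Phi_closed[OF XY M_zero[OF XY]] by (simp add: Phi_zero XY)
  fix a assume a: "a \<in> Mor C X Y"
  obtain f where f: "f \<in> M X Y" "a = \<Phi> X Y f" using XY a by (rule Phi_cases)
  show "\<one>\<^bsub>Hom C X Y\<^esub> \<otimes>\<^bsub>Hom C X Y\<^esub> a = a"
    using Phi_add[OF XY M_zero[OF XY] f(1)] f XY by (simp add: Phi_zero)
  show "\<exists>b \<in> Mor C X Y. b \<otimes>\<^bsub>Hom C X Y\<^esub> a = \<one>\<^bsub>Hom C X Y\<^esub>"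
    using Phi_add[OF XY M_minus[OF XY f(1)] f(1)] Phi_closed[OF XY M_minus[OF XY f(1)]] f XY
    by (auto simp: Phi_zero intro!: bexI[of _ "\<Phi> X Y (- f)"])
  fix b assume b: "b \<in> Mor C X Y"
  obtain g where g: "g \<in> M X Y" "b = \<Phi> X Y g" using XY b by (rule Phi_cases)
  show "a \<otimes>\<^bsub>Hom C X Y\<^esub> b \<in> Mor C X Y"
    using Phi_closed[OF XY M_add[OF XY f(1) g(1)]] f g XY by (simp add: Phi_add)
  show "a \<otimes>\<^bsub>Hom C X Y\<^esub> b = b \<otimes>\<^bsub>Hom C X Y\<^esub> a"
    using f g XY by (simp add: Phi_add[symmetric] add.commute)
  fix c assume c: "c \<in> Mor C X Y"
  obtain h where h: "h \<in> M X Y" "c = \<Phi> X Y h" using XY c by (rule Phi_cases)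
  show "a \<otimes>\<^bsub>Hom C X Y\<^esub> b \<otimes>\<^bsub>Hom C X Y\<^esub> c = a \<otimes>\<^bsub>Hom C X Y\<^esub> (b \<otimes>\<^bsub>Hom C X Y\<^esub> c)"
    using f g h XY by (simp add: Phi_add[symmetric] M_add add.assoc)
qed

lemma Phi_minus:
  assumes "X \<in> Ob C" "Y \<in> Ob C" "f \<in> M X Y"
  shows "inv\<^bsub>Hom C X Y\<^esub> (\<Phi> X Y f) = \<Phi> X Y (- f)"
proof -
  interpret comm_group "Hom C X Y" using assms by (intro Hom_group)
  show ?thesis
    using assms by (intro inv_equality) (simp_all add: Phi_add[symmetric] M_minus Phi_zero Phi_closed)
qed

sublocale preadditive_category C
proof (rule preadditive_category.intro)
  fix X Y assume XY: "X \<in> Ob C" "Y \<in> Ob C"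
  then show "comm_group (Hom C X Y)" by (rule Hom_group)
  fix f assume f: "f \<in> Mor C X Y"
  obtain f' where f': "f' \<in> M X Y" "f = \<Phi> X Y f'" using XY f by (rule Phi_cases)
  show "Comp C X X Y f (IdM C X) = f" "Comp C X Y Y (IdM C Y) f = f"
    using XY f' by (simp_all add: Phi_id[symmetric] Phi_comp[symmetric] M_id M_unit)
  fix Z assume Z: "Z \<in> Ob C"
  { fix g assume g: "g \<in> Mor C Y Z"
    obtain g' where g': "g' \<in> M Y Z" "g = \<Phi> Y Z g'" by (rule Phi_cases[OF XY(2) Z g])
    show "Comp C X Y Z g f \<in> Mor C X Z"
      using XY Z f' g' by (simp add: Phi_comp[symmetric] M_comp Phi_closed)
    { fix h assume h: "h \<in> Mor C Y Z"
      obtain h' where h': "h' \<in> M Y Z" "h = \<Phi> Y Z h'" by (rule Phi_cases[OF XY(2) Z h])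
      show "Comp C X Y Z (g \<otimes>\<^bsub>Hom C Y Z\<^esub> h) f = Comp C X Y Z g f \<otimes>\<^bsub>Hom C X Z\<^esub> Comp C X Y Z h f"
        using XY Z f' g' h' by (simp add: Phi_comp[symmetric] M_comp Phi_add[symmetric] M_add distrib_right) }
    { fix h assume h: "h \<in> Mor C X Y"
      obtain h' where h': "h' \<in> M X Y" "h = \<Phi> X Y h'" by (rule Phi_cases[OF XY h])
      show "Comp C X Y Z g (f \<otimes>\<^bsub>Hom C X Y\<^esub> h) = Comp C X Y Z g f \<otimes>\<^bsub>Hom C X Z\<^esub> Comp C X Y Z g h"
        using XY Z f' g' h' by (simp add: Phi_comp[symmetric] M_comp Phi_add[symmetric] M_add distrib_left) }
    { fix W h assume W: "W \<in> Ob C" and h: "h \<in> Mor C Z W"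
      obtain h' where h': "h' \<in> M Z W" "h = \<Phi> Z W h'" by (rule Phi_cases[OF Z W h])
      show "Comp C X Z W h (Comp C X Y Z g f) = Comp C X Y W (Comp C Y Z W h g) f"
        using XY Z W f' g' h' by (simp add: Phi_comp[symmetric] M_comp mult.assoc) } }
next
  fix X assume "X \<in> Ob C"
  then show "IdM C X \<in> Mor C X X" using Phi_closed[OF _ _ M_id] by (simp add: Phi_id[symmetric])
qed

end

text \<open>\<open>ok\<close> will stand for finite generation and freeness of the image of the
  idempotent, and \<open>\<sigma>\<close> for the sign given by the parity of the degree. Closure of
  \<open>ok\<close> under cones and sums together with \<open>ess_surj\<close> brings these
  constructions back into \<open>C\<close>.\<close>

locale dg_represented_category = doubling s t s' t' +
  represented_category C "\<lambda>X Y. dmap (F X) (F Y)" "\<lambda>X Y. dnull (F X) (F Y)" "\<lambda>X. fst (F X)" \<Phi>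
  for s t s' t' :: "'r::{ring,monoid_mult}" and C :: "('o, 'm) precat" and F and \<Phi> +
  fixes ok :: "'r \<times> 'r \<Rightarrow> bool" and \<sigma> :: 'r
  assumes F_dobj: "X \<in> Ob C \<Longrightarrow> is_dobj (F X)" and F_ok: "X \<in> Ob C \<Longrightarrow> ok (F X)"
    and ok_cone: "\<lbrakk>ok A; ok B; f \<in> dmap A B\<rbrakk> \<Longrightarrow> ok (cone A B f)"
    and ok_dsum: "\<lbrakk>ok A; ok B\<rbrakk> \<Longrightarrow> ok (dsum A B)"
    and ok_zero: "ok (0, 0)"
    and ess_surj: "\<lbrakk>is_dobj A; ok A\<rbrakk> \<Longrightarrow> \<exists>X \<in> Ob C. \<exists>f g. hiso A (F X) f g"
    and sigma_sq: "\<sigma> * \<sigma> = 1"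
    and sigma_fst: "X \<in> Ob C \<Longrightarrow> \<sigma> * fst (F X) = fst (F X) * \<sigma>"
    and sigma_snd: "X \<in> Ob C \<Longrightarrow> \<sigma> * snd (F X) = - (snd (F X) * \<sigma>)"
begin

lemma heq_iff: "\<lbrakk>X \<in> Ob C; Y \<in> Ob C; f \<in> dmap (F X) (F Y); g \<in> dmap (F X) (F Y)\<rbrakk>
    \<Longrightarrow> \<Phi> X Y f = \<Phi> X Y g \<longleftrightarrow> heq (F X) (F Y) f g"
  by (simp add: Phi_eq heq_def)

section \<open>The sign and the suspension\<close>

lemma sigma_sq' [simp]: "\<sigma> * \<sigma> = 1" "\<sigma> * (\<sigma> * x) = x"
  by (simp_all add: sigma_sq flip: mult.assoc)

lemma sigma_rules:
  assumes "X \<in> Ob C"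
  shows "\<sigma> * fst (F X) = fst (F X) * \<sigma>" "\<sigma> * snd (F X) = - (snd (F X) * \<sigma>)"
    "\<sigma> * (fst (F X) * x) = fst (F X) * (\<sigma> * x)" "\<sigma> * (snd (F X) * x) = - (snd (F X) * (\<sigma> * x))"
proof -
  show *: "\<sigma> * fst (F X) = fst (F X) * \<sigma>" "\<sigma> * snd (F X) = - (snd (F X) * \<sigma>)"
    using assms by (rule sigma_fst sigma_snd)+
  show "\<sigma> * (fst (F X) * x) = fst (F X) * (\<sigma> * x)" "\<sigma> * (snd (F X) * x) = - (snd (F X) * (\<sigma> * x))"
    using * by (metis mult.assoc, metis * mult.assoc mult_minus_left)
qed

lemma sigma_left:
  assumes "X \<in> Ob C"
  shows "fst (F X) * (\<sigma> * x) = \<sigma> * (fst (F X) * x)" "snd (F X) * (\<sigma> * x) = - (\<sigma> * (snd (F X) * x))"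
  using sigma_rules(3,4)[OF assms, of x] by simp_all

text \<open>Since \<open>\<sigma>\<close> anticommutes with the differential and is invertible, left
  multiplication by it exchanges maps into \<open>F X\<close> with maps into its suspension. This is
  how third maps of triangles are read.\<close>

lemma sigma_dmap_sus:
  assumes "X \<in> Ob C" shows "\<sigma> * h \<in> dmap A (sus (F X)) \<longleftrightarrow> h \<in> dmap A (F X)"
proof -
  have cancel: "\<sigma> * x = \<sigma> * y \<longleftrightarrow> x = y" for x y by (metis sigma_sq'(2))
  show ?thesis
    by (simp add: dmap_def mult.assoc sigma_left[OF assms] cancel)
qed

lemma sigma_conj_dmap:
  assumes "X \<in> Ob C" "Y \<in> Ob C" "f \<in> dmap (F X) (F Y)"
  shows "\<sigma> * f * \<sigma> \<in> dmap (F X) (F Y)"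
  using assms
  by (intro dmapI) (simp_all add: mult.assoc sigma_left sigma_rules(1,2) dmap_rules)

lemma sigma_conj_heq:
  assumes XY: "X \<in> Ob C" "Y \<in> Ob C" and h: "heq (F X) (F Y) f g"
  shows "heq (F X) (F Y) (\<sigma> * f * \<sigma>) (\<sigma> * g * \<sigma>)"
proof -
  obtain k where k: "f = g + (snd (F Y) * k + k * snd (F X))" "fst (F Y) * k = k" "k * fst (F X) = k"
    using h by (rule heqE_homotopy)
  note k' = k(2,3) hom_rules[OF k(2,3)]
  show ?thesis
    \<comment> \<open>The sign of the homotopy comes from moving \<open>\<sigma>\<close> past a
      differential.\<close>
    by (rule heqI_homotopy[where h = "- (\<sigma> * k * \<sigma>)"])
      (use XY heq_dmap[OF h] sigma_conj_dmap in \<open>simp_all only:\<close>,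
       simp_all add: k(1) algebra_simps sigma_left sigma_rules(1,2) XY k')
qed

text \<open>The choice of the representative is harmless because conjugation by
  \<open>\<sigma>\<close> preserves homotopy; afterwards only \<open>Sigma_Phi\<close> is
  used.\<close>

definition \<Sigma>m :: "'o \<Rightarrow> 'o \<Rightarrow> 'm \<Rightarrow> 'm"
  where "\<Sigma>m X Y a = \<Phi> X Y (\<sigma> * (SOME f. f \<in> dmap (F X) (F Y) \<and> \<Phi> X Y f = a) * \<sigma>)"

lemma Sigma_Phi:
  assumes XY: "X \<in> Ob C" "Y \<in> Ob C" and f: "f \<in> dmap (F X) (F Y)"
  shows "\<Sigma>m X Y (\<Phi> X Y f) = \<Phi> X Y (\<sigma> * f * \<sigma>)"
proof -
  define g where "g = (SOME g. g \<in> dmap (F X) (F Y) \<and> \<Phi> X Y g = \<Phi> X Y f)"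
  have g: "g \<in> dmap (F X) (F Y) \<and> \<Phi> X Y g = \<Phi> X Y f"
    unfolding g_def by (rule someI[of _ f]) (use f in simp)
  then have "heq (F X) (F Y) g f" using XY f by (simp add: heq_iff[symmetric])
  then have "heq (F X) (F Y) (\<sigma> * g * \<sigma>) (\<sigma> * f * \<sigma>)" using XY by (intro sigma_conj_heq)
  then show ?thesis unfolding \<Sigma>m_def g_def[symmetric] using XY by (simp add: heq_iff heq_dmap)
qed

text \<open>An object is zero as soon as its identity is the zero morphism, and in the
  representation this says that \<open>F N\<close> is contractible.\<close>

lemma zero_object_iff:
  assumes N: "N \<in> Ob C"
  shows "zero_object C N \<longleftrightarrow> heq (F N) (F N) (fst (F N)) 0"
proof
  assume "zero_object C N"
  then have "\<exists>!f. f \<in> Mor C N N" using N by (auto simp: zero_object_def)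
  then have "\<Phi> N N (fst (F N)) = \<Phi> N N 0"
    using N by (metis Phi_closed M_zero M_id)
  then show "heq (F N) (F N) (fst (F N)) 0"
    using N by (simp add: heq_iff[OF N N M_id[OF N] M_zero[OF N N]])
next
  assume h: "heq (F N) (F N) (fst (F N)) 0"
  have "a = \<Phi> X N 0" if X: "X \<in> Ob C" and a: "a \<in> Mor C X N" for X a
  proof -
    obtain f where f: "f \<in> dmap (F X) (F N)" "a = \<Phi> X N f" using X N a by (rule Phi_cases)
    have "heq (F X) (F N) f 0" using heq_compR[OF h f(1)] f(1) by (simp add: dmap_rules)
    then show ?thesis using X N f by (simp add: heq_iff)
  qed
  moreover have "a = \<Phi> N X 0" if X: "X \<in> Ob C" and a: "a \<in> Mor C N X" for X a
  proof -
    obtain f where f: "f \<in> dmap (F N) (F X)" "a = \<Phi> N X f" using N X a by (rule Phi_cases)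
    have "heq (F N) (F X) f 0" using heq_compL[OF h f(1)] f(1) by (simp add: dmap_rules)
    then show ?thesis using X N f by (simp add: heq_iff)
  qed
  ultimately show "zero_object C N"
    unfolding zero_object_def using N Phi_closed[OF _ _ M_zero] by blast
qed

lemma iso_mor_iff:
  assumes XY: "X \<in> Ob C" "Y \<in> Ob C" and f: "f \<in> dmap (F X) (F Y)"
  shows "iso_mor C X Y (\<Phi> X Y f) \<longleftrightarrow> (\<exists>g. hiso (F X) (F Y) f g)"
proof
  assume "iso_mor C X Y (\<Phi> X Y f)"
  then obtain b where b: "b \<in> Mor C Y X" "Comp C X Y X b (\<Phi> X Y f) = IdM C X"
    "Comp C Y X Y (\<Phi> X Y f) b = IdM C Y" by (auto simp: iso_mor_def)
  obtain g where g: "g \<in> dmap (F Y) (F X)" "b = \<Phi> Y X g" using XY(2,1) b(1) by (rule Phi_cases)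
  have "hiso (F X) (F Y) f g"
    using b XY f g by (simp add: hiso_def heq_iff[symmetric] Phi_comp Phi_id M_id dmap_comp)
  then show "\<exists>g. hiso (F X) (F Y) f g" ..
next
  assume "\<exists>g. hiso (F X) (F Y) f g"
  then obtain g where g: "hiso (F X) (F Y) f g" ..
  then have "g \<in> dmap (F Y) (F X)" by (simp add: hiso_def)
  then show "iso_mor C X Y (\<Phi> X Y f)"
    unfolding iso_mor_def using g XY f
    by (intro conjI Phi_closed bexI[of _ "\<Phi> Y X g"])
      (simp_all add: hiso_def heq_iff[symmetric] Phi_comp[symmetric] Phi_id[symmetric] M_id dmap_comp)
qed

sublocale additive_category C
proof
  have "is_dobj (0, 0 :: 'r)" by (simp add: is_dobj_def)
  then obtain N f g where N: "N \<in> Ob C" "hiso (0, 0) (F N) f g" using ess_surj ok_zero by blast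
  \<comment> \<open>A map out of the object \<open>(0, 0)\<close> satisfies
    \<open>f * 0 = f\<close>.\<close>
  then have "f = 0" by (auto simp: hiso_def dmap_def)
  with N have "heq (F N) (F N) (fst (F N)) 0" by (auto simp: hiso_def intro: heq_sym)
  then show "\<exists>Z. zero_object C Z" using zero_object_iff[OF N(1)] by blast
next
  fix X Y assume XY: "X \<in> Ob C" "Y \<in> Ob C"
  let ?A = "F X" and ?B = "F Y"
  let ?D = "dsum ?A ?B"
  have A: "is_dobj ?A" "is_dobj ?B" using XY by (auto intro: F_dobj)
  have D: "is_dobj ?D" using A by (rule is_dobj_dsum)
  obtain P f g where P: "P \<in> Ob C" "hiso ?D (F P) f g" using ess_surj[OF D] XY F_ok ok_dsum by blast
  have fg: "f \<in> dmap ?D (F P)" "g \<in> dmap (F P) ?D" "heq ?D ?D (g * f) (fst ?D)"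
    "heq (F P) (F P) (f * g) (fst (F P))" using P by (auto simp: hiso_def)
  note R = dsum_def algebra_simps dobj_rules[OF A(1)] dobj_rules[OF A(2)]
  \<comment> \<open>These form a strict biproduct inside the ring. The equivalence of
    \<open>?D\<close> with \<open>F P\<close> carries it over to \<open>P\<close>, where its
    equations hold up to homotopy.\<close>
  define i j p q where "i = s * fst ?A" and "j = t * fst ?B" and "p = fst ?A * s'" and "q = fst ?B * t'"
  have ij: "i \<in> dmap ?A ?D" "j \<in> dmap ?B ?D" "p \<in> dmap ?D ?A" "q \<in> dmap ?D ?B"
    unfolding i_def j_def p_def q_def by (rule dmapI; simp add: R)+
  have e: "p * i = fst ?A" "q * j = fst ?B" "q * i = 0" "p * j = 0" "i * p + j * q = fst ?D"
    by (simp_all add: i_def j_def p_def q_def R)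
  have m: "f * i \<in> dmap ?A (F P)" "f * j \<in> dmap ?B (F P)" "p * g \<in> dmap (F P) ?A" "q * g \<in> dmap (F P) ?B"
    using ij fg by (auto intro: dmap_comp)
  have h: "heq W V (x * g * (f * y)) (x * y)" if "x \<in> dmap ?D V" "y \<in> dmap W ?D" for x y V W
    using heq_compL[OF heq_compR[OF fg(3) that(2)] that(1)] dmap_unit[OF that(2)] by (simp add: mult.assoc)
  have "f * i * (p * g) + f * j * (q * g) = f * (i * p + j * q) * g" by (simp add: algebra_simps)
  also have "\<dots> = f * g" unfolding e(5) by (simp add: dmap_unit[OF fg(1)])
  finally have sum: "heq (F P) (F P) (f * i * (p * g) + f * j * (q * g)) (fst (F P))" using fg(4) by simp
  have h': "heq ?A ?A (p * g * (f * i)) (fst ?A)" "heq ?B ?B (q * g * (f * j)) (fst ?B)"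
    "heq ?A ?B (q * g * (f * i)) 0" "heq ?B ?A (p * g * (f * j)) 0"
    using h[OF ij(3,1)] h[OF ij(4,2)] h[OF ij(4,1)] h[OF ij(3,2)] by (simp_all only: e)
  show "\<exists>P \<in> Ob C. \<exists>i \<in> Mor C X P. \<exists>j \<in> Mor C Y P. \<exists>p \<in> Mor C P X. \<exists>q \<in> Mor C P Y.
          Comp C X P X p i = IdM C X \<and> Comp C Y P Y q j = IdM C Y \<and>
          Comp C X P Y q i = \<one>\<^bsub>Hom C X Y\<^esub> \<and> Comp C Y P X p j = \<one>\<^bsub>Hom C Y X\<^esub> \<and>
          Comp C P X P i p \<otimes>\<^bsub>Hom C P P\<^esub> Comp C P Y P j q = IdM C P"
    by (rule bexI[OF _ P(1)], rule bexI[of _ "\<Phi> X P (f * i)"], rule bexI[of _ "\<Phi> Y P (f * j)"],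
        rule bexI[of _ "\<Phi> P X (p * g)"], rule bexI[of _ "\<Phi> P Y (q * g)"])
      (use XY P(1) h' sum m in \<open>simp_all add: Phi_closed Phi_comp[symmetric] Phi_id[symmetric]
         Phi_zero[symmetric] Phi_add[symmetric] heq_iff heq_dmap dmap_comp\<close>)
qed

lemma automorphism: "additive_automorphism C (\<lambda>X. X) \<Sigma>m"
proof
  show "bij_betw (\<lambda>X. X) (Ob C) (Ob C)" by (simp add: bij_betw_def)
next
  fix X Y assume XY: "X \<in> Ob C" "Y \<in> Ob C"
  \<comment> \<open>Conjugation by \<open>\<sigma>\<close> is an involution, so
    \<open>\<Sigma>m\<close> is its own inverse.\<close>
  have twice: "\<Sigma>m X Y (\<Sigma>m X Y a) = a" if a: "a \<in> Mor C X Y" for a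
  proof -
    obtain f where f: "f \<in> dmap (F X) (F Y)" "a = \<Phi> X Y f" using XY a by (rule Phi_cases)
    have "\<sigma> * (\<sigma> * f * \<sigma>) * \<sigma> = f" by (simp add: mult.assoc)
    then show ?thesis using f XY sigma_conj_dmap[OF XY f(1)] by (simp add: Sigma_Phi)
  qed
  have closed: "\<Sigma>m X Y a \<in> Mor C X Y" if a: "a \<in> Mor C X Y" for a
  proof -
    obtain f where f: "f \<in> dmap (F X) (F Y)" "a = \<Phi> X Y f" using XY a by (rule Phi_cases)
    then show ?thesis using XY by (simp add: Sigma_Phi Phi_closed sigma_conj_dmap)
  qed
  show "\<Sigma>m X Y \<in> iso (Hom C X Y) (Hom C X Y)"
    unfolding iso_def hom_def
  proof (intro CollectI conjI ballI)
    show "\<Sigma>m X Y \<in> Mor C X Y \<rightarrow> Mor C X Y" using closed by blast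
    show "bij_betw (\<Sigma>m X Y) (Mor C X Y) (Mor C X Y)"
      by (rule bij_betw_byWitness[where f' = "\<Sigma>m X Y"]) (use closed twice in auto)
    fix a b assume a: "a \<in> Mor C X Y" and b: "b \<in> Mor C X Y"
    obtain f where f: "f \<in> dmap (F X) (F Y)" "a = \<Phi> X Y f" using XY a by (rule Phi_cases)
    obtain g where g: "g \<in> dmap (F X) (F Y)" "b = \<Phi> X Y g" using XY b by (rule Phi_cases)
    show "\<Sigma>m X Y (a \<otimes>\<^bsub>Hom C X Y\<^esub> b) = \<Sigma>m X Y a \<otimes>\<^bsub>Hom C X Y\<^esub> \<Sigma>m X Y b"
      using XY f g sigma_conj_dmap[OF XY f(1)] sigma_conj_dmap[OF XY g(1)]
      by (simp add: Phi_add[symmetric] Sigma_Phi dmap_add distrib_left distrib_right)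
  qed
next
  fix X assume X: "X \<in> Ob C"
  have "\<sigma> * fst (F X) * \<sigma> = fst (F X)" by (simp add: mult.assoc sigma_rules(3)[OF X])
  then show "\<Sigma>m X X (IdM C X) = IdM C X"
    using X by (simp add: Phi_id[symmetric] Sigma_Phi M_id)
next
  fix X Y Z f g assume XYZ: "X \<in> Ob C" "Y \<in> Ob C" "Z \<in> Ob C" and f: "f \<in> Mor C X Y" and g: "g \<in> Mor C Y Z"
  obtain f' where f': "f' \<in> dmap (F X) (F Y)" "f = \<Phi> X Y f'" by (rule Phi_cases[OF XYZ(1,2) f])
  obtain g' where g': "g' \<in> dmap (F Y) (F Z)" "g = \<Phi> Y Z g'" by (rule Phi_cases[OF XYZ(2,3) g])
  have "\<sigma> * g' * \<sigma> * (\<sigma> * f' * \<sigma>) = \<sigma> * (g' * f') * \<sigma>" by (simp add: mult.assoc)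
  then show "\<Sigma>m X Z (Comp C X Y Z g f) = Comp C X Y Z (\<Sigma>m Y Z g) (\<Sigma>m X Y f)"
    using XYZ f' g' by (simp add: Phi_comp[symmetric] Sigma_Phi dmap_comp sigma_conj_dmap)
qed

section \<open>Distinguished triangles\<close>

definition \<Delta> :: "('o, 'm) triangle set"
  where "\<Delta> = {(X, Y, Z, a, b, c). X \<in> Ob C \<and> Y \<in> Ob C \<and> Z \<in> Ob C \<and>
    (\<exists>f \<in> dmap (F X) (F Y). \<exists>g \<in> dmap (F Y) (F Z). \<exists>h \<in> dmap (F Z) (F X).
      a = \<Phi> X Y f \<and> b = \<Phi> Y Z g \<and> c = \<Phi> Z X h \<and> tri (F X) (F Y) (F Z) f g (\<sigma> * h))}"

lemma tri_cong:
  assumes A: "is_dobj A" "is_dobj B" "is_dobj D" and T: "tri A B D f g h"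
    and f: "heq A B f f'" and g: "heq B D g g'" and h: "heq D (sus A) h h'"
  shows "tri A B D f' g' h'"
proof (rule tri_iso[OF A A T heq_dmap(2)[OF f] heq_dmap(2)[OF g] heq_dmap(2)[OF h]
      hiso_id[OF A(1)] hiso_id[OF A(2)] hiso_id[OF A(3)]])
  show "heq A B (fst B * f) (f' * fst A)" "heq B D (fst D * g) (g' * fst B)"
    "heq D (sus A) (fst A * h) (h' * fst D)"
    using f g h heq_dmap[OF f] heq_dmap[OF g] heq_dmap[OF h] by (auto simp: dmap_def)
qed

text \<open>This equivalence is what allows the suspension functor to be the identity on
  objects.\<close>

lemma sigma_hiso:
  assumes X: "X \<in> Ob C"
  shows "hiso (F X) (sus (F X)) (\<sigma> * fst (F X)) (\<sigma> * fst (F X))"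
proof -
  note D = F_dobj[OF X]
  have 1: "\<sigma> * fst (F X) \<in> dmap (F X) (sus (F X))" using X D by (simp add: sigma_dmap_sus dmap_id)
  then have 2: "\<sigma> * fst (F X) \<in> dmap (sus (F X)) (F X)" using dmap_sus[of "F X" "sus (F X)"] by simp
  have "\<sigma> * fst (F X) * (\<sigma> * fst (F X)) = fst (F X)"
    using D by (simp add: mult.assoc sigma_left[OF X] dobj_rules)
  then show ?thesis using D 1 2 by (intro hisoI_strict) auto
qed

lemma sigma_heq:
  assumes X: "X \<in> Ob C" and h: "heq A (F X) h h'"
  shows "heq A (sus (F X)) (\<sigma> * h) (\<sigma> * h')"
proof -
  have "heq A (sus (F X)) (\<sigma> * fst (F X) * h) (\<sigma> * fst (F X) * h')"
    using h sigma_hiso[OF X] by (intro heq_compL) (auto simp: hiso_def)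
  then show ?thesis using heq_dmap[OF h] by (simp add: mult.assoc dmap_rules)
qed

lemma sigma_heq_cancel:
  assumes X: "X \<in> Ob C" and h: "heq A (sus (F X)) (\<sigma> * x) (\<sigma> * y)"
  shows "heq A (F X) x y"
proof -
  have "\<sigma> * fst (F X) \<in> dmap (sus (F X)) (F X)"
    using hiso_sym[OF sigma_hiso[OF X]] by (simp add: hiso_def)
  from heq_compL[OF h this] have "heq A (F X) (\<sigma> * fst (F X) * (\<sigma> * x)) (\<sigma> * fst (F X) * (\<sigma> * y))" .
  moreover have "x \<in> dmap A (F X)" "y \<in> dmap A (F X)"
    using heq_dmap[OF h] X by (auto simp: sigma_dmap_sus)
  ultimately show ?thesis by (simp add: mult.assoc dmap_rules sigma_left[OF X])
qed

text \<open>\<open>\<Delta>\<close> asks for some representatives, and by \<open>tri_cong\<close>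
  any others do as well. The factor \<open>\<sigma>\<close> redirects the third map from
  \<open>F X\<close> to \<open>sus (F X)\<close>.\<close>

lemma Delta_iff:
  assumes O: "X \<in> Ob C" "Y \<in> Ob C" "Z \<in> Ob C"
    and f: "f \<in> dmap (F X) (F Y)" and g: "g \<in> dmap (F Y) (F Z)" and h: "h \<in> dmap (F Z) (F X)"
  shows "(X, Y, Z, \<Phi> X Y f, \<Phi> Y Z g, \<Phi> Z X h) \<in> \<Delta> \<longleftrightarrow> tri (F X) (F Y) (F Z) f g (\<sigma> * h)"
proof
  assume "(X, Y, Z, \<Phi> X Y f, \<Phi> Y Z g, \<Phi> Z X h) \<in> \<Delta>"
  then obtain f' g' h' where m: "f' \<in> dmap (F X) (F Y)" "g' \<in> dmap (F Y) (F Z)" "h' \<in> dmap (F Z) (F X)"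
    and eq: "\<Phi> X Y f = \<Phi> X Y f'" "\<Phi> Y Z g = \<Phi> Y Z g'" "\<Phi> Z X h = \<Phi> Z X h'"
    and T: "tri (F X) (F Y) (F Z) f' g' (\<sigma> * h')"
    unfolding \<Delta>_def by blast
  have "heq (F X) (F Y) f' f" "heq (F Y) (F Z) g' g" "heq (F Z) (F X) h' h"
    using eq O f g h m by (simp_all add: heq_iff[symmetric])
  then show "tri (F X) (F Y) (F Z) f g (\<sigma> * h)"
    using T O by (blast intro: tri_cong F_dobj sigma_heq)
next
  assume "tri (F X) (F Y) (F Z) f g (\<sigma> * h)"
  then show "(X, Y, Z, \<Phi> X Y f, \<Phi> Y Z g, \<Phi> Z X h) \<in> \<Delta>" unfolding \<Delta>_def using O f g h by blast
qed

lemma Delta_cases: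
  assumes "(X, Y, Z, a, b, c) \<in> \<Delta>"
  obtains f g h where "X \<in> Ob C" "Y \<in> Ob C" "Z \<in> Ob C" "f \<in> dmap (F X) (F Y)" "g \<in> dmap (F Y) (F Z)"
    "h \<in> dmap (F Z) (F X)" "a = \<Phi> X Y f" "b = \<Phi> Y Z g" "c = \<Phi> Z X h" "tri (F X) (F Y) (F Z) f g (\<sigma> * h)"
  using assms unfolding \<Delta>_def by blast

text \<open>Rotation in the ring puts \<open>sus (F X)\<close> in third place. Replacing it by
  \<open>F X\<close> along \<open>sigma_hiso\<close> turns \<open>- f\<close> into
  \<open>- (f * \<sigma>)\<close>, which is \<open>\<sigma>\<close> times the negative of the
  suspended map.\<close>

lemma tri_rotate_iff:
  assumes O: "X \<in> Ob C" "Y \<in> Ob C" "Z \<in> Ob C"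
    and f: "f \<in> dmap (F X) (F Y)" and g: "g \<in> dmap (F Y) (F Z)" and h: "h \<in> dmap (F Z) (F X)"
  shows "tri (F X) (F Y) (F Z) f g (\<sigma> * h) \<longleftrightarrow> tri (F Y) (F Z) (F X) g h (\<sigma> * (- (\<sigma> * f * \<sigma>)))"
proof -
  note D = F_dobj[OF O(1)] F_dobj[OF O(2)] F_dobj[OF O(3)]
  have 3: "\<sigma> * (- (\<sigma> * f * \<sigma>)) = - (f * \<sigma>)" by (simp add: mult.assoc)
  have h': "\<sigma> * h \<in> dmap (F Z) (sus (F X))" using h O by (simp add: sigma_dmap_sus)
  have f': "- f \<in> dmap (sus (F X)) (sus (F Y))" using f by simp
  have f3: "- (f * \<sigma>) \<in> dmap (F X) (sus (F Y))"
    using sigma_dmap_sus[OF O(2), of "- (\<sigma> * f * \<sigma>)" "F X"] sigma_conj_dmap[OF O(1,2) f] unfolding 3 by simp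
  have s: "hiso (sus (F X)) (F X) (\<sigma> * fst (F X)) (\<sigma> * fst (F X))"
    using hiso_sym[OF sigma_hiso[OF O(1)]] .
  have r: "heq A B x y" if "x \<in> dmap A B" "x = y" for A B x y using that heq_refl by blast
  have D': "is_dobj (sus (F X))" using D by simp
  have "tri (F X) (F Y) (F Z) f g (\<sigma> * h) \<longleftrightarrow> tri (F Y) (F Z) (sus (F X)) g (\<sigma> * h) (- f)"
    using tri_rotate[OF D] tri_rotate_back[OF D] by blast
  also have "\<dots> \<longleftrightarrow> tri (F Y) (F Z) (F X) g h (- (f * \<sigma>))"
  proof
    assume T: "tri (F Y) (F Z) (sus (F X)) g (\<sigma> * h) (- f)"
    show "tri (F Y) (F Z) (F X) g h (- (f * \<sigma>))"
    proof (rule tri_iso[OF D(2,3) D' D(2,3,1) T g h f3 hiso_id[OF D(2)] hiso_id[OF D(3)] s])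
      show "heq (F Y) (F Z) (fst (F Z) * g) (g * fst (F Y))"
        using g by (intro r) (simp_all add: dmap_rules)
      show "heq (F Z) (F X) (\<sigma> * fst (F X) * (\<sigma> * h)) (h * fst (F Z))"
        using h by (intro r) (simp_all add: mult.assoc sigma_left[OF O(1)] dmap_rules)
      show "heq (sus (F X)) (sus (F Y)) (fst (F Y) * - f) (- (f * \<sigma>) * (\<sigma> * fst (F X)))"
        using f by (intro r) (simp_all add: mult.assoc dmap_rules)
    qed
  next
    assume T: "tri (F Y) (F Z) (F X) g h (- (f * \<sigma>))"
    show "tri (F Y) (F Z) (sus (F X)) g (\<sigma> * h) (- f)"
    proof (rule tri_iso[OF D(2,3,1) D(2,3) D' T g h' f' hiso_id[OF D(2)] hiso_id[OF D(3)] sigma_hiso[OF O(1)]])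
      show "heq (F Y) (F Z) (fst (F Z) * g) (g * fst (F Y))"
        using g by (intro r) (simp_all add: dmap_rules)
      show "heq (F Z) (sus (F X)) (\<sigma> * fst (F X) * h) (\<sigma> * h * fst (F Z))"
        using h h' by (intro r) (simp_all add: mult.assoc dmap_rules)
      show "heq (F X) (sus (F Y)) (fst (F Y) * - (f * \<sigma>)) (- f * (\<sigma> * fst (F X)))"
        using f f3 by (intro r) (simp_all add: mult.assoc dmap_rules sigma_rules(1)[OF O(1)])
    qed
  qed
  finally show ?thesis unfolding 3 .
qed

theorem triangulated: "triangulated_category C (\<lambda>X. X) \<Sigma>m \<Delta>"
proof -
  interpret additive_automorphism C "\<lambda>X. X" \<Sigma>m by (rule automorphism)
  show ?thesis
  proof
    show "\<Delta> \<subseteq> triangles C (\<lambda>X. X)"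
      unfolding \<Delta>_def triangles_def by (auto intro: Phi_closed)
  next
    fix X Y Z f g h X' Y' Z' f' g' h' a b c
    assume T: "(X, Y, Z, f, g, h) \<in> \<Delta>" and T': "(X', Y', Z', f', g', h') \<in> triangles C (\<lambda>X. X)"
      and iso: "iso_mor C X X' a" "iso_mor C Y Y' b" "iso_mor C Z Z' c"
      and eq: "Comp C X Y Y' b f = Comp C X X' Y' f' a" "Comp C Y Z Z' c g = Comp C Y Y' Z' g' b"
        "Comp C Z X X' (\<Sigma>m X X' a) h = Comp C Z Z' X' h' c"
    from T' have O': "X' \<in> Ob C" "Y' \<in> Ob C" "Z' \<in> Ob C"
      and m': "f' \<in> Mor C X' Y'" "g' \<in> Mor C Y' Z'" "h' \<in> Mor C Z' X'" by (auto simp: triangles_def)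
    obtain f1 g1 h1 where O: "X \<in> Ob C" "Y \<in> Ob C" "Z \<in> Ob C" and m: "f1 \<in> dmap (F X) (F Y)"
      "g1 \<in> dmap (F Y) (F Z)" "h1 \<in> dmap (F Z) (F X)" and
      R: "f = \<Phi> X Y f1" "g = \<Phi> Y Z g1" "h = \<Phi> Z X h1" and T1: "tri (F X) (F Y) (F Z) f1 g1 (\<sigma> * h1)"
      using T by (rule Delta_cases)
    obtain f2 where f2: "f2 \<in> dmap (F X') (F Y')" "f' = \<Phi> X' Y' f2" by (rule Phi_cases[OF O'(1) O'(2) m'(1)])
    obtain g2 where g2: "g2 \<in> dmap (F Y') (F Z')" "g' = \<Phi> Y' Z' g2" by (rule Phi_cases[OF O'(2) O'(3) m'(2)])
    obtain h2 where h2: "h2 \<in> dmap (F Z') (F X')" "h' = \<Phi> Z' X' h2" by (rule Phi_cases[OF O'(3) O'(1) m'(3)])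
    have abc: "a \<in> Mor C X X'" "b \<in> Mor C Y Y'" "c \<in> Mor C Z Z'" using iso by (auto simp: iso_mor_def)
    obtain a1 where a1: "a1 \<in> dmap (F X) (F X')" "a = \<Phi> X X' a1" by (rule Phi_cases[OF O(1) O'(1) abc(1)])
    obtain b1 where b1: "b1 \<in> dmap (F Y) (F Y')" "b = \<Phi> Y Y' b1" by (rule Phi_cases[OF O(2) O'(2) abc(2)])
    obtain c1 where c1: "c1 \<in> dmap (F Z) (F Z')" "c = \<Phi> Z Z' c1" by (rule Phi_cases[OF O(3) O'(3) abc(3)])
    obtain a2 b2 c2 where i: "hiso (F X) (F X') a1 a2" "hiso (F Y) (F Y') b1 b2" "hiso (F Z) (F Z') c1 c2"
      using iso O O' a1 b1 c1 by (auto simp: iso_mor_iff)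
    note D = F_dobj[OF O(1)] F_dobj[OF O(2)] F_dobj[OF O(3)] F_dobj[OF O'(1)] F_dobj[OF O'(2)] F_dobj[OF O'(3)]
    have e: "heq (F X) (F Y') (b1 * f1) (f2 * a1)" "heq (F Y) (F Z') (c1 * g1) (g2 * b1)"
      "heq (F Z) (F X') (\<sigma> * a1 * \<sigma> * h1) (h2 * c1)"
      using eq O O' m R a1 b1 c1 f2 g2 h2
      by (simp_all add: heq_iff[symmetric] Phi_comp Sigma_Phi sigma_conj_dmap dmap_comp)
    have e3: "heq (F Z) (sus (F X')) (a1 * (\<sigma> * h1)) (\<sigma> * h2 * c1)"
      using sigma_heq[OF O'(1) e(3)] by (simp add: mult.assoc)
    have "tri (F X') (F Y') (F Z') f2 g2 (\<sigma> * h2)"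
      using tri_iso[OF D T1 f2(1) g2(1) _ i e(1,2) e3] h2 O' by (simp add: sigma_dmap_sus)
    then show "(X', Y', Z', f', g', h') \<in> \<Delta>" using O' f2 g2 h2 by (simp add: Delta_iff)
  next
    fix X N assume X: "X \<in> Ob C" and N: "zero_object C N"
    then have N': "N \<in> Ob C" by (auto simp: zero_object_def)
    have "tri (F X) (F X) (F N) (fst (F X)) 0 (\<sigma> * 0)"
      using X N N' by (simp add: tri_id F_dobj zero_object_iff)
    then show "(X, X, N, IdM C X, \<one>\<^bsub>Hom C X N\<^esub>, \<one>\<^bsub>Hom C N X\<^esub>) \<in> \<Delta>"
      using X N' by (simp add: Phi_id[symmetric] Phi_zero[symmetric] Delta_iff M_id)
  next
    fix X Y f assume XY: "X \<in> Ob C" "Y \<in> Ob C" and f: "f \<in> Mor C X Y"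
    obtain f1 where f1: "f1 \<in> dmap (F X) (F Y)" "f = \<Phi> X Y f1" using XY f by (rule Phi_cases)
    let ?C = "cone (F X) (F Y) f1"
    note D = F_dobj[OF XY(1)] F_dobj[OF XY(2)]
    have C: "is_dobj ?C" using D f1(1) by (rule is_dobj_cone)
    \<comment> \<open>The cone need not be of the form \<open>F Z\<close>; essential surjectivity
      supplies an equivalent object that is.\<close>
    obtain Z c c' where Z: "Z \<in> Ob C" and c: "hiso ?C (F Z) c c'"
      using ess_surj[OF C ok_cone] F_ok XY f1 by blast
    have cm: "c \<in> dmap ?C (F Z)" "c' \<in> dmap (F Z) ?C" "heq ?C ?C (c' * c) (fst ?C)" using c by (auto simp: hiso_def)
    note i = cone_incl[OF D f1(1)] and p = cone_proj[OF D f1(1)]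
    \<comment> \<open>The leading \<open>\<sigma>\<close> in \<open>h\<close> brings the projection
      back from the suspension of \<open>F X\<close> to \<open>F X\<close>.\<close>
    define g h where "g = c * (s * fst (F Y))" and "h = \<sigma> * (fst (F X) * t' * c')"
    have g: "g \<in> dmap (F Y) (F Z)" unfolding g_def using i cm(1) by (rule dmap_comp)
    have sh: "\<sigma> * h \<in> dmap (F Z) (sus (F X))" unfolding h_def using dmap_comp[OF cm(2) p] by simp
    then have h: "h \<in> dmap (F Z) (F X)" using XY by (simp add: sigma_dmap_sus)
    have "heq ?C (sus (F X)) (\<sigma> * h * c) (fst (F X) * t')"
      using heq_compL[OF cm(3) p] dmap_unit(2)[OF p] by (simp add: h_def mult.assoc)
    then have "tri (F X) (F Y) (F Z) f1 g (\<sigma> * h)"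
      unfolding tri_def using f1(1) g sh c heq_refl[OF g] by (auto simp: g_def)
    then show "\<exists>Z g h. (X, Y, Z, f, g, h) \<in> \<Delta>"
      using XY Z f1 g h by (auto simp: Delta_iff[symmetric])
  next
    fix X Y Z f g h assume T: "(X, Y, Z, f, g, h) \<in> triangles C (\<lambda>X. X)"
    from T have O: "X \<in> Ob C" "Y \<in> Ob C" "Z \<in> Ob C"
      and m: "f \<in> Mor C X Y" "g \<in> Mor C Y Z" "h \<in> Mor C Z X" by (auto simp: triangles_def)
    obtain f1 where f1: "f1 \<in> dmap (F X) (F Y)" "f = \<Phi> X Y f1" by (rule Phi_cases[OF O(1) O(2) m(1)])
    obtain g1 where g1: "g1 \<in> dmap (F Y) (F Z)" "g = \<Phi> Y Z g1" by (rule Phi_cases[OF O(2) O(3) m(2)])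
    obtain h1 where h1: "h1 \<in> dmap (F Z) (F X)" "h = \<Phi> Z X h1" by (rule Phi_cases[OF O(3) O(1) m(3)])
    show "((X, Y, Z, f, g, h) \<in> \<Delta>) = ((Y, Z, X, g, h, inv\<^bsub>Hom C X Y\<^esub> \<Sigma>m X Y f) \<in> \<Delta>)"
      using O f1 g1 h1 sigma_conj_dmap[OF O(1,2) f1(1)]
      by (simp add: Sigma_Phi Phi_minus Delta_iff tri_rotate_iff[OF O])
  next
    fix X Y Z f g h X' Y' Z' f' g' h' a b
    assume T: "(X, Y, Z, f, g, h) \<in> \<Delta>" and T': "(X', Y', Z', f', g', h') \<in> \<Delta>"
      and a: "a \<in> Mor C X X'" and b: "b \<in> Mor C Y Y'" and eq: "Comp C X Y Y' b f = Comp C X X' Y' f' a"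
    obtain f1 g1 h1 where O: "X \<in> Ob C" "Y \<in> Ob C" "Z \<in> Ob C" and m: "f1 \<in> dmap (F X) (F Y)"
      "g1 \<in> dmap (F Y) (F Z)" "h1 \<in> dmap (F Z) (F X)" and
      R: "f = \<Phi> X Y f1" "g = \<Phi> Y Z g1" "h = \<Phi> Z X h1" and T1: "tri (F X) (F Y) (F Z) f1 g1 (\<sigma> * h1)"
      using T by (rule Delta_cases)
    obtain f2 g2 h2 where O': "X' \<in> Ob C" "Y' \<in> Ob C" "Z' \<in> Ob C" and m': "f2 \<in> dmap (F X') (F Y')"
      "g2 \<in> dmap (F Y') (F Z')" "h2 \<in> dmap (F Z') (F X')" and
      R': "f' = \<Phi> X' Y' f2" "g' = \<Phi> Y' Z' g2" "h' = \<Phi> Z' X' h2" and T2: "tri (F X') (F Y') (F Z') f2 g2 (\<sigma> * h2)"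
      using T' by (rule Delta_cases)
    obtain a1 where a1: "a1 \<in> dmap (F X) (F X')" "a = \<Phi> X X' a1" by (rule Phi_cases[OF O(1) O'(1) a])
    obtain b1 where b1: "b1 \<in> dmap (F Y) (F Y')" "b = \<Phi> Y Y' b1" by (rule Phi_cases[OF O(2) O'(2) b])
    note D = F_dobj[OF O(1)] F_dobj[OF O(2)] F_dobj[OF O(3)] F_dobj[OF O'(1)] F_dobj[OF O'(2)] F_dobj[OF O'(3)]
    have e: "heq (F X) (F Y') (b1 * f1) (f2 * a1)"
      using eq O O' m m' R R' a1 b1 by (simp add: heq_iff[symmetric] Phi_comp dmap_comp)
    obtain d where d: "d \<in> dmap (F Z) (F Z')" "heq (F Y) (F Z') (d * g1) (g2 * b1)"
      "heq (F Z) (sus (F X')) (a1 * (\<sigma> * h1)) (\<sigma> * h2 * d)"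
      using tri_morphism[OF D(1,2,4,5) T1 T2 a1(1) b1(1) e] by blast
    have "heq (F Z) (F X') (\<sigma> * a1 * \<sigma> * h1) (h2 * d)"
      using d(3) O' by (intro sigma_heq_cancel) (simp_all add: mult.assoc)
    then show "\<exists>c \<in> Mor C Z Z'. Comp C Y Z Z' c g = Comp C Y Y' Z' g' b \<and>
              Comp C Z X X' (\<Sigma>m X X' a) h = Comp C Z Z' X' h' c"
      using d(1,2) O O' m m' R R' a1 b1
      by (intro bexI[of _ "\<Phi> Z Z' d"])
        (simp_all add: Phi_closed Phi_comp[symmetric] Sigma_Phi sigma_conj_dmap heq_iff dmap_comp)
  next
    fix X Y Z' f i i' Z X' g j j' Y' k k'
    assume T1: "(X, Y, Z', f, i, i') \<in> \<Delta>" and T2: "(Y, Z, X', g, j, j') \<in> \<Delta>"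
      and T3: "(X, Z, Y', Comp C X Y Z g f, k, k') \<in> \<Delta>"
    obtain f1 i1 i2 where O1: "X \<in> Ob C" "Y \<in> Ob C" "Z' \<in> Ob C" and m1: "f1 \<in> dmap (F X) (F Y)"
      "i1 \<in> dmap (F Y) (F Z')" "i2 \<in> dmap (F Z') (F X)" and
      R1: "f = \<Phi> X Y f1" "i = \<Phi> Y Z' i1" "i' = \<Phi> Z' X i2" and U1: "tri (F X) (F Y) (F Z') f1 i1 (\<sigma> * i2)"
      using T1 by (rule Delta_cases)
    obtain g1 j1 j2 where O2: "Z \<in> Ob C" "X' \<in> Ob C" and m2: "g1 \<in> dmap (F Y) (F Z)"
      "j1 \<in> dmap (F Z) (F X')" "j2 \<in> dmap (F X') (F Y)" and
      R2: "g = \<Phi> Y Z g1" "j = \<Phi> Z X' j1" "j' = \<Phi> X' Y j2" and U2: "tri (F Y) (F Z) (F X') g1 j1 (\<sigma> * j2)"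
      using T2 by (rule Delta_cases)
    have O3: "Y' \<in> Ob C" using T3 by (auto elim: Delta_cases)
    obtain k1 k2 where m3: "k1 \<in> dmap (F Z) (F Y')" "k2 \<in> dmap (F Y') (F X)"
      and R3: "k = \<Phi> Z Y' k1" "k' = \<Phi> Y' X k2"
      using T3 by (auto elim: Delta_cases)
    have gf: "g1 * f1 \<in> dmap (F X) (F Z)" using m1(1) m2(1) by (rule dmap_comp)
    have U3: "tri (F X) (F Z) (F Y') (g1 * f1) k1 (\<sigma> * k2)"
      using T3 O1 O2 O3 m1 m2 m3 R1 R2 R3 gf by (simp add: Phi_comp[symmetric] Delta_iff)
    note D = F_dobj[OF O1(1)] F_dobj[OF O1(2)] F_dobj[OF O2(1)] F_dobj[OF O1(3)] F_dobj[OF O2(2)] F_dobj[OF O3]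
    obtain u v where uv: "u \<in> dmap (F Z') (F Y')" "v \<in> dmap (F Y') (F X')"
        "tri (F Z') (F Y') (F X') u v (i1 * (\<sigma> * j2))"
        "heq (F Y) (F Y') (u * i1) (k1 * g1)" "heq (F Z') (sus (F X)) (\<sigma> * k2 * u) (\<sigma> * i2)"
        "heq (F Z) (F X') (v * k1) j1" "heq (F Y') (sus (F Y)) (\<sigma> * j2 * v) (f1 * (\<sigma> * k2))"
      using tri_octahedron[OF D U1 U2 U3] by blast
    \<comment> \<open>The octahedron of the ring gives the relations into suspended objects, with
      \<open>\<sigma>\<close> in front; cancelling it gives those among the objects of
      \<open>C\<close>.\<close>
    have k2u: "heq (F Z') (F X) (k2 * u) i2"
      using uv(5) O1 by (intro sigma_heq_cancel) (simp_all add: mult.assoc)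
    have "\<sigma> * (\<sigma> * f1 * \<sigma> * k2) = f1 * (\<sigma> * k2)" by (simp add: mult.assoc)
    then have j2v: "heq (F Y') (F Y) (j2 * v) (\<sigma> * f1 * \<sigma> * k2)"
      using uv(7) O1 by (intro sigma_heq_cancel) (simp_all add: mult.assoc)
    have w: "\<sigma> * i1 * \<sigma> * j2 \<in> dmap (F X') (F Z')"
      using dmap_comp[OF m2(3) sigma_conj_dmap[OF O1(2,3) m1(2)]] .
    have "\<sigma> * (\<sigma> * i1 * \<sigma> * j2) = i1 * (\<sigma> * j2)" by (simp add: mult.assoc)
    then have "(Z', Y', X', \<Phi> Z' Y' u, \<Phi> Y' X' v, \<Phi> X' Z' (\<sigma> * i1 * \<sigma> * j2)) \<in> \<Delta>"
      using uv w O1 O2 O3 by (simp add: Delta_iff)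
    then show "\<exists>u v. (Z', Y', X', u, v, Comp C X' Y Z' (\<Sigma>m Y Z' i) j') \<in> \<Delta> \<and>
              Comp C Y Z' Y' u i = Comp C Y Z Y' k g \<and>
              Comp C Z' Y' X k' u = i' \<and>
              Comp C Z Y' X' v k = j \<and>
              Comp C Y' X' Y j' v = Comp C Y' X Y (\<Sigma>m X Y f) k'"
      using uv k2u j2v w O1 O2 O3 m1 m2 m3
      by (intro exI[of _ "\<Phi> Z' Y' u"] exI[of _ "\<Phi> Y' X' v"] conjI)
        (simp_all add: R1 R2 R3 Sigma_Phi Phi_comp[symmetric] sigma_conj_dmap heq_iff dmap_comp)
  qed
qed

end

section \<open>Finitely generated free groups\<close>

definition subgp :: "'g::ab_group_add set \<Rightarrow> bool"
  where "subgp Q \<longleftrightarrow> 0 \<in> Q \<and> (\<forall>x \<in> Q. \<forall>y \<in> Q. x - y \<in> Q)"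

definition additive_on :: "'g::ab_group_add set \<Rightarrow> ('g \<Rightarrow> 'h::ab_group_add) \<Rightarrow> bool"
  where "additive_on Q f \<longleftrightarrow> (\<forall>x \<in> Q. \<forall>y \<in> Q. f (x + y) = f x + f y)"

lemma subgpD:
  assumes "subgp Q"
  shows "0 \<in> Q" "\<lbrakk>x \<in> Q; y \<in> Q\<rbrakk> \<Longrightarrow> x - y \<in> Q" "x \<in> Q \<Longrightarrow> - x \<in> Q" "\<lbrakk>x \<in> Q; y \<in> Q\<rbrakk> \<Longrightarrow> x + y \<in> Q"
proof -
  show 0: "0 \<in> Q" and d: "\<And>x y. \<lbrakk>x \<in> Q; y \<in> Q\<rbrakk> \<Longrightarrow> x - y \<in> Q" using assms by (auto simp: subgp_def)
  show m: "\<And>x. x \<in> Q \<Longrightarrow> - x \<in> Q" using d[OF 0] by simp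
  show "\<lbrakk>x \<in> Q; y \<in> Q\<rbrakk> \<Longrightarrow> x + y \<in> Q" using d[OF _ m, of x y] by simp
qed

lemma additive_onD:
  assumes "subgp Q" "additive_on Q f"
  shows "f 0 = 0" "\<lbrakk>x \<in> Q; y \<in> Q\<rbrakk> \<Longrightarrow> f (x + y) = f x + f y" "x \<in> Q \<Longrightarrow> f (- x) = - f x"
    "\<lbrakk>x \<in> Q; y \<in> Q\<rbrakk> \<Longrightarrow> f (x - y) = f x - f y"
proof -
  note q = subgpD[OF assms(1)]
  show a: "\<And>x y. \<lbrakk>x \<in> Q; y \<in> Q\<rbrakk> \<Longrightarrow> f (x + y) = f x + f y" using assms(2) by (simp add: additive_on_def)
  show 0: "f 0 = 0" using a[OF q(1) q(1)] by simp
  show m: "\<And>x. x \<in> Q \<Longrightarrow> f (- x) = - f x" using a[OF _ q(3), of x x for x] 0 by (simp add: eq_neg_iff_add_eq_0 add.commute)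
  show "\<lbrakk>x \<in> Q; y \<in> Q\<rbrakk> \<Longrightarrow> f (x - y) = f x - f y" using a[OF _ q(3), of x y] m by simp
qed

lemma additive_on_subset: "\<lbrakk>additive_on Q f; K \<subseteq> Q\<rbrakk> \<Longrightarrow> additive_on K f"
  by (auto simp: additive_on_def)

lemma subgp_kernel: "\<lbrakk>subgp Q; additive_on Q f\<rbrakk> \<Longrightarrow> subgp {x \<in> Q. f x = 0}"
  by (simp add: subgp_def[of "{x \<in> Q. f x = 0}"] additive_onD(1,4)[of Q f] subgpD(1,2))

definition zmul :: "int \<Rightarrow> 'g::ab_group_add \<Rightarrow> 'g"
  where "zmul m x = (\<Sum>i<nat m. x) - (\<Sum>i<nat (- m). x)"

lemma zmul_0 [simp]: "zmul 0 x = 0"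
  by (simp add: zmul_def)

lemma zmul_succ: "zmul (m + 1) x = zmul m x + x"
proof (cases "0 \<le> m")
  case True
  then have "nat (m + 1) = Suc (nat m)" "nat (- (m + 1)) = 0" "nat (- m) = 0" by auto
  then show ?thesis by (simp add: zmul_def add.commute)
next
  case False
  then have "nat (- m) = Suc (nat (- (m + 1)))" "nat m = 0" "nat (m + 1) = 0" by auto
  then show ?thesis by (simp add: zmul_def add.commute)
qed

lemma zmul_pred: "zmul (m - 1) x = zmul m x - x"
  using zmul_succ[of "m - 1" x] by simp

lemma zmul_add: "zmul (m + n) x = zmul m x + zmul n x"
proof (induction n rule: int_induct[where k = 0])
  case (step1 i)
  then show ?case using zmul_succ[of "m + i" x] zmul_succ[of i x] by (simp add: add.assoc)
next
  case (step2 i)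
  then show ?case using zmul_pred[of "m + i" x] zmul_pred[of i x] by (simp add: add_diff_eq)
qed simp

lemma zmul_mem:
  assumes "subgp Q" "x \<in> Q" shows "zmul m x \<in> Q"
  using assms by (induction m rule: int_induct[where k = 0]) (auto simp: zmul_succ zmul_pred subgpD)

lemma additive_on_zmul:
  assumes "subgp Q" "additive_on Q f" "x \<in> Q" shows "f (zmul m x) = zmul m (f x)"
  using assms by (induction m rule: int_induct[where k = 0])
    (auto simp: zmul_succ zmul_pred zmul_mem additive_onD[OF assms(1,2)])

lemma zmul_int [simp]: "zmul m (x :: int) = m * x"
  by (induction m rule: int_induct[where k = 0]) (auto simp: zmul_succ zmul_pred algebra_simps)

lemma zmul_Pair: "zmul m (x, y) = (zmul m x, zmul m y)"
  by (induction m rule: int_induct[where k = 0]) (auto simp: zmul_succ zmul_pred zero_prod_def)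

text \<open>The functionals in \<open>P\<close> are the coordinates of an embedding into \<open>\<int>\<^sup>m\<close>. Unlike the existence of a basis, this
  condition passes to subgroups for trivial reasons.\<close>

definition fgfree :: "'g::ab_group_add set \<Rightarrow> bool"
  where "fgfree Q \<longleftrightarrow> subgp Q \<and> (\<exists>P :: ('g \<Rightarrow> int) set. finite P \<and> (\<forall>\<phi> \<in> P. additive_on Q \<phi>) \<and>
    (\<forall>x \<in> Q. (\<forall>\<phi> \<in> P. \<phi> x = 0) \<longrightarrow> x = 0))"

lemma fgfree_subgp: "fgfree Q \<Longrightarrow> subgp Q"
  by (simp add: fgfree_def)

text \<open>The coordinates of the targets, composed with a finite family of maps that is jointly
  injective, are coordinates on \<open>Q\<close>. Subgroups, products and graded groups are all
  covered by this.\<close>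

lemma fgfree_joint:
  fixes \<psi> :: "'i \<Rightarrow> 'g::ab_group_add \<Rightarrow> 'h::ab_group_add"
  assumes Q: "subgp Q" and I: "finite I"
    and \<psi>: "\<And>i. i \<in> I \<Longrightarrow> additive_on Q (\<psi> i)" "\<And>i x. \<lbrakk>i \<in> I; x \<in> Q\<rbrakk> \<Longrightarrow> \<psi> i x \<in> P i"
    and P: "\<And>i. i \<in> I \<Longrightarrow> fgfree (P i)"
    and inj: "\<And>x. \<lbrakk>x \<in> Q; \<And>i. i \<in> I \<Longrightarrow> \<psi> i x = 0\<rbrakk> \<Longrightarrow> x = 0"
  shows "fgfree Q"
proof -
  have "\<forall>i \<in> I. \<exists>S :: ('h \<Rightarrow> int) set. finite S \<and> (\<forall>\<phi> \<in> S. additive_on (P i) \<phi>) \<and>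
    (\<forall>x \<in> P i. (\<forall>\<phi> \<in> S. \<phi> x = 0) \<longrightarrow> x = 0)"
    using P by (simp add: fgfree_def)
  from bchoice[OF this] obtain S :: "'i \<Rightarrow> ('h \<Rightarrow> int) set" where
    "\<forall>i \<in> I. finite (S i) \<and> (\<forall>\<phi> \<in> S i. additive_on (P i) \<phi>) \<and> (\<forall>x \<in> P i. (\<forall>\<phi> \<in> S i. \<phi> x = 0) \<longrightarrow> x = 0)" ..
  then have S: "\<And>i. i \<in> I \<Longrightarrow> finite (S i)"
    "\<And>i \<phi>. \<lbrakk>i \<in> I; \<phi> \<in> S i\<rbrakk> \<Longrightarrow> additive_on (P i) \<phi>"
    "\<And>i x. \<lbrakk>i \<in> I; x \<in> P i; \<forall>\<phi> \<in> S i. \<phi> x = 0\<rbrakk> \<Longrightarrow> x = 0"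
    by auto
  let ?T = "\<Union>i \<in> I. (\<lambda>\<phi>. \<phi> \<circ> \<psi> i) ` S i"
  have 1: "finite ?T" using I S(1) by (intro finite_UN_I finite_imageI)
  have 2: "\<forall>\<phi> \<in> ?T. additive_on Q \<phi>"
    using \<psi> S(2) by (auto simp: additive_on_def)
  have 3: "x = 0" if x: "x \<in> Q" and 0: "\<forall>\<phi> \<in> ?T. \<phi> x = 0" for x
  proof (rule inj[OF x])
    fix i assume i: "i \<in> I"
    have "\<forall>\<phi> \<in> S i. \<phi> (\<psi> i x) = 0" using 0 i by auto
    then show "\<psi> i x = 0" using S(3)[OF i \<psi>(2)[OF i x]] by simp
  qed
  show ?thesis
    unfolding fgfree_def by (intro conjI exI[of _ ?T] Q 1 2) (use 3 in simp)
qed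

lemma fgfree_inj:
  assumes "subgp Q" "additive_on Q \<psi>" "\<And>x. x \<in> Q \<Longrightarrow> \<psi> x \<in> P" "fgfree P" "\<And>x. \<lbrakk>x \<in> Q; \<psi> x = 0\<rbrakk> \<Longrightarrow> x = 0"
  shows "fgfree Q"
  using assms by (intro fgfree_joint[of Q "{()}" "\<lambda>_. \<psi>" "\<lambda>_. P"]) auto

lemma fgfree_subset: "\<lbrakk>fgfree P; subgp Q; Q \<subseteq> P\<rbrakk> \<Longrightarrow> fgfree Q"
  by (rule fgfree_inj[where \<psi> = "\<lambda>x. x" and P = P]) (auto simp: additive_on_def)

lemma fgfree_induct [consumes 1, case_names trivial step]:
  assumes "fgfree Q" and "P {0}"
    and step: "\<And>Q \<pi>. \<lbrakk>subgp Q; additive_on Q (\<pi> :: _ \<Rightarrow> int); P {x \<in> Q. \<pi> x = 0}\<rbrakk> \<Longrightarrow> P Q"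
  shows "P Q"
proof -
  obtain S :: "('a \<Rightarrow> int) set" where "finite S" "\<forall>\<phi> \<in> S. additive_on Q \<phi>" "\<forall>x \<in> Q. (\<forall>\<phi> \<in> S. \<phi> x = 0) \<longrightarrow> x = 0" "subgp Q"
    using assms(1) by (auto simp: fgfree_def)
  then show ?thesis
  proof (induction S arbitrary: Q rule: finite_induct)
    case empty
    then have "Q = {0}" by (auto simp: subgp_def)
    then show ?case using assms(2) by simp
  next
    case (insert \<pi> S)
    have "P {x \<in> Q. \<pi> x = 0}"
      by (rule insert.IH) (use insert.prems in \<open>auto intro: additive_on_subset subgp_kernel\<close>)
    then show ?case using insert.prems by (intro step[of Q \<pi>]) auto
  qed
qed

text \<open>The values of \<open>\<pi>\<close> form a subgroup of the integers. If \<open>s\<close>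
  attains its least positive element, then \<open>Q\<close> is the sum of the kernel and the
  multiples of \<open>s\<close>.\<close>

lemma kernel_complement:
  assumes Q: "subgp Q" and \<pi>: "additive_on Q (\<pi> :: _ \<Rightarrow> int)"
  obtains s where "s \<in> Q" "\<And>x. x \<in> Q \<Longrightarrow> \<pi> s dvd \<pi> x"
    "\<And>x. x \<in> Q \<Longrightarrow> x - zmul (\<pi> x div \<pi> s) s \<in> {x \<in> Q. \<pi> x = 0}"
proof (cases "\<forall>x \<in> Q. \<pi> x = 0")
  case True
  \<comment> \<open>If \<open>\<pi>\<close> vanishes, \<open>s = 0\<close> will do: all quotients
    are \<open>0 div 0\<close>, which is 0.\<close>
  then show ?thesis using that[of 0] Q additive_onD(1)[OF Q \<pi>] by (auto simp: subgp_def zmul_mem)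
next
  case False
  define T where "T = {n. 0 < n \<and> (\<exists>x \<in> Q. \<pi> x = int n)}"
  obtain x where x: "x \<in> Q" "\<pi> x \<noteq> 0" using False by auto
  have "nat \<bar>\<pi> x\<bar> \<in> T"
    unfolding T_def using x subgpD(3)[OF Q x(1)] additive_onD(3)[OF Q \<pi> x(1)]
    by (cases "\<pi> x < 0") (auto intro!: bexI[of _ "if \<pi> x < 0 then - x else x"])
  then have L: "(LEAST n. n \<in> T) \<in> T" "\<And>n. n \<in> T \<Longrightarrow> (LEAST n. n \<in> T) \<le> n" by (auto intro: LeastI Least_le)
  then obtain s where s: "s \<in> Q" "\<pi> s = int (LEAST n. n \<in> T)" "0 < \<pi> s" by (auto simp: T_def)
  have *: "\<pi> (y - zmul (\<pi> y div \<pi> s) s) = 0" "y - zmul (\<pi> y div \<pi> s) s \<in> Q" if y: "y \<in> Q" for y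
  proof -
    show z: "y - zmul (\<pi> y div \<pi> s) s \<in> Q" using Q y s by (intro subgpD zmul_mem)
    have "\<pi> (y - zmul (\<pi> y div \<pi> s) s) = \<pi> y mod \<pi> s"
      using Q \<pi> y s by (simp add: additive_onD[OF Q \<pi>] zmul_mem additive_on_zmul[OF Q \<pi>] minus_div_mult_eq_mod)
    moreover have "\<pi> y mod \<pi> s = 0"
    proof (rule ccontr)
      assume n0: "\<pi> y mod \<pi> s \<noteq> 0"
      have "0 \<le> \<pi> y mod \<pi> s" "\<pi> y mod \<pi> s < \<pi> s" using s(3) by auto
      then have "nat (\<pi> y mod \<pi> s) \<in> T" unfolding T_def using z n0 calculation by auto
      from L(2)[OF this] show False using \<open>\<pi> y mod \<pi> s < \<pi> s\<close> \<open>0 \<le> \<pi> y mod \<pi> s\<close> s(2) by linarith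
    qed
    ultimately show "\<pi> (y - zmul (\<pi> y div \<pi> s) s) = 0" by simp
  qed
  show ?thesis
  proof (rule that[OF s(1)])
    fix y assume y: "y \<in> Q"
    show "y - zmul (\<pi> y div \<pi> s) s \<in> {x \<in> Q. \<pi> x = 0}" using *[OF y] by simp
    have "\<pi> y = (\<pi> y div \<pi> s) * \<pi> s"
      using *(1)[OF y] Q y s by (simp add: additive_onD[OF Q \<pi>] zmul_mem additive_on_zmul[OF Q \<pi>])
    then show "\<pi> s dvd \<pi> y" by (metis dvd_triv_right)
  qed
qed

text \<open>Finitely generated free groups are projective: a total additive relation contains a homomorphism.\<close>

lemma fgfree_lift:
  assumes "fgfree Q" and R: "subgp (R :: ('g::ab_group_add \<times> 'h::ab_group_add) set)"
    and "\<And>x. x \<in> Q \<Longrightarrow> \<exists>y. (x, y) \<in> R"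
  obtains f where "additive_on Q f" "\<And>x. x \<in> Q \<Longrightarrow> (x, f x) \<in> R"
proof -
  have "\<exists>f. additive_on Q f \<and> (\<forall>x \<in> Q. (x, f x) \<in> R)"
    using assms(1,3)
  proof (induction rule: fgfree_induct)
    case trivial
    show ?case using R by (intro exI[of _ "\<lambda>_. 0"]) (auto simp: additive_on_def subgp_def zero_prod_def)
  next
    case (step Q \<pi>)
    let ?K = "{x \<in> Q. \<pi> x = 0}"
    have K: "subgp ?K" using step.hyps by (rule subgp_kernel)
    obtain f where f: "additive_on ?K f" "\<And>x. x \<in> ?K \<Longrightarrow> (x, f x) \<in> R" using step.IH step.prems by auto
    obtain s where s: "s \<in> Q" "\<And>x. x \<in> Q \<Longrightarrow> \<pi> s dvd \<pi> x"
      "\<And>x. x \<in> Q \<Longrightarrow> x - zmul (\<pi> x div \<pi> s) s \<in> ?K" using step.hyps by (rule kernel_complement) blast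
    obtain y where y: "(s, y) \<in> R" using step.prems s(1) by blast
    \<comment> \<open>Keep \<open>f\<close> on the kernel and send \<open>s\<close> to
      \<open>y\<close>; if \<open>\<pi>\<close> is zero, all quotients vanish and \<open>g\<close>
      reduces to \<open>f\<close>.\<close>
    define g where "g = (\<lambda>x. f (x - zmul (\<pi> x div \<pi> s) s) + zmul (\<pi> x div \<pi> s) y)"
    have "additive_on Q g"
      unfolding additive_on_def
    proof (intro ballI)
      fix u v assume u: "u \<in> Q" and v: "v \<in> Q"
      have d: "\<pi> (u + v) div \<pi> s = \<pi> u div \<pi> s + \<pi> v div \<pi> s"
        using u v s(2) by (simp add: additive_onD[OF step.hyps] div_plus_div_distrib_dvd_left)
      have "u + v - zmul (\<pi> (u + v) div \<pi> s) s
          = (u - zmul (\<pi> u div \<pi> s) s) + (v - zmul (\<pi> v div \<pi> s) s)"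
        by (simp add: d zmul_add algebra_simps)
      then show "g (u + v) = g u + g v"
        unfolding g_def using additive_onD(2)[OF K f(1) s(3)[OF u] s(3)[OF v]]
        by (simp add: d zmul_add algebra_simps)
    qed
    moreover have "(x, g x) \<in> R" if x: "x \<in> Q" for x
    proof -
      have "(x - zmul (\<pi> x div \<pi> s) s, f (x - zmul (\<pi> x div \<pi> s) s)) + zmul (\<pi> x div \<pi> s) (s, y) \<in> R"
        by (intro subgpD(4)[OF R] zmul_mem[OF R] y f(2) s(3) x)
      then show ?thesis by (simp add: zmul_Pair g_def)
    qed
    ultimately show ?case by blast
  qed
  then show ?thesis using that by blast
qed

text \<open>Being defined by coordinates, these groups come without generators. The chosen
  \<open>s\<close> of each induction step are generators; they are needed to meet the definition of
  finite generation for complexes.\<close>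

lemma fgfree_finite_generators:
  assumes "fgfree Q"
  obtains S where "finite S" "S \<subseteq> Q" "\<And>H. \<lbrakk>subgp H; S \<subseteq> H\<rbrakk> \<Longrightarrow> Q \<subseteq> H"
proof -
  have "\<exists>S. finite S \<and> S \<subseteq> Q \<and> (\<forall>H. subgp H \<longrightarrow> S \<subseteq> H \<longrightarrow> Q \<subseteq> H)"
    using assms
  proof (induction rule: fgfree_induct)
    case trivial
    show ?case by (intro exI[of _ "{}"]) (auto simp: subgp_def)
  next
    case (step Q \<pi>)
    let ?K = "{x \<in> Q. \<pi> x = 0}"
    obtain S where S: "finite S" "S \<subseteq> ?K" "\<And>H. \<lbrakk>subgp H; S \<subseteq> H\<rbrakk> \<Longrightarrow> ?K \<subseteq> H" using step.IH by blast
    obtain s where s: "s \<in> Q" "\<And>x. x \<in> Q \<Longrightarrow> x - zmul (\<pi> x div \<pi> s) s \<in> ?K"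
      using step.hyps by (rule kernel_complement) blast
    have "Q \<subseteq> H" if H: "subgp H" "insert s S \<subseteq> H" for H
    proof
      fix x assume x: "x \<in> Q"
      have "x - zmul (\<pi> x div \<pi> s) s \<in> H" using S(3)[OF H(1)] H(2) s(2)[OF x] by blast
      then have "x - zmul (\<pi> x div \<pi> s) s + zmul (\<pi> x div \<pi> s) s \<in> H"
        using H by (intro subgpD(4)[OF H(1)] zmul_mem) auto
      then show "x \<in> H" by simp
    qed
    then show ?case using S(1,2) s(1) by (intro exI[of _ "insert s S"]) auto
  qed
  then show ?thesis using that by blast
qed

text \<open>Countability is what allows the group to be copied into an arbitrary infinite
  type.\<close>

lemma fgfree_countable:
  assumes "fgfree Q" shows "countable Q"
  using assms
proof (induction rule: fgfree_induct)
  case (step Q \<pi>)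
  let ?K = "{x \<in> Q. \<pi> x = 0}"
  obtain s where s: "s \<in> Q" "\<And>x. x \<in> Q \<Longrightarrow> x - zmul (\<pi> x div \<pi> s) s \<in> ?K"
    using step.hyps by (rule kernel_complement) blast
  have "Q \<subseteq> (\<lambda>(k, m). k + zmul m s) ` (?K \<times> UNIV)"
  proof
    fix x assume "x \<in> Q"
    then show "x \<in> (\<lambda>(k, m). k + zmul m s) ` (?K \<times> UNIV)"
      using s(2) by (intro image_eqI[of _ _ "(x - zmul (\<pi> x div \<pi> s) s, \<pi> x div \<pi> s)"]) auto
  qed
  then show ?case by (rule countable_subset) (intro countable_image countable_SIGMA step.IH, auto)
qed simp

section \<open>Differential groups\<close>

typedef (overloaded) 'u endo = "{f :: 'u::ab_group_add \<Rightarrow> 'u. \<forall>x y. f (x + y) = f x + f y}"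
  morphisms app Endo
  by (rule exI[of _ "\<lambda>x. x"]) simp

setup_lifting type_definition_endo

instantiation endo :: (ab_group_add) "{ring, monoid_mult}"
begin

lift_definition zero_endo :: "'a endo" is "\<lambda>_. 0" by simp
lift_definition one_endo :: "'a endo" is "\<lambda>x. x" by simp
lift_definition plus_endo :: "'a endo \<Rightarrow> 'a endo \<Rightarrow> 'a endo" is "\<lambda>f g x. f x + g x" by (simp add: algebra_simps)
lift_definition minus_endo :: "'a endo \<Rightarrow> 'a endo \<Rightarrow> 'a endo" is "\<lambda>f g x. f x - g x" by (simp add: algebra_simps)
lift_definition uminus_endo :: "'a endo \<Rightarrow> 'a endo" is "\<lambda>f x. - f x" by (simp add: algebra_simps)
lift_definition times_endo :: "'a endo \<Rightarrow> 'a endo \<Rightarrow> 'a endo" is "\<lambda>f g x. f (g x)" by simp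

instance
  by standard (transfer; simp add: algebra_simps fun_eq_iff)+

end

lemma app_zero [simp]: "app 0 x = 0" and app_one [simp]: "app 1 x = x"
  and app_plus [simp]: "app (f + g) x = app f x + app g x"
  and app_minus [simp]: "app (f - g) x = app f x - app g x"
  and app_uminus [simp]: "app (- f) x = - app f x"
  and app_times [simp]: "app (f * g) x = app f (app g x)"
  by (transfer; simp)+

lemma app_add [simp]: "app f (x + y) = app f x + app f y"
  using app[of f] by simp

lemma additive_on_app: "additive_on Q (app f)"
  by (simp add: additive_on_def)

lemma app_0 [simp]: "app f 0 = 0"
  using app_add[of f 0 0] by simp

lemma app_neg [simp]: "app f (- x) = - app f x"
  using app_add[of f x "- x"] by (simp add: eq_neg_iff_add_eq_0 add.commute)

lemma app_diff [simp]: "app f (x - y) = app f x - app f y"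
  using app_add[of f x "- y"] by simp

lemma endo_eqI: "(\<And>x. app f x = app g x) \<Longrightarrow> f = g"
  by (simp add: app_inject[symmetric] fun_eq_iff)

lemma app_Endo: "(\<And>x y. f (x + y) = f x + f y) \<Longrightarrow> app (Endo f) = f"
  by (simp add: Endo_inverse)

section \<open>Acyclic objects and quasi-isomorphisms\<close>

definition im :: "'u::ab_group_add endo \<Rightarrow> 'u set"
  where "im e = {x. app e x = x}"

lemma im_iff: "x \<in> im e \<longleftrightarrow> app e x = x"
  by (simp add: im_def)

lemma subgp_im: "subgp (im e)"
  by (simp add: subgp_def im_def)

definition acyclic :: "'u::ab_group_add endo \<times> 'u endo \<Rightarrow> bool"
  where "acyclic A \<longleftrightarrow> (\<forall>x \<in> im (fst A). app (snd A) x = 0 \<longrightarrow> (\<exists>y \<in> im (fst A). x = app (snd A) y))"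

text \<open>Injectivity and surjectivity on homology, expressed by elements so that no quotient
  groups occur.\<close>

definition qis :: "'u::ab_group_add endo \<times> 'u endo \<Rightarrow> 'u endo \<times> 'u endo \<Rightarrow> 'u endo \<Rightarrow> bool"
  where "qis A B f \<longleftrightarrow> f \<in> dmap A B \<and>
    (\<forall>x \<in> im (fst A). app (snd A) x = 0 \<longrightarrow> (\<exists>y \<in> im (fst B). app f x = app (snd B) y) \<longrightarrow>
      (\<exists>x' \<in> im (fst A). x = app (snd A) x')) \<and>
    (\<forall>y \<in> im (fst B). app (snd B) y = 0 \<longrightarrow>
      (\<exists>x \<in> im (fst A). \<exists>y' \<in> im (fst B). app (snd A) x = 0 \<and> y = app f x + app (snd B) y'))"

text \<open>The source splits as cycles plus a complement mapped isomorphically onto the boundaries; both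
  summands are free, and a null homotopy is chosen on the cycles first.\<close>

lemma dmap_free_acyclic:
  fixes A C :: "'u::ab_group_add endo \<times> 'u endo"
  assumes A: "is_dobj A" "fgfree (im (fst A))" and C: "is_dobj C" "acyclic C" and f: "f \<in> dmap A C"
  shows "f \<in> dnull A C"
proof -
  obtain e \<delta> where Ad: "A = (e, \<delta>)" by (cases A)
  obtain e' \<delta>' where Cd: "C = (e', \<delta>')" by (cases C)
  have e: "app e (app e x) = app e x" "app e (app \<delta> x) = app \<delta> x" "app \<delta> (app e x) = app \<delta> x" "app \<delta> (app \<delta> x) = 0"
    for x using A(1) by (auto simp: is_dobj_def Ad simp flip: app_times)
  have e': "app e' (app e' x) = app e' x" "app e' (app \<delta>' x) = app \<delta>' x" "app \<delta>' (app e' x) = app \<delta>' x" "app \<delta>' (app \<delta>' x) = 0"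
    for x using C(1) by (auto simp: is_dobj_def Cd simp flip: app_times)
  have f: "app e' (app f x) = app f x" "app f (app e x) = app f x" "app \<delta>' (app f x) = app f (app \<delta> x)" for x
    using f by (auto simp: dmap_def Ad Cd simp flip: app_times)
  define Z where "Z = {x \<in> im e. app \<delta> x = 0}"
  define B where "B = app \<delta> ` im e"
  have Z: "fgfree Z" "subgp Z"
  proof -
    show "subgp Z" unfolding Z_def by (intro subgp_kernel subgp_im additive_on_app)
    then show "fgfree Z" using A(2) by (rule_tac fgfree_subset) (auto simp: Ad Z_def)
  qed
  have BZ: "B \<subseteq> Z" by (auto simp: B_def Z_def im_iff e)
  have B: "fgfree B" "subgp B"
  proof -
    show "subgp B" unfolding subgp_def
    proof (intro conjI ballI)
      show "0 \<in> B" by (auto simp: B_def im_iff intro!: image_eqI[of _ _ 0])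
      fix x y assume "x \<in> B" "y \<in> B"
      then obtain u v where "x = app \<delta> u" "y = app \<delta> v" "u \<in> im e" "v \<in> im e" by (auto simp: B_def)
      then show "x - y \<in> B" by (auto simp: B_def im_iff intro!: image_eqI[of _ _ "u - v"])
    qed
    then show "fgfree B" using Z(1) BZ by (rule_tac fgfree_subset)
  qed
  have "subgp {(b, x). x \<in> im e \<and> app \<delta> x = b}" by (auto simp: subgp_def im_iff zero_prod_def)
  then obtain r where r: "additive_on B r" "\<And>b. b \<in> B \<Longrightarrow> r b \<in> im e \<and> app \<delta> (r b) = b"
    using B(1) by (rule_tac fgfree_lift[of B]) (auto simp: B_def)
  have "subgp {(z, y). y \<in> im e' \<and> app \<delta>' y = app f z}" by (auto simp: subgp_def im_iff zero_prod_def)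
  moreover have "\<exists>y. y \<in> im e' \<and> app \<delta>' y = app f z" if "z \<in> Z" for z
    using C(2) that f by (auto simp: acyclic_def Cd im_iff Z_def dest!: bspec[of _ _ "app f z"])
  ultimately obtain h where h: "additive_on Z h" "\<And>z. z \<in> Z \<Longrightarrow> h z \<in> im e' \<and> app \<delta>' (h z) = app f z"
    using Z(1) by (rule_tac fgfree_lift[of Z]) auto
  have hB: "additive_on B h" using h(1) BZ by (rule additive_on_subset)
  note rB = additive_onD[OF B(2) r(1)] and hB' = additive_onD[OF B(2) hB]
  \<comment> \<open>On the lift \<open>r b\<close> of a boundary the homotopy is to take a value
    \<open>k b\<close> with \<open>\<delta>' (k b) + h b = f (r b)\<close>. Such values exist
    because \<open>f (r b) - h b\<close> is a cycle and the target is acyclic.\<close>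
  have "subgp {(b, y). b \<in> B \<and> y \<in> im e' \<and> app \<delta>' y = app f (r b) - h b}"
    using B(2) by (auto simp: subgp_def im_iff zero_prod_def rB hB')
  moreover have "\<exists>y. b \<in> B \<and> y \<in> im e' \<and> app \<delta>' y = app f (r b) - h b" if b: "b \<in> B" for b
  proof -
    have "app f (r b) - h b \<in> im e'" using f h(2) BZ b by (auto simp: im_iff)
    moreover have "app \<delta>' (app f (r b) - h b) = 0" using f r(2)[OF b] h(2) BZ b by auto
    moreover have "\<forall>x \<in> im e'. app \<delta>' x = 0 \<longrightarrow> (\<exists>y \<in> im e'. x = app \<delta>' y)"
      using C(2) by (simp add: acyclic_def Cd)
    ultimately obtain y where "y \<in> im e'" "app f (r b) - h b = app \<delta>' y" by blast
    then show ?thesis using b by (intro exI[of _ y]) simp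
  qed
  ultimately obtain k where k: "additive_on B k" "\<And>b. b \<in> B \<Longrightarrow> k b \<in> im e' \<and> app \<delta>' (k b) = app f (r b) - h b"
    using B(1) by (rule_tac fgfree_lift[of B]) auto
  \<comment> \<open>The two summands belong to the decomposition of \<open>e x\<close> into the
    cycle \<open>e x - r (\<delta> x)\<close> and the lift \<open>r (\<delta> x)\<close>.\<close>
  define H where "H = Endo (\<lambda>x. h (app e x - r (app \<delta> x)) + k (app \<delta> x))"
  have dB: "app \<delta> x \<in> B" for x unfolding B_def by (rule image_eqI[of _ _ "app e x"]) (auto simp: im_iff e)
  have zZ: "app e x - r (app \<delta> x) \<in> Z" for x
    using r(2)[OF dB[of x]] by (auto simp: Z_def im_iff e)
  have H: "app H = (\<lambda>x. h (app e x - r (app \<delta> x)) + k (app \<delta> x))"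
    unfolding H_def
  proof (rule app_Endo)
    fix x y
    have eq: "app e (x + y) - r (app \<delta> (x + y)) = (app e x - r (app \<delta> x)) + (app e y - r (app \<delta> y))"
      using rB(2)[OF dB dB] by simp
    show "h (app e (x + y) - r (app \<delta> (x + y))) + k (app \<delta> (x + y)) =
      h (app e x - r (app \<delta> x)) + k (app \<delta> x) + (h (app e y - r (app \<delta> y)) + k (app \<delta> y))"
      unfolding eq unfolding additive_onD(2)[OF Z(2) h(1) zZ zZ] app_add additive_onD(2)[OF B(2) k(1) dB dB]
      by (simp add: algebra_simps)
  qed
  have H1: "app e' (app H x) = app H x" for x
    using h(2)[OF zZ] k(2)[OF dB] by (simp add: H im_iff)
  have H2: "app H (app e x) = app H x" for x by (simp add: H e)
  have "app f x = app \<delta>' (app H x) + app H (app \<delta> x)" for x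
  proof -
    have "app H (app \<delta> x) = h (app \<delta> x)"
      by (simp add: H e additive_onD(1)[OF B(2) k(1)] rB)
    then show ?thesis using h(2)[OF zZ[of x]] k(2)[OF dB[of x]] f by (simp add: H)
  qed
  then show ?thesis
    by (intro dnullI[where h = H] endo_eqI) (simp_all add: Ad Cd H1 H2)
qed

locale endo_doubling = doubling s t s' t' for s t s' t' :: "'u::ab_group_add endo"
begin

lemma app_rules [simp]: "app s' (app s x) = x" "app t' (app t x) = x" "app s' (app t x) = 0" "app t' (app s x) = 0"
  by (simp_all flip: app_times)

text \<open>For a cycle of the cone with components \<open>b\<close> and \<open>a\<close>,
  injectivity on homology makes \<open>a\<close> the boundary of some \<open>a'\<close>, and
  surjectivity applied to the cycle \<open>b + f a'\<close> corrects the other component.\<close>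

lemma acyclic_cone:
  assumes A: "is_dobj A" "is_dobj B" and f: "qis A B f"
  shows "acyclic (cone A B f)"
  unfolding acyclic_def
proof (intro ballI impI)
  obtain e \<delta> where Ad: "A = (e, \<delta>)" by (cases A)
  obtain e' \<delta>' where Bd: "B = (e', \<delta>')" by (cases B)
  have e: "app e (app e x) = app e x" "app e (app \<delta> x) = app \<delta> x" "app \<delta> (app e x) = app \<delta> x" "app \<delta> (app \<delta> x) = 0"
    for x using A(1) by (auto simp: is_dobj_def Ad simp flip: app_times)
  have e': "app e' (app e' x) = app e' x" "app e' (app \<delta>' x) = app \<delta>' x" "app \<delta>' (app e' x) = app \<delta>' x" "app \<delta>' (app \<delta>' x) = 0"
    for x using A(2) by (auto simp: is_dobj_def Bd simp flip: app_times)
  have f1: "app e' (app f x) = app f x" "app f (app e x) = app f x" "app \<delta>' (app f x) = app f (app \<delta> x)" for x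
    using f by (auto simp: qis_def dmap_def Ad Bd simp flip: app_times)
  have f2: "\<exists>x'. app e x' = x' \<and> x = app \<delta> x'" if "app e x = x" "app \<delta> x = 0" "app e' y = y" "app f x = app \<delta>' y" for x y
    using f that unfolding qis_def Ad Bd im_def by (auto; blast)
  have f3: "\<exists>x y'. app e x = x \<and> app e' y' = y' \<and> app \<delta> x = 0 \<and> y = app f x + app \<delta>' y'" if "app e' y = y" "app \<delta>' y = 0" for y
    using f that unfolding qis_def Ad Bd im_def by (auto; blast)
  fix x assume x: "x \<in> im (fst (cone A B f))" and x0: "app (snd (cone A B f)) x = 0"
  define b a where "b = app s' x" and "a = app t' x"
  have x': "app s (app e' b) + app t (app e a) = x" using x by (simp add: im_iff cone_def Ad Bd a_def b_def)
  have ab: "app e' b = b" "app e a = a"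
    using arg_cong[OF x', of "app s'"] arg_cong[OF x', of "app t'"] by (simp_all add: a_def b_def)
  have x0': "app s (app \<delta>' b) + app s (app f a) - app t (app \<delta> a) = 0"
    using x0 by (simp add: cone_def Ad Bd a_def b_def)
  have 0: "app \<delta>' b + app f a = 0" "app \<delta> a = 0"
    using arg_cong[OF x0', of "app s'"] arg_cong[OF x0', of "app t'"] by simp_all
  have "app f a = app \<delta>' (- b)" using 0(1) by (simp add: eq_neg_iff_add_eq_0 add.commute)
  then obtain a' where a': "app e a' = a'" "a = app \<delta> a'" using f2[of a "- b"] ab 0 by auto
  have "app \<delta>' (b + app f a') = 0" using 0(1) a' by (simp add: f1)
  moreover have "app e' (b + app f a') = b + app f a'" using ab by (simp add: f1)
  ultimately obtain u v where uv: "app e u = u" "app e' v = v" "app \<delta> u = 0" "b + app f a' = app f u + app \<delta>' v"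
    using f3 by blast
  let ?y = "app s v + app t (u - a')"
  have "b = app \<delta>' v + app f u - app f a'" using uv(4) by (simp add: algebra_simps)
  then have "app s b = app s (app \<delta>' v) + app s (app f u) - app s (app f a')" by simp
  moreover have "app t a = app t (app \<delta> a')" using a' by simp
  ultimately have "x = app (snd (cone A B f)) ?y"
    using x'[unfolded ab, symmetric] uv by (simp add: cone_def Ad Bd)
  moreover have "?y \<in> im (fst (cone A B f))"
    using uv a' by (simp add: im_iff cone_def Ad Bd)
  ultimately show "\<exists>y \<in> im (fst (cone A B f)). x = app (snd (cone A B f)) y" by blast
qed

text \<open>Included into the acyclic cone of \<open>q\<close>, the map \<open>a\<close> becomes
  null homotopic. The second component of the null homotopy is the lift, and the first one is the
  homotopy between \<open>q * b\<close> and \<open>a\<close>.\<close>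

lemma qis_lift:
  fixes A B D :: "'u endo \<times> 'u endo"
  assumes A: "is_dobj A" "fgfree (im (fst A))" and B: "is_dobj B" "is_dobj D" and q: "qis B D q" and a: "a \<in> dmap A D"
  obtains b where "b \<in> dmap A B" "heq A D (q * b) a"
proof -
  let ?C = "cone B D q"
  have qm: "q \<in> dmap B D" using q by (simp add: qis_def)
  have C: "is_dobj ?C" using B qm by (rule is_dobj_cone)
  have "s * a \<in> dmap A ?C"
    using dmap_comp[OF a cone_incl[OF B qm]] by (simp add: mult.assoc dmap_rules[OF a])
  then have "s * a \<in> dnull A ?C"
    using dmap_free_acyclic A C acyclic_cone[OF B q] by blast
  then obtain h where h: "s * a = snd ?C * h + h * snd A" "fst ?C * h = h" "h * fst A = h" by (rule dnullE)
  define h1 h2 where "h1 = s' * h" and "h2 = t' * h"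
  have 1: "a = snd D * h1 + q * h2 + h1 * snd A"
    using arg_cong[OF h(1), of "\<lambda>x. s' * x"] by (simp add: h1_def h2_def cone_def algebra_simps)
  have 2: "snd B * h2 = h2 * snd A"
    using arg_cong[OF h(1), of "\<lambda>x. t' * x"] by (simp add: h2_def cone_def algebra_simps)
  have 3: "fst D * h1 = h1" "fst B * h2 = h2"
    using arg_cong[OF h(2), of "\<lambda>x. s' * x"] arg_cong[OF h(2), of "\<lambda>x. t' * x"]
    by (simp_all add: h1_def h2_def cone_def algebra_simps)
  have 4: "h1 * fst A = h1" "h2 * fst A = h2" using h(3) by (simp_all add: h1_def h2_def mult.assoc)
  have b: "h2 \<in> dmap A B" using 2 3 4 by (intro dmapI)
  have "heq A D a (q * h2)"
    using a dmap_comp[OF b qm] 1 3 4 by (intro heqI_homotopy[where h = h1]) (simp_all add: algebra_simps)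
  then show ?thesis using b that heq_sym by blast
qed

text \<open>A null homotopy \<open>k\<close> of \<open>q * b\<close> combines with \<open>b\<close>
  to a map from the suspension of A to the acyclic cone of \<open>q\<close>. The second component of
  a null homotopy of that map contracts \<open>b\<close>.\<close>

lemma qis_cancel:
  fixes A B D :: "'u endo \<times> 'u endo"
  assumes A: "is_dobj A" "fgfree (im (fst A))" and B: "is_dobj B" "is_dobj D" and q: "qis B D q" and b: "b \<in> dmap A B"
    and qb: "q * b \<in> dnull A D"
  shows "b \<in> dnull A B"
proof -
  let ?C = "cone B D q"
  have qm: "q \<in> dmap B D" using q by (simp add: qis_def)
  have C: "is_dobj ?C" using B qm by (rule is_dobj_cone)
  obtain k where k: "q * b = snd D * k + k * snd A" "fst D * k = k" "k * fst A = k" using qb by (rule dnullE)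
  note b' = dmap_rules[OF b]
  have "s * k - t * b \<in> dmap (sus A) ?C"
    by (rule dmapI) (simp_all add: cone_def algebra_simps k b')
  then have "s * k - t * b \<in> dnull (sus A) ?C"
    using A C acyclic_cone[OF B q] by (intro dmap_free_acyclic) auto
  then obtain h where h: "s * k - t * b = snd ?C * h + h * snd (sus A)" "fst ?C * h = h" "h * fst (sus A) = h"
    by (rule dnullE)
  define h2 where "h2 = t' * h"
  have 1: "b = snd B * h2 + h2 * snd A"
    using arg_cong[OF h(1), of "\<lambda>x. t' * x"] by (simp add: h2_def cone_def algebra_simps)
  have 2: "fst B * h2 = h2" "h2 * fst A = h2"
    using arg_cong[OF h(2), of "\<lambda>x. t' * x"] h(3) by (simp_all add: h2_def cone_def algebra_simps)
  show ?thesis using 1 2 by (intro dnullI[where h = h2])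
qed

end

section \<open>Complexes as differential groups\<close>

text \<open>The product of all abelian groups with elements of type \<open>'a\<close>, as one type. Every such group
  is a retract of it, which turns group homomorphisms into elements of one ring.\<close>

typedef 'a univ = "{v :: 'a monoid \<Rightarrow> 'a. \<forall>G. if comm_group G then v G \<in> carrier G else v G = undefined}"
  morphisms pr Univ
  by (rule exI[of _ "\<lambda>G. if comm_group G then \<one>\<^bsub>G\<^esub> else undefined"])
    (auto intro: monoid.one_closed group.is_monoid comm_group.axioms)

setup_lifting type_definition_univ

lemma comm_groupD:
  assumes "comm_group G"
  shows "\<one>\<^bsub>G\<^esub> \<in> carrier G" "\<lbrakk>x \<in> carrier G; y \<in> carrier G\<rbrakk> \<Longrightarrow> x \<otimes>\<^bsub>G\<^esub> y \<in> carrier G"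
    "x \<in> carrier G \<Longrightarrow> inv\<^bsub>G\<^esub> x \<in> carrier G" "x \<in> carrier G \<Longrightarrow> \<one>\<^bsub>G\<^esub> \<otimes>\<^bsub>G\<^esub> x = x"
    "x \<in> carrier G \<Longrightarrow> x \<otimes>\<^bsub>G\<^esub> \<one>\<^bsub>G\<^esub> = x"
    "\<lbrakk>x \<in> carrier G; y \<in> carrier G; z \<in> carrier G\<rbrakk> \<Longrightarrow> x \<otimes>\<^bsub>G\<^esub> y \<otimes>\<^bsub>G\<^esub> z = x \<otimes>\<^bsub>G\<^esub> (y \<otimes>\<^bsub>G\<^esub> z)"
    "\<lbrakk>x \<in> carrier G; y \<in> carrier G\<rbrakk> \<Longrightarrow> x \<otimes>\<^bsub>G\<^esub> y = y \<otimes>\<^bsub>G\<^esub> x"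
    "x \<in> carrier G \<Longrightarrow> inv\<^bsub>G\<^esub> x \<otimes>\<^bsub>G\<^esub> x = \<one>\<^bsub>G\<^esub>" "x \<in> carrier G \<Longrightarrow> x \<otimes>\<^bsub>G\<^esub> inv\<^bsub>G\<^esub> x = \<one>\<^bsub>G\<^esub>"
proof -
  interpret comm_group G by fact
  show "\<one>\<^bsub>G\<^esub> \<in> carrier G" "\<lbrakk>x \<in> carrier G; y \<in> carrier G\<rbrakk> \<Longrightarrow> x \<otimes>\<^bsub>G\<^esub> y \<in> carrier G"
    "x \<in> carrier G \<Longrightarrow> inv\<^bsub>G\<^esub> x \<in> carrier G" "x \<in> carrier G \<Longrightarrow> \<one>\<^bsub>G\<^esub> \<otimes>\<^bsub>G\<^esub> x = x"
    "x \<in> carrier G \<Longrightarrow> x \<otimes>\<^bsub>G\<^esub> \<one>\<^bsub>G\<^esub> = x"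
    "\<lbrakk>x \<in> carrier G; y \<in> carrier G; z \<in> carrier G\<rbrakk> \<Longrightarrow> x \<otimes>\<^bsub>G\<^esub> y \<otimes>\<^bsub>G\<^esub> z = x \<otimes>\<^bsub>G\<^esub> (y \<otimes>\<^bsub>G\<^esub> z)"
    "\<lbrakk>x \<in> carrier G; y \<in> carrier G\<rbrakk> \<Longrightarrow> x \<otimes>\<^bsub>G\<^esub> y = y \<otimes>\<^bsub>G\<^esub> x"
    "x \<in> carrier G \<Longrightarrow> inv\<^bsub>G\<^esub> x \<otimes>\<^bsub>G\<^esub> x = \<one>\<^bsub>G\<^esub>" "x \<in> carrier G \<Longrightarrow> x \<otimes>\<^bsub>G\<^esub> inv\<^bsub>G\<^esub> x = \<one>\<^bsub>G\<^esub>"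
    by (auto simp: m_assoc intro: m_comm)
qed

instantiation univ :: (type) ab_group_add
begin

lift_definition zero_univ :: "'a univ" is "\<lambda>G. if comm_group G then \<one>\<^bsub>G\<^esub> else undefined"
  by (simp add: comm_groupD)
lift_definition plus_univ :: "'a univ \<Rightarrow> 'a univ \<Rightarrow> 'a univ"
  is "\<lambda>v w G. if comm_group G then v G \<otimes>\<^bsub>G\<^esub> w G else undefined"
  by (simp add: comm_groupD)
lift_definition uminus_univ :: "'a univ \<Rightarrow> 'a univ"
  is "\<lambda>v G. if comm_group G then inv\<^bsub>G\<^esub> (v G) else undefined"
  by (simp add: comm_groupD)
definition minus_univ :: "'a univ \<Rightarrow> 'a univ \<Rightarrow> 'a univ"
  where "minus_univ v w = v + - w"

instance
proof
  fix a b c :: "'a univ"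
  show "a + b + c = a + (b + c)" by transfer (auto simp: fun_eq_iff comm_groupD(2,6))
  show "a + b = b + a" by transfer (auto simp: fun_eq_iff intro: comm_groupD(7))
  show "0 + a = a" by transfer (auto simp: fun_eq_iff comm_groupD)
  show "- a + a = 0" by transfer (auto simp: fun_eq_iff comm_groupD)
  show "a - b = a + - b" by (simp add: minus_univ_def)
qed

end

text \<open>Elements outside the carrier are sent to zero, so that the map is total.\<close>

lift_definition inc :: "'a monoid \<Rightarrow> 'a \<Rightarrow> 'a univ"
  is "\<lambda>G x H. if comm_group H then (if H = G \<and> x \<in> carrier G then x else \<one>\<^bsub>H\<^esub>) else undefined"
  by (auto simp: comm_groupD)

lemma pr_closed [simp]: "comm_group G \<Longrightarrow> pr v G \<in> carrier G"
  by transfer (metis (full_types))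

lemma pr_inc [simp]: "\<lbrakk>comm_group G; x \<in> carrier G\<rbrakk> \<Longrightarrow> pr (inc G x) G = x"
  by transfer simp

lemma pr_plus [simp]: "comm_group G \<Longrightarrow> pr (v + w) G = pr v G \<otimes>\<^bsub>G\<^esub> pr w G"
  and pr_zero [simp]: "comm_group G \<Longrightarrow> pr 0 G = \<one>\<^bsub>G\<^esub>"
  and pr_uminus [simp]: "comm_group G \<Longrightarrow> pr (- v) G = inv\<^bsub>G\<^esub> (pr v G)"
  by (transfer; simp)+

lemma inc_mult: "\<lbrakk>comm_group G; x \<in> carrier G; y \<in> carrier G\<rbrakk> \<Longrightarrow> inc G (x \<otimes>\<^bsub>G\<^esub> y) = inc G x + inc G y"
  by transfer (auto simp: comm_groupD)

lemma inc_one [simp]: "comm_group G \<Longrightarrow> inc G \<one>\<^bsub>G\<^esub> = 0"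
  by transfer (auto simp: comm_groupD)

lemma inc_inv: "\<lbrakk>comm_group G; x \<in> carrier G\<rbrakk> \<Longrightarrow> inc G (inv\<^bsub>G\<^esub> x) = - inc G x"
  using inc_mult[of G "inv\<^bsub>G\<^esub> x" x] by (simp add: comm_groupD eq_neg_iff_add_eq_0)

lemma inc_eq_iff: "\<lbrakk>comm_group G; x \<in> carrier G; y \<in> carrier G\<rbrakk> \<Longrightarrow> inc G x = inc G y \<longleftrightarrow> x = y"
  by (metis pr_inc)

text \<open>The integer index is the degree; the natural number makes the group isomorphic to its own square.\<close>

type_synonym 'a uu = "nat \<Rightarrow> int \<Rightarrow> 'a univ"

definition cgrp :: "'a cochain_complex \<Rightarrow> bool"
  where "cgrp X \<longleftrightarrow> (\<forall>n. comm_group (grp X n))"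

lemma cgrpD [simp]: "cgrp X \<Longrightarrow> comm_group (grp X n)"
  by (simp add: cgrp_def)

section \<open>Graded homomorphisms as ring elements\<close>

definition ghom :: "int \<Rightarrow> 'a cochain_complex \<Rightarrow> 'a cochain_complex \<Rightarrow> (int \<Rightarrow> 'a \<Rightarrow> 'a) set"
  where "ghom i X Y = {f. \<forall>n. f n \<in> hom (grp X n) (grp Y (n + i))}"

lemma ghomD:
  assumes "f \<in> ghom i X Y"
  shows "x \<in> carrier (grp X n) \<Longrightarrow> f n x \<in> carrier (grp Y (n + i))"
    "\<lbrakk>x \<in> carrier (grp X n); y \<in> carrier (grp X n)\<rbrakk> \<Longrightarrow>
      f n (x \<otimes>\<^bsub>grp X n\<^esub> y) = f n x \<otimes>\<^bsub>grp Y (n + i)\<^esub> f n y"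
  using assms by (auto simp: ghom_def hom_def)

lemma ghomD':
  assumes "f \<in> ghom i X Y"
  shows "x \<in> carrier (grp X (n - i)) \<Longrightarrow> f (n - i) x \<in> carrier (grp Y n)"
    "\<lbrakk>x \<in> carrier (grp X (n - i)); y \<in> carrier (grp X (n - i))\<rbrakk> \<Longrightarrow>
      f (n - i) (x \<otimes>\<^bsub>grp X (n - i)\<^esub> y) = f (n - i) x \<otimes>\<^bsub>grp Y n\<^esub> f (n - i) y"
  using ghomD[OF assms, of _ "n - i"] by simp_all

text \<open>A complex occupies slot \<open>k = 0\<close> only; the other slots are left free for
  cones and direct sums.\<close>

definition hat :: "int \<Rightarrow> 'a cochain_complex \<Rightarrow> 'a cochain_complex \<Rightarrow> (int \<Rightarrow> 'a \<Rightarrow> 'a) \<Rightarrow> 'a uu endo"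
  where "hat i X Y f = Endo (\<lambda>u k n. if k = 0
    then inc (grp Y n) (f (n - i) (pr (u 0 (n - i)) (grp X (n - i)))) else 0)"

lemma app_hat:
  assumes "cgrp X" "cgrp Y" "f \<in> ghom i X Y"
  shows "app (hat i X Y f) u k n =
    (if k = 0 then inc (grp Y n) (f (n - i) (pr (u 0 (n - i)) (grp X (n - i)))) else 0)"
proof -
  have "app (hat i X Y f) = (\<lambda>u k n. if k = 0
    then inc (grp Y n) (f (n - i) (pr (u 0 (n - i)) (grp X (n - i)))) else 0)"
    unfolding hat_def by (rule app_Endo) (auto simp: fun_eq_iff assms ghomD'[OF assms(3)] inc_mult)
  then show ?thesis by simp
qed

lemma ghom_comp:
  assumes "f \<in> ghom i X Y" "g \<in> ghom j Y Z"
  shows "(\<lambda>n x. g (n + i) (f n x)) \<in> ghom (i + j) X Z"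
  using ghomD[OF assms(1)] ghomD[OF assms(2)] by (auto simp: ghom_def hom_def simp flip: add.assoc)

lemma hat_comp:
  assumes "cgrp X" "cgrp Y" "cgrp Z" and f: "f \<in> ghom i X Y" and g: "g \<in> ghom j Y Z"
  shows "hat j Y Z g * hat i X Y f = hat (i + j) X Z (\<lambda>n x. g (n + i) (f n x))"
proof (rule endo_eqI, intro ext)
  fix u :: "'a uu" and k :: nat and n :: int
  have eq: "n - j - i = n - (i + j)" "n - (i + j) + i = n - j" by simp_all
  have "f (n - (i + j)) (pr (u 0 (n - (i + j))) (grp X (n - (i + j)))) \<in> carrier (grp Y (n - j))"
    using ghomD'(1)[OF f, of _ "n - j"] assms(1) by (simp add: eq)
  then show "app (hat j Y Z g * hat i X Y f) u k n = app (hat (i + j) X Z (\<lambda>n x. g (n + i) (f n x))) u k n"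
    using assms ghom_comp[OF f g] by (simp add: app_hat eq)
qed

lemma ghom_id: "(\<lambda>n x. x) \<in> ghom 0 X X"
  by (simp add: ghom_def hom_def)

definition eX :: "'a cochain_complex \<Rightarrow> 'a uu endo"
  where "eX X = hat 0 X X (\<lambda>n x. x)"

lemma app_eX: "cgrp X \<Longrightarrow> app (eX X) u k n = (if k = 0 then inc (grp X n) (pr (u 0 n) (grp X n)) else 0)"
  by (simp add: eX_def app_hat ghom_id)

lemma hat_unit:
  assumes "cgrp X" "cgrp Y" "f \<in> ghom i X Y"
  shows "eX Y * hat i X Y f = hat i X Y f" "hat i X Y f * eX X = hat i X Y f"
  using hat_comp[OF assms(1,2,2,3) ghom_id] hat_comp[OF assms(1,1,2) ghom_id assms(3)] by (simp_all add: eX_def)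

lemma eX_idem [simp]: "cgrp X \<Longrightarrow> eX X * eX X = eX X"
  using hat_unit[OF _ _ ghom_id[of X]] by (simp add: eX_def)

lemma hat_cong:
  assumes "cgrp X" "\<And>n x. x \<in> carrier (grp X n) \<Longrightarrow> f n x = g n x"
  shows "hat i X Y f = hat i X Y g"
  unfolding hat_def by (intro arg_cong[where f = Endo] ext) (simp add: assms)

definition sing :: "int \<Rightarrow> 'a univ \<Rightarrow> 'a uu"
  where "sing n v = (\<lambda>k m. if k = 0 \<and> m = n then v else 0)"

lemma hat_eqD:
  assumes "cgrp X" "cgrp Y" "f \<in> ghom i X Y" "g \<in> ghom i X Y" "hat i X Y f = hat i X Y g"
    and x: "x \<in> carrier (grp X n)"
  shows "f n x = g n x"
proof -
  have "app (hat i X Y f) (sing n (inc (grp X n) x)) 0 (n + i) = app (hat i X Y g) (sing n (inc (grp X n) x)) 0 (n + i)"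
    using assms(5) by simp
  then show ?thesis
    using assms(1-4) x ghomD(1)[OF assms(3) x] ghomD(1)[OF assms(4) x]
    by (simp add: app_hat sing_def inc_eq_iff)
qed

lemma ghom_mult:
  assumes "cgrp Y" and f: "f \<in> ghom i X Y" and g: "g \<in> ghom i X Y"
  shows "(\<lambda>n x. f n x \<otimes>\<^bsub>grp Y (n + i)\<^esub> g n x) \<in> ghom i X Y"
proof -
  have "(f n x \<otimes>\<^bsub>grp Y (n + i)\<^esub> f n y) \<otimes>\<^bsub>grp Y (n + i)\<^esub> (g n x \<otimes>\<^bsub>grp Y (n + i)\<^esub> g n y)
    = (f n x \<otimes>\<^bsub>grp Y (n + i)\<^esub> g n x) \<otimes>\<^bsub>grp Y (n + i)\<^esub> (f n y \<otimes>\<^bsub>grp Y (n + i)\<^esub> g n y)"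
    if "x \<in> carrier (grp X n)" "y \<in> carrier (grp X n)" for n x y
  proof -
    interpret comm_group "grp Y (n + i)" using assms(1) by simp
    show ?thesis using that ghomD(1)[OF f] ghomD(1)[OF g] by (simp add: m_ac)
  qed
  then show ?thesis
    using ghomD[OF f] ghomD[OF g] assms(1) by (simp add: ghom_def hom_def comm_groupD)
qed

lemma hat_add:
  assumes "cgrp X" "cgrp Y" "f \<in> ghom i X Y" "g \<in> ghom i X Y"
  shows "hat i X Y (\<lambda>n x. f n x \<otimes>\<^bsub>grp Y (n + i)\<^esub> g n x) = hat i X Y f + hat i X Y g"
  by (rule endo_eqI, intro ext)
    (use assms ghom_mult[OF assms(2-4)] ghomD'(1)[OF assms(3)] ghomD'(1)[OF assms(4)] in \<open>simp add: app_hat inc_mult\<close>)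

lemma ghom_one: "cgrp Y \<Longrightarrow> (\<lambda>n x. \<one>\<^bsub>grp Y (n + i)\<^esub>) \<in> ghom i X Y"
  by (simp add: ghom_def hom_def comm_groupD)

lemma hat_one: "\<lbrakk>cgrp X; cgrp Y\<rbrakk> \<Longrightarrow> hat i X Y (\<lambda>n x. \<one>\<^bsub>grp Y (n + i)\<^esub>) = 0"
  by (rule endo_eqI, intro ext) (simp add: app_hat ghom_one)

lemma ghom_inv:
  assumes "cgrp Y" and f: "f \<in> ghom i X Y"
  shows "(\<lambda>n x. inv\<^bsub>grp Y (n + i)\<^esub> f n x) \<in> ghom i X Y"
proof -
  have "inv\<^bsub>grp Y (n + i)\<^esub> (x \<otimes>\<^bsub>grp Y (n + i)\<^esub> y) = inv\<^bsub>grp Y (n + i)\<^esub> x \<otimes>\<^bsub>grp Y (n + i)\<^esub> inv\<^bsub>grp Y (n + i)\<^esub> y"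
    if "x \<in> carrier (grp Y (n + i))" "y \<in> carrier (grp Y (n + i))" for n x y
    using that assms(1) by (simp add: comm_group.inv_mult)
  then show ?thesis using ghomD[OF f] assms(1) by (simp add: ghom_def hom_def comm_groupD)
qed

lemma hat_inv:
  assumes "cgrp X" "cgrp Y" "f \<in> ghom i X Y"
  shows "hat i X Y (\<lambda>n x. inv\<^bsub>grp Y (n + i)\<^esub> f n x) = - hat i X Y f"
  by (rule endo_eqI, intro ext)
    (use assms ghom_inv[OF assms(2,3)] ghomD'(1)[OF assms(3)] in \<open>simp add: app_hat inc_inv\<close>)

section \<open>Homogeneous components\<close>

definition rs :: "int \<Rightarrow> 'a uu \<Rightarrow> 'a uu"
  where "rs n u = (\<lambda>k m. if m = n then u k m else 0)"

lemma rs_add [simp]: "rs n (u + v) = rs n u + rs n v" and rs_0 [simp]: "rs n 0 = 0"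
  and rs_uminus [simp]: "rs n (- u) = - rs n u" and rs_diff [simp]: "rs n (u - v) = rs n u - rs n v"
  by (auto simp: rs_def fun_eq_iff)

lemma rs_rs: "rs n (rs m u) = (if m = n then rs n u else 0)"
  by (auto simp: rs_def fun_eq_iff)

lemma rs_at: "rs n u k n = u k n" and rs_other: "m \<noteq> n \<Longrightarrow> rs n u k m = 0"
  by (simp_all add: rs_def)

definition deg :: "int \<Rightarrow> 'a uu endo \<Rightarrow> bool"
  where "deg i r \<longleftrightarrow> (\<forall>u n. app r (rs n u) = rs (n + i) (app r u))"

definition cmp :: "int \<Rightarrow> 'a uu endo \<Rightarrow> 'a uu endo"
  where "cmp i r = Endo (\<lambda>u k m. app r (rs (m - i) u) k m)"

lemma app_cmp: "app (cmp i r) u k m = app r (rs (m - i) u) k m"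
proof -
  have "app (cmp i r) = (\<lambda>u k m. app r (rs (m - i) u) k m)"
    unfolding cmp_def by (rule app_Endo) (simp add: fun_eq_iff)
  then show ?thesis by simp
qed

lemma degD: "deg i r \<Longrightarrow> app r (rs n u) = rs (n + i) (app r u)"
  by (simp add: deg_def)

lemma degD_at: "deg i r \<Longrightarrow> app r (rs (m - i) u) k m = app r u k m"
  by (simp add: degD rs_at)

lemma deg_cmp [simp]: "deg i (cmp i r)"
  unfolding deg_def
proof (intro allI ext)
  fix u :: "'a uu" and n m :: int and k :: nat
  show "app (cmp i r) (rs n u) k m = rs (n + i) (app (cmp i r) u) k m"
    by (cases "m = n + i") (auto simp: app_cmp rs_rs rs_at rs_other)
qed

lemma cmp_deg: "deg i r \<Longrightarrow> cmp i r = r"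
  by (rule endo_eqI, intro ext) (simp add: app_cmp degD_at)

lemma cmp_deg_other: "\<lbrakk>deg j r; i \<noteq> j\<rbrakk> \<Longrightarrow> cmp i r = 0"
  by (rule endo_eqI, intro ext) (simp add: app_cmp degD rs_other)

lemma cmp_add [simp]: "cmp i (r + q) = cmp i r + cmp i q" and cmp_0 [simp]: "cmp i 0 = 0"
  and cmp_uminus [simp]: "cmp i (- r) = - cmp i r" and cmp_diff [simp]: "cmp i (r - q) = cmp i r - cmp i q"
  by (rule endo_eqI, intro ext, simp add: app_cmp)+

lemma cmp_sum [simp]: "cmp i (\<Sum>x\<in>I. r x) = (\<Sum>x\<in>I. cmp i (r x))"
  by (induction I rule: infinite_finite_induct) auto

lemma cmp_mult_right:
  assumes "deg j q" shows "cmp (i + j) (r * q) = cmp i r * q"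
proof (rule endo_eqI, intro ext)
  fix u :: "'a uu" and k :: nat and m :: int
  have "app q (rs (m - (i + j)) u) = rs (m - i) (app q u)"
    using degD[OF assms, of "m - (i + j)" u] by (simp add: algebra_simps)
  then show "app (cmp (i + j) (r * q)) u k m = app (cmp i r * q) u k m" by (simp add: app_cmp)
qed

lemma cmp_mult_left:
  assumes "deg i r" shows "cmp (i + j) (r * q) = r * cmp j q"
proof (rule endo_eqI, intro ext)
  fix u :: "'a uu" and k :: nat and m :: int
  have 1: "app r v k m = app r w k m" if "rs (m - i) v = rs (m - i) w" for v w
    using degD_at[OF assms, of m v k] degD_at[OF assms, of m w k] that by simp
  have 2: "rs (m - i) (app q (rs (m - (i + j)) u)) = rs (m - i) (app (cmp j q) u)"
  proof (intro ext)
    fix l n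
    show "rs (m - i) (app q (rs (m - (i + j)) u)) l n = rs (m - i) (app (cmp j q) u) l n"
      by (cases "n = m - i") (simp_all add: rs_at rs_other app_cmp diff_diff_eq)
  qed
  show "app (cmp (i + j) (r * q)) u k m = app (r * cmp j q) u k m"
    using 1[OF 2] by (simp only: app_cmp app_times)
qed

lemma deg_mult: "\<lbrakk>deg i r; deg j q\<rbrakk> \<Longrightarrow> deg (i + j) (r * q)"
  by (simp add: deg_def add.commute add.left_commute)

lemma deg_add: "\<lbrakk>deg i r; deg i q\<rbrakk> \<Longrightarrow> deg i (r + q)" and deg_0 [simp]: "deg i 0"
  and deg_diff: "\<lbrakk>deg i r; deg i q\<rbrakk> \<Longrightarrow> deg i (r - q)"
  by (simp_all add: deg_def)

lemma deg_hat:
  assumes "cgrp X" "cgrp Y" "f \<in> ghom i X Y" shows "deg i (hat i X Y f)"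
  unfolding deg_def
proof (intro allI ext)
  fix u :: "'a uu" and n m :: int and k :: nat
  have one: "f j \<one>\<^bsub>grp X j\<^esub> = \<one>\<^bsub>grp Y (j + i)\<^esub>" for j
    using assms by (intro hom_one) (auto simp: ghom_def comm_group.axioms)
  show "app (hat i X Y f) (rs n u) k m = rs (n + i) (app (hat i X Y f) u) k m"
    using one[of "m - i"] assms by (cases "m = n + i") (auto simp: app_hat rs_at rs_other)
qed

lemma deg_eX: "cgrp X \<Longrightarrow> deg 0 (eX X)"
  unfolding eX_def by (intro deg_hat ghom_id)

definition unhat :: "int \<Rightarrow> 'a cochain_complex \<Rightarrow> 'a cochain_complex \<Rightarrow> 'a uu endo \<Rightarrow> int \<Rightarrow> 'a \<Rightarrow> 'a"
  where "unhat i X Y r = (\<lambda>n. \<lambda>x \<in> carrier (grp X n).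
    pr (app r (sing n (inc (grp X n) x)) 0 (n + i)) (grp Y (n + i)))"

lemma sing_add: "sing n (v + w) = sing n v + sing n w"
  by (auto simp: sing_def fun_eq_iff)

lemma unhat_ghom:
  assumes "cgrp X" "cgrp Y" shows "unhat i X Y r \<in> ghom i X Y"
  using assms by (auto simp: ghom_def hom_def unhat_def comm_groupD inc_mult sing_add)

text \<open>A homogeneous element absorbed by the two idempotents depends, in each degree of the
  output, on a single degree of \<open>X\<close>, so it is given by a family of group
  homomorphisms.\<close>

lemma hat_unhat:
  assumes XY: "cgrp X" "cgrp Y" and r: "eX Y * r = r" "r * eX X = r" "deg i r"
  shows "hat i X Y (unhat i X Y r) = r"
proof (rule endo_eqI, intro ext)
  fix u :: "'a uu" and k :: nat and n :: int
  have "sing (n - i) (inc (grp X (n - i)) (pr (u 0 (n - i)) (grp X (n - i)))) = rs (n - i) (app (eX X) u)"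
    using XY by (auto simp: sing_def rs_def app_eX fun_eq_iff)
  then have "app r (sing (n - i) (inc (grp X (n - i)) (pr (u 0 (n - i)) (grp X (n - i))))) 0 n = app r u 0 n"
    using degD_at[OF r(3), of n "app (eX X) u" 0] r(2) by (metis app_times)
  then have "app (hat i X Y (unhat i X Y r)) u k n = (if k = 0 then inc (grp Y n) (pr (app r u 0 n) (grp Y n)) else 0)"
    using XY by (simp add: app_hat unhat_ghom) (simp add: unhat_def)
  also have "\<dots> = app (eX Y) (app r u) k n" using XY by (simp add: app_eX)
  finally show "app (hat i X Y (unhat i X Y r)) u k n = app r u k n"
    using r(1) by (metis app_times)
qed

section \<open>Boundedness and finite sums of components\<close>

definition bdd :: "'a cochain_complex \<Rightarrow> bool"
  where "bdd X \<longleftrightarrow> finite {n. carrier (grp X n) \<noteq> {\<one>\<^bsub>grp X n\<^esub>}}"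

definition supp :: "'a cochain_complex \<Rightarrow> int set"
  where "supp X = {n. carrier (grp X n) \<noteq> {\<one>\<^bsub>grp X n\<^esub>}}"

lemma eX_outside: "\<lbrakk>cgrp X; n \<notin> supp X\<rbrakk> \<Longrightarrow> app (eX X) u k n = 0"
  using pr_closed[of "grp X n" "u 0 n"] by (simp add: app_eX supp_def)

definition degs :: "'a cochain_complex \<Rightarrow> 'a cochain_complex \<Rightarrow> int set"
  where "degs X Y = (\<lambda>(m, n). n - m) ` (supp X \<times> supp Y)"

lemma finite_degs: "\<lbrakk>bdd X; bdd Y\<rbrakk> \<Longrightarrow> finite (degs X Y)"
  by (simp add: degs_def bdd_def supp_def)

lemma cmp_outside:
  assumes XY: "cgrp X" "cgrp Y" and r: "eX Y * r = r" "r * eX X = r" and i: "i \<notin> degs X Y"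
  shows "cmp i r = 0"
proof (rule endo_eqI, intro ext)
  fix u :: "'a uu" and k :: nat and m :: int
  have "app r (rs (m - i) u) k m = 0"
  proof (cases "m \<in> supp Y")
    case False
    then show ?thesis using eX_outside[OF XY(2) False] r(1) by (metis app_times)
  next
    case True
    then have "m - i \<notin> supp X" using i by (force simp: degs_def)
    then have "app (eX X) (rs (m - i) u) = 0"
      using degD[OF deg_eX[OF XY(1)], of "m - i" u] eX_outside[OF XY(1)]
      by (auto simp: fun_eq_iff rs_def)
    then show ?thesis using r(2) by (metis app_times app_0 zero_fun_apply)
  qed
  then show "app (cmp i r) u k m = app 0 u k m" by (simp add: app_cmp)
qed

lemma app_sum [simp]: "app (\<Sum>i\<in>I. r i) u = (\<Sum>i\<in>I. app (r i) u)"
  by (induction I rule: infinite_finite_induct) auto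

lemma app_sum' [simp]: "app r (\<Sum>i\<in>I. u i) = (\<Sum>i\<in>I. app r (u i))"
  by (induction I rule: infinite_finite_induct) auto

lemma sum_uu: "(\<Sum>i\<in>I. (v i :: 'a uu)) k m = (\<Sum>i\<in>I. v i k m)"
  by (induction I rule: infinite_finite_induct) auto

text \<open>The ambient group is a product over all degrees, so an arbitrary endomorphism need not
  be determined by its components. On a bounded complex every element is a finite sum of homogeneous
  ones, and then it is.\<close>

lemma sum_cmp:
  assumes XY: "cgrp X" "cgrp Y" "bdd X" "bdd Y" and r: "eX Y * r = r" "r * eX X = r"
    and I: "finite I" "degs X Y \<subseteq> I"
  shows "r = (\<Sum>i\<in>I. cmp i r)"
proof (rule endo_eqI, intro ext)
  fix u :: "'a uu" and k :: nat and m :: int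
  have z: "app (cmp i r) u k m = 0" if "i \<notin> I" for i
  proof -
    have "i \<notin> degs X Y" using that I by blast
    then show ?thesis using cmp_outside[OF XY(1,2) r] by simp
  qed
  let ?v = "app (eX X) u"
  \<comment> \<open>Enlarged beyond the support so that the differences \<open>m - n\<close> run
    through all of \<open>I\<close>.\<close>
  let ?S = "supp X \<union> (\<lambda>i. m - i) ` I"
  have S: "finite ?S" using XY(3) I by (simp add: bdd_def supp_def)
  have v: "?v = (\<Sum>n \<in> ?S. rs n ?v)"
  proof (intro ext)
    fix l n
    have "(\<Sum>j \<in> ?S. rs j ?v l n) = (\<Sum>j \<in> ?S. if j = n then ?v l n else 0)" by (intro sum.cong) (auto simp: rs_def)
    also have "\<dots> = ?v l n" using S eX_outside[OF XY(1), of n u l] by (simp add: sum.delta)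
    finally show "?v l n = (\<Sum>n \<in> ?S. rs n ?v) l n" by (simp add: sum_uu)
  qed
  have "app r u k m = app r ?v k m" using r(2) by (metis app_times)
  also have "\<dots> = app r (\<Sum>n \<in> ?S. rs n ?v) k m" using v by simp
  also have "\<dots> = (\<Sum>n \<in> ?S. app r (rs n ?v) k m)" by (simp add: sum_uu)
  also have "\<dots> = (\<Sum>n \<in> ?S. app (cmp (m - n) r) u k m)"
  proof (intro sum.cong refl)
    fix n
    have "app r (rs n ?v) = app r (rs n u)"
      using degD[OF deg_eX[OF XY(1)], of n u] r(2) by (metis add.right_neutral app_times)
    then show "app r (rs n ?v) k m = app (cmp (m - n) r) u k m" by (simp add: app_cmp)
  qed
  also have "\<dots> = (\<Sum>i \<in> (\<lambda>n. m - n) ` ?S. app (cmp i r) u k m)"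
    by (subst sum.reindex) (auto simp: inj_on_def)
  also have "\<dots> = (\<Sum>i \<in> I. app (cmp i r) u k m)"
  proof (rule sum.mono_neutral_right)
    show "I \<subseteq> (\<lambda>n. m - n) ` ?S" by (auto simp: image_Un image_image)
  qed (use S z in auto)
  finally show "app r u k m = app (\<Sum>i\<in>I. cmp i r) u k m" by (simp add: sum_uu)
qed

lemma uu_eqI: "(\<And>u k n. app f u k n = app g u k n) \<Longrightarrow> f = (g :: 'a uu endo)"
  by (intro endo_eqI ext)

section \<open>Complexes, chain maps and null homotopies\<close>

lemma bfcD:
  assumes "X \<in> bounded_fg_complexes"
  shows "cgrp X" "bdd X" "diff X \<in> ghom 1 X X" "diff X n \<in> extensional (carrier (grp X n))"
    "x \<in> carrier (grp X n) \<Longrightarrow> diff X (n + 1) (diff X n x) = \<one>\<^bsub>grp X (n + 2)\<^esub>"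
    "finitely_generated (grp X n)"
  using assms by (auto simp: bounded_fg_complexes_def cgrp_def bdd_def ghom_def ehom_def)

definition dX :: "'a cochain_complex \<Rightarrow> 'a uu endo"
  where "dX X = hat 1 X X (diff X)"

definition KO :: "'a cochain_complex \<Rightarrow> 'a uu endo \<times> 'a uu endo"
  where "KO X = (eX X, dX X)"

lemma fst_KO [simp]: "fst (KO X) = eX X" and snd_KO [simp]: "snd (KO X) = dX X"
  by (simp_all add: KO_def)

lemma deg_dX: "X \<in> bounded_fg_complexes \<Longrightarrow> deg 1 (dX X)"
  unfolding dX_def by (intro deg_hat bfcD)

lemma dX_unit:
  assumes "X \<in> bounded_fg_complexes"
  shows "eX X * dX X = dX X" "dX X * eX X = dX X" "dX X * dX X = 0"
proof -
  note X = bfcD[OF assms]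
  show "eX X * dX X = dX X" "dX X * eX X = dX X" unfolding dX_def by (intro hat_unit X)+
  have "dX X * dX X = hat 2 X X (\<lambda>n x. diff X (n + 1) (diff X n x))"
    unfolding dX_def using hat_comp[OF X(1,1,1,3,3)] by simp
  also have "\<dots> = hat 2 X X (\<lambda>n x. \<one>\<^bsub>grp X (n + 2)\<^esub>)" using X(1,5) by (intro hat_cong)
  also have "\<dots> = 0" using X(1) by (simp add: hat_one)
  finally show "dX X * dX X = 0" .
qed

lemma is_dobj_KO: "X \<in> bounded_fg_complexes \<Longrightarrow> is_dobj (KO X)"
  by (simp add: is_dobj_def dX_unit bfcD)

definition M0 :: "'a cochain_complex \<Rightarrow> 'a cochain_complex \<Rightarrow> 'a uu endo set"
  where "M0 X Y = {r \<in> dmap (KO X) (KO Y). deg 0 r}"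

lemma chain_mapsD:
  assumes "f \<in> chain_maps X Y"
  shows "f \<in> ghom 0 X Y" "f n \<in> extensional (carrier (grp X n))"
    "x \<in> carrier (grp X n) \<Longrightarrow> diff Y n (f n x) = f (n + 1) (diff X n x)"
  using assms by (auto simp: chain_maps_def ghom_def ehom_def)

lemma hat_M0:
  assumes "X \<in> bounded_fg_complexes" "Y \<in> bounded_fg_complexes" "f \<in> chain_maps X Y"
  shows "hat 0 X Y f \<in> M0 X Y"
proof -
  note X = bfcD[OF assms(1)] and Y = bfcD[OF assms(2)] and f = chain_mapsD[OF assms(3)]
  have "dX Y * hat 0 X Y f = hat 1 X Y (\<lambda>n x. diff Y n (f n x))"
    unfolding dX_def using hat_comp[OF X(1) Y(1) Y(1) f(1) Y(3)] by simp
  also have "\<dots> = hat 1 X Y (\<lambda>n x. f (n + 1) (diff X n x))" using X(1) f(3) by (intro hat_cong)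
  also have "\<dots> = hat 0 X Y f * dX X"
    unfolding dX_def using hat_comp[OF X(1) X(1) Y(1) X(3) f(1)] by simp
  finally show ?thesis
    unfolding M0_def using hat_unit[OF X(1) Y(1) f(1)] deg_hat[OF X(1) Y(1) f(1)] by (auto intro: dmapI)
qed

lemma unhat_chain_map:
  assumes "X \<in> bounded_fg_complexes" "Y \<in> bounded_fg_complexes" "r \<in> M0 X Y"
  shows "unhat 0 X Y r \<in> chain_maps X Y" "hat 0 X Y (unhat 0 X Y r) = r"
proof -
  note X = bfcD[OF assms(1)] and Y = bfcD[OF assms(2)]
  have r: "eX Y * r = r" "r * eX X = r" "deg 0 r" "dX Y * r = r * dX X" using assms(3) by (auto simp: M0_def dmap_def)
  let ?f = "unhat 0 X Y r"
  have f: "?f \<in> ghom 0 X Y" using X(1) Y(1) by (rule unhat_ghom)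
  show h: "hat 0 X Y ?f = r" using X(1) Y(1) r by (intro hat_unhat)
  have g1: "(\<lambda>n x. diff Y n (?f n x)) \<in> ghom 1 X Y" using ghom_comp[OF f Y(3)] by simp
  have g2: "(\<lambda>n x. ?f (n + 1) (diff X n x)) \<in> ghom 1 X Y" using ghom_comp[OF X(3) f] by simp
  have "hat 1 X Y (\<lambda>n x. diff Y n (?f n x)) = dX Y * r"
    unfolding dX_def using hat_comp[OF X(1) Y(1) Y(1) f Y(3)] h by simp
  also have "\<dots> = hat 1 X Y (\<lambda>n x. ?f (n + 1) (diff X n x))"
    unfolding r(4) unfolding dX_def using hat_comp[OF X(1) X(1) Y(1) X(3) f] h by simp
  finally have "diff Y n (?f n x) = ?f (n + 1) (diff X n x)" if "x \<in> carrier (grp X n)" for n x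
    using hat_eqD[OF X(1) Y(1) g1 g2 _ that] by simp
  moreover have "?f n \<in> extensional (carrier (grp X n))" for n by (simp add: unhat_def)
  ultimately show "?f \<in> chain_maps X Y" using f by (auto simp: chain_maps_def ghom_def ehom_def)
qed

lemma chain_map_eqI:
  assumes "X \<in> bounded_fg_complexes" "Y \<in> bounded_fg_complexes" "f \<in> chain_maps X Y" "g \<in> chain_maps X Y"
    and "hat 0 X Y f = hat 0 X Y g"
  shows "f = g"
proof
  fix n
  have "f n x = g n x" if "x \<in> carrier (grp X n)" for x
    using assms that by (auto intro: hat_eqD[where i = 0 and X = X and Y = Y] bfcD chain_mapsD)
  then show "f n = g n" using assms(3,4) by (auto intro: extensionalityI chain_mapsD)
qed

text \<open>A homotopy found in the ring may be inhomogeneous. The differentials have degree 1 and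
  \<open>f\<close> has degree 0, so its component of degree -1 is again a homotopy, and this one
  comes from the complexes.\<close>

lemma null_homotopic_iff:
  assumes "X \<in> bounded_fg_complexes" "Y \<in> bounded_fg_complexes"
  shows "f \<in> null_homotopic X Y \<longleftrightarrow> f \<in> chain_maps X Y \<and> hat 0 X Y f \<in> dnull (KO X) (KO Y)"
proof -
  note X = bfcD[OF assms(1)] and Y = bfcD[OF assms(2)]
  have sum: "dX Y * hat (- 1) X Y h + hat (- 1) X Y h * dX X =
      hat 0 X Y (\<lambda>n x. diff Y (n - 1) (h n x) \<otimes>\<^bsub>grp Y n\<^esub> h (n + 1) (diff X n x))"
    and gh: "(\<lambda>n x. diff Y (n - 1) (h n x) \<otimes>\<^bsub>grp Y n\<^esub> h (n + 1) (diff X n x)) \<in> ghom 0 X Y"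
    if h: "h \<in> ghom (- 1) X Y" for h
  proof -
    have g1: "(\<lambda>n x. diff Y (n - 1) (h n x)) \<in> ghom 0 X Y" using ghom_comp[OF h Y(3)] by simp
    have g2: "(\<lambda>n x. h (n + 1) (diff X n x)) \<in> ghom 0 X Y" using ghom_comp[OF X(3) h] by simp
    show "dX Y * hat (- 1) X Y h + hat (- 1) X Y h * dX X =
      hat 0 X Y (\<lambda>n x. diff Y (n - 1) (h n x) \<otimes>\<^bsub>grp Y n\<^esub> h (n + 1) (diff X n x))"
      using hat_add[OF X(1) Y(1) g1 g2] hat_comp[OF X(1) Y(1) Y(1) h Y(3)] hat_comp[OF X(1) X(1) Y(1) X(3) h]
      by (simp add: dX_def)
    show "(\<lambda>n x. diff Y (n - 1) (h n x) \<otimes>\<^bsub>grp Y n\<^esub> h (n + 1) (diff X n x)) \<in> ghom 0 X Y"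
      using ghom_mult[OF Y(1) g1 g2] by simp
  qed
  have "(\<exists>h. (\<forall>n. h n \<in> hom (grp X n) (grp Y (n - 1))) \<and>
      (\<forall>n. \<forall>x \<in> carrier (grp X n). f n x = diff Y (n - 1) (h n x) \<otimes>\<^bsub>grp Y n\<^esub> h (n + 1) (diff X n x)))
    \<longleftrightarrow> hat 0 X Y f \<in> dnull (KO X) (KO Y)" if f: "f \<in> chain_maps X Y"
  proof
    assume "\<exists>h. (\<forall>n. h n \<in> hom (grp X n) (grp Y (n - 1))) \<and>
      (\<forall>n. \<forall>x \<in> carrier (grp X n). f n x = diff Y (n - 1) (h n x) \<otimes>\<^bsub>grp Y n\<^esub> h (n + 1) (diff X n x))"
    then obtain h where h: "h \<in> ghom (- 1) X Y"
      "\<And>n x. x \<in> carrier (grp X n) \<Longrightarrow> f n x = diff Y (n - 1) (h n x) \<otimes>\<^bsub>grp Y n\<^esub> h (n + 1) (diff X n x)"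
      by (auto simp: ghom_def)
    have "hat 0 X Y f = dX Y * hat (- 1) X Y h + hat (- 1) X Y h * dX X"
      unfolding sum[OF h(1)] using X(1) h(2) by (intro hat_cong)
    then show "hat 0 X Y f \<in> dnull (KO X) (KO Y)"
      using hat_unit[OF X(1) Y(1) h(1)] by (intro dnullI[where h = "hat (- 1) X Y h"]) simp_all
  next
    assume "hat 0 X Y f \<in> dnull (KO X) (KO Y)"
    then obtain h where h: "hat 0 X Y f = dX Y * h + h * dX X" "eX Y * h = h" "h * eX X = h"
      by (auto elim: dnullE)
    define h' where "h' = cmp (- 1) h"
    have u: "eX Y * h' = h'" "h' * eX X = h'" "deg (- 1) h'"
      using cmp_mult_left[OF deg_eX[OF Y(1)], of "- 1" h] cmp_mult_right[OF deg_eX[OF X(1)], of "- 1" h] h(2,3)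
      by (simp_all add: h'_def)
    have "hat 0 X Y f = cmp 0 (dX Y * h + h * dX X)"
      using h(1) cmp_deg[OF deg_hat[OF X(1) Y(1) chain_mapsD(1)[OF f]]] by simp
    also have "\<dots> = dX Y * h' + h' * dX X"
      using cmp_mult_left[OF deg_dX[OF assms(2)], of "- 1" h] cmp_mult_right[OF deg_dX[OF assms(1)], of "- 1" h]
      by (simp add: h'_def)
    finally have eq: "hat 0 X Y f = dX Y * h' + h' * dX X" .
    let ?k = "unhat (- 1) X Y h'"
    have k: "?k \<in> ghom (- 1) X Y" "hat (- 1) X Y ?k = h'"
      using X(1) Y(1) u by (auto intro: unhat_ghom hat_unhat)
    have "f n x = diff Y (n - 1) (?k n x) \<otimes>\<^bsub>grp Y n\<^esub> ?k (n + 1) (diff X n x)" if "x \<in> carrier (grp X n)" for n x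
      by (rule hat_eqD[OF X(1) Y(1) chain_mapsD(1)[OF f] gh[OF k(1)] _ that])
        (simp add: sum[OF k(1), symmetric] eq k(2))
    then show "\<exists>h. (\<forall>n. h n \<in> hom (grp X n) (grp Y (n - 1))) \<and>
      (\<forall>n. \<forall>x \<in> carrier (grp X n). f n x = diff Y (n - 1) (h n x) \<otimes>\<^bsub>grp Y n\<^esub> h (n + 1) (diff X n x))"
      using k(1) by (intro exI[of _ ?k]) (auto simp: ghom_def)
  qed
  then show ?thesis unfolding null_homotopic_def by blast
qed

section \<open>Homotopy classes\<close>

definition kc :: "'a cochain_complex \<Rightarrow> 'a cochain_complex \<Rightarrow> 'a uu endo \<Rightarrow> (int \<Rightarrow> 'a \<Rightarrow> 'a) set"
  where "kc X Y r = {g \<in> chain_maps X Y. hat 0 X Y g - r \<in> dnull (KO X) (KO Y)}"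

lemma M0_diff: "\<lbrakk>r \<in> M0 X Y; q \<in> M0 X Y\<rbrakk> \<Longrightarrow> r - q \<in> M0 X Y"
  and M0_add: "\<lbrakk>r \<in> M0 X Y; q \<in> M0 X Y\<rbrakk> \<Longrightarrow> r + q \<in> M0 X Y"
  and M0_zero [simp]: "0 \<in> M0 X Y"
  by (auto simp: M0_def dmap_diff dmap_add deg_diff deg_add)

lemma M0_comp: "\<lbrakk>r \<in> M0 X Y; q \<in> M0 Y Z\<rbrakk> \<Longrightarrow> q * r \<in> M0 X Z"
  using deg_mult[of 0 q 0 r] by (auto simp: M0_def dmap_comp)

lemma M0_id: "X \<in> bounded_fg_complexes \<Longrightarrow> eX X \<in> M0 X X"
  using dmap_id[OF is_dobj_KO] by (simp add: M0_def deg_eX bfcD)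

lemma M0_unit: "r \<in> M0 X Y \<Longrightarrow> eX Y * r = r" "r \<in> M0 X Y \<Longrightarrow> r * eX X = r"
  by (auto simp: M0_def dmap_def)

lemma hat_chain_mult:
  assumes "X \<in> bounded_fg_complexes" "Y \<in> bounded_fg_complexes" "f \<in> chain_maps X Y" "g \<in> chain_maps X Y"
  shows "f \<otimes>\<^bsub>chain_map_group X Y\<^esub> g \<in> chain_maps X Y"
    "hat 0 X Y (f \<otimes>\<^bsub>chain_map_group X Y\<^esub> g) = hat 0 X Y f + hat 0 X Y g"
proof -
  note X = bfcD[OF assms(1)] and Y = bfcD[OF assms(2)] and f = chain_mapsD[OF assms(3)] and g = chain_mapsD[OF assms(4)]
  let ?h = "f \<otimes>\<^bsub>chain_map_group X Y\<^esub> g"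
  have h: "?h n x = f n x \<otimes>\<^bsub>grp Y n\<^esub> g n x" if "x \<in> carrier (grp X n)" for n x
    using that by (simp add: chain_map_group_def)
  have "hat 0 X Y ?h = hat 0 X Y (\<lambda>n x. f n x \<otimes>\<^bsub>grp Y n\<^esub> g n x)"
    using X(1) h by (intro hat_cong)
  then show eq: "hat 0 X Y ?h = hat 0 X Y f + hat 0 X Y g"
    using hat_add[OF X(1) Y(1) f(1) g(1)] by simp
  let ?r = "hat 0 X Y f + hat 0 X Y g"
  have r: "?r \<in> M0 X Y" using assms by (intro M0_add hat_M0)
  have gm: "(\<lambda>n x. f n x \<otimes>\<^bsub>grp Y n\<^esub> g n x) \<in> ghom 0 X Y" using ghom_mult[OF Y(1) f(1) g(1)] by simp
  have "?h = unhat 0 X Y ?r"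
  proof
    fix n
    show "?h n = unhat 0 X Y ?r n"
    proof (rule extensionalityI[where A = "carrier (grp X n)"])
      fix x assume x: "x \<in> carrier (grp X n)"
      show "?h n x = unhat 0 X Y ?r n x"
        unfolding h[OF x]
        by (rule hat_eqD[OF X(1) Y(1) gm unhat_ghom[OF X(1) Y(1)] _ x])
          (use unhat_chain_map[OF assms(1,2) r] hat_add[OF X(1) Y(1) f(1) g(1)] in simp)
    qed (simp_all add: chain_map_group_def unhat_def)
  qed
  then show "?h \<in> chain_maps X Y" using unhat_chain_map[OF assms(1,2) r] by simp
qed

lemma homotopy_class_kc:
  assumes "X \<in> bounded_fg_complexes" "Y \<in> bounded_fg_complexes" "f \<in> chain_maps X Y"
  shows "homotopy_class X Y f = kc X Y (hat 0 X Y f)"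
proof (intro equalityI subsetI)
  fix g assume "g \<in> homotopy_class X Y f"
  then obtain k where k: "k \<in> null_homotopic X Y" "g = k \<otimes>\<^bsub>chain_map_group X Y\<^esub> f"
    by (auto simp: homotopy_class_def r_coset_def)
  then show "g \<in> kc X Y (hat 0 X Y f)"
    using assms by (simp add: null_homotopic_iff kc_def hat_chain_mult)
next
  fix g assume "g \<in> kc X Y (hat 0 X Y f)"
  then have g: "g \<in> chain_maps X Y" "hat 0 X Y g - hat 0 X Y f \<in> dnull (KO X) (KO Y)" by (auto simp: kc_def)
  let ?r = "hat 0 X Y g - hat 0 X Y f"
  let ?k = "unhat 0 X Y ?r"
  have r: "?r \<in> M0 X Y" using assms g by (intro M0_diff hat_M0)
  note k = unhat_chain_map[OF assms(1,2) r]
  have "?k \<in> null_homotopic X Y" using assms g k by (simp add: null_homotopic_iff)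
  moreover have "g = ?k \<otimes>\<^bsub>chain_map_group X Y\<^esub> f"
    using assms g k by (intro chain_map_eqI) (auto simp: hat_chain_mult)
  ultimately show "g \<in> homotopy_class X Y f" by (auto simp: homotopy_class_def r_coset_def)
qed

lemma kc_cong:
  assumes "r - q \<in> dnull (KO X) (KO Y)" shows "kc X Y r = kc X Y q"
proof -
  have "x - r \<in> dnull (KO X) (KO Y) \<longleftrightarrow> x - q \<in> dnull (KO X) (KO Y)" for x
    using dnull_add[OF _ assms, of "x - r"] dnull_diff[OF _ assms, of "x - q"] by auto
  then show ?thesis by (simp add: kc_def)
qed

lemma unhat_kc:
  "\<lbrakk>X \<in> bounded_fg_complexes; Y \<in> bounded_fg_complexes; r \<in> M0 X Y\<rbrakk> \<Longrightarrow> unhat 0 X Y r \<in> kc X Y r"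
  by (simp add: kc_def unhat_chain_map)

lemma kc_eq_iff:
  assumes "X \<in> bounded_fg_complexes" "Y \<in> bounded_fg_complexes" "r \<in> M0 X Y" "q \<in> M0 X Y"
  shows "kc X Y r = kc X Y q \<longleftrightarrow> r - q \<in> dnull (KO X) (KO Y)"
proof
  assume "kc X Y r = kc X Y q"
  then have "unhat 0 X Y r \<in> kc X Y q" using unhat_kc[OF assms(1-3)] by simp
  then show "r - q \<in> dnull (KO X) (KO Y)" by (simp add: kc_def unhat_chain_map(2)[OF assms(1-3)])
qed (rule kc_cong)

lemma kc_mult:
  assumes "X \<in> bounded_fg_complexes" "Y \<in> bounded_fg_complexes" "r \<in> M0 X Y" "q \<in> M0 X Y"
  shows "kc X Y r <#>\<^bsub>chain_map_group X Y\<^esub> kc X Y q = kc X Y (r + q)"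
proof (intro equalityI subsetI)
  fix h assume "h \<in> kc X Y r <#>\<^bsub>chain_map_group X Y\<^esub> kc X Y q"
  then obtain f g where fg: "f \<in> kc X Y r" "g \<in> kc X Y q" "h = f \<otimes>\<^bsub>chain_map_group X Y\<^esub> g"
    by (auto simp: set_mult_def)
  have "(hat 0 X Y f - r) + (hat 0 X Y g - q) \<in> dnull (KO X) (KO Y)"
    using fg by (intro dnull_add) (auto simp: kc_def)
  then have "hat 0 X Y f + hat 0 X Y g - (r + q) \<in> dnull (KO X) (KO Y)" by (simp add: algebra_simps)
  then show "h \<in> kc X Y (r + q)"
    using assms fg by (auto simp: kc_def hat_chain_mult)
next
  fix h assume "h \<in> kc X Y (r + q)"
  then have h: "h \<in> chain_maps X Y" "hat 0 X Y h - (r + q) \<in> dnull (KO X) (KO Y)" by (auto simp: kc_def)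
  let ?f = "unhat 0 X Y r" and ?g = "unhat 0 X Y (hat 0 X Y h - r)"
  have g: "hat 0 X Y h - r \<in> M0 X Y" using assms h by (intro M0_diff hat_M0)
  note f' = unhat_chain_map[OF assms(1-3)] and g' = unhat_chain_map[OF assms(1,2) g]
  have "?g \<in> kc X Y q" using g' h(2) by (simp add: kc_def diff_diff_eq)
  moreover have "h = ?f \<otimes>\<^bsub>chain_map_group X Y\<^esub> ?g"
    using assms h f' g' by (intro chain_map_eqI) (auto simp: hat_chain_mult)
  ultimately show "h \<in> kc X Y r <#>\<^bsub>chain_map_group X Y\<^esub> kc X Y q"
    using unhat_kc[OF assms(1-3)] by (auto simp: set_mult_def)
qed

lemma kc_zero:
  assumes "X \<in> bounded_fg_complexes" "Y \<in> bounded_fg_complexes"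
  shows "kc X Y 0 = null_homotopic X Y"
  using assms by (auto simp: kc_def null_homotopic_iff)

lemma rcosets_kc:
  assumes "X \<in> bounded_fg_complexes" "Y \<in> bounded_fg_complexes"
  shows "rcosets\<^bsub>chain_map_group X Y\<^esub> null_homotopic X Y = kc X Y ` M0 X Y"
proof -
  have "rcosets\<^bsub>chain_map_group X Y\<^esub> null_homotopic X Y = homotopy_class X Y ` chain_maps X Y"
    by (auto simp: RCOSETS_def homotopy_class_def chain_map_group_def)
  also have "\<dots> = kc X Y ` M0 X Y"
  proof (intro equalityI subsetI)
    fix a assume "a \<in> homotopy_class X Y ` chain_maps X Y"
    then show "a \<in> kc X Y ` M0 X Y" using assms by (auto simp: homotopy_class_kc hat_M0)
  next
    fix a assume "a \<in> kc X Y ` M0 X Y"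
    then obtain r where r: "r \<in> M0 X Y" "a = kc X Y r" by blast
    then show "a \<in> homotopy_class X Y ` chain_maps X Y"
      using assms unhat_chain_map[OF assms r(1)]
      by (intro image_eqI[of _ _ "unhat 0 X Y r"]) (auto simp: homotopy_class_kc)
  qed
  finally show ?thesis .
qed

lemma kc_comp:
  assumes "X \<in> bounded_fg_complexes" "Y \<in> bounded_fg_complexes" "Z \<in> bounded_fg_complexes"
    and r: "r \<in> M0 X Y" and q: "q \<in> M0 Y Z"
  shows "Comp Kb X Y Z (kc Y Z q) (kc X Y r) = kc X Z (q * r)"
proof -
  note X = bfcD[OF assms(1)] and Y = bfcD[OF assms(2)] and Z = bfcD[OF assms(3)]
  have "homotopy_class X Z (\<lambda>n. compose (carrier (grp X n)) (g n) (f n)) = kc X Z (q * r)"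
    if f: "f \<in> kc X Y r" and g: "g \<in> kc Y Z q" for f g
  proof -
    have f': "f \<in> chain_maps X Y" "hat 0 X Y f - r \<in> dnull (KO X) (KO Y)"
      and g': "g \<in> chain_maps Y Z" "hat 0 Y Z g - q \<in> dnull (KO Y) (KO Z)" using f g by (auto simp: kc_def)
    note fD = chain_mapsD[OF f'(1)] and gD = chain_mapsD[OF g'(1)]
    let ?h = "\<lambda>n. compose (carrier (grp X n)) (g n) (f n)"
    have "?h n \<in> hom (grp X n) (grp Z n)" for n
      using ghomD[OF fD(1)] ghomD[OF gD(1)] X(1) by (auto simp: hom_def compose_def comm_groupD)
    moreover have "f n x \<in> carrier (grp Y n)" "diff X n x \<in> carrier (grp X (n + 1))"
      if "x \<in> carrier (grp X n)" for n x
      using ghomD(1)[OF fD(1) that] ghomD(1)[OF X(3) that] by auto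
    ultimately have h: "?h \<in> chain_maps X Z"
      using fD(3) gD(3) by (auto simp: chain_maps_def ehom_def compose_def)
    have "hat 0 X Z ?h = hat 0 X Z (\<lambda>n x. g n (f n x))" using X(1) by (intro hat_cong) (auto simp: compose_def)
    also have "\<dots> = hat 0 Y Z g * hat 0 X Y f" using hat_comp[OF X(1) Y(1) Z(1) fD(1) gD(1)] by simp
    finally have eq: "hat 0 X Z ?h = hat 0 Y Z g * hat 0 X Y f" .
    have "hat 0 Y Z g * (hat 0 X Y f - r) + (hat 0 Y Z g - q) * r \<in> dnull (KO X) (KO Z)"
      using hat_M0[OF assms(2,3) g'(1)] r f' g'
      by (intro dnull_add dnull_comp_left[where B = "KO Y"] dnull_comp_right[where B = "KO Y"]) (auto simp: M0_def)
    then have "hat 0 Y Z g * hat 0 X Y f - q * r \<in> dnull (KO X) (KO Z)" by (simp add: algebra_simps)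
    then show ?thesis using assms h eq by (simp add: homotopy_class_kc kc_cong)
  qed
  then have "(\<Union>g \<in> kc Y Z q. \<Union>f \<in> kc X Y r. homotopy_class X Z (\<lambda>n. compose (carrier (grp X n)) (g n) (f n)))
     = (\<Union>g \<in> kc Y Z q. \<Union>f \<in> kc X Y r. kc X Z (q * r))" by simp
  \<comment> \<open>A union of copies of one class over nonempty index sets; \<open>unhat\<close>
    provides their members.\<close>
  also have "\<dots> = kc X Z (q * r)" using unhat_kc[OF assms(1,2) r] unhat_kc[OF assms(2,3) q] by blast
  finally show ?thesis by (simp add: Kb_def)
qed

lemma Ob_Kb [simp]: "Ob Kb = bounded_fg_complexes"
  by (simp add: Kb_def)

lemma Hom_Kb: "Hom Kb X Y = chain_map_group X Y Mod null_homotopic X Y"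
  by (simp add: Kb_def)

text \<open>This makes the bounded homotopy category preadditive, as the localization by roofs
  requires.\<close>

interpretation Kb: represented_category Kb M0 "\<lambda>X Y. dnull (KO X) (KO Y)" eX kc
proof
  fix X :: "'a cochain_complex" assume "X \<in> Ob Kb"
  then have X: "X \<in> bounded_fg_complexes" by simp
  then show "eX X \<in> M0 X X" by (rule M0_id)
  let ?i = "\<lambda>n. \<lambda>x \<in> carrier (grp X n). x"
  have i: "?i \<in> chain_maps X X"
    using ghomD(1)[OF bfcD(3)[OF X]] bfcD(1)[OF X] by (auto simp: chain_maps_def ehom_def hom_def comm_groupD)
  have "hat 0 X X ?i = eX X" unfolding eX_def using X by (intro hat_cong) (auto intro: bfcD)
  then show "kc X X (eX X) = IdM Kb X" using X i by (simp add: Kb_def homotopy_class_kc)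
next
  fix X Y :: "'a cochain_complex" assume "X \<in> Ob Kb" "Y \<in> Ob Kb"
  then have XY: "X \<in> bounded_fg_complexes" "Y \<in> bounded_fg_complexes" by simp_all
  show "0 \<in> M0 X Y" by simp
  show "kc X Y ` M0 X Y = Mor Kb X Y" using XY by (simp add: Hom_Kb FactGroup_def rcosets_kc)
  show "kc X Y 0 = \<one>\<^bsub>Hom Kb X Y\<^esub>" using XY by (simp add: Hom_Kb FactGroup_def kc_zero)
  fix f assume f: "f \<in> M0 X Y"
  then show "eX Y * f = f \<and> f * eX X = f" by (simp add: M0_unit)
  { fix Z :: "'a cochain_complex" and g assume "Z \<in> Ob Kb" and g: "g \<in> M0 Y Z"
    then show "kc X Z (g * f) = Comp Kb X Y Z (kc Y Z g) (kc X Y f)" "g * f \<in> M0 X Z"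
      using XY f by (auto simp: kc_comp intro: M0_comp) }
  fix g assume g: "g \<in> M0 X Y"
  show "f - g \<in> M0 X Y" using f g by (rule M0_diff)
  show "kc X Y f = kc X Y g \<longleftrightarrow> f - g \<in> dnull (KO X) (KO Y)" using XY f g by (simp add: kc_eq_iff)
  show "kc X Y (f + g) = kc X Y f \<otimes>\<^bsub>Hom Kb X Y\<^esub> kc X Y g"
    using XY f g by (simp add: Hom_Kb FactGroup_def kc_mult)
qed

section \<open>Shifts\<close>

definition tau :: "int \<Rightarrow> 'a uu endo"
  where "tau i = Endo (\<lambda>u k n. u k (n + i))"

lemma app_tau [simp]: "app (tau i) u k n = u k (n + i)"
proof -
  have "app (tau i) = (\<lambda>(u :: 'a uu) k n. u k (n + i))"
    unfolding tau_def by (rule app_Endo) (simp add: fun_eq_iff)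
  then show ?thesis by simp
qed

lemma tau_tau: "tau i * tau j = tau (i + j)"
  by (rule uu_eqI) (simp add: add.assoc)

lemma tau_0 [simp]: "tau 0 = 1"
  by (rule uu_eqI) simp

lemma tau_inverse [simp]: "tau (- i) * tau i = 1" "tau i * tau (- i) = 1"
  "tau (- i) * (tau i * x) = x" "tau i * (tau (- i) * x) = x"
  by (simp_all add: tau_tau flip: mult.assoc)

lemma deg_tau: "deg (- i) (tau i)"
  by (auto simp: deg_def rs_def fun_eq_iff)

definition tconj :: "int \<Rightarrow> 'a uu endo \<Rightarrow> 'a uu endo"
  where "tconj i r = tau i * r * tau (- i)"

lemma tconj_mult: "tconj i (r * q) = tconj i r * tconj i q"
  by (simp add: tconj_def mult.assoc)

lemma tconj_add: "tconj i (r + q) = tconj i r + tconj i q" and tconj_diff: "tconj i (r - q) = tconj i r - tconj i q"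
  and tconj_0 [simp]: "tconj i 0 = 0" and tconj_minus: "tconj i (- r) = - tconj i r"
  by (simp_all add: tconj_def algebra_simps)

lemma tconj_tconj: "tconj i (tconj j r) = tconj (i + j) r"
proof -
  have "tconj i (tconj j r) = (tau i * tau j) * r * (tau (- j) * tau (- i))" by (simp add: tconj_def mult.assoc)
  also have "- j + - i = - (i + j)" by simp
  then have "(tau i * tau j) * r * (tau (- j) * tau (- i)) = tconj (i + j) r" by (simp only: tconj_def tau_tau)
  finally show ?thesis .
qed

lemma tconj_inverse [simp]: "tconj (- i) (tconj i r) = r" "tconj i (tconj (- i) r) = r"
  by (simp_all add: tconj_tconj) (simp_all add: tconj_def)

lemma deg_tconj: "deg j r \<Longrightarrow> deg j (tconj i r)"
  using deg_mult[OF deg_mult[OF deg_tau[of i], of j r] deg_tau[of "- i"]] by (simp add: tconj_def)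

section \<open>Shifted complexes\<close>

lemma grp_shift [simp]: "grp (shift i X) n = grp X (n + i)"
  by (simp add: shift_def)

definition sgi :: "int \<Rightarrow> 'b::uminus \<Rightarrow> 'b"
  where "sgi i r = (if even i then r else - r)"

lemma cgrp_shift [simp]: "cgrp X \<Longrightarrow> cgrp (shift i X)"
  by (simp add: cgrp_def)

lemma ghom_shift: "f \<in> ghom j X Y \<Longrightarrow> (\<lambda>n. f (n + i)) \<in> ghom j (shift i X) (shift i Y)"
  by (auto simp: ghom_def) (metis add.assoc add.commute)

text \<open>Reindexing a family of maps becomes conjugation by \<open>tau i\<close>, so
  compatibility of the shift with composition reduces to \<open>tconj_mult\<close>.\<close>

lemma hat_shift:
  assumes "cgrp X" "cgrp Y" "f \<in> ghom j X Y"
  shows "hat j (shift i X) (shift i Y) (\<lambda>n. f (n + i)) = tconj i (hat j X Y f)"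
proof (rule uu_eqI)
  fix u k n
  have eq: "n - j + i = n + i - j" by simp
  show "app (hat j (shift i X) (shift i Y) (\<lambda>n. f (n + i))) u k n = app (tconj i (hat j X Y f)) u k n"
    using assms ghom_shift[OF assms(3), of i] by (simp add: tconj_def app_hat eq)
qed

lemma eX_shift: "cgrp X \<Longrightarrow> eX (shift i X) = tconj i (eX X)"
  unfolding eX_def using hat_shift[OF _ _ ghom_id] by blast

lemma shift_shift: 
  assumes "X \<in> bounded_fg_complexes" shows "shift i (shift j X) = shift (i + j) X"
proof -
  note X = bfcD[OF assms]
  have eq: "n + i + j = n + (i + j)" "n + 1 + i + j = n + 1 + (i + j)" "n + i + 1 + j = n + 1 + (i + j)" for n :: int by auto
  have d: "diff X (n + (i + j)) x \<in> carrier (grp X (n + 1 + (i + j)))" if "x \<in> carrier (grp X (n + (i + j)))" for n x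
    using ghomD(1)[OF X(3) that] by (simp add: algebra_simps)
  show ?thesis
    unfolding shift_def
    using d X(1) by (auto simp: fun_eq_iff eq restrict_def group.inv_inv comm_group.axioms)
qed

lemma shift_0: 
  assumes "X \<in> bounded_fg_complexes" shows "shift 0 X = X"
proof -
  have "(\<lambda>n. restrict (diff X n) (carrier (grp X n))) = diff X"
    using bfcD(4)[OF assms] by (simp add: extensional_restrict)
  then show ?thesis unfolding shift_def by (simp add: restrict_def)
qed

lemma ghom_cong:
  assumes "cgrp X" "f \<in> ghom i X Y" "\<And>n x. x \<in> carrier (grp X n) \<Longrightarrow> g n x = f n x"
  shows "g \<in> ghom i X Y"
  using ghomD[OF assms(2)] assms(1,3) by (simp add: ghom_def hom_def comm_groupD)

lemma diff_shift_ghom: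
  assumes "X \<in> bounded_fg_complexes"
  shows "diff (shift i X) \<in> ghom 1 (shift i X) (shift i X)"
    "hat 1 (shift i X) (shift i X) (diff (shift i X)) = sgi i (tconj i (dX X))"
proof -
  note X = bfcD[OF assms]
  have c: "cgrp (shift i X)" using X(1) by simp
  have g: "(\<lambda>n. diff X (n + i)) \<in> ghom 1 (shift i X) (shift i X)" using ghom_shift[OF X(3)] .
  have eq: "diff (shift i X) n x = (if even i then diff X (n + i) x else inv\<^bsub>grp (shift i X) (n + 1)\<^esub> diff X (n + i) x)"
    if "x \<in> carrier (grp (shift i X) n)" for n x
    using that by (simp add: shift_def)
  define f where "f = (\<lambda>n x. if even i then diff X (n + i) x else inv\<^bsub>grp (shift i X) (n + 1)\<^esub> diff X (n + i) x)"
  have f: "f \<in> ghom 1 (shift i X) (shift i X)"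
    using g ghom_inv[OF c g] by (cases "even i") (simp_all add: f_def)
  then show "diff (shift i X) \<in> ghom 1 (shift i X) (shift i X)"
    using c eq by (rule_tac ghom_cong[OF c]) (auto simp: f_def)
  have "hat 1 (shift i X) (shift i X) (diff (shift i X)) = hat 1 (shift i X) (shift i X) f"
    using c eq by (intro hat_cong) (auto simp: f_def)
  also have "\<dots> = sgi i (tconj i (dX X))"
    using hat_inv[OF c c g] hat_shift[OF X(1,1,3), of i] by (cases "even i") (simp_all add: f_def sgi_def dX_def)
  finally show "hat 1 (shift i X) (shift i X) (diff (shift i X)) = sgi i (tconj i (dX X))" .
qed

lemma dX_shift: "X \<in> bounded_fg_complexes \<Longrightarrow> dX (shift i X) = sgi i (tconj i (dX X))"
  unfolding dX_def[of "shift i X"] by (rule diff_shift_ghom)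

lemma shift_bfc:
  assumes "X \<in> bounded_fg_complexes" shows "shift i X \<in> bounded_fg_complexes"
proof -
  note X = bfcD[OF assms] and d = diff_shift_ghom[OF assms, of i]
  have c: "cgrp (shift i X)" using X(1) by simp
  have "finite ((\<lambda>n. n - i) ` supp X)" using X(2) by (simp add: bdd_def supp_def)
  moreover have "{n. carrier (grp (shift i X) n) \<noteq> {\<one>\<^bsub>grp (shift i X) n\<^esub>}} \<subseteq> (\<lambda>n. n - i) ` supp X"
    by (auto simp: supp_def intro!: image_eqI[of _ _ "_ + i"])
  ultimately have b: "finite {n. carrier (grp (shift i X) n) \<noteq> {\<one>\<^bsub>grp (shift i X) n\<^esub>}}" by (rule rev_finite_subset)
  \<comment> \<open>That the shifted differential squares to zero is checked in the ring, where its
    two signs cancel, and then read back on elements.\<close>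
  have "hat 1 (shift i X) (shift i X) (diff (shift i X)) * hat 1 (shift i X) (shift i X) (diff (shift i X)) = 0"
    unfolding d(2) using dX_unit(3)[OF assms] by (simp add: sgi_def flip: tconj_mult)
  then have "hat 2 (shift i X) (shift i X) (\<lambda>n x. diff (shift i X) (n + 1) (diff (shift i X) n x)) = 
      hat 2 (shift i X) (shift i X) (\<lambda>n x. \<one>\<^bsub>grp (shift i X) (n + 2)\<^esub>)"
    using hat_comp[OF c c c d(1) d(1)] hat_one[OF c c, of 2] by simp
  moreover have "(\<lambda>n x. diff (shift i X) (n + 1) (diff (shift i X) n x)) \<in> ghom 2 (shift i X) (shift i X)"
    using ghom_comp[OF d(1) d(1)] by simp
  ultimately have dd: "diff (shift i X) (n + 1) (diff (shift i X) n x) = \<one>\<^bsub>grp (shift i X) (n + 2)\<^esub>"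
    if "x \<in> carrier (grp (shift i X) n)" for n x
    using hat_eqD[OF c c _ ghom_one[OF c, of 2] _ that, of "\<lambda>n x. diff (shift i X) (n + 1) (diff (shift i X) n x)"] by blast
  have e: "diff (shift i X) n \<in> extensional (carrier (grp (shift i X) n))" for n by (simp add: shift_def)
  show ?thesis
    unfolding bounded_fg_complexes_def
    using X(1,6) d(1) b dd e by (simp add: ehom_def ghom_def)
qed

lemma KO_shift_dmap:
  assumes "X \<in> bounded_fg_complexes" "Y \<in> bounded_fg_complexes" "r \<in> dmap (KO X) (KO Y)"
  shows "tconj i r \<in> dmap (KO (shift i X)) (KO (shift i Y))"
  using assms
  by (intro dmapI; simp add: eX_shift dX_shift bfcD dmap_def sgi_def flip: tconj_mult)

lemma KO_shift_dnull:
  assumes "X \<in> bounded_fg_complexes" "Y \<in> bounded_fg_complexes" "r \<in> dnull (KO X) (KO Y)"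
  shows "tconj i r \<in> dnull (KO (shift i X)) (KO (shift i Y))"
proof -
  obtain h where h: "r = dX Y * h + h * dX X" "eX Y * h = h" "h * eX X = h" using assms(3) by (auto elim: dnullE)
  then show ?thesis
    using assms(1,2)
    \<comment> \<open>The homotopy takes over the sign of the shifted differentials.\<close>
    by (intro dnullI[where h = "sgi i (tconj i h)"])
      (simp_all add: eX_shift dX_shift bfcD sgi_def tconj_add[symmetric] flip: tconj_mult)
qed

lemma M0_shift:
  "\<lbrakk>X \<in> bounded_fg_complexes; Y \<in> bounded_fg_complexes; r \<in> M0 X Y\<rbrakk> \<Longrightarrow> tconj i r \<in> M0 (shift i X) (shift i Y)"
  by (simp add: M0_def KO_shift_dmap deg_tconj)

lemma chain_mapI_hat:
  assumes "X \<in> bounded_fg_complexes" "Y \<in> bounded_fg_complexes" and f: "f \<in> ghom 0 X Y"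
    "\<And>n. f n \<in> extensional (carrier (grp X n))" "hat 0 X Y f \<in> M0 X Y"
  shows "f \<in> chain_maps X Y"
proof -
  note X = bfcD[OF assms(1)] and Y = bfcD[OF assms(2)]
  let ?r = "hat 0 X Y f"
  note u = unhat_chain_map[OF assms(1,2) f(3)]
  have "f = unhat 0 X Y ?r"
  proof
    fix n
    show "f n = unhat 0 X Y ?r n"
      using hat_eqD[OF X(1) Y(1) f(1) unhat_ghom[OF X(1) Y(1)], of ?r] u(2) f(2)
      by (intro extensionalityI[where A = "carrier (grp X n)"]) (auto simp: unhat_def)
  qed
  then show ?thesis using u(1) by simp
qed

lemma shift_chain_map:
  assumes "X \<in> bounded_fg_complexes" "Y \<in> bounded_fg_complexes" and f: "f \<in> chain_maps X Y"
  shows "(\<lambda>n. f (n + i)) \<in> chain_maps (shift i X) (shift i Y)"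
    "hat 0 (shift i X) (shift i Y) (\<lambda>n. f (n + i)) = tconj i (hat 0 X Y f)"
proof -
  note X = bfcD[OF assms(1)] and Y = bfcD[OF assms(2)] and f' = chain_mapsD[OF f]
  show eq: "hat 0 (shift i X) (shift i Y) (\<lambda>n. f (n + i)) = tconj i (hat 0 X Y f)"
    using X(1) Y(1) f'(1) by (rule hat_shift)
  show "(\<lambda>n. f (n + i)) \<in> chain_maps (shift i X) (shift i Y)"
    using M0_shift[OF assms(1,2) hat_M0[OF assms]] eq f'(2) ghom_shift[OF f'(1)] assms(1,2)
    by (intro chain_mapI_hat shift_bfc) auto
qed

lemma shift_kc_subset:
  assumes "X \<in> bounded_fg_complexes" "Y \<in> bounded_fg_complexes"
  shows "shift_Kb_mor i (kc X Y r) \<subseteq> kc (shift i X) (shift i Y) (tconj i r)"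
proof
  fix g assume "g \<in> shift_Kb_mor i (kc X Y r)"
  then obtain f where f: "f \<in> chain_maps X Y" "hat 0 X Y f - r \<in> dnull (KO X) (KO Y)" "g = (\<lambda>n. f (n + i))"
    by (auto simp: shift_Kb_mor_def kc_def)
  then show "g \<in> kc (shift i X) (shift i Y) (tconj i r)"
    using shift_chain_map[OF assms f(1), of i] KO_shift_dnull[OF assms f(2), of i] by (simp add: kc_def tconj_diff)
qed

lemma shift_inverse:
  assumes "X \<in> bounded_fg_complexes"
  shows "shift (- i) (shift i X) = X" "shift i (shift (- i) X) = X"
  using shift_shift[OF assms, of "- i" i] shift_shift[OF assms, of i "- i"] shift_0[OF assms] by simp_all

text \<open>Only one inclusion needs a computation; applied to \<open>- i\<close> it yields the
  other.\<close>

lemma shift_kc: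
  assumes "X \<in> bounded_fg_complexes" "Y \<in> bounded_fg_complexes"
  shows "shift_Kb_mor i (kc X Y r) = kc (shift i X) (shift i Y) (tconj i r)"
proof (intro equalityI shift_kc_subset assms subsetI)
  fix g assume g: "g \<in> kc (shift i X) (shift i Y) (tconj i r)"
  have "shift_Kb_mor (- i) (kc (shift i X) (shift i Y) (tconj i r)) \<subseteq> kc X Y r"
    using shift_kc_subset[of "shift i X" "shift i Y" "- i" "tconj i r"] assms
    by (simp add: shift_bfc shift_inverse)
  then have "(\<lambda>n. g (n - i)) \<in> kc X Y r" using g by (auto simp: shift_Kb_mor_def)
  then show "g \<in> shift_Kb_mor i (kc X Y r)" by (auto simp: shift_Kb_mor_def intro!: image_eqI[of _ _ "\<lambda>n. g (n - i)"])
qed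

section \<open>Quasi-isomorphisms\<close>

lemma (in group) coset_eq_iff:
  assumes "subgroup B G" "x \<in> carrier G" "y \<in> carrier G"
  shows "B #> x = B #> y \<longleftrightarrow> x \<otimes> inv y \<in> B"
proof -
  have B: "B \<subseteq> carrier G" using assms(1) by (rule subgroup.subset)
  have xy: "x \<otimes> inv y \<in> carrier G" using assms by simp
  have "B #> x = B #> y \<longleftrightarrow> B #> (x \<otimes> inv y) = B"
    using coset_mult_inv1[OF _ assms(2,3) B] coset_mult_inv2[OF _ assms(2,3) B] by blast
  also have "\<dots> \<longleftrightarrow> x \<otimes> inv y \<in> B"
    using coset_join1[OF _ xy assms(1)] coset_join2[OF xy assms(1)] by blast
  finally show ?thesis .
qed

text \<open>On the coset of \<open>z\<close> the union in the map consists of copies of the coset of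
  \<open>\<phi> z\<close>. Once this is known, bijectivity on cosets splits into one condition for
  injectivity and one for surjectivity, both on elements.\<close>

lemma quotient_iso_iff:
  assumes G: "comm_group G" and H: "comm_group H" and \<phi>: "\<phi> \<in> hom G H"
    and Z: "subgroup ZG G" "subgroup ZH H" and B: "subgroup BG G" "subgroup BH H" "BG \<subseteq> ZG" "BH \<subseteq> ZH"
    and \<phi>Z: "\<phi> ` ZG \<subseteq> ZH" and \<phi>B: "\<phi> ` BG \<subseteq> BH"
  shows "(\<lambda>c. \<Union>x \<in> c. BH #>\<^bsub>H\<^esub> \<phi> x) \<in> iso (G\<lparr>carrier := ZG\<rparr> Mod BG) (H\<lparr>carrier := ZH\<rparr> Mod BH) \<longleftrightarrow>
    (\<forall>x \<in> ZG. \<phi> x \<in> BH \<longrightarrow> x \<in> BG) \<and> (\<forall>y \<in> ZH. \<exists>x \<in> ZG. \<exists>b \<in> BH. y = b \<otimes>\<^bsub>H\<^esub> \<phi> x)"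
proof -
  interpret G: comm_group G by fact
  interpret H: comm_group H by fact
  interpret \<phi>: group_hom G H \<phi> using \<phi> by unfold_locales
  interpret BG: normal BG G using B by (intro G.subgroup_imp_normal)
  interpret BH: normal BH H using B by (intro H.subgroup_imp_normal)
  let ?m = "\<lambda>c. \<Union>x \<in> c. BH #>\<^bsub>H\<^esub> \<phi> x"
  have ZG: "x \<in> carrier G" if "x \<in> ZG" for x using Z(1) that by (rule subgroup.mem_carrier)
  have ZH: "x \<in> carrier H" if "x \<in> ZH" for x using Z(2) that by (rule subgroup.mem_carrier)
  have cG: "carrier (G\<lparr>carrier := ZG\<rparr> Mod BG) = (\<lambda>x. BG #>\<^bsub>G\<^esub> x) ` ZG"
    and cH: "carrier (H\<lparr>carrier := ZH\<rparr> Mod BH) = (\<lambda>x. BH #>\<^bsub>H\<^esub> x) ` ZH"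
    by (auto simp: carrier_FactGroup r_coset_def)
  have mG: "a \<otimes>\<^bsub>G\<lparr>carrier := ZG\<rparr> Mod BG\<^esub> b = a <#>\<^bsub>G\<^esub> b" for a b by (simp add: set_mult_def)
  have mH: "a \<otimes>\<^bsub>H\<lparr>carrier := ZH\<rparr> Mod BH\<^esub> b = a <#>\<^bsub>H\<^esub> b" for a b by (simp add: set_mult_def)
  have m: "?m (BG #>\<^bsub>G\<^esub> z) = BH #>\<^bsub>H\<^esub> \<phi> z" if z: "z \<in> ZG" for z
  proof -
    have "BH #>\<^bsub>H\<^esub> \<phi> x = BH #>\<^bsub>H\<^esub> \<phi> z" if x: "x \<in> BG #>\<^bsub>G\<^esub> z" for x
    proof -
      obtain b where b: "b \<in> BG" "x = b \<otimes>\<^bsub>G\<^esub> z" using x by (auto simp: r_coset_def)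
      have "\<phi> x \<otimes>\<^bsub>H\<^esub> inv\<^bsub>H\<^esub> \<phi> z = \<phi> b" using b ZG[OF z] BG.mem_carrier by (simp add: H.m_assoc)
      then show ?thesis using b \<phi>B ZG[OF z] BG.mem_carrier by (subst H.coset_eq_iff[OF B(2)]) auto
    qed
    then have "?m (BG #>\<^bsub>G\<^esub> z) = (\<Union>x \<in> BG #>\<^bsub>G\<^esub> z. BH #>\<^bsub>H\<^esub> \<phi> z)" by simp
    also have "\<dots> = BH #>\<^bsub>H\<^esub> \<phi> z" using G.rcos_self[OF ZG[OF z] B(1)] by auto
    finally show ?thesis .
  qed
  have hom: "?m \<in> hom (G\<lparr>carrier := ZG\<rparr> Mod BG) (H\<lparr>carrier := ZH\<rparr> Mod BH)"
    unfolding hom_def cG cH mG mH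
  proof (intro CollectI conjI ballI)
    show "?m \<in> (\<lambda>x. BG #>\<^bsub>G\<^esub> x) ` ZG \<rightarrow> (\<lambda>x. BH #>\<^bsub>H\<^esub> x) ` ZH" using m \<phi>Z by auto
    fix a b assume "a \<in> (\<lambda>x. BG #>\<^bsub>G\<^esub> x) ` ZG" "b \<in> (\<lambda>x. BG #>\<^bsub>G\<^esub> x) ` ZG"
    then obtain x y where xy: "x \<in> ZG" "y \<in> ZG" "a = BG #>\<^bsub>G\<^esub> x" "b = BG #>\<^bsub>G\<^esub> y" by blast
    have "x \<otimes>\<^bsub>G\<^esub> y \<in> ZG" using Z(1) xy by (simp add: subgroup.m_closed)
    then show "?m (a <#>\<^bsub>G\<^esub> b) = ?m a <#>\<^bsub>H\<^esub> ?m b"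
      using xy ZG by (simp only: m BG.rcos_sum) (simp add: BH.rcos_sum)
  qed
  have inj: "inj_on ?m ((\<lambda>x. BG #>\<^bsub>G\<^esub> x) ` ZG) \<longleftrightarrow> (\<forall>x \<in> ZG. \<phi> x \<in> BH \<longrightarrow> x \<in> BG)"
  proof
    assume I: "inj_on ?m ((\<lambda>x. BG #>\<^bsub>G\<^esub> x) ` ZG)"
    show "\<forall>x \<in> ZG. \<phi> x \<in> BH \<longrightarrow> x \<in> BG"
    proof (intro ballI impI)
      fix x assume x: "x \<in> ZG" "\<phi> x \<in> BH"
      have 1: "\<one>\<^bsub>G\<^esub> \<in> ZG" using Z(1) by (rule subgroup.one_closed)
      have "BH #>\<^bsub>H\<^esub> \<phi> x = BH #>\<^bsub>H\<^esub> \<phi> \<one>\<^bsub>G\<^esub>" using x ZG by (subst H.coset_eq_iff[OF B(2)]) auto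
      then have "?m (BG #>\<^bsub>G\<^esub> x) = ?m (BG #>\<^bsub>G\<^esub> \<one>\<^bsub>G\<^esub>)" using m[OF x(1)] m[OF 1] by simp
      then have "BG #>\<^bsub>G\<^esub> x = BG #>\<^bsub>G\<^esub> \<one>\<^bsub>G\<^esub>" by (rule inj_onD[OF I]) (use x(1) 1 in blast)+
      then show "x \<in> BG" using x ZG by (subst (asm) G.coset_eq_iff[OF B(1)]) auto
    qed
  next
    assume I: "\<forall>x \<in> ZG. \<phi> x \<in> BH \<longrightarrow> x \<in> BG"
    show "inj_on ?m ((\<lambda>x. BG #>\<^bsub>G\<^esub> x) ` ZG)"
    proof (rule inj_onI)
      fix a b assume "a \<in> (\<lambda>x. BG #>\<^bsub>G\<^esub> x) ` ZG" "b \<in> (\<lambda>x. BG #>\<^bsub>G\<^esub> x) ` ZG" and eq: "?m a = ?m b"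
      then obtain x y where xy: "x \<in> ZG" "y \<in> ZG" "a = BG #>\<^bsub>G\<^esub> x" "b = BG #>\<^bsub>G\<^esub> y" by blast
      have "BH #>\<^bsub>H\<^esub> \<phi> x = BH #>\<^bsub>H\<^esub> \<phi> y" using eq m[OF xy(1)] m[OF xy(2)] xy(3,4) by simp
      then have "\<phi> (x \<otimes>\<^bsub>G\<^esub> inv\<^bsub>G\<^esub> y) \<in> BH" using xy ZG by (subst (asm) H.coset_eq_iff[OF B(2)]) auto
      moreover have "x \<otimes>\<^bsub>G\<^esub> inv\<^bsub>G\<^esub> y \<in> ZG" using Z(1) xy by (simp add: subgroup.m_closed subgroup.m_inv_closed)
      ultimately have "x \<otimes>\<^bsub>G\<^esub> inv\<^bsub>G\<^esub> y \<in> BG" using I by blast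
      then show "a = b" using xy ZG by (simp add: G.coset_eq_iff[OF B(1)])
    qed
  qed
  have surj: "?m ` ((\<lambda>x. BG #>\<^bsub>G\<^esub> x) ` ZG) = (\<lambda>x. BH #>\<^bsub>H\<^esub> x) ` ZH \<longleftrightarrow>
    (\<forall>y \<in> ZH. \<exists>x \<in> ZG. \<exists>b \<in> BH. y = b \<otimes>\<^bsub>H\<^esub> \<phi> x)"
  proof -
    have e1: "?m ` ((\<lambda>x. BG #>\<^bsub>G\<^esub> x) ` ZG) = (\<lambda>x. BH #>\<^bsub>H\<^esub> \<phi> x) ` ZG"
      unfolding image_image by (intro image_cong refl m)
    have e2: "(\<lambda>x. BH #>\<^bsub>H\<^esub> \<phi> x) ` ZG \<subseteq> (\<lambda>x. BH #>\<^bsub>H\<^esub> x) ` ZH" using \<phi>Z by blast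
    have e3: "(\<exists>b \<in> BH. y = b \<otimes>\<^bsub>H\<^esub> \<phi> x) \<longleftrightarrow> BH #>\<^bsub>H\<^esub> y = BH #>\<^bsub>H\<^esub> \<phi> x" if "y \<in> ZH" "x \<in> ZG" for x y
    proof -
      have y: "y \<in> carrier H" and x: "\<phi> x \<in> carrier H" using that ZG ZH by auto
      have e: "y \<otimes>\<^bsub>H\<^esub> inv\<^bsub>H\<^esub> \<phi> x = b \<longleftrightarrow> y = b \<otimes>\<^bsub>H\<^esub> \<phi> x" if "b \<in> BH" for b
        by (rule H.inv_solve_right'[OF BH.mem_carrier[OF that] y x])
      show ?thesis
        unfolding H.coset_eq_iff[OF B(2) y x] using e by metis
    qed
    have "(\<lambda>x. BH #>\<^bsub>H\<^esub> \<phi> x) ` ZG = (\<lambda>x. BH #>\<^bsub>H\<^esub> x) ` ZH \<longleftrightarrow>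
        (\<lambda>x. BH #>\<^bsub>H\<^esub> x) ` ZH \<subseteq> (\<lambda>x. BH #>\<^bsub>H\<^esub> \<phi> x) ` ZG"
      using e2 by (simp only: set_eq_subset simp_thms)
    also have "\<dots> \<longleftrightarrow> (\<forall>y \<in> ZH. \<exists>x \<in> ZG. BH #>\<^bsub>H\<^esub> y = BH #>\<^bsub>H\<^esub> \<phi> x)"
      by (simp only: image_subset_iff image_iff)
    finally show ?thesis unfolding e1 using e3 by simp
  qed
  show ?thesis
    using hom inj surj unfolding iso_def bij_betw_def cG cH by blast
qed

section \<open>Cohomology of complexes\<close>

lemma boundaries_subgroup:
  assumes "X \<in> bounded_fg_complexes"
  shows "subgroup (cycles X n) (grp X n)" "subgroup (boundaries X n) (grp X n)" "boundaries X n \<subseteq> cycles X n"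
proof -
  note X = bfcD[OF assms]
  have g: "group (grp X m)" for m using X(1) by (simp add: comm_group.axioms)
  have d: "diff X m \<in> hom (grp X m) (grp X (m + 1))" for m using X(3) by (simp add: ghom_def)
  have h: "group_hom (grp X m) (grp X (m + 1)) (diff X m)" for m
    using g d by (simp add: group_hom_def group_hom_axioms_def)
  show "subgroup (cycles X n) (grp X n)" unfolding cycles_def by (rule group_hom.subgroup_kernel[OF h])
  show "subgroup (boundaries X n) (grp X n)"
    using group_hom.img_is_subgroup[OF h[of "n - 1"]] by (simp add: boundaries_def)
  show "boundaries X n \<subseteq> cycles X n"
    using X(5)[of _ "n - 1"] ghomD(1)[OF X(3), of _ "n - 1"] by (auto simp: boundaries_def cycles_def kernel_def add.commute)
qed

definition qi_elem :: "'a cochain_complex \<Rightarrow> 'a cochain_complex \<Rightarrow> (int \<Rightarrow> 'a \<Rightarrow> 'a) \<Rightarrow> bool"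
  where "qi_elem X Y f \<longleftrightarrow> (\<forall>n.
    (\<forall>x \<in> cycles X n. f n x \<in> boundaries Y n \<longrightarrow> x \<in> boundaries X n) \<and>
    (\<forall>y \<in> cycles Y n. \<exists>x \<in> cycles X n. \<exists>b \<in> boundaries Y n. y = b \<otimes>\<^bsub>grp Y n\<^esub> f n x))"

lemma cohomology_map_iso_iff:
  assumes "X \<in> bounded_fg_complexes" "Y \<in> bounded_fg_complexes" and f: "f \<in> chain_maps X Y"
  shows "(\<forall>n. cohomology_map Y f n \<in> iso (cohomology X n) (cohomology Y n)) \<longleftrightarrow> qi_elem X Y f"
proof -
  note X = bfcD[OF assms(1)] and Y = bfcD[OF assms(2)] and f' = chain_mapsD[OF f]
  have one: "f n \<one>\<^bsub>grp X n\<^esub> = \<one>\<^bsub>grp Y n\<^esub>" for n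
    using f'(1) X(1) Y(1) by (intro hom_one) (auto simp: ghom_def comm_group.axioms)
  have "f n ` cycles X n \<subseteq> cycles Y n" for n
    using ghomD(1)[OF f'(1)] f'(3) one[of "n + 1"] by (auto simp: cycles_def kernel_def)
  moreover have "f n ` boundaries X n \<subseteq> boundaries Y n" for n
    using f'(3)[of _ "n - 1"] ghomD(1)[OF f'(1), of _ "n - 1"] by (auto simp: boundaries_def) (metis image_eqI)
  moreover have "f n \<in> hom (grp X n) (grp Y n)" for n using f'(1) by (simp add: ghom_def)
  ultimately have "cohomology_map Y f n \<in> iso (cohomology X n) (cohomology Y n) \<longleftrightarrow>
    (\<forall>x \<in> cycles X n. f n x \<in> boundaries Y n \<longrightarrow> x \<in> boundaries X n) \<and>
    (\<forall>y \<in> cycles Y n. \<exists>x \<in> cycles X n. \<exists>b \<in> boundaries Y n. y = b \<otimes>\<^bsub>grp Y n\<^esub> f n x)" for n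
    unfolding cohomology_def cohomology_map_def[abs_def]
    using boundaries_subgroup[OF assms(1), of n] boundaries_subgroup[OF assms(2), of n] X(1) Y(1)
    by (intro quotient_iso_iff) auto
  then show ?thesis by (simp add: qi_elem_def)
qed

section \<open>Comparison of degreewise and total conditions\<close>

definition emb :: "'a cochain_complex \<Rightarrow> (int \<Rightarrow> 'a) \<Rightarrow> 'a uu"
  where "emb X a = (\<lambda>k n. if k = 0 then inc (grp X n) (a n) else 0)"

definition elts :: "'a cochain_complex \<Rightarrow> (int \<Rightarrow> 'a) set"
  where "elts X = {a. \<forall>n. a n \<in> carrier (grp X n)}"

lemma im_eX: 
  assumes "cgrp X" shows "im (eX X) = emb X ` elts X"
proof (intro equalityI subsetI)
  fix u assume "u \<in> im (eX X)"
  then have "u = emb X (\<lambda>n. pr (u 0 n) (grp X n))"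
    using assms by (auto simp: im_iff fun_eq_iff emb_def app_eX)
  then show "u \<in> emb X ` elts X" using assms by (auto simp: elts_def)
next
  fix u assume "u \<in> emb X ` elts X"
  then show "u \<in> im (eX X)" using assms by (auto simp: im_iff fun_eq_iff emb_def elts_def app_eX)
qed

lemma emb_eq_iff:
  assumes "cgrp X" "a \<in> elts X" "b \<in> elts X" shows "emb X a = emb X b \<longleftrightarrow> a = b"
proof
  assume eq: "emb X a = emb X b"
  have "inc (grp X n) (a n) = inc (grp X n) (b n)" for n
    using fun_cong[OF fun_cong[OF eq, of 0], of n] by (simp add: emb_def)
  then show "a = b" using assms by (auto simp: inc_eq_iff elts_def)
qed simp

lemma emb_zero: "cgrp X \<Longrightarrow> emb X (\<lambda>n. \<one>\<^bsub>grp X n\<^esub>) = 0"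
  by (auto simp: emb_def fun_eq_iff)

lemma hat_emb:
  assumes "cgrp X" "cgrp Y" "f \<in> ghom i X Y" "a \<in> elts X"
  shows "app (hat i X Y f) (emb X a) = emb Y (\<lambda>n. f (n - i) (a (n - i)))" "(\<lambda>n. f (n - i) (a (n - i))) \<in> elts Y"
  using assms ghomD'(1)[OF assms(3)] by (auto simp: fun_eq_iff app_hat emb_def elts_def)

lemma emb_add:
  "\<lbrakk>cgrp X; a \<in> elts X; b \<in> elts X\<rbrakk> \<Longrightarrow> emb X a + emb X b = emb X (\<lambda>n. a n \<otimes>\<^bsub>grp X n\<^esub> b n)"
  by (auto simp: fun_eq_iff emb_def elts_def inc_mult)

text \<open>An element of the total group is a family with one member in each degree, and it is a
  cycle or a boundary exactly when all its members are. The degreewise conditions follow by testing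
  on families concentrated in one degree, and the converse by choosing in every degree at
  once.\<close>

lemma qis_iff_elem:
  assumes "X \<in> bounded_fg_complexes" "Y \<in> bounded_fg_complexes" and f: "f \<in> chain_maps X Y"
  shows "qis (KO X) (KO Y) (hat 0 X Y f) \<longleftrightarrow> qi_elem X Y f"
proof -
  note X = bfcD[OF assms(1)] and Y = bfcD[OF assms(2)] and f' = chain_mapsD[OF f]
  have dX: "app (dX V) (emb V a) = emb V (\<lambda>n. diff V (n - 1) (a (n - 1)))" "(\<lambda>n. diff V (n - 1) (a (n - 1))) \<in> elts V"
    if "V \<in> bounded_fg_complexes" "a \<in> elts V" for V a
    unfolding dX_def using hat_emb[OF bfcD(1)[OF that(1)] bfcD(1)[OF that(1)] bfcD(3)[OF that(1)] that(2)] by simp_all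
  have F: "app (hat 0 X Y f) (emb X a) = emb Y (\<lambda>n. f n (a n))" "(\<lambda>n. f n (a n)) \<in> elts Y" if "a \<in> elts X" for a
    using hat_emb[OF X(1) Y(1) f'(1) that] by simp_all
  have cyc: "app (dX V) (emb V a) = 0 \<longleftrightarrow> (\<forall>n. a n \<in> cycles V n)" if V: "V \<in> bounded_fg_complexes" and a: "a \<in> elts V" for V a
  proof -
    have 1: "(\<lambda>n. \<one>\<^bsub>grp V n\<^esub>) \<in> elts V" using bfcD(1)[OF V] by (simp add: elts_def comm_groupD)
    have "app (dX V) (emb V a) = 0 \<longleftrightarrow> (\<lambda>n. diff V (n - 1) (a (n - 1))) = (\<lambda>n. \<one>\<^bsub>grp V n\<^esub>)"
      using emb_eq_iff[OF bfcD(1)[OF V] dX(2)[OF V a] 1] emb_zero[OF bfcD(1)[OF V]] by (simp add: dX(1)[OF V a])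
    also have "\<dots> \<longleftrightarrow> (\<forall>n. diff V n (a n) = \<one>\<^bsub>grp V (n + 1)\<^esub>)"
      by (auto simp: fun_eq_iff) (metis add_diff_cancel_right')
    also have "\<dots> \<longleftrightarrow> (\<forall>n. a n \<in> cycles V n)" using a by (auto simp: cycles_def kernel_def elts_def)
    finally show ?thesis .
  qed
  have bd: "(\<exists>b \<in> elts V. a = (\<lambda>n. diff V (n - 1) (b (n - 1)))) \<longleftrightarrow> (\<forall>n. a n \<in> boundaries V n)" for V :: "'a cochain_complex" and a
  proof
    assume R: "\<forall>n. a n \<in> boundaries V n"
    then have "\<forall>n. \<exists>x. x \<in> carrier (grp V (n - 1)) \<and> a n = diff V (n - 1) x" by (auto simp: boundaries_def)
    from choice[OF this] obtain b where "\<forall>n. b n \<in> carrier (grp V (n - 1)) \<and> a n = diff V (n - 1) (b n)" ..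
    then have b: "b n \<in> carrier (grp V (n - 1))" "a n = diff V (n - 1) (b n)" for n by auto
    show "\<exists>b \<in> elts V. a = (\<lambda>n. diff V (n - 1) (b (n - 1)))"
      using b(1)[of "_ + 1"] b(2) by (intro bexI[of _ "\<lambda>n. b (n + 1)"]) (auto simp: elts_def)
  qed (auto simp: boundaries_def elts_def)
  have bd': "(\<exists>y \<in> im (eX V). emb V a = app (dX V) y) \<longleftrightarrow> (\<forall>n. a n \<in> boundaries V n)"
    if V: "V \<in> bounded_fg_complexes" and a: "a \<in> elts V" for V :: "'a cochain_complex" and a
    unfolding im_eX[OF bfcD(1)[OF V]] bd[symmetric]
    using dX[OF V] a by (auto simp: emb_eq_iff bfcD[OF V])
  have fm: "hat 0 X Y f \<in> dmap (KO X) (KO Y)" using hat_M0[OF assms] by (simp add: M0_def)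
  have inj: "(\<forall>x \<in> im (eX X). app (dX X) x = 0 \<longrightarrow> (\<exists>y \<in> im (eX Y). app (hat 0 X Y f) x = app (dX Y) y) \<longrightarrow>
      (\<exists>x' \<in> im (eX X). x = app (dX X) x')) \<longleftrightarrow>
    (\<forall>a \<in> elts X. (\<forall>n. a n \<in> cycles X n) \<longrightarrow> (\<forall>n. f n (a n) \<in> boundaries Y n) \<longrightarrow> (\<forall>n. a n \<in> boundaries X n))"
    unfolding im_eX[OF X(1)]
    using cyc[OF assms(1)] bd'[OF assms(1)] bd'[OF assms(2)] F by (simp add: im_eX[OF X(1)])
  have surj: "(\<forall>y \<in> im (eX Y). app (dX Y) y = 0 \<longrightarrow>
      (\<exists>x \<in> im (eX X). \<exists>y' \<in> im (eX Y). app (dX X) x = 0 \<and> y = app (hat 0 X Y f) x + app (dX Y) y')) \<longleftrightarrow>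
    (\<forall>c \<in> elts Y. (\<forall>n. c n \<in> cycles Y n) \<longrightarrow> (\<exists>a \<in> elts X. (\<forall>n. a n \<in> cycles X n) \<and>
      (\<exists>b. (\<forall>n. b n \<in> boundaries Y n) \<and> c = (\<lambda>n. f n (a n) \<otimes>\<^bsub>grp Y n\<^esub> b n))))" (is "?L \<longleftrightarrow> ?R")
  proof -
    have e: "(\<exists>y' \<in> im (eX Y). emb Y c = app (hat 0 X Y f) (emb X a) + app (dX Y) y') \<longleftrightarrow>
      (\<exists>b. (\<forall>n. b n \<in> boundaries Y n) \<and> c = (\<lambda>n. f n (a n) \<otimes>\<^bsub>grp Y n\<^esub> b n))"
      if c: "c \<in> elts Y" and a: "a \<in> elts X" for a c
    proof -
      have m: "(\<lambda>n. f n (a n) \<otimes>\<^bsub>grp Y n\<^esub> b n) \<in> elts Y" if "b \<in> elts Y" for b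
        using F(2)[OF a] that Y(1) by (simp add: elts_def comm_groupD)
      have "(\<exists>y' \<in> im (eX Y). emb Y c = app (hat 0 X Y f) (emb X a) + app (dX Y) y') \<longleftrightarrow>
        (\<exists>b \<in> elts Y. c = (\<lambda>n. f n (a n) \<otimes>\<^bsub>grp Y n\<^esub> diff Y (n - 1) (b (n - 1))))"
        unfolding im_eX[OF Y(1)]
        using F[OF a] dX[OF assms(2)] m c by (simp add: emb_add[OF Y(1)] emb_eq_iff[OF Y(1)])
      also have "\<dots> \<longleftrightarrow> (\<exists>b'. (\<exists>b \<in> elts Y. b' = (\<lambda>n. diff Y (n - 1) (b (n - 1)))) \<and>
          c = (\<lambda>n. f n (a n) \<otimes>\<^bsub>grp Y n\<^esub> b' n))" by auto
      finally show ?thesis unfolding bd .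
    qed
    show ?thesis unfolding im_eX[OF Y(1)]
      using cyc[OF assms(1)] cyc[OF assms(2)] e by (simp add: im_eX[OF X(1)] im_eX[OF Y(1)])
  qed
  have inj': "(\<forall>a \<in> elts X. (\<forall>n. a n \<in> cycles X n) \<longrightarrow> (\<forall>n. f n (a n) \<in> boundaries Y n) \<longrightarrow> (\<forall>n. a n \<in> boundaries X n))
    \<longleftrightarrow> (\<forall>n. \<forall>x \<in> cycles X n. f n x \<in> boundaries Y n \<longrightarrow> x \<in> boundaries X n)" (is "?L \<longleftrightarrow> ?R")
  proof
    assume L: ?L
    show ?R
    proof (intro allI ballI impI)
      fix n x assume x: "x \<in> cycles X n" "f n x \<in> boundaries Y n"
      \<comment> \<open>Units in the other degrees are cycles as well as boundaries, so the family
        satisfies the hypotheses everywhere.\<close>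
      let ?a = "\<lambda>m. if m = n then x else \<one>\<^bsub>grp X m\<^esub>"
      have z: "\<one>\<^bsub>grp V m\<^esub> \<in> cycles V m" "\<one>\<^bsub>grp V m\<^esub> \<in> boundaries V m" if "V \<in> bounded_fg_complexes" for V :: "'a cochain_complex" and m
        using boundaries_subgroup[OF that, of m] by (auto intro: subgroup.one_closed)
      have one: "f m \<one>\<^bsub>grp X m\<^esub> = \<one>\<^bsub>grp Y m\<^esub>" for m
        using f'(1) X(1) Y(1) by (intro hom_one) (auto simp: ghom_def comm_group.axioms)
      have "x \<in> carrier (grp X n)" using x(1) by (simp add: cycles_def kernel_def)
      then have a1: "?a \<in> elts X" using X(1) by (auto simp: elts_def comm_groupD)
      have a2: "\<forall>m. ?a m \<in> cycles X m" and a3: "\<forall>m. f m (?a m) \<in> boundaries Y m"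
        using x z[OF assms(1)] z[OF assms(2)] one by auto
      have "\<forall>m. ?a m \<in> boundaries X m" by (rule mp[OF mp[OF bspec[OF L a1] a2] a3])
      from spec[OF this, of n] show "x \<in> boundaries X n" by simp
    qed
  qed blast
  have surj': "(\<forall>c \<in> elts Y. (\<forall>n. c n \<in> cycles Y n) \<longrightarrow> (\<exists>a \<in> elts X. (\<forall>n. a n \<in> cycles X n) \<and>
      (\<exists>b. (\<forall>n. b n \<in> boundaries Y n) \<and> c = (\<lambda>n. f n (a n) \<otimes>\<^bsub>grp Y n\<^esub> b n))))
    \<longleftrightarrow> (\<forall>n. \<forall>y \<in> cycles Y n. \<exists>x \<in> cycles X n. \<exists>b \<in> boundaries Y n. y = b \<otimes>\<^bsub>grp Y n\<^esub> f n x)" (is "?L \<longleftrightarrow> ?R")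
  proof
    assume L: ?L
    show ?R
    proof (intro allI ballI)
      fix n y assume y: "y \<in> cycles Y n"
      let ?c = "\<lambda>m. if m = n then y else \<one>\<^bsub>grp Y m\<^esub>"
      have "y \<in> carrier (grp Y n)" using y by (simp add: cycles_def kernel_def)
      then have c: "?c \<in> elts Y" "\<forall>m. ?c m \<in> cycles Y m"
        using y Y(1) boundaries_subgroup(1)[OF assms(2)] by (auto simp: elts_def comm_groupD intro: subgroup.one_closed)
      obtain a b where ab: "a \<in> elts X" "\<forall>n. a n \<in> cycles X n" "\<forall>n. b n \<in> boundaries Y n"
        and eq: "?c = (\<lambda>n. f n (a n) \<otimes>\<^bsub>grp Y n\<^esub> b n)"
        using mp[OF bspec[OF L c(1)] c(2)] by blast
      have "y = f n (a n) \<otimes>\<^bsub>grp Y n\<^esub> b n" using fun_cong[OF eq, of n] by simp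
      also have "\<dots> = b n \<otimes>\<^bsub>grp Y n\<^esub> f n (a n)"
        using F(2)[OF ab(1)] ab(3) subgroup.mem_carrier[OF boundaries_subgroup(2)[OF assms(2)]] Y(1)
        by (auto simp: elts_def intro: comm_groupD(7))
      finally show "\<exists>x \<in> cycles X n. \<exists>b \<in> boundaries Y n. y = b \<otimes>\<^bsub>grp Y n\<^esub> f n x" using ab by blast
    qed
  next
    assume R: ?R
    show ?L
    proof (intro ballI impI)
      fix c assume c: "c \<in> elts Y" "\<forall>n. c n \<in> cycles Y n"
      \<comment> \<open>Cycle and boundary are paired so that a single use of choice selects
        both.\<close>
      then have "\<forall>n. \<exists>p. fst p \<in> cycles X n \<and> snd p \<in> boundaries Y n \<and> c n = snd p \<otimes>\<^bsub>grp Y n\<^esub> f n (fst p)"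
        using R by fastforce
      from choice[OF this] obtain p where "\<forall>n. fst (p n) \<in> cycles X n \<and> snd (p n) \<in> boundaries Y n \<and>
        c n = snd (p n) \<otimes>\<^bsub>grp Y n\<^esub> f n (fst (p n))" ..
      then have p: "fst (p n) \<in> cycles X n" "snd (p n) \<in> boundaries Y n" "c n = snd (p n) \<otimes>\<^bsub>grp Y n\<^esub> f n (fst (p n))" for n
        by auto
      have a: "(\<lambda>n. fst (p n)) \<in> elts X" using p(1) by (auto simp: elts_def cycles_def kernel_def)
      have "c n = f n (fst (p n)) \<otimes>\<^bsub>grp Y n\<^esub> snd (p n)" for n
        using p(3)[of n] F(2)[OF a] p(2) subgroup.mem_carrier[OF boundaries_subgroup(2)[OF assms(2)]] Y(1)
        by (auto simp: elts_def intro: comm_groupD(7))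
      then show "\<exists>a \<in> elts X. (\<forall>n. a n \<in> cycles X n) \<and>
        (\<exists>b. (\<forall>n. b n \<in> boundaries Y n) \<and> c = (\<lambda>n. f n (a n) \<otimes>\<^bsub>grp Y n\<^esub> b n))"
        using a p by (intro bexI[OF _ a] conjI exI[of _ "\<lambda>n. snd (p n)"]) auto
    qed
  qed
  show ?thesis
    unfolding qis_def qi_elem_def fst_KO snd_KO inj surj inj' surj' using fm by blast
qed

lemma qis_homotopic:
  assumes h: "heq A B f g" and f: "qis A B f" and A: "is_dobj A" "is_dobj B"
  shows "qis A B g"
proof -
  obtain k where k: "f = g + (snd B * k + k * snd A)" "fst B * k = k" "k * fst A = k" using h by (rule heqE_homotopy)
  have k': "app k x \<in> im (fst B)" for x using k(2) by (metis app_times im_iff)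
  have e: "app f x = app g x + app (snd B) (app k x)" if "app (snd A) x = 0" for x using that by (simp add: k(1))
  have im: "y + z \<in> im (fst B)" "y - z \<in> im (fst B)" if "y \<in> im (fst B)" "z \<in> im (fst B)" for y z
    using that by (simp_all add: im_iff)
  show ?thesis
    unfolding qis_def
  proof (intro conjI ballI impI)
    show "g \<in> dmap A B" using h by (rule heq_dmap)
  next
    fix x assume x: "x \<in> im (fst A)" "app (snd A) x = 0" "\<exists>y \<in> im (fst B). app g x = app (snd B) y"
    then obtain y where y: "y \<in> im (fst B)" "app g x = app (snd B) y" by blast
    then have "app f x = app (snd B) (y + app k x)" using e[OF x(2)] by simp
    then show "\<exists>x' \<in> im (fst A). x = app (snd A) x'" using f x im(1)[OF y(1) k'] unfolding qis_def by blast
  next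
    fix y assume y: "y \<in> im (fst B)" "app (snd B) y = 0"
    then obtain x y' where x: "x \<in> im (fst A)" "y' \<in> im (fst B)" "app (snd A) x = 0" "y = app f x + app (snd B) y'"
      using f unfolding qis_def by blast
    then have "y = app g x + app (snd B) (app k x + y')" using e[OF x(3)] by (simp add: add.assoc)
    then show "\<exists>x \<in> im (fst A). \<exists>y' \<in> im (fst B). app (snd A) x = 0 \<and> y = app g x + app (snd B) y'"
      using x im(1)[OF k' x(2)] by blast
  qed
qed

lemma quasi_isos_kc:
  assumes "X \<in> bounded_fg_complexes" "Y \<in> bounded_fg_complexes" and r: "r \<in> M0 X Y"
  shows "kc X Y r \<in> quasi_isos X Y \<longleftrightarrow> qis (KO X) (KO Y) r"
proof -
  have D: "is_dobj (KO X)" "is_dobj (KO Y)" using assms by (auto intro: is_dobj_KO)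
  have m: "kc X Y r \<in> Mor Kb X Y" using assms by (simp add: Hom_Kb FactGroup_def rcosets_kc)
  have "qi_elem X Y f \<longleftrightarrow> qis (KO X) (KO Y) r" if f: "f \<in> kc X Y r" for f
  proof -
    have f': "f \<in> chain_maps X Y" "hat 0 X Y f - r \<in> dnull (KO X) (KO Y)" using f by (auto simp: kc_def)
    then have "heq (KO X) (KO Y) (hat 0 X Y f) r" using r hat_M0[OF assms(1,2) f'(1)] by (simp add: heq_def M0_def)
    then show ?thesis
      using qis_homotopic[OF _ _ D] heq_sym qis_iff_elem[OF assms(1,2) f'(1)] by blast
  qed
  moreover have "f \<in> chain_maps X Y" if "f \<in> kc X Y r" for f using that by (simp add: kc_def)
  ultimately show ?thesis
    unfolding quasi_isos_def using m unhat_kc[OF assms] cohomology_map_iso_iff[OF assms(1,2)] by blast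
qed

section \<open>Folding\<close>

text \<open>\<open>ev\<close> and \<open>od\<close> spread the slots over the even and the odd ones;
  \<open>ev'\<close> and \<open>od'\<close> collect them again.\<close>

definition ev :: "'a uu endo" where "ev = Endo (\<lambda>u k n. if even k then u (k div 2) n else 0)"
definition od :: "'a uu endo" where "od = Endo (\<lambda>u k n. if odd k then u (k div 2) n else 0)"
definition ev' :: "'a uu endo" where "ev' = Endo (\<lambda>u k. u (2 * k))"
definition od' :: "'a uu endo" where "od' = Endo (\<lambda>u k. u (2 * k + 1))"

lemma app_doubling:
  "app ev u k n = (if even k then u (k div 2) n else 0)" "app od u k n = (if odd k then u (k div 2) n else 0)"
  "app ev' u k n = u (2 * k) n" "app od' u k n = u (2 * k + 1) n"
proof -
  have "app ev = (\<lambda>(u :: 'a uu) k n. if even k then u (k div 2) n else 0)"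
    "app od = (\<lambda>(u :: 'a uu) k n. if odd k then u (k div 2) n else 0)"
    "app ev' = (\<lambda>(u :: 'a uu) k. u (2 * k))" "app od' = (\<lambda>(u :: 'a uu) k. u (2 * k + 1))"
    unfolding ev_def od_def ev'_def od'_def by (rule app_Endo; simp add: fun_eq_iff)+
  then show "app ev u k n = (if even k then u (k div 2) n else 0)" "app od u k n = (if odd k then u (k div 2) n else 0)"
    "app ev' u k n = u (2 * k) n" "app od' u k n = u (2 * k + 1) n" by simp_all
qed

interpretation uu: endo_doubling ev od ev' od'
  by unfold_locales (rule uu_eqI; simp add: app_doubling)+

definition sigma :: "'a uu endo" where "sigma = Endo (\<lambda>u k n. sgi n (u k n))"

lemma app_sigma: "app sigma u k n = sgi n (u k n)"
proof -
  have "app sigma = (\<lambda>(u :: 'a uu) k n. sgi n (u k n))"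
    unfolding sigma_def by (rule app_Endo) (simp add: fun_eq_iff sgi_def)
  then show ?thesis by simp
qed

lemma sigma_sigma [simp]: "sigma * sigma = (1 :: 'a uu endo)" "sigma * (sigma * x) = (x :: 'a uu endo)"
proof -
  show "sigma * sigma = (1 :: 'a uu endo)" by (rule uu_eqI) (simp add: app_sigma sgi_def)
  then show "sigma * (sigma * x) = x" by (simp flip: mult.assoc)
qed

lemma deg_sigma: "deg 0 sigma"
  by (auto simp: deg_def rs_def fun_eq_iff app_sigma sgi_def)

lemma sigma_deg:
  fixes r :: "'a uu endo"
  assumes "deg i r" shows "sigma * r = sgi i (r * sigma)"
proof (rule uu_eqI)
  fix u :: "'a uu" and k n
  have s: "rs (n - i) (app sigma u) = sgi (n - i) (rs (n - i) u)"
    by (auto simp: rs_def fun_eq_iff app_sigma sgi_def)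
  have "app r (app sigma u) k n = app r (sgi (n - i) (rs (n - i) u)) k n"
    using degD_at[OF assms, of n "app sigma u" k] s by simp
  also have "\<dots> = sgi (n - i) (app r u k n)" using degD_at[OF assms, of n u k] by (simp add: sgi_def)
  finally show "app (sigma * r) u k n = app (sgi i (r * sigma)) u k n"
    by (auto simp: app_sigma sgi_def)
qed

text \<open>Folding a complex \<open>X\<close> into one differential group with differential \<open>(-1)\<^sup>n d\<close>; with this sign a
  chain map \<open>X \<rightarrow> Y[i]\<close> is a map of degree \<open>i\<close> commuting strictly with the differentials.\<close>

definition TO :: "'a cochain_complex \<Rightarrow> 'a uu endo \<times> 'a uu endo"
  where "TO X = (eX X, sigma * dX X)"

lemma fst_TO [simp]: "fst (TO X) = eX X" and snd_TO [simp]: "snd (TO X) = sigma * dX X"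
  by (simp_all add: TO_def)

lemma sigma_eX: "cgrp X \<Longrightarrow> sigma * eX X = eX X * sigma"
  using sigma_deg[OF deg_eX] by (simp add: sgi_def)

lemma sigma_dX: "X \<in> bounded_fg_complexes \<Longrightarrow> sigma * dX X = - (dX X * sigma)"
  using sigma_deg[OF deg_dX] by (simp add: sgi_def)

lemma is_dobj_TO:
  assumes "X \<in> bounded_fg_complexes" shows "is_dobj (TO X)"
proof -
  have "eX X * (sigma * dX X) = sigma * dX X"
    using sigma_eX[OF bfcD(1)[OF assms]] dX_unit(1)[OF assms] by (metis mult.assoc)
  moreover have "sigma * dX X * (sigma * dX X) = 0"
    using dX_unit(3)[OF assms] by (subst (1) sigma_dX[OF assms]) (simp add: mult.assoc)
  ultimately show ?thesis
    using dX_unit[OF assms] bfcD(1)[OF assms] by (simp add: is_dobj_def mult.assoc)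
qed

section \<open>Homogeneous components of folded maps\<close>

lemma deg_delta: "X \<in> bounded_fg_complexes \<Longrightarrow> deg 1 (sigma * dX X)"
  using deg_mult[OF deg_sigma deg_dX] by simp

lemma cmp_unit:
  assumes "cgrp X" "cgrp Y" "eX Y * r = r" "r * eX X = r"
  shows "eX Y * cmp i r = cmp i r" "cmp i r * eX X = cmp i r"
  using cmp_mult_left[OF deg_eX[OF assms(2)], of i r] cmp_mult_right[OF deg_eX[OF assms(1)], of i r] assms
  by simp_all

lemma dmap_cmp_TO:
  assumes X: "X \<in> bounded_fg_complexes" and Y: "Y \<in> bounded_fg_complexes" and r: "r \<in> dmap (TO X) (TO Y)"
  shows "cmp i r \<in> dmap (TO X) (TO Y)"
proof -
  have "sigma * dX Y * cmp i r = cmp i r * (sigma * dX X)"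
    using cmp_mult_left[OF deg_delta[OF Y], of i r] cmp_mult_right[OF deg_delta[OF X], of i r] r
    by (simp add: dmap_def add.commute)
  then show ?thesis
    using cmp_unit[OF bfcD(1)[OF X] bfcD(1)[OF Y], of r i] r by (auto simp: dmap_def)
qed

text \<open>Stated for arbitrary differentials of degree 1 so that it applies to a complex with
  \<open>d\<close> as well as to its folding with \<open>sigma * d\<close>. The component of degree
  \<open>i\<close> of a boundary is the boundary of the component of degree \<open>i - 1\<close> of
  the homotopy.\<close>

lemma dnull_cmp:
  assumes X: "X \<in> bounded_fg_complexes" and Y: "Y \<in> bounded_fg_complexes"
    and d: "snd A = \<delta>" "snd B = \<delta>'" "deg 1 \<delta>" "deg 1 \<delta>'" "fst A = eX X" "fst B = eX Y" and r: "r \<in> dnull A B"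
  shows "\<exists>h. deg (i - 1) h \<and> cmp i r = \<delta>' * h + h * \<delta> \<and> eX Y * h = h \<and> h * eX X = h"
proof -
  obtain h where h: "r = \<delta>' * h + h * \<delta>" "eX Y * h = h" "h * eX X = h" using r by (auto elim: dnullE simp: d)
  have "cmp i r = \<delta>' * cmp (i - 1) h + cmp (i - 1) h * \<delta>"
    using cmp_mult_left[OF d(4), of "i - 1" h] cmp_mult_right[OF d(3), of "i - 1" h] by (simp add: h(1))
  then show ?thesis using cmp_unit[OF bfcD(1)[OF X] bfcD(1)[OF Y] h(2,3)] by (intro exI[of _ "cmp (i - 1) h"]) simp
qed

lemma dnull_cmp_TO:
  assumes X: "X \<in> bounded_fg_complexes" and Y: "Y \<in> bounded_fg_complexes" and r: "r \<in> dnull (TO X) (TO Y)"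
  shows "cmp i r \<in> dnull (TO X) (TO Y)"
  using dnull_cmp[OF X Y snd_TO snd_TO deg_delta[OF X] deg_delta[OF Y] fst_TO fst_TO r, of i]
  by (auto intro: dnullI)

lemma dnull_cmp_KO:
  assumes X: "X \<in> bounded_fg_complexes" and Y: "Y \<in> bounded_fg_complexes" and r: "r \<in> dnull (KO X) (KO Y)"
  shows "cmp i r \<in> dnull (KO X) (KO Y)"
  using dnull_cmp[OF X Y snd_KO snd_KO deg_dX[OF X] deg_dX[OF Y] fst_KO fst_KO r, of i]
  by (auto intro: dnullI)

lemma tau_cancel: "tau i * x = tau i * y \<longleftrightarrow> x = y"
  by (metis tau_inverse(3))

lemma sgi_sgi [simp]: "sgi i (sgi i (x :: 'b :: group_add)) = x" by (simp add: sgi_def)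
lemma sgi_mult: "sgi i x * y = sgi i (x * (y :: 'b :: ring))" "x * sgi i y = sgi i (x * (y :: 'b :: ring))"
  by (simp_all add: sgi_def)
lemma sgi_swap: "sgi i x = y \<longleftrightarrow> x = sgi i (y :: 'b :: group_add)" by (auto simp: sgi_def)

text \<open>The differential of the shifted complex carries the sign of \<open>i\<close>, and moving
  \<open>sigma\<close> past a map of degree \<open>i\<close> produces the same sign. The two cancel,
  which is the reason for folding with \<open>sigma\<close>.\<close>

lemma KO_TO_dmap:
  assumes X: "X \<in> bounded_fg_complexes" and Y: "Y \<in> bounded_fg_complexes" and a: "deg i a"
  shows "tau i * a \<in> dmap (KO X) (KO (shift i Y)) \<longleftrightarrow> a \<in> dmap (TO X) (TO Y)"
proof -
  have 1: "eX (shift i Y) * (tau i * a) = tau i * a \<longleftrightarrow> eX Y * a = a"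
    using bfcD(1)[OF Y] by (simp add: eX_shift tconj_def mult.assoc tau_cancel)
  have 2: "tau i * a * eX X = tau i * a \<longleftrightarrow> a * eX X = a" by (simp add: mult.assoc tau_cancel)
  have 3: "dX (shift i Y) * (tau i * a) = tau i * sgi i (dX Y * a)"
    using Y by (simp add: dX_shift tconj_def mult.assoc sgi_mult)
  have "dX (shift i Y) * (tau i * a) = tau i * a * dX X \<longleftrightarrow> sgi i (dX Y * a) = a * dX X"
    unfolding 3 mult.assoc tau_cancel ..
  moreover have "sigma * (dX Y * a) = a * (sigma * dX X) \<longleftrightarrow> dX Y * a = sgi i (a * dX X)"
  proof -
    have "a * sigma = sgi i (sigma * a)" using sigma_deg[OF a] by simp
    then have "a * (sigma * dX X) = sgi i (sigma * a) * dX X" by (simp flip: mult.assoc)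
    also have "\<dots> = sigma * sgi i (a * dX X)" by (simp add: sgi_mult mult.assoc)
    finally show ?thesis by (metis sigma_sigma(2))
  qed
  ultimately show ?thesis using 1 2 by (auto simp: dmap_def mult.assoc sgi_swap)
qed

text \<open>Homotopies correspond by \<open>tau i * k\<close> and \<open>k * sigma\<close>. The
  factor \<open>sigma\<close> cancels against the one in the folded differential on the right; on
  the left the two copies of \<open>sigma\<close> around \<open>dX Y * k\<close>, which has degree
  \<open>i\<close>, leave the sign of \<open>i\<close>.\<close>

lemma KO_TO_dnull:
  assumes X: "X \<in> bounded_fg_complexes" and Y: "Y \<in> bounded_fg_complexes" and a: "deg i a"
  shows "tau i * a \<in> dnull (KO X) (KO (shift i Y)) \<longleftrightarrow> a \<in> dnull (TO X) (TO Y)"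
proof
  assume L: "tau i * a \<in> dnull (KO X) (KO (shift i Y))"
  have "deg 0 (tau i * a)" using deg_mult[OF deg_tau[of i] a] by simp
  then obtain h where h: "deg (- 1) h" "tau i * a = dX (shift i Y) * h + h * dX X" "eX (shift i Y) * h = h" "h * eX X = h"
    using dnull_cmp[OF X shift_bfc[OF Y, of i] snd_KO snd_KO deg_dX[OF X] deg_dX[OF shift_bfc[OF Y, of i]] fst_KO fst_KO L, of 0]
    by (auto simp: cmp_deg)
  define k where "k = tau (- i) * h"
  have k: "deg (i - 1) k" using deg_mult[OF deg_tau[of "- i"] h(1)] by (simp add: k_def)
  have h': "h = tau i * k" by (simp add: k_def)
  have 1: "tau i * a = tau i * (sgi i (dX Y * k) + k * dX X)"
    using h(2) Y by (simp add: h' dX_shift tconj_def mult.assoc sgi_mult distrib_left)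
  then have 2: "a = sgi i (dX Y * k) + k * dX X" by (simp only: tau_cancel)
  have u: "eX Y * k = k" "k * eX X = k"
    using h(3,4) bfcD(1)[OF Y] by (simp_all add: h' eX_shift tconj_def mult.assoc tau_cancel)
  have dk: "deg i (dX Y * k)" using deg_mult[OF deg_dX[OF Y] k] by simp
  have 3: "sigma * (dX Y * k) * sigma = sgi i (dX Y * k)"
    using sigma_deg[OF dk] by (simp add: mult.assoc sgi_mult)
  show "a \<in> dnull (TO X) (TO Y)"
  proof (rule dnullI[where h = "k * sigma"])
    show "a = snd (TO Y) * (k * sigma) + k * sigma * snd (TO X)"
      using 2 3 by (simp add: mult.assoc)
    show "fst (TO Y) * (k * sigma) = k * sigma" using u by (simp flip: mult.assoc)
    show "k * sigma * fst (TO X) = k * sigma"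
      using u sigma_eX[OF bfcD(1)[OF X]] by (simp add: mult.assoc) (simp flip: mult.assoc)
  qed
next
  assume R: "a \<in> dnull (TO X) (TO Y)"
  obtain k where k: "deg (i - 1) k" "a = sigma * dX Y * k + k * (sigma * dX X)" "eX Y * k = k" "k * eX X = k"
    using dnull_cmp[OF X Y snd_TO snd_TO deg_delta[OF X] deg_delta[OF Y] fst_TO fst_TO R, of i] a
    by (auto simp: cmp_deg)
  have dk: "deg i (dX Y * k)" using deg_mult[OF deg_dX[OF Y] k(1)] by simp
  have "sigma * (dX Y * k) = sgi i (dX Y * (k * sigma))"
    using sigma_deg[OF dk] by (simp add: mult.assoc)
  then have 2: "a = sgi i (dX Y * (k * sigma)) + k * sigma * dX X" using k(2) by (simp add: mult.assoc)
  show "tau i * a \<in> dnull (KO X) (KO (shift i Y))"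
  proof (rule dnullI[where h = "tau i * (k * sigma)"])
    show "tau i * a = snd (KO (shift i Y)) * (tau i * (k * sigma)) + tau i * (k * sigma) * snd (KO X)"
      using Y by (simp add: 2 dX_shift tconj_def mult.assoc sgi_mult distrib_left)
    show "fst (KO (shift i Y)) * (tau i * (k * sigma)) = tau i * (k * sigma)"
      using k(3) bfcD(1)[OF Y] by (simp add: eX_shift tconj_def mult.assoc tau_cancel) (simp flip: mult.assoc)
    show "tau i * (k * sigma) * fst (KO X) = tau i * (k * sigma)"
      using k(4) sigma_eX[OF bfcD(1)[OF X]] by (simp add: mult.assoc tau_cancel) (simp flip: mult.assoc)
  qed
qed

text \<open>\<open>sigma\<close> is invertible and anticommutes with the differential, so folding
  changes neither the cycles nor the boundaries.\<close>

lemma qis_KO_TO: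
  assumes X: "X \<in> bounded_fg_complexes" and Y: "Y \<in> bounded_fg_complexes" and q: "qis (KO X) (KO Y) q" "deg 0 q"
  shows "qis (TO X) (TO Y) q"
proof -
  have im: "app sigma y \<in> im (eX V)" if "y \<in> im (eX V)" "cgrp V" for y and V :: "'a cochain_complex"
    using that sigma_eX[OF that(2)] by (metis app_times im_iff)
  have z: "app sigma y = 0 \<longleftrightarrow> y = 0" for y :: "'a uu" by (metis app_0 app_one app_times sigma_sigma(1))
  have b: "(\<exists>y \<in> im (eX V). x = app sigma (app (dX V) y)) \<longleftrightarrow> (\<exists>y \<in> im (eX V). x = app (dX V) y)"
    if V: "V \<in> bounded_fg_complexes" for V :: "'a cochain_complex" and x
  proof -
    have c: "app sigma (app (dX V) y) = - app (dX V) (app sigma y)" for y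
      using arg_cong[OF sigma_dX[OF V], of "\<lambda>r. app r y"] by simp
    have ss: "app sigma (app sigma y) = y" for y :: "'a uu" by (simp flip: app_times)
    have n: "- app sigma y \<in> im (eX V)" if "y \<in> im (eX V)" for y
      using im[OF that bfcD(1)[OF V]] by (simp add: im_iff)
    show ?thesis
    proof
      assume "\<exists>y \<in> im (eX V). x = app sigma (app (dX V) y)"
      then obtain y where "y \<in> im (eX V)" "x = app sigma (app (dX V) y)" ..
      then show "\<exists>y \<in> im (eX V). x = app (dX V) y" using n by (intro bexI[of _ "- app sigma y"]) (auto simp: c)
    next
      assume "\<exists>y \<in> im (eX V). x = app (dX V) y"
      then obtain y where "y \<in> im (eX V)" "x = app (dX V) y" ..
      then show "\<exists>y \<in> im (eX V). x = app sigma (app (dX V) y)"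
        using n by (intro bexI[of _ "- app sigma y"]) (auto simp: c ss)
    qed
  qed
  have m: "q \<in> dmap (TO X) (TO Y)"
    using KO_TO_dmap[OF X Y q(2)] q(1) by (simp add: qis_def shift_0[OF Y])
  have s: "(\<exists>x \<in> im (eX X). \<exists>y' \<in> im (eX Y). app (dX X) x = 0 \<and> y = app q x + app sigma (app (dX Y) y'))
    \<longleftrightarrow> (\<exists>x \<in> im (eX X). \<exists>y' \<in> im (eX Y). app (dX X) x = 0 \<and> y = app q x + app (dX Y) y')" for y
  proof -
    have "(\<exists>y' \<in> im (eX Y). y = app q x + app sigma (app (dX Y) y')) \<longleftrightarrow>
      (\<exists>y' \<in> im (eX Y). y = app q x + app (dX Y) y')" for x
      using b[OF Y, of "y - app q x"] by (simp add: diff_eq_eq add.commute)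
    then show ?thesis by blast
  qed
  show ?thesis
    using q(1) m unfolding qis_def fst_TO snd_TO fst_KO snd_KO app_times z b[OF X] b[OF Y] s by blast
qed

section \<open>Free complexes and quasi-isomorphisms\<close>

definition free :: "'a cochain_complex \<Rightarrow> bool"
  where "free X \<longleftrightarrow> X \<in> bounded_fg_complexes \<and> fgfree (im (eX X))"

text \<open>The lifting lemma for differential groups ignores the grading; the degree 0 component of
  the lift it gives is again a lift, because \<open>t\<close> and \<open>a\<close> have degree
  0.\<close>

lemma free_lift_KO:
  assumes P: "free P" and W: "W \<in> bounded_fg_complexes" "W' \<in> bounded_fg_complexes"
    and t: "t \<in> M0 W W'" "qis (KO W) (KO W') t" and a: "a \<in> M0 P W'"
  shows "\<exists>b \<in> M0 P W. t * b - a \<in> dnull (KO P) (KO W')"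
proof -
  have P': "P \<in> bounded_fg_complexes" "fgfree (im (fst (KO P)))" using P by (auto simp: free_def)
  have a': "a \<in> dmap (KO P) (KO W')" "deg 0 a" "deg 0 t" using a t by (auto simp: M0_def)
  obtain b where b: "b \<in> dmap (KO P) (KO W)" "heq (KO P) (KO W') (t * b) a"
    using uu.qis_lift[OF is_dobj_KO[OF P'(1)] P'(2) is_dobj_KO[OF W(1)] is_dobj_KO[OF W(2)] t(2) a'(1)] .
  have "t * cmp 0 b - a = cmp 0 (t * b - a)"
    using cmp_mult_left[OF a'(3), of 0 b] a'(2) by (simp add: cmp_deg)
  also have "\<dots> \<in> dnull (KO P) (KO W')" using b(2) P' W by (intro dnull_cmp_KO) (auto simp: heq_def)
  finally have 1: "t * cmp 0 b - a \<in> dnull (KO P) (KO W')" .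
  have "dX W * cmp 0 b = cmp 0 b * dX P"
    using cmp_mult_left[OF deg_dX[OF W(1)], of 0 b] cmp_mult_right[OF deg_dX[OF P'(1)], of 0 b] b(1)
    by (simp add: dmap_def)
  then have "cmp 0 b \<in> M0 P W"
    using cmp_unit[OF bfcD(1)[OF P'(1)] bfcD(1)[OF W(1)], of b 0] b(1) by (auto simp: M0_def dmap_def)
  then show ?thesis using 1 by blast
qed

lemma free_cancel_KO:
  assumes P: "free P" and W: "W \<in> bounded_fg_complexes" "W' \<in> bounded_fg_complexes"
    and t: "qis (KO W) (KO W') t" and b: "b \<in> M0 P W" "t * b \<in> dnull (KO P) (KO W')"
  shows "b \<in> dnull (KO P) (KO W)"
  using uu.qis_cancel[OF is_dobj_KO _ is_dobj_KO[OF W(1)] is_dobj_KO[OF W(2)] t _ b(2)] P b(1)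
  by (auto simp: free_def M0_def)

lemma Kb_cases:
  assumes "X \<in> bounded_fg_complexes" "Y \<in> bounded_fg_complexes" "a \<in> Mor Kb X Y"
  obtains r where "r \<in> M0 X Y" "a = kc X Y r"
  using assms Kb.Phi_cases[of X Y a] by auto

lemma quasi_isos_cases:
  assumes "X \<in> bounded_fg_complexes" "Y \<in> bounded_fg_complexes" "a \<in> quasi_isos X Y"
  obtains r where "r \<in> M0 X Y" "a = kc X Y r" "qis (KO X) (KO Y) r"
proof -
  have "a \<in> Mor Kb X Y" using assms(3) by (simp add: quasi_isos_def)
  from Kb_cases[OF assms(1,2) this] obtain r where "r \<in> M0 X Y" "a = kc X Y r" .
  then show ?thesis using that assms by (simp add: quasi_isos_kc)
qed

text \<open>Existence is \<open>free_lift_KO\<close> and uniqueness is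
  \<open>free_cancel_KO\<close>: morphisms out of a free complex treat quasi-isomorphisms as
  invertible. This is the only property of resolutions that the analysis of roofs relies on.\<close>

lemma free_local:
  assumes P: "free P" and W: "W \<in> bounded_fg_complexes" "W' \<in> bounded_fg_complexes"
    and t: "t \<in> quasi_isos W W'" and a: "a \<in> Mor Kb P W'"
  shows "\<exists>!b. b \<in> Mor Kb P W \<and> Comp Kb P W W' t b = a"
proof -
  have P': "P \<in> bounded_fg_complexes" using P by (simp add: free_def)
  obtain t' where t': "t' \<in> M0 W W'" "t = kc W W' t'" "qis (KO W) (KO W') t'" using W t by (rule quasi_isos_cases)
  obtain a' where a': "a' \<in> M0 P W'" "a = kc P W' a'" using P' W(2) a by (rule Kb_cases)
  obtain b where b: "b \<in> M0 P W" "t' * b - a' \<in> dnull (KO P) (KO W')"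
    using free_lift_KO[OF P W t'(1,3) a'(1)] by blast
  have "Comp Kb P W W' t (kc P W b) = a"
    using b P' W t' a' M0_comp[OF b(1) t'(1)] by (simp add: kc_comp kc_eq_iff)
  moreover have "kc P W b \<in> Mor Kb P W" using Kb.Phi_closed[of P W b] P' W b by simp
  moreover have "c = d" if c: "c \<in> Mor Kb P W" "Comp Kb P W W' t c = a"
    and d: "d \<in> Mor Kb P W" "Comp Kb P W W' t d = a" for c d
  proof -
    obtain c' where c': "c' \<in> M0 P W" "c = kc P W c'" using P' W(1) c(1) by (rule Kb_cases)
    obtain d' where d': "d' \<in> M0 P W" "d = kc P W d'" using P' W(1) d(1) by (rule Kb_cases)
    have "t' * c' - t' * d' \<in> dnull (KO P) (KO W')"
      using c(2) d(2) P' W t' c' d' M0_comp[OF c'(1) t'(1)] M0_comp[OF d'(1) t'(1)] by (simp add: kc_comp kc_eq_iff[symmetric])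
    then have "t' * (c' - d') \<in> dnull (KO P) (KO W')" by (simp add: right_diff_distrib)
    then have "c' - d' \<in> dnull (KO P) (KO W)"
      using free_cancel_KO[OF P W t'(3) M0_diff[OF c'(1) d'(1)]] by blast
    then show ?thesis using P' W c' d' by (simp add: kc_eq_iff)
  qed
  ultimately show ?thesis by blast
qed

lemma quasi_isos_comp:
  assumes O: "X \<in> bounded_fg_complexes" "Y \<in> bounded_fg_complexes" "Z \<in> bounded_fg_complexes"
    and a: "a \<in> quasi_isos X Y" and b: "b \<in> quasi_isos Y Z"
  shows "Comp Kb X Y Z b a \<in> quasi_isos X Z"
proof -
  obtain r where r: "r \<in> M0 X Y" "a = kc X Y r" "qis (KO X) (KO Y) r" using O(1,2) a by (rule quasi_isos_cases)
  obtain q where q: "q \<in> M0 Y Z" "b = kc Y Z q" "qis (KO Y) (KO Z) q" using O(2,3) b by (rule quasi_isos_cases)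
  have qr: "q * r \<in> dmap (KO X) (KO Z)" using M0_comp[OF r(1) q(1)] by (simp add: M0_def)
  have m: "app r x \<in> im (eX Y)" "app q y \<in> im (eX Z)" "app (dX Y) (app r x) = app r (app (dX X) x)"
    "app (dX Z) (app q y) = app q (app (dX Y) y)" for x y
    using r(1) q(1) by (auto simp: M0_def dmap_def im_iff simp flip: app_times)
  have "qis (KO X) (KO Z) (q * r)"
    unfolding qis_def fst_KO snd_KO
  proof (intro conjI ballI impI qr)
    fix x assume x: "x \<in> im (eX X)" "app (dX X) x = 0" "\<exists>y \<in> im (eX Z). app (q * r) x = app (dX Z) y"
    have "app (dX Y) (app r x) = 0" using x(2) m by simp
    then have "\<exists>y \<in> im (eX Y). app r x = app (dX Y) y" using q(3) m(1) x(3) unfolding qis_def by simp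
    then show "\<exists>x' \<in> im (eX X). x = app (dX X) x'" using r(3) x(1,2) unfolding qis_def by simp
  next
    fix z assume z: "z \<in> im (eX Z)" "app (dX Z) z = 0"
    then obtain y z' where y: "y \<in> im (eX Y)" "z' \<in> im (eX Z)" "app (dX Y) y = 0" "z = app q y + app (dX Z) z'"
      using q(3) unfolding qis_def fst_KO snd_KO by blast
    then obtain x y' where x: "x \<in> im (eX X)" "y' \<in> im (eX Y)" "app (dX X) x = 0" "y = app r x + app (dX Y) y'"
      using r(3) unfolding qis_def fst_KO snd_KO by blast
    have "z = app (q * r) x + app (dX Z) (app q y' + z')" using y(4) x(4) m(4) by (simp add: add.assoc)
    moreover have "app q y' + z' \<in> im (eX Z)" using m(2)[of y'] y(2) by (simp add: im_iff)
    ultimately show "\<exists>x \<in> im (eX X). \<exists>y' \<in> im (eX Z). app (dX X) x = 0 \<and> z = app (q * r) x + app (dX Z) y'"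
      using x by blast
  qed
  then show ?thesis using O r q M0_comp[OF r(1) q(1)] by (simp add: kc_comp quasi_isos_kc)
qed

lemma quasi_isos_id: "X \<in> bounded_fg_complexes \<Longrightarrow> IdM Kb X \<in> quasi_isos X X"
proof -
  assume X: "X \<in> bounded_fg_complexes"
  have "qis (KO X) (KO X) (eX X)"
    unfolding qis_def fst_KO snd_KO
  proof (intro conjI ballI impI)
    show "eX X \<in> dmap (KO X) (KO X)" using M0_id[OF X] by (simp add: M0_def)
    show "\<exists>x' \<in> im (eX X). x = app (dX X) x'" if "x \<in> im (eX X)" "\<exists>y \<in> im (eX X). app (eX X) x = app (dX X) y" for x
      using that by (simp add: im_iff)
    show "\<exists>x \<in> im (eX X). \<exists>y' \<in> im (eX X). app (dX X) x = 0 \<and> y = app (eX X) x + app (dX X) y'"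
      if "y \<in> im (eX X)" "app (dX X) y = 0" for y
      using that by (intro bexI[of _ y] bexI[of _ 0]) (auto simp: im_iff)
  qed
  then show ?thesis using X Kb.Phi_id[of X] by (simp add: quasi_isos_kc M0_id flip: Kb.Phi_id)
qed

text \<open>\<open>tau i\<close> carries cycles and boundaries to those of the shifted complex; the
  sign of the shifted differential is moved into the preimage chosen for a boundary.\<close>

lemma quasi_isos_shift:
  assumes X: "X \<in> bounded_fg_complexes" and Y: "Y \<in> bounded_fg_complexes" and a: "a \<in> quasi_isos X Y"
  shows "shift_Kb_mor i a \<in> quasi_isos (shift i X) (shift i Y)"
proof -
  obtain r where r: "r \<in> M0 X Y" "a = kc X Y r" "qis (KO X) (KO Y) r" using X Y a by (rule quasi_isos_cases)
  note c = M0_shift[OF X Y r(1), of i]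
  have inv: "app (tau i) (app (tau (- i)) x) = x" "app (tau (- i)) (app (tau i) x) = x" for x :: "'a uu"
    by (simp_all flip: app_times)
  have im: "x \<in> im (eX (shift i V)) \<longleftrightarrow> app (tau (- i)) x \<in> im (eX V)" if "V \<in> bounded_fg_complexes" for x and V :: "'a cochain_complex"
    using bfcD(1)[OF that] inv by (simp add: im_iff eX_shift tconj_def) metis
  have d: "app (dX (shift i V)) x = sgi i (app (tau i) (app (dX V) (app (tau (- i)) x)))"
    if "V \<in> bounded_fg_complexes" for x and V :: "'a cochain_complex"
    using that by (simp add: dX_shift tconj_def sgi_def)
  have t0: "app (tau i) x = 0 \<longleftrightarrow> x = 0" for x :: "'a uu" by (metis app_0 inv(2))
  have neg: "- x \<in> im (eX V) \<longleftrightarrow> x \<in> im (eX V)" for x and V :: "'a cochain_complex" by (simp add: im_iff)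
  have "qis (KO (shift i X)) (KO (shift i Y)) (tconj i r)"
    unfolding qis_def fst_KO snd_KO
  proof (intro conjI ballI impI)
    show "tconj i r \<in> dmap (KO (shift i X)) (KO (shift i Y))" using c by (simp add: M0_def)
  next
    fix x assume x: "x \<in> im (eX (shift i X))" "app (dX (shift i X)) x = 0"
      "\<exists>y \<in> im (eX (shift i Y)). app (tconj i r) x = app (dX (shift i Y)) y"
    then obtain y where y: "app (tau (- i)) y \<in> im (eX Y)" "app (tconj i r) x = app (dX (shift i Y)) y" by (auto simp: im[OF Y])
    have "app (dX X) (app (tau (- i)) x) = 0"
      using x(2) t0 by (simp add: d[OF X] sgi_def split: if_splits)
    moreover have "app r (app (tau (- i)) x) = app (dX Y) (sgi i (app (tau (- i)) y))"
    proof -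
      have "app (tau i) (app r (app (tau (- i)) x)) = app (tau i) (app (dX Y) (sgi i (app (tau (- i)) y)))"
        using y(2) by (simp add: tconj_def d[OF Y] sgi_def split: if_splits)
      then show ?thesis by (metis inv(2))
    qed
    moreover have "sgi i (app (tau (- i)) y) \<in> im (eX Y)" using y(1) by (simp add: sgi_def neg)
    moreover have "app (tau (- i)) x \<in> im (eX X)" using x(1) by (simp add: im[OF X])
    ultimately obtain z where z: "z \<in> im (eX X)" "app (tau (- i)) x = app (dX X) z" using r(3) unfolding qis_def fst_KO snd_KO by blast
    have "x = app (dX (shift i X)) (sgi i (app (tau i) z))"
      using arg_cong[OF z(2), of "app (tau i)"] by (simp add: d[OF X] inv sgi_def)
    moreover have "sgi i (app (tau i) z) \<in> im (eX (shift i X))" using z(1) by (simp add: im[OF X] sgi_def inv neg)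
    ultimately show "\<exists>x' \<in> im (eX (shift i X)). x = app (dX (shift i X)) x'" by blast
  next
    fix y assume y: "y \<in> im (eX (shift i Y))" "app (dX (shift i Y)) y = 0"
    have "app (dX Y) (app (tau (- i)) y) = 0"
      using y(2) t0 by (simp add: d[OF Y] sgi_def split: if_splits)
    moreover have "app (tau (- i)) y \<in> im (eX Y)" using y(1) by (simp add: im[OF Y])
    ultimately obtain x y' where x: "x \<in> im (eX X)" "y' \<in> im (eX Y)" "app (dX X) x = 0"
      "app (tau (- i)) y = app r x + app (dX Y) y'" using r(3) unfolding qis_def fst_KO snd_KO by blast
    let ?x = "app (tau i) x" and ?y = "sgi i (app (tau i) y')"
    have "y = app (tau i) (app r x + app (dX Y) y')" using arg_cong[OF x(4), of "app (tau i)"] by (simp add: inv del: app_add)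
    then have "y = app (tconj i r) ?x + app (dX (shift i Y)) ?y" by (simp add: tconj_def d[OF Y] inv sgi_def)
    moreover have "?x \<in> im (eX (shift i X))" "?y \<in> im (eX (shift i Y))" "app (dX (shift i X)) ?x = 0"
      using x by (simp_all add: im[OF X] im[OF Y] inv d[OF X] sgi_def neg)
    ultimately show "\<exists>x \<in> im (eX (shift i X)). \<exists>y' \<in> im (eX (shift i Y)). app (dX (shift i X)) x = 0 \<and>
      y = app (tconj i r) x + app (dX (shift i Y)) y'" by blast
  qed
  then show ?thesis using X Y c r(2) by (simp add: shift_kc quasi_isos_kc shift_bfc)
qed

section \<open>Free resolutions\<close>

lemma generate_fgfree:
  assumes G: "comm_group G" and Q: "fgfree Q" and \<kappa>: "bij_betw \<kappa> Q (carrier G)"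
    "\<And>x y. \<lbrakk>x \<in> Q; y \<in> Q\<rbrakk> \<Longrightarrow> \<kappa> (x + y) = \<kappa> x \<otimes>\<^bsub>G\<^esub> \<kappa> y"
  shows "finitely_generated G"
proof -
  interpret comm_group G by fact
  note q = subgpD[OF fgfree_subgp[OF Q]]
  have c: "\<kappa> x \<in> carrier G" if "x \<in> Q" for x using \<kappa>(1) that by (auto simp: bij_betw_def)
  have k0: "\<kappa> 0 = \<one>\<^bsub>G\<^esub>" using \<kappa>(2)[OF q(1) q(1)] c[OF q(1)] by simp
  have kn: "\<kappa> (- x) = inv\<^bsub>G\<^esub> \<kappa> x" if "x \<in> Q" for x
    using \<kappa>(2)[OF q(3)[OF that] that] k0 c[OF that] c[OF q(3)[OF that]] by (intro inv_equality[symmetric]) auto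
  obtain S where S: "finite S" "S \<subseteq> Q" "\<And>H. \<lbrakk>subgp H; S \<subseteq> H\<rbrakk> \<Longrightarrow> Q \<subseteq> H"
    using Q by (rule fgfree_finite_generators) blast
  have sub: "\<kappa> ` S \<subseteq> carrier G" using S(2) c by auto
  let ?H = "{x \<in> Q. \<kappa> x \<in> generate G (\<kappa> ` S)}"
  have "subgp ?H"
    unfolding subgp_def
  proof (intro conjI ballI)
    show "0 \<in> ?H" using q(1) k0 by (simp add: generate.one)
    fix x y assume xy: "x \<in> ?H" "y \<in> ?H"
    then have "\<kappa> (x + - y) = \<kappa> x \<otimes>\<^bsub>G\<^esub> inv\<^bsub>G\<^esub> \<kappa> y" using \<kappa>(2)[of x "- y"] q kn by simp
    moreover have "inv\<^bsub>G\<^esub> \<kappa> y \<in> generate G (\<kappa> ` S)" using xy sub by (simp add: generate_m_inv_closed)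
    ultimately show "x - y \<in> ?H" using xy q by (simp add: generate.eng)
  qed
  moreover have "S \<subseteq> ?H" using S(2) by (auto intro: generate.incl)
  ultimately have "Q \<subseteq> ?H" by (rule S(3))
  then have "\<kappa> ` Q \<subseteq> generate G (\<kappa> ` S)" by blast
  then have "carrier G \<subseteq> generate G (\<kappa> ` S)" using bij_betw_imp_surj_on[OF \<kappa>(1)] by simp
  then have "generate G (\<kappa> ` S) = carrier G" using generate_in_carrier[OF sub] by auto
  then show ?thesis unfolding finitely_generated_def using S(1) sub by (intro exI[of _ "\<kappa> ` S"]) auto
qed

text \<open>The constructions below produce groups in other types such as pairs of functions. Free
  groups being countable, they can be copied into any infinite type \<open>'a\<close>, with
  operations defined through the bijections \<open>\<kappa> n\<close>.\<close>

lemma free_complex_transport: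
  fixes Q :: "int \<Rightarrow> 't::ab_group_add set" and d :: "int \<Rightarrow> 't \<Rightarrow> 't"
  assumes inf: "infinite (UNIV :: 'a set)" and Q: "\<And>n. fgfree (Q n)"
    and d: "\<And>n. additive_on (Q n) (d n)" "\<And>n x. x \<in> Q n \<Longrightarrow> d n x \<in> Q (n + 1)" "\<And>n x. x \<in> Q n \<Longrightarrow> d (n + 1) (d n x) = 0"
    and fin: "finite {n. Q n \<noteq> {0}}"
  obtains P :: "'a cochain_complex" and \<kappa> where "free P" "\<And>n. bij_betw (\<kappa> n) (Q n) (carrier (grp P n))"
    "\<And>n x y. \<lbrakk>x \<in> Q n; y \<in> Q n\<rbrakk> \<Longrightarrow> \<kappa> n (x + y) = \<kappa> n x \<otimes>\<^bsub>grp P n\<^esub> \<kappa> n y"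
    "\<And>n x. x \<in> Q n \<Longrightarrow> diff P n (\<kappa> n x) = \<kappa> (n + 1) (d n x)"
proof -
  note q = subgpD[OF fgfree_subgp[OF Q]]
  \<comment> \<open>Here the infinity of the type enters.\<close>
  obtain g :: "nat \<Rightarrow> 'a" where g: "inj g" using infinite_countable_subset[OF inf] by auto
  define \<kappa> where "\<kappa> n = g \<circ> to_nat_on (Q n)" for n
  have inj: "inj_on (\<kappa> n) (Q n)" for n
    unfolding \<kappa>_def by (intro comp_inj_on inj_on_to_nat_on fgfree_countable Q inj_on_subset[OF g subset_UNIV])
  define \<iota> where "\<iota> n = the_inv_into (Q n) (\<kappa> n)" for n
  have \<iota>: "\<iota> n (\<kappa> n x) = x" if "x \<in> Q n" for n x
    unfolding \<iota>_def using the_inv_into_f_f[OF inj that] .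
  define P where "P = \<lparr>grp = (\<lambda>n. \<lparr>carrier = \<kappa> n ` Q n, monoid.mult = (\<lambda>a b. \<kappa> n (\<iota> n a + \<iota> n b)), one = \<kappa> n 0\<rparr>),
    diff = (\<lambda>n. \<lambda>a \<in> \<kappa> n ` Q n. \<kappa> (n + 1) (d n (\<iota> n a)))\<rparr>"
  have car: "carrier (grp P n) = \<kappa> n ` Q n" and one: "\<one>\<^bsub>grp P n\<^esub> = \<kappa> n 0" for n by (simp_all add: P_def)
  have mult: "\<kappa> n x \<otimes>\<^bsub>grp P n\<^esub> \<kappa> n y = \<kappa> n (x + y)" if "x \<in> Q n" "y \<in> Q n" for n x y
    using that by (simp add: P_def \<iota>)
  have dif: "diff P n (\<kappa> n x) = \<kappa> (n + 1) (d n x)" if "x \<in> Q n" for n x using that by (simp add: P_def \<iota>)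
  have cg: "comm_group (grp P n)" for n
  proof (rule comm_groupI)
    show "\<one>\<^bsub>grp P n\<^esub> \<in> carrier (grp P n)" using q(1) by (simp add: car one)
    fix a assume "a \<in> carrier (grp P n)"
    then obtain x where x: "x \<in> Q n" "a = \<kappa> n x" by (auto simp: car)
    show "\<one>\<^bsub>grp P n\<^esub> \<otimes>\<^bsub>grp P n\<^esub> a = a" using x q(1) by (simp add: one mult)
    show "\<exists>b \<in> carrier (grp P n). b \<otimes>\<^bsub>grp P n\<^esub> a = \<one>\<^bsub>grp P n\<^esub>"
      using x q(3) by (intro bexI[of _ "\<kappa> n (- x)"]) (simp_all add: car one mult)
    fix b assume "b \<in> carrier (grp P n)"
    then obtain y where y: "y \<in> Q n" "b = \<kappa> n y" by (auto simp: car)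
    show "a \<otimes>\<^bsub>grp P n\<^esub> b \<in> carrier (grp P n)" using x y q(4) by (simp add: car mult)
    show "a \<otimes>\<^bsub>grp P n\<^esub> b = b \<otimes>\<^bsub>grp P n\<^esub> a" using x y by (simp add: mult add.commute)
    fix c assume "c \<in> carrier (grp P n)"
    then obtain z where z: "z \<in> Q n" "c = \<kappa> n z" by (auto simp: car)
    show "a \<otimes>\<^bsub>grp P n\<^esub> b \<otimes>\<^bsub>grp P n\<^esub> c = a \<otimes>\<^bsub>grp P n\<^esub> (b \<otimes>\<^bsub>grp P n\<^esub> c)"
      using x y z q(4) by (simp add: mult add.assoc)
  qed
  have bij: "bij_betw (\<kappa> n) (Q n) (carrier (grp P n))" for n using inj by (simp add: bij_betw_def car)
  have fg: "finitely_generated (grp P n)" for n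
    using generate_fgfree[OF cg Q bij] by (simp add: mult)
  have hom: "diff P n \<in> ehom (grp P n) (grp P (n + 1))" for n
  proof -
    have "diff P n (\<kappa> n x \<otimes>\<^bsub>grp P n\<^esub> \<kappa> n y) = diff P n (\<kappa> n x) \<otimes>\<^bsub>grp P (n + 1)\<^esub> diff P n (\<kappa> n y)"
      if "x \<in> Q n" "y \<in> Q n" for x y
      using that d(2) additive_onD(2)[OF fgfree_subgp[OF Q] d(1)] by (simp add: mult dif q(4))
    moreover have "diff P n (\<kappa> n x) \<in> carrier (grp P (n + 1))" if "x \<in> Q n" for x
      using that d(2) by (simp add: dif car)
    ultimately show ?thesis unfolding ehom_def hom_def by (auto simp: car) (simp add: P_def)
  qed
  have dd: "diff P (n + 1) (diff P n a) = \<one>\<^bsub>grp P (n + 2)\<^esub>" if "a \<in> carrier (grp P n)" for n a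
    using that d(2,3) by (auto simp: car dif one add.assoc)
  have "{n. carrier (grp P n) \<noteq> {\<one>\<^bsub>grp P n\<^esub>}} \<subseteq> {n. Q n \<noteq> {0}}" by (auto simp: car one)
  then have fin': "finite (supp P)" unfolding supp_def using fin by (rule finite_subset)
  then have bfc: "P \<in> bounded_fg_complexes"
    using cg fg hom dd by (simp add: bounded_fg_complexes_def supp_def)
  note c = bfcD(1)[OF bfc]
  have "fgfree (im (eX P))"
  \<comment> \<open>An element of the total group vanishes when its members in the finitely many
    degrees of the support do, so these members are jointly injective.\<close>
  proof (rule fgfree_joint[where I = "supp P" and P = Q and \<psi> = "\<lambda>n u. \<iota> n (pr (u 0 n) (grp P n))"])
    show "subgp (im (eX P))" by (rule subgp_im)
    show "finite (supp P)" by (rule fin')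
    have pi: "\<exists>x \<in> Q n. pr v (grp P n) = \<kappa> n x" for v n using pr_closed[OF cg] by (auto simp: car)
    fix n
    show "fgfree (Q n)" by (rule Q)
    show "\<iota> n (pr (u 0 n) (grp P n)) \<in> Q n" for u using pi[of n "u 0 n"] \<iota> by auto
    show "additive_on (im (eX P)) (\<lambda>u. \<iota> n (pr (u 0 n) (grp P n)))"
      unfolding additive_on_def
    proof (intro ballI)
      fix u v :: "'a uu"
      obtain x y where "x \<in> Q n" "y \<in> Q n" "pr (u 0 n) (grp P n) = \<kappa> n x" "pr (v 0 n) (grp P n) = \<kappa> n y"
        using pi[of n "u 0 n"] pi[of n "v 0 n"] by blast
      then show "\<iota> n (pr ((u + v) 0 n) (grp P n)) = \<iota> n (pr (u 0 n) (grp P n)) + \<iota> n (pr (v 0 n) (grp P n))"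
        using cg q(4) by (simp add: mult \<iota>)
    qed
  next
    fix u assume u: "u \<in> im (eX P)" and z: "\<And>n. n \<in> supp P \<Longrightarrow> \<iota> n (pr (u 0 n) (grp P n)) = 0"
    have "u k n = 0" for k n
    proof (cases "n \<in> supp P")
      case True
      obtain x where x: "x \<in> Q n" "pr (u 0 n) (grp P n) = \<kappa> n x" using pr_closed[OF cg, of "u 0 n" n] by (auto simp: car)
      then have "pr (u 0 n) (grp P n) = \<one>\<^bsub>grp P n\<^esub>" using z[OF True] \<iota>[OF x(1)] by (simp add: one)
      then have "app (eX P) u k n = 0" using c cg by (simp add: app_eX)
      then show ?thesis using u by (simp add: im_iff)
    next
      case False
      then show ?thesis using eX_outside[OF c False, of u k] u by (simp add: im_iff)
    qed
    then show "u = 0" by (simp add: fun_eq_iff)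
  qed
  then have "free P" using bfc by (simp add: free_def)
  then show ?thesis using bij mult dif by (intro that[of P \<kappa>]) auto
qed

section \<open>Free covers and resolutions\<close>

lemma supported_functions_fgfree:
  assumes "finite S" shows "fgfree {v :: 'a \<Rightarrow> int. \<forall>x. x \<notin> S \<longrightarrow> v x = 0}"
  unfolding fgfree_def
proof (intro conjI exI[of _ "(\<lambda>x v. v x) ` S"])
  show "subgp {v :: 'a \<Rightarrow> int. \<forall>x. x \<notin> S \<longrightarrow> v x = 0}" by (auto simp: subgp_def)
  show "finite ((\<lambda>x v. v x) ` S)" using assms by simp
  show "\<forall>\<phi> \<in> (\<lambda>x v. v x) ` S. additive_on {v :: 'a \<Rightarrow> int. \<forall>x. x \<notin> S \<longrightarrow> v x = 0} \<phi>"
    by (auto simp: additive_on_def)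
  show "\<forall>v \<in> {v :: 'a \<Rightarrow> int. \<forall>x. x \<notin> S \<longrightarrow> v x = 0}. (\<forall>\<phi> \<in> (\<lambda>x v. v x) ` S. \<phi> v = 0) \<longrightarrow> v = 0"
    by (auto simp: fun_eq_iff)
qed

lemma subgp_inc: 
  assumes "comm_group G" shows "subgp (inc G ` carrier G)"
  unfolding subgp_def
proof (intro conjI ballI)
  show "0 \<in> inc G ` carrier G" using assms by (intro image_eqI[of _ _ "\<one>\<^bsub>G\<^esub>"]) (simp_all add: comm_groupD)
  fix v w assume "v \<in> inc G ` carrier G" "w \<in> inc G ` carrier G"
  then obtain x y where "x \<in> carrier G" "y \<in> carrier G" "v = inc G x" "w = inc G y" by blast
  then show "v - w \<in> inc G ` carrier G"
    using assms by (intro image_eqI[of _ _ "x \<otimes>\<^bsub>G\<^esub> inv\<^bsub>G\<^esub> y"]) (simp_all add: comm_groupD inc_mult inc_inv)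
qed

lemma free_cover:
  fixes G :: "'a monoid"
  assumes G: "comm_group G" "finitely_generated G"
  obtains F and \<epsilon> :: "('a \<Rightarrow> int) \<Rightarrow> 'a univ" where "fgfree F" "additive_on F \<epsilon>" "\<epsilon> ` F = inc G ` carrier G"
    "carrier G = {\<one>\<^bsub>G\<^esub>} \<Longrightarrow> F = {0}"
proof -
  interpret comm_group G by (rule G(1))
  \<comment> \<open>A trivial group gets the empty set of generators, so that its cover is trivial
    too; this keeps resolutions bounded.\<close>
  have "\<exists>S. finite S \<and> S \<subseteq> carrier G \<and> generate G S = carrier G \<and> (carrier G = {\<one>\<^bsub>G\<^esub>} \<longrightarrow> S = {})"
  proof (cases "carrier G = {\<one>\<^bsub>G\<^esub>}")
    case True
    then show ?thesis by (intro exI[of _ "{}"]) (simp add: generate_empty)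
  next
    case False
    then show ?thesis using G(2) by (auto simp: finitely_generated_def)
  qed
  then obtain S where S: "finite S" "S \<subseteq> carrier G" "generate G S = carrier G" "carrier G = {\<one>\<^bsub>G\<^esub>} \<Longrightarrow> S = {}"
    by blast
  define F where "F = {v :: 'a \<Rightarrow> int. \<forall>x. x \<notin> S \<longrightarrow> v x = 0}"
  define \<epsilon> where "\<epsilon> v = (\<Sum>x\<in>S. zmul (v x) (inc G x))" for v :: "'a \<Rightarrow> int"
  have F: "fgfree F" unfolding F_def using S(1) by (rule supported_functions_fgfree)
  have a: "additive_on F \<epsilon>" by (simp add: additive_on_def \<epsilon>_def zmul_add sum.distrib)
  note V = subgp_inc[OF G(1)]
  have "\<epsilon> v \<in> inc G ` carrier G" for v
  proof -
    have "(\<Sum>x\<in>T. zmul (v x) (inc G x)) \<in> inc G ` carrier G" if "finite T" "T \<subseteq> S" for T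
      using that
    proof (induction T rule: finite_induct)
      case (insert x T)
      then show ?case using S(2) by (auto intro!: subgpD(4)[OF V] zmul_mem[OF V])
    qed (simp add: subgpD(1)[OF V])
    then show ?thesis using S(1) by (simp add: \<epsilon>_def)
  qed
  moreover have "inc G x \<in> \<epsilon> ` F" if "x \<in> carrier G" for x
  proof -
    note q = subgpD[OF fgfree_subgp[OF F]] and e = additive_onD[OF fgfree_subgp[OF F] a]
    have gc: "y \<in> carrier G" if "y \<in> generate G S" for y using S(2) that generate_in_carrier by blast
    have "x \<in> generate G S" using that S(3) by simp
    then show ?thesis
    proof (induction rule: generate.induct)
      case one
      show ?case by (rule image_eqI[of _ _ 0]) (simp_all only: inc_one[OF G(1)] e(1) q(1))
    next
      case (incl h)
      let ?v = "\<lambda>x. if x = h then 1 else 0 :: int"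
      have "\<epsilon> ?v = (\<Sum>x\<in>S. if x = h then inc G x else 0)"
        unfolding \<epsilon>_def using zmul_succ[of 0] by (intro sum.cong) auto
      then have "\<epsilon> ?v = inc G h" using S(1) incl by (simp add: sum.delta)
      then show ?case using incl by (intro image_eqI[of _ _ ?v]) (auto simp: F_def)
    next
      case (inv h)
      let ?v = "\<lambda>x. if x = h then - 1 else 0 :: int"
      have "\<epsilon> ?v = (\<Sum>x\<in>S. if x = h then - inc G x else 0)"
        unfolding \<epsilon>_def using zmul_pred[of 0] by (intro sum.cong) auto
      then have "\<epsilon> ?v = inc G (inv\<^bsub>G\<^esub> h)" using S(1,2) inv G(1) by (auto simp: sum.delta inc_inv)
      then show ?case using inv by (intro image_eqI[of _ _ ?v]) (auto simp: F_def)
    next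
      case (eng h1 h2)
      then obtain v w where vw: "v \<in> F" "w \<in> F" "inc G h1 = \<epsilon> v" "inc G h2 = \<epsilon> w" by blast
      then have "inc G (h1 \<otimes>\<^bsub>G\<^esub> h2) = \<epsilon> (v + w)"
        using inc_mult[OF G(1) gc[OF eng(1)] gc[OF eng(2)]] e(2)[OF vw(1,2)] by argo
      then show ?case using q(4)[OF vw(1,2)] by (rule image_eqI)
    qed
  qed
  ultimately have "\<epsilon> ` F = inc G ` carrier G" by blast
  moreover have "F = {0}" if "carrier G = {\<one>\<^bsub>G\<^esub>}" using S(4)[OF that] by (auto simp: F_def fun_eq_iff)
  ultimately show ?thesis using that F a by blast
qed

text \<open>Free resolution without induction: with \<open>F\<^sup>n\<close> mapping onto \<open>X\<^sup>n\<close>, take the preimages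
  \<open>Z \<supseteq> K\<close> of cycles and boundaries and put \<open>P\<^sup>n = Z\<^sup>n \<oplus> K\<^sup>n\<^sup>+\<^sup>1\<close> with \<open>d (a, k) = (k, 0)\<close>. Boundedness
  on the left is possible because subgroups of free groups are free.\<close>

lemma free_resolution:
  fixes X :: "'a cochain_complex"
  assumes inf: "infinite (UNIV :: 'a set)" and X: "X \<in> bounded_fg_complexes"
  obtains P p where "free P" "p \<in> M0 P X" "qis (KO P) (KO X) p"
proof -
  note XD = bfcD[OF X]
  have cg: "comm_group (grp X n)" for n using XD(1) by simp
  have "\<forall>n. \<exists>Fe :: ('a \<Rightarrow> int) set \<times> (('a \<Rightarrow> int) \<Rightarrow> 'a univ). fgfree (fst Fe) \<and> additive_on (fst Fe) (snd Fe) \<and>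
    snd Fe ` fst Fe = inc (grp X n) ` carrier (grp X n) \<and> (carrier (grp X n) = {\<one>\<^bsub>grp X n\<^esub>} \<longrightarrow> fst Fe = {0})"
  proof
    fix n
    obtain F and \<epsilon> :: "('a \<Rightarrow> int) \<Rightarrow> 'a univ" where "fgfree F" "additive_on F \<epsilon>"
      "\<epsilon> ` F = inc (grp X n) ` carrier (grp X n)" "carrier (grp X n) = {\<one>\<^bsub>grp X n\<^esub>} \<Longrightarrow> F = {0}"
      using free_cover[OF cg XD(6), of n] by metis
    then show "\<exists>Fe :: ('a \<Rightarrow> int) set \<times> (('a \<Rightarrow> int) \<Rightarrow> 'a univ). fgfree (fst Fe) \<and> additive_on (fst Fe) (snd Fe) \<and>
      snd Fe ` fst Fe = inc (grp X n) ` carrier (grp X n) \<and> (carrier (grp X n) = {\<one>\<^bsub>grp X n\<^esub>} \<longrightarrow> fst Fe = {0})"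
      by (intro exI[of _ "(F, \<epsilon>)"]) simp
  qed
  from choice[OF this] obtain Fe :: "int \<Rightarrow> ('a \<Rightarrow> int) set \<times> (('a \<Rightarrow> int) \<Rightarrow> 'a univ)" where
    Fe: "\<forall>n. fgfree (fst (Fe n)) \<and> additive_on (fst (Fe n)) (snd (Fe n)) \<and>
    snd (Fe n) ` fst (Fe n) = inc (grp X n) ` carrier (grp X n) \<and> (carrier (grp X n) = {\<one>\<^bsub>grp X n\<^esub>} \<longrightarrow> fst (Fe n) = {0})" ..
  define F \<epsilon> where "F n = fst (Fe n)" and "\<epsilon> n = snd (Fe n)" for n
  have F: "fgfree (F n)" "additive_on (F n) (\<epsilon> n)" "\<epsilon> n ` F n = inc (grp X n) ` carrier (grp X n)"
    "carrier (grp X n) = {\<one>\<^bsub>grp X n\<^esub>} \<Longrightarrow> F n = {0}" for n using Fe by (auto simp: F_def \<epsilon>_def)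
  note Fq = subgpD[OF fgfree_subgp[OF F(1)]] and \<epsilon>q = additive_onD[OF fgfree_subgp[OF F(1)] F(2)]
  have \<epsilon>p: "inc (grp X n) (pr (\<epsilon> n a) (grp X n)) = \<epsilon> n a" if "a \<in> F n" for n a
    using F(3)[of n] that cg by (metis (no_types, lifting) imageE image_eqI pr_inc)
  define D where "D n v = inc (grp X (n + 1)) (diff X n (pr v (grp X n)))" for n v
  have dc: "diff X n x \<in> carrier (grp X (n + 1))" if "x \<in> carrier (grp X n)" for n x using ghomD(1)[OF XD(3) that] .
  have D: "additive_on UNIV (D n)" for n
    using cg ghomD[OF XD(3)] by (simp add: additive_on_def D_def inc_mult)
  have UN: "subgp (UNIV :: 'a univ set)" by (simp add: subgp_def)
  note Dq = additive_onD[OF UN D]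
  have DD: "D (n + 1) (D n v) = 0" for n v
    using cg XD(5)[of "pr v (grp X n)" n] dc[of "pr v (grp X n)" n] by (simp add: D_def add.assoc)
  have Dinc: "D n (inc (grp X n) x) = inc (grp X (n + 1)) (diff X n x)" if "x \<in> carrier (grp X n)" for n x
    using that cg by (simp add: D_def)
  define Z where "Z n = {a \<in> F n. D n (\<epsilon> n a) = 0}" for n
  define V where "V n = inc (grp X n) ` carrier (grp X n)" for n
  have Vq: "subgp (V n)" for n unfolding V_def using subgp_inc[OF cg] .
  define K where "K n = {a \<in> F n. \<exists>w \<in> V (n - 1). \<epsilon> n a = D (n - 1) w}" for n
  have Z: "fgfree (Z n)" for n
  proof (rule fgfree_subset[OF F(1)])
    show "subgp (Z n)" unfolding Z_def subgp_def using Fq \<epsilon>q Dq by auto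
  qed (auto simp: Z_def)
  have K: "fgfree (K n)" for n
  proof (rule fgfree_subset[OF F(1)])
    show "subgp (K n)"
      unfolding subgp_def
    proof (intro conjI ballI)
      show "0 \<in> K n" using Fq(1) \<epsilon>q(1) Dq(1) subgpD(1)[OF Vq] by (force simp: K_def)
      fix a b assume "a \<in> K n" "b \<in> K n"
      then obtain w w' where "a \<in> F n" "b \<in> F n" "w \<in> V (n - 1)" "w' \<in> V (n - 1)" "\<epsilon> n a = D (n - 1) w" "\<epsilon> n b = D (n - 1) w'"
        by (auto simp: K_def)
      then show "a - b \<in> K n" using Fq(2) \<epsilon>q(4) Dq(4)[of w w'] subgpD(2)[OF Vq, of w "n - 1" w']
        by (auto simp: K_def intro!: bexI[of _ "w - w'"])
    qed
  qed (auto simp: K_def)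
  have KZ: "a \<in> Z n" if "a \<in> K n" for a n
    using that DD[of "n - 1"] by (auto simp: K_def Z_def)
  \<comment> \<open>The covered boundaries form a free group, so preimages under the differential of
    \<open>X\<close> can be chosen additively.\<close>
  have "\<forall>n. \<exists>l. additive_on (K (n + 1)) l \<and> (\<forall>k \<in> K (n + 1). l k \<in> V n \<and> D n (l k) = \<epsilon> (n + 1) k)"
  proof
    fix n
    let ?R = "{(k, w). k \<in> F (n + 1) \<and> w \<in> V n \<and> D n w = \<epsilon> (n + 1) k}"
    note q = subgpD[OF fgfree_subgp[OF F(1)[of "n + 1"]]] subgpD[OF Vq[of n]]
      additive_onD[OF fgfree_subgp[OF F(1)[of "n + 1"]] F(2)[of "n + 1"]] additive_onD[OF UN D[of n]]
    have "subgp ?R"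
      unfolding subgp_def
      by (auto simp: zero_prod_def q simp del: plus_fun_apply)
    moreover have "\<exists>w. (k, w) \<in> ?R" if "k \<in> K (n + 1)" for k using that by (auto simp: K_def)
    ultimately obtain l where "additive_on (K (n + 1)) l" "\<And>k. k \<in> K (n + 1) \<Longrightarrow> (k, l k) \<in> ?R"
      using fgfree_lift[OF K] by blast
    then show "\<exists>l. additive_on (K (n + 1)) l \<and> (\<forall>k \<in> K (n + 1). l k \<in> V n \<and> D n (l k) = \<epsilon> (n + 1) k)"
      by (intro exI[of _ l]) auto
  qed
  from choice[OF this] obtain l where l: "\<forall>n. additive_on (K (n + 1)) (l n) \<and>
    (\<forall>k \<in> K (n + 1). l n k \<in> V n \<and> D n (l n k) = \<epsilon> (n + 1) k)" ..
  then have l1: "additive_on (K (n + 1)) (l n)" and l2: "k \<in> K (n + 1) \<Longrightarrow> l n k \<in> V n" "k \<in> K (n + 1) \<Longrightarrow> D n (l n k) = \<epsilon> (n + 1) k" for n k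
    by auto
  note lq = additive_onD[OF fgfree_subgp[OF K] l1]
  define Q where "Q n = Z n \<times> K (n + 1)" for n
  have sg: "subgp (Q n)" for n
    using fgfree_subgp[OF Z[of n]] fgfree_subgp[OF K[of "n + 1"]]
    unfolding subgp_def Q_def by (simp add: zero_prod_def mem_Times_iff)
  have Q: "fgfree (Q n)" for n
  proof (rule fgfree_joint[where I = "{False, True}" and \<psi> = "\<lambda>b. if b then fst else snd" and P = "\<lambda>b. if b then Z n else K (n + 1)"])
    show "subgp (Q n)" by (rule sg)
    show "x = 0" if "x \<in> Q n" "\<And>b. b \<in> {False, True} \<Longrightarrow> (if b then fst else snd) x = 0" for x
      using that(2)[of True] that(2)[of False] by (simp add: prod_eq_iff zero_prod_def)
  qed (auto simp: additive_on_def Q_def Z K)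
  have fin: "finite {n. Q n \<noteq> {0}}"
  proof (rule finite_subset)
    \<comment> \<open>Degree \<open>n + 1\<close> enters because \<open>Q n\<close> contains
      \<open>K (n + 1)\<close>; the resolution may start one degree below \<open>X\<close>.\<close>
    have "Q n = {0}" if "n \<notin> supp X" "n + 1 \<notin> supp X" for n
    proof -
      have "F n = {0}" "F (n + 1) = {0}" using that F(4) by (auto simp: supp_def)
      then show ?thesis using subgpD(1)[OF sg[of n]] by (auto simp: Q_def Z_def K_def zero_prod_def)
    qed
    then show "{n. Q n \<noteq> {0}} \<subseteq> supp X \<union> (\<lambda>n. n - 1) ` supp X" by force
    show "finite (supp X \<union> (\<lambda>n. n - 1) ` supp X)" using XD(2) by (simp add: bdd_def supp_def)
  qed
  define d where "d = (\<lambda>(n :: int) (z :: ('a \<Rightarrow> int) \<times> ('a \<Rightarrow> int)). (snd z, 0 :: 'a \<Rightarrow> int))"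
  have K0: "0 \<in> K n" and Z0: "0 \<in> Z n" for n using subgpD(1)[OF fgfree_subgp[OF K]] subgpD(1)[OF fgfree_subgp[OF Z]] by auto
  have d: "additive_on (Q n) (d n)" "z \<in> Q n \<Longrightarrow> d n z \<in> Q (n + 1)" "d (n + 1) (d n z) = 0" for n z
    using KZ K0 by (auto simp: additive_on_def d_def Q_def zero_prod_def)
  obtain P :: "'a cochain_complex" and \<kappa> where P: "free P" "\<And>n. bij_betw (\<kappa> n) (Q n) (carrier (grp P n))"
    "\<And>n x y. \<lbrakk>x \<in> Q n; y \<in> Q n\<rbrakk> \<Longrightarrow> \<kappa> n (x + y) = \<kappa> n x \<otimes>\<^bsub>grp P n\<^esub> \<kappa> n y"
    "\<And>n x. x \<in> Q n \<Longrightarrow> diff P n (\<kappa> n x) = \<kappa> (n + 1) (d n x)"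
    using free_complex_transport[OF inf Q d(1) d(2) d(3) fin] by metis
  have bP: "P \<in> bounded_fg_complexes" using P(1) by (simp add: free_def)
  have cP: "comm_group (grp P n)" for n using bfcD(1)[OF bP] by simp
  define \<iota> where "\<iota> n = the_inv_into (Q n) (\<kappa> n)" for n
  have \<iota>: "\<iota> n (\<kappa> n x) = x" if "x \<in> Q n" for n x
    using the_inv_into_f_f[OF bij_betw_imp_inj_on[OF P(2)] that] by (simp add: \<iota>_def)
  have car: "carrier (grp P n) = \<kappa> n ` Q n" for n using P(2) by (simp add: bij_betw_def)
  have one: "\<one>\<^bsub>grp P n\<^esub> = \<kappa> n 0" for n
  proof -
    interpret comm_group "grp P n" by (rule cP)
    have "\<kappa> n 0 \<in> carrier (grp P n)" using car subgpD(1)[OF sg] by auto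
    moreover have "\<kappa> n 0 \<otimes>\<^bsub>grp P n\<^esub> \<kappa> n 0 = \<kappa> n 0" using P(3)[OF subgpD(1)[OF sg] subgpD(1)[OF sg]] by simp
    ultimately show ?thesis by (metis l_cancel_one')
  qed
  \<comment> \<open>The resolution map. It commutes with the differentials because
    \<open>\<epsilon>\<close> sends \<open>Z\<close> to cycles and the differential of
    \<open>l k\<close> is \<open>\<epsilon> k\<close>.\<close>
  define e where "e n z = \<epsilon> n (fst z) + l n (snd z)" for n z
  have eV: "e n z \<in> V n" if "z \<in> Q n" for n z
    using that F(3)[of n] l2(1) by (auto simp: e_def Q_def Z_def V_def intro!: subgpD(4)[OF Vq[unfolded V_def]])
  have eq: "e n (x + y) = e n x + e n y" if "x \<in> Q n" "y \<in> Q n" for n x y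
    using that \<epsilon>q(2) lq(2) by (auto simp: e_def Q_def Z_def)
  have inc_e: "inc (grp X n) (pr (e n z) (grp X n)) = e n z" if "z \<in> Q n" for n z
    using eV[OF that] cg by (auto simp: V_def)
  define p where "p n = (\<lambda>a \<in> carrier (grp P n). pr (e n (\<iota> n a)) (grp X n))" for n
  have pk: "p n (\<kappa> n z) = pr (e n z) (grp X n)" if "z \<in> Q n" for n z
    using that by (simp add: p_def car \<iota>)
  have De: "D n (e n z) = e (n + 1) (d n z)" if "z \<in> Q n" for n z
    using that l2(2) lq(1) Dq(2) by (auto simp: e_def d_def Q_def Z_def)
  have p: "p \<in> chain_maps P X"
    unfolding chain_maps_def
  proof (intro CollectI conjI allI ballI)
    fix n
    have "p n (\<kappa> n x \<otimes>\<^bsub>grp P n\<^esub> \<kappa> n y) = p n (\<kappa> n x) \<otimes>\<^bsub>grp X n\<^esub> p n (\<kappa> n y)" if "x \<in> Q n" "y \<in> Q n" for x y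
      using that cg by (simp add: P(3)[symmetric] pk subgpD(4)[OF sg] eq)
    then show "p n \<in> ehom (grp P n) (grp X n)"
      using cg by (auto simp: ehom_def hom_def car pk) (simp add: p_def car)
    fix a assume "a \<in> carrier (grp P n)"
    then obtain z where z: "z \<in> Q n" "a = \<kappa> n z" by (auto simp: car)
    have "diff X n (pr (e n z) (grp X n)) = pr (D n (e n z)) (grp X (n + 1))"
      using cg dc[of "pr (e n z) (grp X n)" n] by (simp add: D_def)
    then show "diff X n (p n a) = p (n + 1) (diff P n a)"
      using z d(2) by (simp add: pk P(4) De)
  qed
  have "qi_elem P X p"
    unfolding qi_elem_def
  proof (intro allI conjI ballI impI)
    fix n a assume a: "a \<in> cycles P n" "p n a \<in> boundaries X n"
    then have "a \<in> carrier (grp P n)" by (simp add: cycles_def kernel_def)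
    then obtain z where z: "z \<in> Q n" "a = \<kappa> n z" by (auto simp: car)
    have "diff P n a = \<one>\<^bsub>grp P (n + 1)\<^esub>" using a(1) by (simp add: cycles_def kernel_def)
    then have "\<iota> (n + 1) (\<kappa> (n + 1) (d n z)) = \<iota> (n + 1) (\<kappa> (n + 1) 0)" using z by (simp add: P(4) one)
    then have "d n z = 0" using d(2)[OF z(1)] subgpD(1)[OF sg] by (simp add: \<iota>)
    then have s: "snd z = 0" by (simp add: d_def zero_prod_def)
    obtain x where x: "x \<in> carrier (grp X (n - 1))" "p n a = diff X (n - 1) x" using a(2) by (auto simp: boundaries_def)
    have "\<epsilon> n (fst z) = e n z" using lq(1) by (simp add: e_def s)
    also have "\<dots> = inc (grp X n) (p n a)" using z inc_e by (simp add: pk)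
    also have "\<dots> = D (n - 1) (inc (grp X (n - 1)) x)" using x Dinc[OF x(1)] by simp
    \<comment> \<open>Cycles of the resolution have zero second component. If such a
      \<open>z\<close> maps to a boundary, its first component lies in \<open>K n\<close>, so
      \<open>z\<close> is the differential of \<open>(0, fst z)\<close>.\<close>
    finally have "fst z \<in> K n" using z x by (auto simp: K_def Q_def Z_def V_def)
    then have w: "(0, fst z) \<in> Q (n - 1)" using Z0 by (simp add: Q_def)
    have "d (n - 1) (0, fst z) = z" using s by (simp add: d_def prod_eq_iff)
    then have "a = diff P (n - 1) (\<kappa> (n - 1) (0, fst z))" using P(4)[OF w] z by simp
    then show "a \<in> boundaries P n" using w by (auto simp: boundaries_def car)
  next
    fix n y assume y: "y \<in> cycles X n"
    then have yc: "y \<in> carrier (grp X n)" "diff X n y = \<one>\<^bsub>grp X (n + 1)\<^esub>" by (auto simp: cycles_def kernel_def)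
    then obtain a where a: "a \<in> F n" "\<epsilon> n a = inc (grp X n) y" using F(3)[of n] by (metis (no_types, lifting) imageE image_eqI)
    have "D n (\<epsilon> n a) = 0" using a(2) Dinc[OF yc(1)] yc(2) cg by simp
    then have z: "(a, 0) \<in> Q n" using a(1) K0 by (simp add: Q_def Z_def)
    have "\<kappa> n (a, 0) \<in> cycles P n"
      using z P(4)[OF z] by (auto simp: cycles_def kernel_def car one d_def zero_prod_def)
    moreover have "p n (\<kappa> n (a, 0)) = y" using pk[OF z] a(2) yc(1) cg lq(1) by (simp add: e_def)
    moreover have "\<one>\<^bsub>grp X n\<^esub> \<in> boundaries X n" using boundaries_subgroup(2)[OF X] by (rule subgroup.one_closed)
    moreover have "\<one>\<^bsub>grp X n\<^esub> \<otimes>\<^bsub>grp X n\<^esub> y = y" using cg yc(1) by (simp add: comm_groupD)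
    ultimately show "\<exists>x \<in> cycles P n. \<exists>b \<in> boundaries X n. y = b \<otimes>\<^bsub>grp X n\<^esub> p n x" by metis
  qed
  then have "qis (KO P) (KO X) (hat 0 P X p)" using qis_iff_elem[OF bP X p] by simp
  then show ?thesis using that P(1) hat_M0[OF bP X p] by blast
qed

section \<open>Roofs\<close>

text \<open>If every object \<open>X\<close> receives an inverted morphism from an object \<open>R X\<close> that inverted morphisms cannot
  distinguish from a projective one, then the roofs from \<open>X\<close> to \<open>Y\<close> are classified by
  morphisms \<open>R X \<rightarrow> Y\<close>.\<close>

locale local_resolutions = preadditive_category K for K :: "('o, 'm) precat" +
  fixes S :: "'o \<Rightarrow> 'o \<Rightarrow> 'm set" and R :: "'o \<Rightarrow> 'o" and p :: "'o \<Rightarrow> 'm"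
  assumes S_Mor: "\<lbrakk>X \<in> Ob K; Y \<in> Ob K; a \<in> S X Y\<rbrakk> \<Longrightarrow> a \<in> Mor K X Y"
    and S_Comp: "\<lbrakk>X \<in> Ob K; Y \<in> Ob K; Z \<in> Ob K; a \<in> S X Y; b \<in> S Y Z\<rbrakk> \<Longrightarrow> Comp K X Y Z b a \<in> S X Z"
    and S_Id: "X \<in> Ob K \<Longrightarrow> IdM K X \<in> S X X"
    and R_Ob: "X \<in> Ob K \<Longrightarrow> R X \<in> Ob K" and p_S: "X \<in> Ob K \<Longrightarrow> p X \<in> S (R X) X"
    and R_local: "\<lbrakk>X \<in> Ob K; W \<in> Ob K; W' \<in> Ob K; t \<in> S W W'; a \<in> Mor K (R X) W'\<rbrakk>
      \<Longrightarrow> \<exists>!b. b \<in> Mor K (R X) W \<and> Comp K (R X) W W' t b = a"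
begin

definition lift :: "'o \<Rightarrow> 'o \<Rightarrow> 'o \<Rightarrow> 'm \<Rightarrow> 'm \<Rightarrow> 'm"
  where "lift X W W' t a = (THE b. b \<in> Mor K (R X) W \<and> Comp K (R X) W W' t b = a)"

lemma lift:
  assumes "X \<in> Ob K" "W \<in> Ob K" "W' \<in> Ob K" "t \<in> S W W'" "a \<in> Mor K (R X) W'"
  shows "lift X W W' t a \<in> Mor K (R X) W" "Comp K (R X) W W' t (lift X W W' t a) = a"
  using theI'[OF R_local[OF assms]] by (auto simp: lift_def)

lemma lift_eqI:
  assumes "X \<in> Ob K" "W \<in> Ob K" "W' \<in> Ob K" "t \<in> S W W'" "b \<in> Mor K (R X) W"
  shows "lift X W W' t (Comp K (R X) W W' t b) = b"
proof -
  have "Comp K (R X) W W' t b \<in> Mor K (R X) W'" using assms by (intro Comp_closed R_Ob S_Mor[OF assms(2,3)])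
  from R_local[OF assms(1-4) this] show ?thesis unfolding lift_def using assms(5) by (intro the1_equality) auto
qed

text \<open>The roof is evaluated on the resolution: \<open>p X\<close> is lifted through the
  inverted leg and then composed with the other one.\<close>

definition val :: "'o \<Rightarrow> 'o \<Rightarrow> ('o, 'm) roof \<Rightarrow> 'm"
  where "val X Y = (\<lambda>(W, s, f). Comp K (R X) W Y f (lift X W X s (p X)))"

lemma p_Mor: "X \<in> Ob K \<Longrightarrow> p X \<in> Mor K (R X) X"
  by (intro S_Mor p_S R_Ob)

lemma val_closed:
  assumes "X \<in> Ob K" "Y \<in> Ob K" "(W, s, f) \<in> roofs K S X Y"
  shows "val X Y (W, s, f) \<in> Mor K (R X) Y"
  using assms lift(1)[OF assms(1), of W X s "p X"] by (auto simp: val_def roofs_def intro!: Comp_closed R_Ob p_Mor)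

lemma val_precomp:
  assumes XY: "X \<in> Ob K" "Y \<in> Ob K" and r: "(W, s, f) \<in> roofs K S X Y" and V: "V \<in> Ob K" "u \<in> Mor K V W" "Comp K V W X s u \<in> S V X"
  shows "val X Y (V, Comp K V W X s u, Comp K V W Y f u) = val X Y (W, s, f)"
proof -
  have W: "W \<in> Ob K" "s \<in> S W X" "f \<in> Mor K W Y" using r by (auto simp: roofs_def)
  have s: "s \<in> Mor K W X" using W XY by (intro S_Mor)
  note RX = R_Ob[OF XY(1)]
  define w where "w = lift X V X (Comp K V W X s u) (p X)"
  have w: "w \<in> Mor K (R X) V" "Comp K (R X) V X (Comp K V W X s u) w = p X"
    unfolding w_def using lift[OF XY(1) V(1) XY(1) V(3) p_Mor[OF XY(1)]] by auto
  have uw: "Comp K (R X) V W u w \<in> Mor K (R X) W" using V W w RX by (intro Comp_closed) auto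
  have "Comp K (R X) W X s (Comp K (R X) V W u w) = p X"
    using w V W s XY RX by (simp add: Comp_assoc)
  then have "lift X W X s (p X) = Comp K (R X) V W u w" using lift_eqI[OF XY(1) W(1) XY(1) W(2) uw] by simp
  then show ?thesis using w V W XY RX by (simp add: val_def w_def[symmetric] Comp_assoc)
qed

text \<open>Refining a roof does not change its value. Conversely \<open>R X\<close> with the two
  lifts of \<open>p X\<close> is a common refinement of any two roofs with equal value. In
  particular the relation is an equivalence.\<close>

lemma roof_rel_iff:
  assumes XY: "X \<in> Ob K" "Y \<in> Ob K"
  shows "(r, r') \<in> roof_rel K S X Y \<longleftrightarrow> r \<in> roofs K S X Y \<and> r' \<in> roofs K S X Y \<and> val X Y r = val X Y r'"
proof -
  obtain W s f where r: "r = (W, s, f)" by (cases r)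
  obtain W' s' f' where r': "r' = (W', s', f')" by (cases r')
  show ?thesis
  proof
    assume "(r, r') \<in> roof_rel K S X Y"
    then obtain V u u' where R: "(W, s, f) \<in> roofs K S X Y" "(W', s', f') \<in> roofs K S X Y" and
      V: "V \<in> Ob K" "u \<in> Mor K V W" "u' \<in> Mor K V W'" "Comp K V W X s u \<in> S V X"
        "Comp K V W X s u = Comp K V W' X s' u'" "Comp K V W Y f u = Comp K V W' Y f' u'"
      by (auto simp: roof_rel_def r r')
    have "val X Y r = val X Y r'"
      using val_precomp[OF XY R(1) V(1,2,4)] val_precomp[OF XY R(2) V(1,3)] V(4-6) by (simp add: r r')
    then show "r \<in> roofs K S X Y \<and> r' \<in> roofs K S X Y \<and> val X Y r = val X Y r'" using R by (simp add: r r')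
  next
    assume L: "r \<in> roofs K S X Y \<and> r' \<in> roofs K S X Y \<and> val X Y r = val X Y r'"
    then have W: "W \<in> Ob K" "s \<in> S W X" "W' \<in> Ob K" "s' \<in> S W' X" by (auto simp: roofs_def r r')
    note l = lift[OF XY(1) W(1) XY(1) W(2) p_Mor[OF XY(1)]] and l' = lift[OF XY(1) W(3) XY(1) W(4) p_Mor[OF XY(1)]]
    show "(r, r') \<in> roof_rel K S X Y"
      using L l l' p_S[OF XY(1)] R_Ob[OF XY(1)]
      by (auto simp: roof_rel_def r r' val_def intro!: bexI[of _ "R X"] bexI[OF _ l(1)] bexI[OF _ l'(1)])
  qed
qed

definition \<rho> :: "'o \<Rightarrow> 'o \<Rightarrow> 'm \<Rightarrow> ('o, 'm) roof set"
  where "\<rho> X Y a = {r \<in> roofs K S X Y. val X Y r = a}"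

lemma roof_class:
  assumes "X \<in> Ob K" "Y \<in> Ob K" "r \<in> roofs K S X Y"
  shows "roof_rel K S X Y `` {r} = \<rho> X Y (val X Y r)"
  using assms by (auto simp: \<rho>_def roof_rel_iff)

lemma canonical_roof:
  assumes "X \<in> Ob K" "Y \<in> Ob K" "a \<in> Mor K (R X) Y"
  shows "(R X, p X, a) \<in> \<rho> X Y a" "(R X, p X, a) \<in> roofs K S X Y"
proof -
  note RX = R_Ob[OF assms(1)]
  have "lift X (R X) X (p X) (Comp K (R X) (R X) X (p X) (IdM K (R X))) = IdM K (R X)"
    using assms RX by (intro lift_eqI p_S Id_closed)
  then have "lift X (R X) X (p X) (p X) = IdM K (R X)"
    using Comp_Id_right[OF RX assms(1) p_Mor[OF assms(1)]] by simp
  then show "(R X, p X, a) \<in> roofs K S X Y" "(R X, p X, a) \<in> \<rho> X Y a"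
    using assms RX p_S Comp_Id_right by (auto simp: \<rho>_def roofs_def val_def)
qed

lemma \<rho>_inj: "\<lbrakk>X \<in> Ob K; Y \<in> Ob K; a \<in> Mor K (R X) Y\<rbrakk> \<Longrightarrow> \<rho> X Y a = \<rho> X Y b \<longleftrightarrow> a = b"
  using canonical_roof(1)[of X Y a] by (auto simp: \<rho>_def)

lemma roof_classes:
  assumes XY: "X \<in> Ob K" "Y \<in> Ob K"
  shows "roofs K S X Y // roof_rel K S X Y = \<rho> X Y ` Mor K (R X) Y"
proof (intro equalityI subsetI)
  fix c assume "c \<in> roofs K S X Y // roof_rel K S X Y"
  then obtain r where r: "r \<in> roofs K S X Y" "c = roof_rel K S X Y `` {r}" by (auto simp: quotient_def)
  then show "c \<in> \<rho> X Y ` Mor K (R X) Y"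
    using XY val_closed[OF XY] by (cases r) (auto simp: roof_class)
next
  fix c assume "c \<in> \<rho> X Y ` Mor K (R X) Y"
  then obtain a where a: "a \<in> Mor K (R X) Y" "c = \<rho> X Y a" by blast
  note c = canonical_roof[OF XY a(1)]
  then have "c = roof_rel K S X Y `` {(R X, p X, a)}" using a XY by (simp add: roof_class \<rho>_def)
  then show "c \<in> roofs K S X Y // roof_rel K S X Y" using c(2) by (auto simp: quotient_def)
qed

text \<open>All pairs of roofs with a common denominator give the same class, and the canonical pair
  over \<open>R X\<close> shows that such pairs exist, so the union is this class.\<close>

lemma roof_mult:
  assumes XY: "X \<in> Ob K" "Y \<in> Ob K" and a: "a \<in> Mor K (R X) Y" and b: "b \<in> Mor K (R X) Y"
  shows "\<rho> X Y a \<otimes>\<^bsub>roof_Hom K S X Y\<^esub> \<rho> X Y b = \<rho> X Y (a \<otimes>\<^bsub>Hom K (R X) Y\<^esub> b)"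
proof -
  have c: "roof_rel K S X Y `` {(W, s, f \<otimes>\<^bsub>Hom K W Y\<^esub> g)} = \<rho> X Y (a \<otimes>\<^bsub>Hom K (R X) Y\<^esub> b)"
    if f: "(W, s, f) \<in> \<rho> X Y a" and g: "(W, s, g) \<in> \<rho> X Y b" for W s f g
  proof -
    have W: "W \<in> Ob K" "s \<in> S W X" "f \<in> Mor K W Y" "g \<in> Mor K W Y" using f g by (auto simp: \<rho>_def roofs_def)
    note l = lift[OF XY(1) W(1) XY(1) W(2) p_Mor[OF XY(1)]]
    interpret H: comm_group "Hom K W Y" using W XY by (intro Hom_comm_group)
    have "(W, s, f \<otimes>\<^bsub>Hom K W Y\<^esub> g) \<in> roofs K S X Y" using W by (simp add: roofs_def)
    moreover have "val X Y (W, s, f \<otimes>\<^bsub>Hom K W Y\<^esub> g) = a \<otimes>\<^bsub>Hom K (R X) Y\<^esub> b"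
      using f g W l XY R_Ob[OF XY(1)] by (simp add: \<rho>_def val_def Comp_add_left)
    ultimately show ?thesis using XY by (simp add: roof_class)
  qed
  have "\<rho> X Y a \<otimes>\<^bsub>roof_Hom K S X Y\<^esub> \<rho> X Y b
    = \<Union>{roof_rel K S X Y `` {(W, s, f \<otimes>\<^bsub>Hom K W Y\<^esub> g)} | W s f g. (W, s, f) \<in> \<rho> X Y a \<and> (W, s, g) \<in> \<rho> X Y b}"
    by (simp add: roof_Hom_def)
  also have "{roof_rel K S X Y `` {(W, s, f \<otimes>\<^bsub>Hom K W Y\<^esub> g)} | W s f g. (W, s, f) \<in> \<rho> X Y a \<and> (W, s, g) \<in> \<rho> X Y b}
    = {\<rho> X Y (a \<otimes>\<^bsub>Hom K (R X) Y\<^esub> b)}"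
    (is "?A = _")
  proof (intro equalityI subsetI)
    fix z assume "z \<in> ?A"
    then show "z \<in> {\<rho> X Y (a \<otimes>\<^bsub>Hom K (R X) Y\<^esub> b)}" using c by blast
  next
    fix z assume "z \<in> {\<rho> X Y (a \<otimes>\<^bsub>Hom K (R X) Y\<^esub> b)}"
    then have "z = roof_rel K S X Y `` {(R X, p X, a \<otimes>\<^bsub>Hom K (R X) Y\<^esub> b)}"
      using c[OF canonical_roof(1)[OF XY a] canonical_roof(1)[OF XY b]] by simp
    then show "z \<in> ?A" using canonical_roof(1)[OF XY a] canonical_roof(1)[OF XY b] by blast
  qed
  finally show ?thesis by simp
qed

lemma roof_one:
  assumes XY: "X \<in> Ob K" "Y \<in> Ob K"
  shows "\<one>\<^bsub>roof_Hom K S X Y\<^esub> = \<rho> X Y \<one>\<^bsub>Hom K (R X) Y\<^esub>"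
proof -
  note RX = R_Ob[OF XY(1)]
  interpret H: comm_group "Hom K X Y" using XY by (intro Hom_comm_group)
  interpret H': comm_group "Hom K (R X) Y" using XY RX by (intro Hom_comm_group)
  have r: "(X, IdM K X, \<one>\<^bsub>Hom K X Y\<^esub>) \<in> roofs K S X Y" using XY S_Id by (simp add: roofs_def)
  have l: "lift X X X (IdM K X) (p X) \<in> Mor K (R X) X" using XY S_Id p_Mor by (intro lift(1))
  let ?z = "val X Y (X, IdM K X, \<one>\<^bsub>Hom K X Y\<^esub>)"
  have z: "?z \<in> Mor K (R X) Y" using XY r by (intro val_closed)
  \<comment> \<open>The value of the zero roof is idempotent in a group, hence zero.\<close>
  have "?z \<otimes>\<^bsub>Hom K (R X) Y\<^esub> ?z = ?z"
    using l XY RX Comp_add_left[OF RX XY l H.one_closed H.one_closed] by (simp add: val_def)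
  then have "?z = \<one>\<^bsub>Hom K (R X) Y\<^esub>" using z by (metis H'.l_cancel_one')
  then show ?thesis using XY r by (simp add: roof_Hom_def roof_class)
qed

lemma roof_Hom_comm_group:
  assumes XY: "X \<in> Ob K" "Y \<in> Ob K" shows "comm_group (roof_Hom K S X Y)"
proof -
  interpret H: comm_group "Hom K (R X) Y" using XY R_Ob by (intro Hom_comm_group)
  have car: "carrier (roof_Hom K S X Y) = \<rho> X Y ` Mor K (R X) Y"
    using roof_classes[OF XY] by (simp add: roof_Hom_def)
  note m = roof_mult[OF XY] and o = roof_one[OF XY]
  show ?thesis
  proof (rule comm_groupI)
    show "\<one>\<^bsub>roof_Hom K S X Y\<^esub> \<in> carrier (roof_Hom K S X Y)" by (simp add: car o)
    fix a assume "a \<in> carrier (roof_Hom K S X Y)"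
    then obtain x where x: "x \<in> Mor K (R X) Y" "a = \<rho> X Y x" by (auto simp: car)
    show "\<one>\<^bsub>roof_Hom K S X Y\<^esub> \<otimes>\<^bsub>roof_Hom K S X Y\<^esub> a = a" using x by (simp add: m o)
    show "\<exists>b \<in> carrier (roof_Hom K S X Y). b \<otimes>\<^bsub>roof_Hom K S X Y\<^esub> a = \<one>\<^bsub>roof_Hom K S X Y\<^esub>"
      using x by (intro bexI[of _ "\<rho> X Y (inv\<^bsub>Hom K (R X) Y\<^esub> x)"]) (simp_all add: m o car)
    fix b assume "b \<in> carrier (roof_Hom K S X Y)"
    then obtain y where y: "y \<in> Mor K (R X) Y" "b = \<rho> X Y y" by (auto simp: car)
    show "a \<otimes>\<^bsub>roof_Hom K S X Y\<^esub> b \<in> carrier (roof_Hom K S X Y)" using x y by (simp add: m car)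
    show "a \<otimes>\<^bsub>roof_Hom K S X Y\<^esub> b = b \<otimes>\<^bsub>roof_Hom K S X Y\<^esub> a" using x y by (simp add: m H.m_comm)
    fix c assume "c \<in> carrier (roof_Hom K S X Y)"
    then obtain z where z: "z \<in> Mor K (R X) Y" "c = \<rho> X Y z" by (auto simp: car)
    show "a \<otimes>\<^bsub>roof_Hom K S X Y\<^esub> b \<otimes>\<^bsub>roof_Hom K S X Y\<^esub> c = a \<otimes>\<^bsub>roof_Hom K S X Y\<^esub> (b \<otimes>\<^bsub>roof_Hom K S X Y\<^esub> c)"
      using x y z by (simp add: m H.m_assoc)
  qed
qed

lemma roof_Id:
  assumes X: "X \<in> Ob K" shows "IdM (localization K S) X = \<rho> X X (p X)"
proof -
  have r: "(X, IdM K X, IdM K X) \<in> roofs K S X X" using X S_Id Id_closed by (simp add: roofs_def)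
  have l: "lift X X X (IdM K X) (p X) \<in> Mor K (R X) X" "Comp K (R X) X X (IdM K X) (lift X X X (IdM K X) (p X)) = p X"
    using lift[OF X X X S_Id[OF X] p_Mor[OF X]] by auto
  then have "val X X (X, IdM K X, IdM K X) = p X" by (simp add: val_def)
  then show ?thesis using roof_class[OF X X r] by (simp add: localization_def)
qed

text \<open>The second factor may be any roof with any lift of \<open>a\<close> to its apex. This
  generality is needed because the shift of a canonical roof of \<open>Y\<close> has apex
  \<open>shift i (R Y)\<close>, which need not be the resolution chosen for
  \<open>shift i Y\<close>.\<close>

lemma roof_Comp:
  assumes O: "X \<in> Ob K" "Y \<in> Ob K" "Z \<in> Ob K" and a: "a \<in> Mor K (R X) Y"
    and r: "(W', t, g) \<in> roofs K S Y Z" and l: "l \<in> Mor K (R X) W'" "Comp K (R X) W' Y t l = a"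
  shows "Comp (localization K S) X Y Z (roof_rel K S Y Z `` {(W', t, g)}) (\<rho> X Y a) = \<rho> X Z (Comp K (R X) W' Z g l)"
proof -
  note RX = R_Ob[OF O(1)] and RY = R_Ob[OF O(2)]
  have W': "W' \<in> Ob K" "t \<in> S W' Y" "g \<in> Mor K W' Z" using r by (auto simp: roofs_def)
  have t: "t \<in> Mor K W' Y" using W' O by (intro S_Mor)
  let ?b = "val Y Z (W', t, g)"
  have c: "roof_rel K S X Z `` {(V, Comp K V W X s u, Comp K V U Z h v)} = \<rho> X Z (Comp K (R X) W' Z g l)"
    if f: "(W, s, f) \<in> \<rho> X Y a" and h: "(U, q, h) \<in> \<rho> Y Z ?b"
      and V: "V \<in> Ob K" "u \<in> S V W" "v \<in> Mor K V U" and e: "Comp K V W Y f u = Comp K V U Y q v" for W s f U q h V u v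
  proof -
    have W: "W \<in> Ob K" "s \<in> S W X" "f \<in> Mor K W Y" and fa: "val X Y (W, s, f) = a" using f by (auto simp: \<rho>_def roofs_def)
    have U: "U \<in> Ob K" "q \<in> S U Y" "h \<in> Mor K U Z" and hb: "val Y Z (U, q, h) = ?b" using h by (auto simp: \<rho>_def roofs_def)
    have rW: "(W, s, f) \<in> roofs K S X Y" using W by (simp add: roofs_def)
    have u: "u \<in> Mor K V W" using V W by (intro S_Mor)
    have q: "q \<in> Mor K U Y" using U O by (intro S_Mor)
    have su: "Comp K V W X s u \<in> S V X" using V W O by (intro S_Comp)
    define w where "w = lift X V X (Comp K V W X s u) (p X)"
    have w: "w \<in> Mor K (R X) V" unfolding w_def using lift(1)[OF O(1) V(1) O(1) su p_Mor[OF O(1)]] .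
    have "a = val X Y (V, Comp K V W X s u, Comp K V W Y f u)"
      using val_precomp[OF O(1,2) rW V(1) u su] fa by simp
    also have "\<dots> = Comp K (R X) V Y (Comp K V U Y q v) w" by (simp add: val_def w_def e)
    also have "\<dots> = Comp K (R X) U Y q (Comp K (R X) V U v w)" using w V U q O RX by (simp add: Comp_assoc)
    finally have av: "a = Comp K (R X) U Y q (Comp K (R X) V U v w)" .
    define m where "m = lift X (R Y) Y (p Y) a"
    have m: "m \<in> Mor K (R X) (R Y)" "Comp K (R X) (R Y) Y (p Y) m = a"
      unfolding m_def using lift[OF O(1) RY O(2) p_S[OF O(2)] a] by auto
    \<comment> \<open>Every admissible composite factors through the lift \<open>m\<close> of
      \<open>a\<close> to \<open>R Y\<close>, by uniqueness of lifts; it therefore depends only on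
      the value of the second roof.\<close>
    have key: "Comp K (R X) B Z h' l' = Comp K (R X) (R Y) Z (val Y Z (B, q', h')) m"
      if B: "B \<in> Ob K" "q' \<in> S B Y" "h' \<in> Mor K B Z" and l': "l' \<in> Mor K (R X) B" "Comp K (R X) B Y q' l' = a" for B q' h' l'
    proof -
      have q': "q' \<in> Mor K B Y" using B O by (intro S_Mor)
      define n where "n = lift Y B Y q' (p Y)"
      have n: "n \<in> Mor K (R Y) B" "Comp K (R Y) B Y q' n = p Y"
        unfolding n_def using lift[OF O(2) B(1) O(2) B(2) p_Mor[OF O(2)]] by auto
      have nm: "Comp K (R X) (R Y) B n m \<in> Mor K (R X) B" using n m B RX RY by (intro Comp_closed)
      have "Comp K (R X) B Y q' (Comp K (R X) (R Y) B n m) = a"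
        using n m B q' O RX RY by (simp add: Comp_assoc)
      then have "l' = Comp K (R X) (R Y) B n m"
        using lift_eqI[OF O(1) B(1) O(2) B(2) l'(1)] lift_eqI[OF O(1) B(1) O(2) B(2) nm] l'(2) by simp
      then show ?thesis using n m B O RX RY by (simp add: val_def n_def[symmetric] Comp_assoc)
    qed
    have vw: "Comp K (R X) V U v w \<in> Mor K (R X) U" using w V U RX by (intro Comp_closed)
    have "Comp K (R X) V Z (Comp K V U Z h v) w = Comp K (R X) U Z h (Comp K (R X) V U v w)"
      using w V U O RX by (simp add: Comp_assoc)
    also have "\<dots> = Comp K (R X) (R Y) Z ?b m" using key[OF U vw av[symmetric]] hb by simp
    also have "\<dots> = Comp K (R X) W' Z g l" using key[OF W' l] by simp
    finally have "val X Z (V, Comp K V W X s u, Comp K V U Z h v) = Comp K (R X) W' Z g l"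
      by (simp add: val_def w_def)
    moreover have "(V, Comp K V W X s u, Comp K V U Z h v) \<in> roofs K S X Z"
      using V su Comp_closed[OF V(1) U(1) O(3) V(3) U(3)] by (simp add: roofs_def)
    ultimately show ?thesis using O by (simp add: roof_class)
  qed
  let ?A = "{roof_rel K S X Z `` {(V, Comp K V W X s u, Comp K V U Z h v)} | W s f U q h V u v.
          (W, s, f) \<in> \<rho> X Y a \<and> (U, q, h) \<in> \<rho> Y Z ?b \<and>
          V \<in> Ob K \<and> u \<in> S V W \<and> v \<in> Mor K V U \<and> Comp K V W Y f u = Comp K V U Y q v}"
  have "?A \<subseteq> {\<rho> X Z (Comp K (R X) W' Z g l)}" using c by blast
  moreover have "roof_rel K S X Z `` {(R X, Comp K (R X) (R X) X (p X) (IdM K (R X)), Comp K (R X) W' Z g l)} \<in> ?A"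
  proof -
    have "(R X, p X, a) \<in> \<rho> X Y a" using canonical_roof(1)[OF O(1,2) a] .
    moreover have "(W', t, g) \<in> \<rho> Y Z ?b" using r by (simp add: \<rho>_def)
    moreover have "Comp K (R X) (R X) Y a (IdM K (R X)) = Comp K (R X) W' Y t l"
      using l a RX O by (simp add: Comp_Id_right)
    ultimately show ?thesis using RX S_Id[OF RX] l(1) by blast
  qed
  ultimately have "?A = {\<rho> X Z (Comp K (R X) W' Z g l)}" by blast
  moreover have "Comp (localization K S) X Y Z (roof_rel K S Y Z `` {(W', t, g)}) (\<rho> X Y a) = \<Union>?A"
    unfolding roof_class[OF O(2,3) r] by (simp add: localization_def)
  ultimately show ?thesis by simp
qed

end

lemma shift_Kb_Comp:
  assumes O: "X \<in> bounded_fg_complexes" "Y \<in> bounded_fg_complexes" "Z \<in> bounded_fg_complexes"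
    and a: "a \<in> Mor Kb X Y" and b: "b \<in> Mor Kb Y Z"
  shows "shift_Kb_mor i (Comp Kb X Y Z b a) =
    Comp Kb (shift i X) (shift i Y) (shift i Z) (shift_Kb_mor i b) (shift_Kb_mor i a)"
proof -
  obtain r where r: "r \<in> M0 X Y" "a = kc X Y r" using O(1,2) a by (rule Kb_cases)
  obtain q where q: "q \<in> M0 Y Z" "b = kc Y Z q" using O(2,3) b by (rule Kb_cases)
  show ?thesis
    using O r q M0_shift[OF O(1,2) r(1)] M0_shift[OF O(2,3) q(1)]
    by (simp add: kc_comp shift_kc shift_bfc tconj_mult)
qed

lemma shift_Kb_Mor:
  assumes "X \<in> bounded_fg_complexes" "Y \<in> bounded_fg_complexes" "a \<in> Mor Kb X Y"
  shows "shift_Kb_mor i a \<in> Mor Kb (shift i X) (shift i Y)"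
proof -
  obtain r where r: "r \<in> M0 X Y" "a = kc X Y r" using assms by (rule Kb_cases)
  then show ?thesis
    using assms M0_shift[OF assms(1,2) r(1)] Kb.Phi_closed[of "shift i X" "shift i Y"] by (simp add: shift_kc shift_bfc)
qed

section \<open>The orbit category\<close>

definition shift_roof :: "int \<Rightarrow> ('a cochain_complex, (int \<Rightarrow> 'a \<Rightarrow> 'a) set) roof \<Rightarrow> ('a cochain_complex, (int \<Rightarrow> 'a \<Rightarrow> 'a) set) roof"
  where "shift_roof i = (\<lambda>(W, s, f). (shift i W, shift_Kb_mor i s, shift_Kb_mor i f))"

lemma roof_relI:
  assumes "(W, s, f) \<in> roofs C S X Y" "(W', s', f') \<in> roofs C S X Y" "V \<in> Ob C" "u \<in> Mor C V W" "u' \<in> Mor C V W'"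
    "Comp C V W X s u \<in> S V X" "Comp C V W X s u = Comp C V W' X s' u'" "Comp C V W Y f u = Comp C V W' Y f' u'"
  shows "((W, s, f), (W', s', f')) \<in> roof_rel C S X Y"
  unfolding roof_rel_def mem_Collect_eq prod.case
  by (intro conjI assms(1,2) bexI[OF _ assms(3)] bexI[OF _ assms(4)] bexI[OF _ assms(5)] assms(6-8))

lemma shift_roof_rel:
  assumes O: "X \<in> bounded_fg_complexes" "Y \<in> bounded_fg_complexes"
    and r: "(r, r') \<in> roof_rel Kb quasi_isos X Y"
  shows "(shift_roof i r, shift_roof i r') \<in> roof_rel Kb quasi_isos (shift i X) (shift i Y)"
proof -
  obtain W s f where rW: "r = (W, s, f)" by (cases r)
  obtain W' s' f' where rW': "r' = (W', s', f')" by (cases r')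
  obtain V u u' where R: "(W, s, f) \<in> roofs Kb quasi_isos X Y" "(W', s', f') \<in> roofs Kb quasi_isos X Y" and
      V: "V \<in> Ob Kb" "u \<in> Mor Kb V W" "u' \<in> Mor Kb V W'" "Comp Kb V W X s u \<in> quasi_isos V X"
        "Comp Kb V W X s u = Comp Kb V W' X s' u'" "Comp Kb V W Y f u = Comp Kb V W' Y f' u'"
    using r by (auto simp: roof_rel_def rW rW')
  have W: "W \<in> bounded_fg_complexes" "s \<in> quasi_isos W X" "f \<in> Mor Kb W Y" "W' \<in> bounded_fg_complexes" "s' \<in> quasi_isos W' X" "f' \<in> Mor Kb W' Y"
    using R by (auto simp: roofs_def)
  have V': "V \<in> bounded_fg_complexes" using V by simp
  have s: "s \<in> Mor Kb W X" "s' \<in> Mor Kb W' X" using W by (auto simp: quasi_isos_def)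
  have "(shift i W, shift_Kb_mor i s, shift_Kb_mor i f) \<in> roofs Kb quasi_isos (shift i X) (shift i Y)"
    "(shift i W', shift_Kb_mor i s', shift_Kb_mor i f') \<in> roofs Kb quasi_isos (shift i X) (shift i Y)"
    using W O by (auto simp: roofs_def shift_bfc quasi_isos_shift shift_Kb_Mor)
  moreover have "shift i V \<in> Ob Kb" using shift_bfc[OF V'] by simp
  moreover have "shift_Kb_mor i u \<in> Mor Kb (shift i V) (shift i W)" "shift_Kb_mor i u' \<in> Mor Kb (shift i V) (shift i W')"
    using V V' W by (auto intro: shift_Kb_Mor)
  moreover have "Comp Kb (shift i V) (shift i W) (shift i X) (shift_Kb_mor i s) (shift_Kb_mor i u) \<in> quasi_isos (shift i V) (shift i X)"
    using quasi_isos_shift[OF V' O(1) V(4), of i] unfolding shift_Kb_Comp[OF V' W(1) O(1) V(2) s(1)] .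
  moreover have "Comp Kb (shift i V) (shift i W) (shift i X) (shift_Kb_mor i s) (shift_Kb_mor i u) =
      Comp Kb (shift i V) (shift i W') (shift i X) (shift_Kb_mor i s') (shift_Kb_mor i u')"
    "Comp Kb (shift i V) (shift i W) (shift i Y) (shift_Kb_mor i f) (shift_Kb_mor i u) =
      Comp Kb (shift i V) (shift i W') (shift i Y) (shift_Kb_mor i f') (shift_Kb_mor i u')"
    using shift_Kb_Comp[OF V' W(1) O(1) V(2) s(1), of i] shift_Kb_Comp[OF V' W(4) O(1) V(3) s(2), of i]
      shift_Kb_Comp[OF V' W(1) O(2) V(2) W(3), of i] shift_Kb_Comp[OF V' W(4) O(2) V(3) W(6), of i] V(5,6) by simp_all
  ultimately show ?thesis
    unfolding shift_roof_def rW rW' prod.case by (rule roof_relI)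
qed

lemma shift_Kb_mor_inverse:
  assumes "X \<in> bounded_fg_complexes" "Y \<in> bounded_fg_complexes" "a \<in> Mor Kb X Y"
  shows "shift_Kb_mor i (shift_Kb_mor (- i) a) = a"
proof -
  obtain r where r: "r \<in> M0 X Y" "a = kc X Y r" using assms by (rule Kb_cases)
  then show ?thesis using assms by (simp add: shift_kc shift_bfc shift_inverse)
qed

text \<open>Shifting preserves the relation on roofs. Applying this to \<open>- i\<close> shows that
  every roof equivalent to the shifted one is itself a shift.\<close>

lemma shift_Db_mor_class:
  assumes O: "X \<in> bounded_fg_complexes" "Y \<in> bounded_fg_complexes" and rr: "r \<in> roofs Kb quasi_isos X Y"
  shows "shift_Db_mor i (roof_rel Kb quasi_isos X Y `` {r}) = roof_rel Kb quasi_isos (shift i X) (shift i Y) `` {shift_roof i r}"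
proof (intro equalityI subsetI)
  fix z assume "z \<in> shift_Db_mor i (roof_rel Kb quasi_isos X Y `` {r})"
  then show "z \<in> roof_rel Kb quasi_isos (shift i X) (shift i Y) `` {shift_roof i r}"
    using shift_roof_rel[OF O] by (auto simp: shift_Db_mor_def shift_roof_def)
next
  fix z assume z: "z \<in> roof_rel Kb quasi_isos (shift i X) (shift i Y) `` {shift_roof i r}"
  then have zr: "(shift_roof i r, z) \<in> roof_rel Kb quasi_isos (shift i X) (shift i Y)" by simp
  obtain W s f where r: "r = (W, s, f)" by (cases r)
  obtain V t g where zV: "z = (V, t, g)" by (cases z)
  have roof: "(V, t, g) \<in> roofs Kb quasi_isos (shift i X) (shift i Y)" "(shift i W, shift_Kb_mor i s, shift_Kb_mor i f) \<in> roofs Kb quasi_isos (shift i X) (shift i Y)"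
    using zr by (auto simp: roof_rel_def zV r shift_roof_def)
  then have V: "V \<in> bounded_fg_complexes" "t \<in> Mor Kb V (shift i X)" "g \<in> Mor Kb V (shift i Y)" by (auto simp: roofs_def quasi_isos_def)
  note I = shift_roof_rel[OF shift_bfc[OF O(1)] shift_bfc[OF O(2)] zr, of "- i"]
  have inv: "shift_roof i (shift_roof (- i) z) = z"
    using V shift_Kb_mor_inverse[OF V(1) shift_bfc[OF O(1)] V(2)] shift_Kb_mor_inverse[OF V(1) shift_bfc[OF O(2)] V(3)]
    by (simp add: shift_roof_def zV shift_inverse)
  have W: "W \<in> bounded_fg_complexes" "s \<in> Mor Kb W X" "f \<in> Mor Kb W Y" using rr by (auto simp: r roofs_def quasi_isos_def)
  have "shift_roof (- i) (shift_roof i r) = r"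
    using W O shift_Kb_mor_inverse[OF W(1) O(1) W(2), of "- i"] shift_Kb_mor_inverse[OF W(1) O(2) W(3), of "- i"]
    by (simp add: shift_roof_def r shift_inverse)
  then have "(r, shift_roof (- i) z) \<in> roof_rel Kb quasi_isos X Y" using I by (simp add: shift_inverse O)
  then show "z \<in> shift_Db_mor i (roof_rel Kb quasi_isos X Y `` {r})"
    using inv by (auto simp: shift_Db_mor_def shift_roof_def[symmetric] intro!: image_eqI[of _ _ "shift_roof (- i) z"])
qed

text \<open>\<open>R_id\<close> keeps free complexes unchanged, so that the folding of a free
  complex is literally \<open>F X\<close>; essential surjectivity is obtained through this.\<close>

locale resolution_choice =
  fixes R :: "'a cochain_complex \<Rightarrow> 'a cochain_complex" and p :: "'a cochain_complex \<Rightarrow> 'a uu endo"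
  assumes R_free: "X \<in> bounded_fg_complexes \<Longrightarrow> free (R X)"
    and p_M0: "X \<in> bounded_fg_complexes \<Longrightarrow> p X \<in> M0 (R X) X"
    and p_qis: "X \<in> bounded_fg_complexes \<Longrightarrow> qis (KO (R X)) (KO X) (p X)"
    and R_id: "free X \<Longrightarrow> R X = X"
begin

lemma R_bfc: "X \<in> bounded_fg_complexes \<Longrightarrow> R X \<in> bounded_fg_complexes"
  using R_free by (auto simp: free_def)

sublocale local_resolutions Kb quasi_isos R "\<lambda>X. kc (R X) X (p X)"
proof (intro local_resolutions.intro local_resolutions_axioms.intro Kb.preadditive_category_axioms)
  fix X Y Z :: "'a cochain_complex" and a b
  assume X: "X \<in> Ob Kb"
  then show "IdM Kb X \<in> quasi_isos X X" "R X \<in> Ob Kb" "kc (R X) X (p X) \<in> quasi_isos (R X) X"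
    by (auto simp: quasi_isos_id R_bfc quasi_isos_kc p_M0 p_qis)
  assume Y: "Y \<in> Ob Kb" and a: "a \<in> quasi_isos X Y"
  then show "a \<in> Mor Kb X Y" by (simp add: quasi_isos_def)
  assume "Z \<in> Ob Kb" "b \<in> quasi_isos Y Z"
  then show "Comp Kb X Y Z b a \<in> quasi_isos X Z" using X Y a by (simp add: quasi_isos_comp)
next
  fix X W W' :: "'a cochain_complex" and t a
  assume "X \<in> Ob Kb" "W \<in> Ob Kb" "W' \<in> Ob Kb" "t \<in> quasi_isos W W'" "a \<in> Mor Kb (R X) W'"
  then show "\<exists>!b. b \<in> Mor Kb (R X) W \<and> Comp Kb (R X) W W' t b = a"
    by (simp add: free_local R_free)
qed

lemma Hom_Db: "Hom Db X Y = roof_Hom Kb quasi_isos X Y"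
  by (simp add: Db_def localization_def)

lemma Ob_orbit [simp]: "Ob Db_orbit = bounded_fg_complexes"
  by (simp add: Db_orbit_def orbit_category_def Db_def localization_def)

lemma Hom_orbit: "Hom Db_orbit X Y = sum_group UNIV (\<lambda>i. Hom Db X (shift i Y))"
  by (simp add: Db_orbit_def orbit_category_def)

lemma Db_group:
  fixes X Y :: "'a cochain_complex"
  shows "\<lbrakk>X \<in> bounded_fg_complexes; Y \<in> bounded_fg_complexes\<rbrakk> \<Longrightarrow> comm_group (Hom Db X Y)"
  unfolding Hom_Db by (intro roof_Hom_comm_group) simp_all

lemma carrier_orbit:
  fixes X Y :: "'a cochain_complex"
  assumes "X \<in> bounded_fg_complexes" "Y \<in> bounded_fg_complexes"
  shows "Mor Db_orbit X Y = {f. (\<forall>i. f i \<in> Mor Db X (shift i Y)) \<and> finite {i. f i \<noteq> \<one>\<^bsub>Hom Db X (shift i Y)\<^esub>}}"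
  unfolding Hom_orbit using assms
  by (subst carrier_sum_group) (auto intro: comm_group.axioms Db_group shift_bfc)

section \<open>Morphisms as ring elements\<close>

definition \<kappa> :: "'a cochain_complex \<Rightarrow> 'a cochain_complex \<Rightarrow> 'a uu endo \<Rightarrow> 'a Db_mor"
  where "\<kappa> X Y v = \<rho> X Y (kc (R X) Y v)"

lemma \<kappa>_image:
  assumes "X \<in> bounded_fg_complexes" "Y \<in> bounded_fg_complexes"
  shows "\<kappa> X Y ` M0 (R X) Y = Mor Db X Y"
proof -
  have "Mor Db X Y = \<rho> X Y ` Mor Kb (R X) Y" using assms by (simp add: Hom_Db roof_Hom_def roof_classes)
  also have "Mor Kb (R X) Y = kc (R X) Y ` M0 (R X) Y" using Kb.Phi_image[of "R X" Y] assms R_bfc by simp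
  finally show ?thesis by (simp add: \<kappa>_def[abs_def] image_image)
qed

lemma kc_Mor: "\<lbrakk>X \<in> bounded_fg_complexes; Y \<in> bounded_fg_complexes; v \<in> M0 X Y\<rbrakk> \<Longrightarrow> kc X Y v \<in> Mor Kb X Y"
  using Kb.Phi_closed[of X Y v] by simp

lemma \<kappa>_eq_iff:
  assumes "X \<in> bounded_fg_complexes" "Y \<in> bounded_fg_complexes" "v \<in> M0 (R X) Y" "w \<in> M0 (R X) Y"
  shows "\<kappa> X Y v = \<kappa> X Y w \<longleftrightarrow> v - w \<in> dnull (KO (R X)) (KO Y)"
  using assms by (simp add: \<kappa>_def \<rho>_inj kc_Mor R_bfc kc_eq_iff)

lemma \<kappa>_add:
  assumes "X \<in> bounded_fg_complexes" "Y \<in> bounded_fg_complexes" "v \<in> M0 (R X) Y" "w \<in> M0 (R X) Y"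
  shows "\<kappa> X Y (v + w) = \<kappa> X Y v \<otimes>\<^bsub>Hom Db X Y\<^esub> \<kappa> X Y w"
  using assms Kb.Phi_add[of "R X" Y v w] by (simp add: \<kappa>_def Hom_Db roof_mult kc_Mor R_bfc)

lemma \<kappa>_zero:
  assumes "X \<in> bounded_fg_complexes" "Y \<in> bounded_fg_complexes"
  shows "\<kappa> X Y 0 = \<one>\<^bsub>Hom Db X Y\<^esub>"
  using assms Kb.Phi_zero[of "R X" Y] by (simp add: \<kappa>_def Hom_Db roof_one R_bfc)

lemma \<kappa>_closed: "\<lbrakk>X \<in> bounded_fg_complexes; Y \<in> bounded_fg_complexes; v \<in> M0 (R X) Y\<rbrakk> \<Longrightarrow> \<kappa> X Y v \<in> Mor Db X Y"
  using \<kappa>_image by blast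

lemma deg_tau_mult: "deg i w \<Longrightarrow> deg 0 (tau i * w)"
  using deg_mult[OF deg_tau[of i], of i w] by simp

lemma tau_M0:
  assumes "X \<in> bounded_fg_complexes" "Y \<in> bounded_fg_complexes" "deg i w"
  shows "tau i * w \<in> M0 X (shift i Y) \<longleftrightarrow> w \<in> dmap (TO X) (TO Y)"
  using assms by (simp add: M0_def KO_TO_dmap deg_tau_mult)

text \<open>The component of degree \<open>i\<close> of a folded map becomes, after translation by
  \<open>tau i\<close>, a chain map to \<open>shift i Y\<close>; the family of all components is a
  morphism of the orbit category.\<close>

definition \<Psi> :: "'a cochain_complex \<Rightarrow> 'a cochain_complex \<Rightarrow> 'a uu endo \<Rightarrow> int \<Rightarrow> 'a Db_mor"
  where "\<Psi> X Y w = (\<lambda>i. \<kappa> X (shift i Y) (tau i * cmp i w))"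

lemma cmp_M0:
  assumes "X \<in> bounded_fg_complexes" "Y \<in> bounded_fg_complexes" "w \<in> dmap (TO X) (TO Y)"
  shows "tau i * cmp i w \<in> M0 X (shift i Y)"
  using assms by (simp add: tau_M0 dmap_cmp_TO)

lemma TO_unit: "w \<in> dmap (TO X) (TO Y) \<Longrightarrow> eX Y * w = w \<and> w * eX X = w"
  by (simp add: dmap_def)

lemma dnull_TO_sum: "(\<And>i. i \<in> I \<Longrightarrow> w i \<in> dnull A B) \<Longrightarrow> (\<Sum>i\<in>I. w i) \<in> dnull A B"
  by (induction I rule: infinite_finite_induct) (auto intro: dnull_add)

lemma dmap_sum: "(\<And>i. i \<in> I \<Longrightarrow> w i \<in> dmap A B) \<Longrightarrow> (\<Sum>i\<in>I. w i) \<in> dmap A B"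
  by (induction I rule: infinite_finite_induct) (auto intro: dmap_add)

text \<open>Between bounded complexes a folded map is the sum of finitely many components, so
  contracting each of them contracts the sum.\<close>

lemma dnull_TO_iff:
  assumes X: "X \<in> bounded_fg_complexes" and Y: "Y \<in> bounded_fg_complexes" and w: "w \<in> dmap (TO X) (TO Y)"
  shows "w \<in> dnull (TO X) (TO Y) \<longleftrightarrow> (\<forall>i. tau i * cmp i w \<in> dnull (KO X) (KO (shift i Y)))"
proof -
  have "w = (\<Sum>i\<in>degs X Y. cmp i w)"
    using TO_unit[OF w] bfcD(1,2)[OF X] bfcD(1,2)[OF Y] by (intro sum_cmp[where X = X and Y = Y]) (auto intro: finite_degs)
  then have "w \<in> dnull (TO X) (TO Y)" if "\<forall>i. cmp i w \<in> dnull (TO X) (TO Y)"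
    using dnull_TO_sum[of "degs X Y" "\<lambda>i. cmp i w"] that by metis
  then show ?thesis using KO_TO_dnull[OF X Y deg_cmp] dnull_cmp_TO[OF X Y] by blast
qed

lemma \<Psi>_closed:
  assumes X: "X \<in> bounded_fg_complexes" and Y: "Y \<in> bounded_fg_complexes" and w: "w \<in> dmap (TO (R X)) (TO Y)"
  shows "\<Psi> X Y w \<in> Mor Db_orbit X Y"
proof -
  note RX = R_bfc[OF X]
  have "{i. \<Psi> X Y w i \<noteq> \<one>\<^bsub>Hom Db X (shift i Y)\<^esub>} \<subseteq> degs (R X) Y"
  proof
    fix i assume i: "i \<in> {i. \<Psi> X Y w i \<noteq> \<one>\<^bsub>Hom Db X (shift i Y)\<^esub>}"
    show "i \<in> degs (R X) Y"
    proof (rule ccontr)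
      assume "i \<notin> degs (R X) Y"
      then have "cmp i w = 0" using TO_unit[OF w] bfcD(1)[OF RX] bfcD(1)[OF Y] by (intro cmp_outside[where X = "R X" and Y = Y]) auto
      then show False using i X shift_bfc[OF Y] by (simp add: \<Psi>_def \<kappa>_zero)
    qed
  qed
  then have "finite {i. \<Psi> X Y w i \<noteq> \<one>\<^bsub>Hom Db X (shift i Y)\<^esub>}"
    using finite_degs[OF bfcD(2)[OF RX] bfcD(2)[OF Y]] by (rule finite_subset)
  then show ?thesis
    using X Y cmp_M0[OF RX Y w] by (simp add: carrier_orbit \<Psi>_def \<kappa>_closed shift_bfc)
qed

text \<open>Finite support of the family allows its members, translated back by
  \<open>tau (- i)\<close>, to be added up to one folded map.\<close>

lemma \<Psi>_surj:
  assumes X: "X \<in> bounded_fg_complexes" and Y: "Y \<in> bounded_fg_complexes" and f: "f \<in> Mor Db_orbit X Y"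
  shows "\<exists>w \<in> dmap (TO (R X)) (TO Y). f = \<Psi> X Y w"
proof -
  note RX = R_bfc[OF X]
  define A where "A = {i. f i \<noteq> \<one>\<^bsub>Hom Db X (shift i Y)\<^esub>}"
  have fA: "finite A" and fi: "f i \<in> Mor Db X (shift i Y)" for i using f X Y by (auto simp: carrier_orbit A_def)
  have "\<forall>i. \<exists>v. v \<in> M0 (R X) (shift i Y) \<and> f i = \<kappa> X (shift i Y) v"
  proof
    fix i
    have "f i \<in> \<kappa> X (shift i Y) ` M0 (R X) (shift i Y)" using fi \<kappa>_image[OF X shift_bfc[OF Y]] by blast
    then show "\<exists>v. v \<in> M0 (R X) (shift i Y) \<and> f i = \<kappa> X (shift i Y) v" by blast
  qed
  from choice[OF this] obtain v where v: "\<And>i. v i \<in> M0 (R X) (shift i Y)" "\<And>i. f i = \<kappa> X (shift i Y) (v i)" by blast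
  define w where "w = (\<Sum>i\<in>A. tau (- i) * v i)"
  have dg: "deg i (tau (- i) * v i)" for i
    using deg_mult[OF deg_tau[of "- i"], of 0 "v i"] v(1)[of i] by (simp add: M0_def)
  have m: "tau (- i) * v i \<in> dmap (TO (R X)) (TO Y)" for i
    using tau_M0[OF RX Y dg, of i] v(1)[of i] by simp
  have w: "w \<in> dmap (TO (R X)) (TO Y)" unfolding w_def using m by (rule dmap_sum)
  have "cmp i w = (if i \<in> A then tau (- i) * v i else 0)" for i
  proof -
    have "cmp i w = (\<Sum>j\<in>A. cmp i (tau (- j) * v j))" by (simp add: w_def)
    also have "\<dots> = (\<Sum>j\<in>A. if j = i then tau (- i) * v i else 0)"
      using cmp_deg[OF dg] cmp_deg_other[OF dg] by (intro sum.cong) auto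
    finally show ?thesis using fA by (simp add: sum.delta)
  qed
  then have "\<Psi> X Y w i = f i" for i
    using v(2)[of i] \<kappa>_zero[OF X shift_bfc[OF Y], of i] by (auto simp: \<Psi>_def A_def)
  then show ?thesis using w by (intro bexI[of _ w]) auto
qed

lemma \<Psi>_eq_iff:
  assumes X: "X \<in> bounded_fg_complexes" and Y: "Y \<in> bounded_fg_complexes"
    and w: "w \<in> dmap (TO (R X)) (TO Y)" "w' \<in> dmap (TO (R X)) (TO Y)"
  shows "\<Psi> X Y w = \<Psi> X Y w' \<longleftrightarrow> w - w' \<in> dnull (TO (R X)) (TO Y)"
proof -
  note RX = R_bfc[OF X]
  have "\<Psi> X Y w i = \<Psi> X Y w' i \<longleftrightarrow> tau i * cmp i (w - w') \<in> dnull (KO (R X)) (KO (shift i Y))" for i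
    unfolding \<Psi>_def using \<kappa>_eq_iff[OF X shift_bfc[OF Y] cmp_M0[OF RX Y w(1)] cmp_M0[OF RX Y w(2)]]
    by (simp add: right_diff_distrib)
  then show ?thesis using dnull_TO_iff[OF RX Y dmap_diff[OF w]] by (simp add: fun_eq_iff)
qed

lemma \<Psi>_add:
  assumes X: "X \<in> bounded_fg_complexes" and Y: "Y \<in> bounded_fg_complexes"
    and w: "w \<in> dmap (TO (R X)) (TO Y)" "w' \<in> dmap (TO (R X)) (TO Y)"
  shows "\<Psi> X Y (w + w') = \<Psi> X Y w \<otimes>\<^bsub>Hom Db_orbit X Y\<^esub> \<Psi> X Y w'"
  unfolding Hom_orbit mult_sum_group
  using \<kappa>_add[OF X shift_bfc[OF Y] cmp_M0[OF R_bfc[OF X] Y w(1)] cmp_M0[OF R_bfc[OF X] Y w(2)]]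
  by (simp add: \<Psi>_def distrib_left restrict_def)

section \<open>The representation of the orbit category\<close>

definition F :: "'a cochain_complex \<Rightarrow> 'a uu endo \<times> 'a uu endo"
  where "F X = TO (R X)"

text \<open>Composing with \<open>p Y\<close> passes from maps between resolutions, which can be
  composed, to maps \<open>R X \<rightarrow> Y\<close>, which classify morphisms of the orbit
  category.\<close>

definition \<Phi> :: "'a cochain_complex \<Rightarrow> 'a cochain_complex \<Rightarrow> 'a uu endo \<Rightarrow> int \<Rightarrow> 'a Db_mor"
  where "\<Phi> X Y r = \<Psi> X Y (p Y * r)"

lemma p_deg: "X \<in> bounded_fg_complexes \<Longrightarrow> deg 0 (p X)"
  using p_M0 by (simp add: M0_def)

lemma p_qis_TO: "X \<in> bounded_fg_complexes \<Longrightarrow> qis (TO (R X)) (TO X) (p X)"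
  by (intro qis_KO_TO R_bfc p_qis p_deg)

lemma p_dmap: "X \<in> bounded_fg_complexes \<Longrightarrow> p X \<in> dmap (TO (R X)) (TO X)"
  using p_qis_TO by (simp add: qis_def)

lemma cmp_p: "X \<in> bounded_fg_complexes \<Longrightarrow> cmp i (p X * r) = p X * cmp i r"
  using cmp_mult_left[OF p_deg, of X i r] by simp

lemma R_fgfree: "X \<in> bounded_fg_complexes \<Longrightarrow> fgfree (im (fst (TO (R X))))"
  using R_free[of X] by (simp add: free_def)

lemma p_cancel:
  assumes X: "X \<in> bounded_fg_complexes" and Y: "Y \<in> bounded_fg_complexes" and r: "r \<in> dmap (TO (R X)) (TO (R Y))"
  shows "p Y * r \<in> dnull (TO (R X)) (TO Y) \<longleftrightarrow> r \<in> dnull (TO (R X)) (TO (R Y))"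
  using uu.qis_cancel[OF is_dobj_TO[OF R_bfc[OF X]] R_fgfree[OF X] is_dobj_TO[OF R_bfc[OF Y]] is_dobj_TO[OF Y] p_qis_TO[OF Y] r]
    dnull_comp_left[OF _ p_dmap[OF Y]] by blast

text \<open>The shifted canonical roof of the component of \<open>q\<close> has apex
  \<open>shift i (R Y)\<close>. There the component of \<open>r\<close> already provides the lift
  that \<open>roof_Comp\<close> asks for, since the shifted \<open>p Y\<close> composed with it is
  the component of \<open>p Y * r\<close>.\<close>

lemma \<Phi>_summand:
  assumes X: "X \<in> bounded_fg_complexes" and Y: "Y \<in> bounded_fg_complexes" and Z: "Z \<in> bounded_fg_complexes"
    and r: "r \<in> dmap (TO (R X)) (TO (R Y))" and q: "q \<in> dmap (TO (R Y)) (TO Z)"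
  shows "Comp Db X (shift i Y) (shift n Z) (shift_Db_mor i (\<Psi> Y Z q (n - i))) (\<Phi> X Y r i)
    = \<kappa> X (shift n Z) (tau n * (cmp (n - i) q * cmp i r))"
    "tau n * (cmp (n - i) q * cmp i r) \<in> M0 (R X) (shift n Z)"
proof -
  note RX = R_bfc[OF X] and RY = R_bfc[OF Y] and sY = shift_bfc[OF Y, of i] and sRY = shift_bfc[OF R_bfc[OF Y], of i]
  let ?m = "n - i"
  have sZ: "shift i (shift ?m Z) = shift n Z" using shift_shift[OF Z, of i ?m] by simp
  let ?c = "tau ?m * cmp ?m q"
  have c: "?c \<in> M0 (R Y) (shift ?m Z)" using RY Z q by (rule cmp_M0)
  have cc: "tconj i ?c \<in> M0 (shift i (R Y)) (shift n Z)" using M0_shift[OF RY shift_bfc[OF Z] c, of i] sZ by simp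
  have can: "(R Y, kc (R Y) Y (p Y), kc (R Y) (shift ?m Z) ?c) \<in> roofs Kb quasi_isos Y (shift ?m Z)"
    "(R Y, kc (R Y) Y (p Y), kc (R Y) (shift ?m Z) ?c) \<in> \<rho> Y (shift ?m Z) (kc (R Y) (shift ?m Z) ?c)"
    using canonical_roof[of Y "shift ?m Z" "kc (R Y) (shift ?m Z) ?c"] Y shift_bfc[OF Z] kc_Mor[OF RY shift_bfc[OF Z] c] by simp_all
  have "\<Psi> Y Z q ?m = roof_rel Kb quasi_isos Y (shift ?m Z) `` {(R Y, kc (R Y) Y (p Y), kc (R Y) (shift ?m Z) ?c)}"
    using can Y shift_bfc[OF Z] roof_class[OF _ _ can(1)] by (simp add: \<Psi>_def \<kappa>_def \<rho>_def)
  then have 1: "shift_Db_mor i (\<Psi> Y Z q ?m) = roof_rel Kb quasi_isos (shift i Y) (shift n Z) ``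
      {(shift i (R Y), kc (shift i (R Y)) (shift i Y) (tconj i (p Y)), kc (shift i (R Y)) (shift n Z) (tconj i ?c))}"
    using shift_Db_mor_class[OF Y shift_bfc[OF Z] can(1), of i] RY Y Z
    by (simp add: shift_roof_def shift_kc shift_bfc sZ)
  let ?l = "tau i * cmp i r"
  have l: "?l \<in> M0 (R X) (shift i (R Y))" using RX RY r by (rule cmp_M0)
  have cp: "tconj i (p Y) \<in> M0 (shift i (R Y)) (shift i Y)" using RY Y p_M0[OF Y] by (rule M0_shift)
  have pr: "p Y * r \<in> dmap (TO (R X)) (TO Y)" using r p_dmap[OF Y] by (rule dmap_comp)
  have a: "tau i * cmp i (p Y * r) \<in> M0 (R X) (shift i Y)" using RX Y pr by (rule cmp_M0)
  have e1: "tconj i (p Y) * ?l = tau i * cmp i (p Y * r)" using Y by (simp add: tconj_def mult.assoc cmp_p)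
  have "tau i * tau ?m = (tau n :: 'a uu endo)" using tau_tau[of i ?m] by simp
  then have e2: "tconj i ?c * ?l = tau n * (cmp ?m q * cmp i r)" by (simp add: tconj_def mult.assoc) (simp flip: mult.assoc)
  have roof: "(shift i (R Y), kc (shift i (R Y)) (shift i Y) (tconj i (p Y)), kc (shift i (R Y)) (shift n Z) (tconj i ?c))
      \<in> roofs Kb quasi_isos (shift i Y) (shift n Z)"
    using sRY sY shift_bfc[OF Z] quasi_isos_shift[OF RY Y, of "kc (R Y) Y (p Y)" i] Y RY p_M0[OF Y] p_qis[OF Y] cc
    by (simp add: roofs_def kc_Mor shift_kc quasi_isos_kc)
  have lM: "kc (R X) (shift i (R Y)) ?l \<in> Mor Kb (R X) (shift i (R Y))" using RX sRY l by (rule kc_Mor)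
  have lp: "Comp Kb (R X) (shift i (R Y)) (shift i Y) (kc (shift i (R Y)) (shift i Y) (tconj i (p Y))) (kc (R X) (shift i (R Y)) ?l)
      = kc (R X) (shift i Y) (tau i * cmp i (p Y * r))"
    using kc_comp[OF RX sRY sY l cp] e1 by simp
  have aM: "kc (R X) (shift i Y) (tau i * cmp i (p Y * r)) \<in> Mor Kb (R X) (shift i Y)" using RX sY a by (rule kc_Mor)
  have "Comp Db X (shift i Y) (shift n Z) (shift_Db_mor i (\<Psi> Y Z q ?m)) (\<Phi> X Y r i)
     = \<rho> X (shift n Z) (Comp Kb (R X) (shift i (R Y)) (shift n Z) (kc (shift i (R Y)) (shift n Z) (tconj i ?c)) (kc (R X) (shift i (R Y)) ?l))"
    unfolding 1 unfolding Db_def \<Phi>_def \<Psi>_def \<kappa>_def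
    using X sY shift_bfc[OF Z] by (intro roof_Comp[OF _ _ _ aM roof lM lp]) simp_all
  also have "\<dots> = \<kappa> X (shift n Z) (tau n * (cmp ?m q * cmp i r))"
    using kc_comp[OF RX sRY shift_bfc[OF Z] l cc] e2 by (simp add: \<kappa>_def)
  finally show "Comp Db X (shift i Y) (shift n Z) (shift_Db_mor i (\<Psi> Y Z q ?m)) (\<Phi> X Y r i)
     = \<kappa> X (shift n Z) (tau n * (cmp ?m q * cmp i r))" .
  show "tau n * (cmp ?m q * cmp i r) \<in> M0 (R X) (shift n Z)" using M0_comp[OF l cc] e2 by simp
qed

lemma finprod_\<kappa>:
  assumes X: "X \<in> bounded_fg_complexes" and Y: "Y \<in> bounded_fg_complexes" and "finite I" "\<And>i. i \<in> I \<Longrightarrow> v i \<in> M0 (R X) Y"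
  shows "finprod (Hom Db X Y) (\<lambda>i. \<kappa> X Y (v i)) I = \<kappa> X Y (\<Sum>i\<in>I. v i) \<and> (\<Sum>i\<in>I. v i) \<in> M0 (R X) Y"
proof -
  interpret comm_group "Hom Db X Y" using X Y by (rule Db_group)
  show ?thesis
    using assms(3,4)
  proof (induction I rule: finite_induct)
    case empty
    then show ?case using X Y by (simp add: \<kappa>_zero)
  next
    case (insert i I)
    then have "\<kappa> X Y (v j) \<in> Mor Db X Y" if "j \<in> insert i I" for j using that X Y by (intro \<kappa>_closed) auto
    then show ?case using insert X Y by (simp add: finprod_insert Pi_def \<kappa>_add M0_add)
  qed
qed

lemma \<Phi>_comp:
  assumes X: "X \<in> bounded_fg_complexes" and Y: "Y \<in> bounded_fg_complexes" and Z: "Z \<in> bounded_fg_complexes"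
    and r: "r \<in> dmap (F X) (F Y)" and q: "q \<in> dmap (F Y) (F Z)"
  shows "\<Phi> X Z (q * r) = Comp Db_orbit X Y Z (\<Phi> Y Z q) (\<Phi> X Y r)"
proof
  fix n
  note RX = R_bfc[OF X] and RY = R_bfc[OF Y] and sZ = shift_bfc[OF Z, of n]
  have r: "r \<in> dmap (TO (R X)) (TO (R Y))" and q: "q \<in> dmap (TO (R Y)) (TO (R Z))" using r q by (auto simp: F_def)
  let ?q = "p Z * q"
  have q': "?q \<in> dmap (TO (R Y)) (TO Z)" using q p_dmap[OF Z] by (rule dmap_comp)
  have pr: "p Y * r \<in> dmap (TO (R X)) (TO Y)" using r p_dmap[OF Y] by (rule dmap_comp)
  define T where "T i = tau n * (cmp (n - i) ?q * cmp i r)" for i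
  define A where "A = {i. \<Phi> X Y r i \<noteq> \<one>\<^bsub>Hom Db X (shift i Y)\<^esub>}"
  \<comment> \<open>Composition in the orbit category runs over the support \<open>A\<close> of the
    family, whereas the decomposition of \<open>r\<close> runs over degrees in which
    \<open>r\<close> may be nonzero. Both are compared on the union.\<close>
  define I where "I = A \<union> degs (R X) (R Y)"
  have TM: "T i \<in> M0 (R X) (shift n Z)" for i unfolding T_def using \<Phi>_summand(2)[OF X Y Z r q'] .
  have "finite A" using \<Psi>_closed[OF X Y pr] X Y by (simp add: carrier_orbit A_def \<Phi>_def)
  then have fI: "finite I" using finite_degs[OF bfcD(2)[OF RX] bfcD(2)[OF RY]] by (simp add: I_def)
  interpret comm_group "Hom Db X (shift n Z)" using X sZ by (rule Db_group)
  \<comment> \<open>Outside \<open>A\<close> the component of \<open>r\<close> need not vanish, but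
    it is null homotopic: its composite with \<open>p Y\<close> is, and \<open>p Y\<close> can be
    cancelled.\<close>
  have z: "\<kappa> X (shift n Z) (T i) = \<one>\<^bsub>Hom Db X (shift n Z)\<^esub>" if "i \<notin> A" for i
  proof -
    have "\<kappa> X (shift i Y) (tau i * cmp i (p Y * r)) = \<kappa> X (shift i Y) 0"
      using that \<kappa>_zero[OF X shift_bfc[OF Y]] by (simp add: A_def \<Phi>_def \<Psi>_def)
    then have "tau i * cmp i (p Y * r) \<in> dnull (KO (R X)) (KO (shift i Y))"
      using \<kappa>_eq_iff[OF X shift_bfc[OF Y] cmp_M0[OF RX Y pr] M0_zero] by simp
    then have "p Y * cmp i r \<in> dnull (TO (R X)) (TO Y)"
      unfolding KO_TO_dnull[OF RX Y deg_cmp] by (simp add: cmp_p[OF Y])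
    then have "cmp i r \<in> dnull (TO (R X)) (TO (R Y))" using p_cancel[OF X Y dmap_cmp_TO[OF RX RY r]] by blast
    then have "cmp (n - i) ?q * cmp i r \<in> dnull (TO (R X)) (TO Z)"
      using dmap_cmp_TO[OF RY Z q'] by (rule dnull_comp_left)
    moreover have "deg n (cmp (n - i) ?q * cmp i r)" using deg_mult[of "n - i" "cmp (n - i) ?q" i "cmp i r"] by simp
    ultimately have "T i \<in> dnull (KO (R X)) (KO (shift n Z))" unfolding T_def using KO_TO_dnull[OF RX Z] by blast
    then show ?thesis using \<kappa>_eq_iff[OF X sZ TM M0_zero] \<kappa>_zero[OF X sZ] by simp
  qed
  have closed: "\<kappa> X (shift n Z) (T i) \<in> Mor Db X (shift n Z)" for i using X sZ TM by (rule \<kappa>_closed)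
  have "Comp Db_orbit X Y Z (\<Phi> Y Z q) (\<Phi> X Y r) n
     = finprod (Hom Db X (shift n Z)) (\<lambda>i. Comp Db X (shift i Y) (shift n Z) (shift_Db_mor i (\<Phi> Y Z q (n - i))) (\<Phi> X Y r i)) A"
    by (simp add: Db_orbit_def orbit_category_def A_def)
  also have "\<dots> = finprod (Hom Db X (shift n Z)) (\<lambda>i. \<kappa> X (shift n Z) (T i)) A"
    unfolding \<Phi>_def[of Y Z q] \<Phi>_summand(1)[OF X Y Z r q'] T_def ..
  also have "\<dots> = finprod (Hom Db X (shift n Z)) (\<lambda>i. \<kappa> X (shift n Z) (T i)) I"
    using fI z closed by (intro finprod_mono_neutral_cong_left) (auto simp: I_def)
  also have "\<dots> = \<kappa> X (shift n Z) (\<Sum>i\<in>I. T i)" using finprod_\<kappa>[OF X sZ fI, of T] TM by blast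
  also have "(\<Sum>i\<in>I. T i) = tau n * (\<Sum>i\<in>I. cmp n (?q * cmp i r))"
    unfolding T_def sum_distrib_left
  proof (rule sum.cong[OF refl])
    fix i
    show "tau n * (cmp (n - i) ?q * cmp i r) = tau n * cmp n (?q * cmp i r)"
      using cmp_mult_right[OF deg_cmp[of i r], of "n - i" ?q] by simp
  qed
  also have "(\<Sum>i\<in>I. cmp n (?q * cmp i r)) = cmp n (?q * (\<Sum>i\<in>I. cmp i r))"
    unfolding sum_distrib_left using cmp_sum fI by metis
  also have "(\<Sum>i\<in>I. cmp i r) = r"
    using TO_unit[OF r] bfcD(1,2)[OF RX] bfcD(1,2)[OF RY] fI by (intro sum_cmp[where X = "R X" and Y = "R Y", symmetric]) (auto simp: I_def)
  finally show "\<Phi> X Z (q * r) n = Comp Db_orbit X Y Z (\<Phi> Y Z q) (\<Phi> X Y r) n"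
    by (simp add: \<Phi>_def \<Psi>_def mult.assoc)
qed

lemma orbit_represented:
  "represented_category Db_orbit (\<lambda>X Y. dmap (F X) (F Y)) (\<lambda>X Y. dnull (F X) (F Y)) (\<lambda>X. fst (F X)) \<Phi>"
proof
  fix X :: "'a cochain_complex" assume "X \<in> Ob Db_orbit"
  then have X: "X \<in> bounded_fg_complexes" by simp
  then show "fst (F X) \<in> dmap (F X) (F X)" unfolding F_def by (intro dmap_id is_dobj_TO R_bfc)
  show "\<Phi> X X (fst (F X)) = IdM Db_orbit X"
  proof
    fix n
    have p: "p X * fst (F X) = p X" using p_M0[OF X] by (simp add: F_def M0_unit)
    show "\<Phi> X X (fst (F X)) n = IdM Db_orbit X n"
    proof (cases "n = 0")
      case True
      have "IdM Db X = \<kappa> X X (p X)" using roof_Id[of X] X by (simp add: Db_def \<kappa>_def)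
      then show ?thesis using True X p cmp_deg[OF p_deg[OF X]]
        by (simp add: \<Phi>_def \<Psi>_def shift_0 Db_orbit_def orbit_category_def)
    next
      case False
      then show ?thesis using X p cmp_deg_other[OF p_deg[OF X], of n] \<kappa>_zero[OF X shift_bfc[OF X]]
        by (simp add: \<Phi>_def \<Psi>_def Db_orbit_def orbit_category_def)
    qed
  qed
next
  fix X Y :: "'a cochain_complex" assume "X \<in> Ob Db_orbit" "Y \<in> Ob Db_orbit"
  then have XY: "X \<in> bounded_fg_complexes" "Y \<in> bounded_fg_complexes" by simp_all
  have pf: "p Y * f \<in> dmap (TO (R X)) (TO Y)" if "f \<in> dmap (F X) (F Y)" for f
    using that p_dmap[OF XY(2)] by (auto simp: F_def intro: dmap_comp)
  show "0 \<in> dmap (F X) (F Y)" by simp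
  show "\<Phi> X Y 0 = \<one>\<^bsub>Hom Db_orbit X Y\<^esub>"
    using \<kappa>_zero[OF XY(1) shift_bfc[OF XY(2)]] by (simp add: \<Phi>_def \<Psi>_def Hom_orbit restrict_def)
  show "\<Phi> X Y ` dmap (F X) (F Y) = Mor Db_orbit X Y"
  proof (intro equalityI subsetI)
    fix a assume "a \<in> \<Phi> X Y ` dmap (F X) (F Y)"
    then show "a \<in> Mor Db_orbit X Y" using \<Psi>_closed[OF XY pf] by (auto simp: \<Phi>_def)
  next
    fix a assume "a \<in> Mor Db_orbit X Y"
    then obtain w where w: "w \<in> dmap (TO (R X)) (TO Y)" "a = \<Psi> X Y w" using \<Psi>_surj[OF XY] by blast
    \<comment> \<open>A folded map into \<open>Y\<close> lifts up to homotopy to the resolution of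
      \<open>Y\<close>, because \<open>R X\<close> is free and \<open>p Y\<close> a
      quasi-isomorphism.\<close>
    obtain b where b: "b \<in> dmap (TO (R X)) (TO (R Y))" "heq (TO (R X)) (TO Y) (p Y * b) w"
      using uu.qis_lift[OF is_dobj_TO[OF R_bfc[OF XY(1)]] R_fgfree[OF XY(1)] is_dobj_TO[OF R_bfc[OF XY(2)]]
          is_dobj_TO[OF XY(2)] p_qis_TO[OF XY(2)] w(1)] .
    then have "\<Psi> X Y (p Y * b) = \<Psi> X Y w" using w(1) \<Psi>_eq_iff[OF XY, of "p Y * b" w] by (simp add: heq_def)
    then have "a = \<Phi> X Y b" using w(2) by (simp add: \<Phi>_def)
    then show "a \<in> \<Phi> X Y ` dmap (F X) (F Y)" using b(1) by (simp add: F_def)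
  qed
  fix f assume f: "f \<in> dmap (F X) (F Y)"
  then show "fst (F Y) * f = f \<and> f * fst (F X) = f" by (simp add: dmap_def)
  { fix Z :: "'a cochain_complex" and g assume "Z \<in> Ob Db_orbit" and g: "g \<in> dmap (F Y) (F Z)"
    then show "\<Phi> X Z (g * f) = Comp Db_orbit X Y Z (\<Phi> Y Z g) (\<Phi> X Y f)" "g * f \<in> dmap (F X) (F Z)"
      using XY f by (auto intro: \<Phi>_comp dmap_comp) }
  fix g assume g: "g \<in> dmap (F X) (F Y)"
  show "f - g \<in> dmap (F X) (F Y)" using f g by (rule dmap_diff)
  have "f - g \<in> dmap (TO (R X)) (TO (R Y))" using f g by (auto simp: F_def intro: dmap_diff)
  then show "\<Phi> X Y f = \<Phi> X Y g \<longleftrightarrow> f - g \<in> dnull (F X) (F Y)"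
    using \<Psi>_eq_iff[OF XY pf[OF f] pf[OF g]] p_cancel[OF XY, of "f - g"]
    by (simp add: \<Phi>_def F_def right_diff_distrib)
  show "\<Phi> X Y (f + g) = \<Phi> X Y f \<otimes>\<^bsub>Hom Db_orbit X Y\<^esub> \<Phi> X Y g"
    using \<Psi>_add[OF XY pf[OF f] pf[OF g]] by (simp add: \<Phi>_def distrib_left)
qed

end

section \<open>Essential surjectivity\<close>

lemma (in endo_doubling) fgfree_double:
  assumes "fgfree (im e)" "fgfree (im e')" shows "fgfree (im (s * e * s' + t * e' * t'))"
proof (rule fgfree_joint[where I = "{False, True}" and \<psi> = "\<lambda>b. app (if b then s' else t')" and P = "\<lambda>b. if b then im e else im e'"])
  let ?E = "s * e * s' + t * e' * t'"
  have E: "app s (app e (app s' x)) + app t (app e' (app t' x)) = x" if "x \<in> im ?E" for x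
    using that by (simp add: im_iff)
  have st: "app e (app s' x) = app s' x" "app e' (app t' x) = app t' x" if "x \<in> im ?E" for x
    using arg_cong[OF E[OF that], of "app s'"] arg_cong[OF E[OF that], of "app t'"] by simp_all
  show "subgp (im ?E)" by (rule subgp_im)
  show "app (if b then s' else t') x \<in> (if b then im e else im e')" if "x \<in> im ?E" for b x
    using st[OF that] by (simp add: im_iff)
  show "x = 0" if x: "x \<in> im ?E" and z: "\<And>b. b \<in> {False, True} \<Longrightarrow> app (if b then s' else t') x = 0" for x
    using E[OF x] z[of True] z[of False] by simp
qed (use assms additive_on_app in auto)

text \<open>A free differential group \<open>A\<close> is the folding of the two-term complex \<open>im \<delta> \<rightarrow> ker \<delta>\<close>, because
  \<open>im \<delta>\<close> is free and \<open>\<delta> : A \<rightarrow> im \<delta>\<close> therefore splits. The sign undoes the one in \<^const>\<open>TO\<close>.\<close>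

lemma two_term_model:
  fixes A :: "'a uu endo \<times> 'a uu endo"
  assumes inf: "infinite (UNIV :: 'a set)" and A: "is_dobj A" "fgfree (im (fst A))"
  shows "\<exists>X f g. free X \<and> hiso A (TO X) f g"
proof -
  obtain e \<delta> where Ad: "A = (e, \<delta>)" by (cases A)
  have e: "app e (app e x) = app e x" "app e (app \<delta> x) = app \<delta> x" "app \<delta> (app e x) = app \<delta> x" "app \<delta> (app \<delta> x) = 0"
    for x using A(1) by (auto simp: is_dobj_def Ad simp flip: app_times)
  define Z where "Z = {x \<in> im e. app \<delta> x = 0}"
  define B where "B = app \<delta> ` im e"
  have Z: "fgfree Z" "subgp Z"
  proof -
    show "subgp Z" unfolding Z_def by (intro subgp_kernel subgp_im additive_on_app)
    then show "fgfree Z" using A(2) by (rule_tac fgfree_subset) (auto simp: Ad Z_def)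
  qed
  have BZ: "B \<subseteq> Z" by (auto simp: B_def Z_def im_iff e)
  have B: "fgfree B" "subgp B"
  proof -
    show "subgp B" unfolding subgp_def
    proof (intro conjI ballI)
      show "0 \<in> B" by (auto simp: B_def im_iff intro!: image_eqI[of _ _ 0])
      fix x y assume "x \<in> B" "y \<in> B"
      then obtain u v where "x = app \<delta> u" "y = app \<delta> v" "u \<in> im e" "v \<in> im e" by (auto simp: B_def)
      then show "x - y \<in> B" by (auto simp: B_def im_iff intro!: image_eqI[of _ _ "u - v"])
    qed
    then show "fgfree B" using Z(1) BZ by (rule_tac fgfree_subset)
  qed
  have "subgp {(b, x). x \<in> im e \<and> app \<delta> x = b}" by (auto simp: subgp_def im_iff zero_prod_def)
  then obtain r where r: "additive_on B r" "\<And>b. b \<in> B \<Longrightarrow> r b \<in> im e \<and> app \<delta> (r b) = b"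
    using B(1) by (rule_tac fgfree_lift[of B]) (auto simp: B_def)
  note rB = additive_onD[OF B(2) r(1)]
  have dB: "app \<delta> x \<in> B" for x unfolding B_def by (rule image_eqI[of _ _ "app e x"]) (auto simp: im_iff e)
  have zZ: "app e x - r (app \<delta> x) \<in> Z" for x
    using r(2)[OF dB[of x]] by (auto simp: Z_def im_iff e)
  \<comment> \<open>Placing the cycles in the odd degree 1 makes \<open>sigma\<close> equal to -1 on
    the target of the differential, which is the sign that \<open>d\<close> compensates.\<close>
  define Q where "Q n = (if n = 0 then B else if n = 1 then Z else {0})" for n :: int
  define d where "d n x = (if n = 0 then - x else 0)" for n :: int and x :: "'a uu"
  have z0: "fgfree {0 :: 'a uu}" unfolding fgfree_def by (intro conjI exI[of _ "{}"]) (auto simp: subgp_def)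
  have Qf: "fgfree (Q n)" for n using B Z z0 by (simp add: Q_def)
  have 1: "additive_on (Q n) (d n)" for n by (auto simp: additive_on_def d_def)
  have 2: "d n x \<in> Q (n + 1)" if "x \<in> Q n" for n x
    using that BZ subgpD(3)[OF Z(2)] subgpD(1)[OF Z(2)] subgpD(1)[OF B(2)] by (auto simp: d_def Q_def)
  have 3: "d (n + 1) (d n x) = 0" for n x by (simp add: d_def)
  have "{n. Q n \<noteq> {0}} \<subseteq> {0, 1}" by (auto simp: Q_def)
  then have fin: "finite {n. Q n \<noteq> {0}}" by (rule finite_subset) simp
  obtain X :: "'a cochain_complex" and \<kappa> where X: "free X" "\<And>n. bij_betw (\<kappa> n) (Q n) (carrier (grp X n))"
    "\<And>n x y. \<lbrakk>x \<in> Q n; y \<in> Q n\<rbrakk> \<Longrightarrow> \<kappa> n (x + y) = \<kappa> n x \<otimes>\<^bsub>grp X n\<^esub> \<kappa> n y"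
    "\<And>n x. x \<in> Q n \<Longrightarrow> diff X n (\<kappa> n x) = \<kappa> (n + 1) (d n x)"
    using free_complex_transport[OF inf Qf 1 2 3 fin] by metis
  have bX: "X \<in> bounded_fg_complexes" using X(1) by (simp add: free_def)
  note cX = bfcD(1)[OF bX]
  have cg: "comm_group (grp X n)" for n using cX by simp
  define \<iota> where "\<iota> n = the_inv_into (Q n) (\<kappa> n)" for n
  have \<iota>: "\<iota> n (\<kappa> n x) = x" if "x \<in> Q n" for n x
    using the_inv_into_f_f[OF bij_betw_imp_inj_on[OF X(2)] that] by (simp add: \<iota>_def)
  have car: "carrier (grp X n) = \<kappa> n ` Q n" for n using X(2) by (simp add: bij_betw_def)
  note Qq = subgpD[OF fgfree_subgp[OF Qf]]
  have one: "\<one>\<^bsub>grp X n\<^esub> = \<kappa> n 0" for n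
  proof -
    interpret comm_group "grp X n" by (rule cg)
    have "\<kappa> n 0 \<in> carrier (grp X n)" using car Qq(1) by auto
    moreover have "\<kappa> n 0 \<otimes>\<^bsub>grp X n\<^esub> \<kappa> n 0 = \<kappa> n 0" using X(3)[OF Qq(1) Qq(1)] by simp
    ultimately show ?thesis by (metis l_cancel_one')
  qed
  \<comment> \<open>The coordinates of \<open>x\<close> in the splitting: its differential, and the
    cycle that remains after subtracting the chosen preimage of that differential.\<close>
  define c where "c x n = (if n = 0 then app \<delta> x else if n = 1 then app e x - r (app \<delta> x) else 0)" for x and n :: int
  have cQ: "c x n \<in> Q n" for x n using dB zZ by (simp add: c_def Q_def)
  have cadd: "c (x + y) n = c x n + c y n" for x y n using rB(2)[OF dB dB] by (simp add: c_def)
  define f where "f = Endo (\<lambda>x. emb X (\<lambda>n. \<kappa> n (c x n)))"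
  have el: "(\<lambda>n. \<kappa> n (v n)) \<in> elts X" if "\<And>n. v n \<in> Q n" for v using that by (auto simp: elts_def car)
  have f: "app f x = emb X (\<lambda>n. \<kappa> n (c x n))" for x
  proof -
    have "app f = (\<lambda>x. emb X (\<lambda>n. \<kappa> n (c x n)))"
      unfolding f_def using emb_add[OF cX el[of "c _"] el[of "c _"]] cQ
      by (intro app_Endo) (simp add: cadd X(3))
    then show ?thesis by simp
  qed
  have pQ: "\<exists>x \<in> Q n. pr v (grp X n) = \<kappa> n x" for v n using pr_closed[OF cg] by (auto simp: car)
  define h where "h n u = \<iota> n (pr (u 0 n) (grp X n))" for n and u :: "'a uu"
  have hQ: "h n u \<in> Q n" for n u using pQ[of n "u 0 n"] \<iota> by (auto simp: h_def)
  have hadd: "h n (u + v) = h n u + h n v" for n u v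
  proof -
    obtain x y where "x \<in> Q n" "y \<in> Q n" "pr (u 0 n) (grp X n) = \<kappa> n x" "pr (v 0 n) (grp X n) = \<kappa> n y"
      using pQ[of n "u 0 n"] pQ[of n "v 0 n"] by blast
    then show ?thesis using cg Qq(4) by (simp add: h_def \<iota> flip: X(3))
  qed
  have h0: "h 0 u \<in> B" "h 1 u \<in> Z" for u using hQ[of 0 u] hQ[of 1 u] by (simp_all add: Q_def)
  \<comment> \<open>The inverse of the splitting: lift the boundary by \<open>r\<close> and add the
    cycle.\<close>
  define g where "g = Endo (\<lambda>u. r (h 0 u) + h 1 u)"
  have g: "app g u = r (h 0 u) + h 1 u" for u
  proof -
    have "app g = (\<lambda>u. r (h 0 u) + h 1 u)"
      unfolding g_def using rB(2)[OF h0(1) h0(1)] by (intro app_Endo) (simp add: hadd)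
    then show ?thesis by simp
  qed
  have h_emb: "h n (emb X (\<lambda>n. \<kappa> n (v n))) = v n" if "\<And>n. v n \<in> Q n" for v n
  proof -
    have "\<kappa> n (v n) \<in> carrier (grp X n)" unfolding car using that by (rule imageI)
    then show ?thesis by (simp add: h_def emb_def \<iota>[OF that] pr_inc[OF cg])
  qed
  have imX: "\<exists>v. (\<forall>n. v n \<in> Q n) \<and> u = emb X (\<lambda>n. \<kappa> n (v n))" if "u \<in> im (eX X)" for u
  proof -
    have "u \<in> emb X ` elts X" using that unfolding im_eX[OF cX] .
    then obtain a where a: "a \<in> elts X" "u = emb X a" by (elim imageE)
    have "\<forall>n. \<exists>x. x \<in> Q n \<and> a n = \<kappa> n x" using a(1) unfolding elts_def car by blast
    from choice[OF this] obtain v where v: "\<forall>n. v n \<in> Q n \<and> a n = \<kappa> n (v n)" ..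
    have "a = (\<lambda>n. \<kappa> n (v n))" using v by (intro ext) blast
    then show ?thesis using a(2) v by blast
  qed
  have dT: "app (sigma * dX X) (emb X (\<lambda>n. \<kappa> n (v n))) = emb X (\<lambda>n. \<kappa> n (if n = 1 then v 0 else 0))"
    if v: "\<And>n. v n \<in> Q n" for v
  proof -
    have "app (dX X) (emb X (\<lambda>n. \<kappa> n (v n))) = emb X (\<lambda>n. diff X (n - 1) (\<kappa> (n - 1) (v (n - 1))))"
      unfolding dX_def using hat_emb(1)[OF cX cX bfcD(3)[OF bX] el[OF v]] .
    also have "(\<lambda>n. diff X (n - 1) (\<kappa> (n - 1) (v (n - 1)))) = (\<lambda>n. \<kappa> n (if n = 1 then - v 0 else 0))"
      using X(4)[OF v] by (auto simp: fun_eq_iff d_def)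
    finally have 1: "app (dX X) (emb X (\<lambda>n. \<kappa> n (v n))) = emb X (\<lambda>n. \<kappa> n (if n = 1 then - v 0 else 0))" .
    have "v 0 \<in> Z" using v[of 0] BZ by (auto simp: Q_def)
    then have vZ: "v 0 \<in> Q 1" "- v 0 \<in> Q 1" using subgpD(3)[OF Z(2)] by (simp_all add: Q_def)
    have "inc (grp X 1) (\<kappa> 1 (- v 0)) + inc (grp X 1) (\<kappa> 1 (v 0)) = inc (grp X 1) (\<kappa> 1 0)"
      using vZ car[of 1] X(3)[OF vZ(2,1)] inc_mult[OF cg, of "\<kappa> 1 (- v 0)" 1 "\<kappa> 1 (v 0)"] by simp
    then have "inc (grp X 1) (\<kappa> 1 (- v 0)) + inc (grp X 1) (\<kappa> 1 (v 0)) = 0"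
      unfolding one[of 1, symmetric] by (simp only: inc_one[OF cg])
    then have m: "- inc (grp X 1) (\<kappa> 1 (- v 0)) = inc (grp X 1) (\<kappa> 1 (v 0))" by (rule minus_unique)
    have z: "inc (grp X n) (\<kappa> n 0) = 0" for n using one[of n, symmetric] cg[of n] by simp
    show ?thesis unfolding app_times 1
      using m z by (auto simp: fun_eq_iff app_sigma emb_def sgi_def)
  qed
  have TX: "is_dobj (TO X)" using bX by (rule is_dobj_TO)
  have eE: "app (eX X) (emb X (\<lambda>n. \<kappa> n (v n))) = emb X (\<lambda>n. \<kappa> n (v n))" if "\<And>n. v n \<in> Q n" for v
    using im_eX[OF cX] el[OF that] by (auto simp: im_iff[symmetric])
  have ce: "c (app e x) = c x" for x by (simp add: c_def e fun_eq_iff)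
  have cd: "c (app \<delta> x) = (\<lambda>n. if n = 1 then c x 0 else 0)" for x
    using rB(1) by (auto simp: c_def e fun_eq_iff)
  have f1: "f \<in> dmap A (TO X)"
    by (intro dmapI endo_eqI) (use dT[OF cQ] eE[OF cQ] in \<open>simp_all add: Ad f ce cd\<close>)
  have he: "h n (app (eX X) u) = h n u" for n u using cX cg by (simp add: h_def app_eX)
  have hd: "h n (app (sigma * dX X) u) = (if n = 1 then h 0 u else 0)" for n u
  proof -
    obtain v where v: "\<And>n. v n \<in> Q n" "app (eX X) u = emb X (\<lambda>n. \<kappa> n (v n))"
      using imX[of "app (eX X) u"] cX by (auto simp: im_iff simp flip: app_times)
    have w: "(if n = 1 then v 0 else 0) \<in> Q n" for n using v(1)[of 0] BZ subgpD(1)[OF Z(2)] subgpD(1)[OF B(2)] by (auto simp: Q_def)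
    have "app (sigma * dX X) u = app (sigma * dX X) (app (eX X) u)"
      using dX_unit(2)[OF bX] by (metis app_times mult.assoc)
    also have "\<dots> = emb X (\<lambda>n. \<kappa> n (if n = 1 then v 0 else 0))" unfolding v(2) by (rule dT[OF v(1)])
    finally have "h n (app (sigma * dX X) u) = (if n = 1 then v 0 else 0)" using h_emb[OF w] by simp
    moreover have "h 0 u = v 0" using h_emb[OF v(1), of 0] he[of 0 u] v(2) by simp
    ultimately show ?thesis by simp
  qed
  have rim: "app e (r (h 0 u)) = r (h 0 u)" "app e (h 1 u) = h 1 u" "app \<delta> (r (h 0 u)) = h 0 u" "app \<delta> (h 1 u) = 0" for u
    using r(2)[OF h0(1)[of u]] h0(2)[of u] by (auto simp: Z_def im_iff)
  have "e * g = g" by (rule endo_eqI) (simp add: g rim)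
  moreover have "g * eX X = g" by (rule endo_eqI) (simp only: app_times[of g] g he)
  moreover have "\<delta> * g = g * (sigma * dX X)"
  proof (rule endo_eqI)
    fix u
    have "app (g * (sigma * dX X)) u = h 0 u" by (simp add: app_times[of g] g hd rB(1) del: app_times)
    then show "app (\<delta> * g) u = app (g * (sigma * dX X)) u" by (simp add: g rim del: app_times) (simp add: g rim)
  qed
  ultimately have g1: "g \<in> dmap (TO X) A" by (intro dmapI) (simp_all add: Ad)
  have "g * f = fst A"
    by (rule endo_eqI) (use h_emb[OF cQ] in \<open>simp add: Ad f g c_def\<close>)
  moreover have "f * g = fst (TO X)"
  proof (rule endo_eqI)
    fix u
    obtain v where v: "\<And>n. v n \<in> Q n" "app (eX X) u = emb X (\<lambda>n. \<kappa> n (v n))"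
      using imX[of "app (eX X) u"] cX by (auto simp: im_iff simp flip: app_times)
    have hv: "h n u = v n" for n using h_emb[OF v(1), of n] he[of n u] v(2) by simp
    have "c (app g u) n = v n" for n
      using rim[of u] v(1)[of n] by (auto simp: c_def g hv Q_def split: if_splits)
    then show "app (f * g) u = app (fst (TO X)) u" by (simp add: f v(2))
  qed
  ultimately have "hiso A (TO X) f g" using A(1) TX f1 g1 by (intro hisoI_strict)
  then show ?thesis using X(1) by blast
qed

text \<open>Free complexes are treated first and resolved by themselves, as \<open>R_id\<close>
  demands; all others get the resolution constructed above.\<close>

lemma resolution_choice_exists:
  assumes inf: "infinite (UNIV :: 'a set)"
  shows "\<exists>R p. resolution_choice (R :: 'a cochain_complex \<Rightarrow> _) p"
proof -
  have "\<forall>X :: 'a cochain_complex. \<exists>Pp. X \<in> bounded_fg_complexes \<longrightarrow> free (fst Pp) \<and> snd Pp \<in> M0 (fst Pp) X \<and>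
    qis (KO (fst Pp)) (KO X) (snd Pp) \<and> (free X \<longrightarrow> fst Pp = X)"
  proof
    fix X :: "'a cochain_complex"
    show "\<exists>Pp. X \<in> bounded_fg_complexes \<longrightarrow> free (fst Pp) \<and> snd Pp \<in> M0 (fst Pp) X \<and>
      qis (KO (fst Pp)) (KO X) (snd Pp) \<and> (free X \<longrightarrow> fst Pp = X)"
    proof (cases "free X")
      case True
      then have X: "X \<in> bounded_fg_complexes" by (simp add: free_def)
      have "kc X X (eX X) \<in> quasi_isos X X" using quasi_isos_id[OF X] Kb.Phi_id[of X] X by simp
      then have "qis (KO X) (KO X) (eX X)" using X M0_id[OF X] by (simp add: quasi_isos_kc)
      then show ?thesis using True M0_id[OF X] by (intro exI[of _ "(X, eX X)"]) simp
    next
      case False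
      show ?thesis
      proof (cases "X \<in> bounded_fg_complexes")
        case True
        then obtain P p where "free P" "p \<in> M0 P X" "qis (KO P) (KO X) p" using free_resolution[OF inf] by blast
        then show ?thesis using False by (intro exI[of _ "(P, p)"]) simp
      qed simp
    qed
  qed
  from choice[OF this] obtain Pp where "\<forall>X :: 'a cochain_complex. X \<in> bounded_fg_complexes \<longrightarrow> free (fst (Pp X)) \<and>
    snd (Pp X) \<in> M0 (fst (Pp X)) X \<and> qis (KO (fst (Pp X))) (KO X) (snd (Pp X)) \<and> (free X \<longrightarrow> fst (Pp X) = X)" ..
  then have "resolution_choice (\<lambda>X. fst (Pp X)) (\<lambda>X. snd (Pp X))"
    by unfold_locales (auto simp: free_def)
  then show ?thesis by blast
qed

lemma (in resolution_choice) orbit_dg_represented: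
  assumes inf: "infinite (UNIV :: 'a set)"
  shows "dg_represented_category ev od ev' od' Db_orbit F \<Phi> (\<lambda>A. fgfree (im (fst A))) sigma"
proof (intro dg_represented_category.intro dg_represented_category_axioms.intro uu.doubling_axioms orbit_represented)
  fix X :: "'a cochain_complex" assume "X \<in> Ob Db_orbit"
  then have X: "X \<in> bounded_fg_complexes" by simp
  show "is_dobj (F X)" unfolding F_def by (intro is_dobj_TO R_bfc X)
  show "fgfree (im (fst (F X)))" using R_fgfree[OF X] by (simp add: F_def)
  show "sigma * fst (F X) = fst (F X) * sigma" using sigma_eX[OF bfcD(1)[OF R_bfc[OF X]]] by (simp add: F_def)
  have "dX (R X) * sigma = - (sigma * dX (R X))" using sigma_dX[OF R_bfc[OF X]] by simp
  then show "sigma * snd (F X) = - (snd (F X) * sigma)" by (simp add: F_def mult.assoc)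
next
  fix A B :: "'a uu endo \<times> 'a uu endo" and f
  assume "fgfree (im (fst A))" "fgfree (im (fst B))"
  then show "fgfree (im (fst (uu.cone A B f)))" "fgfree (im (fst (uu.dsum A B)))"
    by (simp_all add: uu.cone_def uu.dsum_def uu.fgfree_double)
next
  show "fgfree (im (fst (0 :: 'a uu endo, 0 :: 'a uu endo)))"
    unfolding fgfree_def by (intro conjI subgp_im exI[of _ "{}"]) (auto simp: im_iff)
  show "sigma * sigma = (1 :: 'a uu endo)" by simp
next
  fix A :: "'a uu endo \<times> 'a uu endo" assume "is_dobj A" "fgfree (im (fst A))"
  then obtain X f g where X: "free X" "hiso A (TO X) f g" using two_term_model[OF inf] by blast
  then have "X \<in> Ob Db_orbit" "F X = TO X" by (auto simp: free_def F_def R_id)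
  then show "\<exists>X \<in> Ob Db_orbit. \<exists>f g. hiso A (F X) f g"
    using X(2) by (intro bexI[of _ X] exI[of _ f] exI[of _ g]) simp_all
qed

theorem mainTheorem2:
  assumes "infinite (UNIV :: 'a set)"
  shows "\<exists>\<Sigma> \<Sigma>m \<Delta>.
    triangulated_category (Db_orbit :: ('a cochain_complex, int \<Rightarrow> 'a Db_mor) precat) \<Sigma> \<Sigma>m \<Delta>"
proof -
  obtain R and p :: "'a cochain_complex \<Rightarrow> 'a uu endo" where "resolution_choice R p"
    using resolution_choice_exists[OF assms] by blast
  then interpret resolution_choice R p .
  interpret dg: dg_represented_category ev od ev' od' Db_orbit F \<Phi> "\<lambda>A. fgfree (im (fst A))" sigma
    using assms by (rule orbit_dg_represented)
  show ?thesis using dg.triangulated by blast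
qed

end
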